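(* Let $q$ be a prime power, $K=\mathbb{F}_q(X)$, and $G=\mathbb{Z}/r_1\mathbb{Z}\times\cdots\times\mathbb{Z}/r_n\mathbb{Z}$ with $r_j\mid r_{j+1}$ for all $j$, and assume $q\equiv 1\pmod{r_n}$. Let $\vec d=(d(\vec\alpha))_{\vec\alpha\in\mathcal R}$ range over vectors of non-negative integers as in the context. Then for every non-negative integer $M$, as $d(\vec\alpha)\to\infty$ for all $\vec\alpha\in\mathcal{R}$, $$\frac{|\{C\in\mathcal{H}^{\vec d} : \#C(\mathbb{F}_q) = M\}|}{|\mathcal{H}^{\vec d}|} \sim\mathrm{Prob}\Big(\sum_{i=1}^{q+1} X_i= M\Big),$$ where $X_1,\dots,X_{q+1}$ are i.i.d. random variables taking the value $0$ or $\frac{|G|}{s}$ for some positive divisor $s\mid r_n$, with $$X_i = \begin{cases} \frac{|G|}{s} & \text{with probability } \frac{s\phi_G(s)}{|G|(q+|G|-1)} \text{ for each } s\mid r_n,\ s\neq 1, \\ |G| & \text{with probability } \frac{q}{|G|(q+|G|-1)}, \\ 0 & \text{with probability } \frac{(|G|-1)(q+|G|)-\sum_{s\mid r_n}s\phi_G(s)+1}{|G|(q+|G|-1)}, \end{cases}$$ and $\phi_G(s)$ is the number of elements of $G$ of order $s$.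
   Context: Let $\mathcal R$ be the set of integer vectors $\vec\alpha=(\alpha_1,\dots,\alpha_n)$ with $0\le\alpha_j\le r_j-1$ for all $j$ and $\vec\alpha\neq(0,\dots,0)$. The vector $\vec d=(d(\vec\alpha))_{\vec\alpha\in\mathcal R}$ consists of non-negative integers satisfying $\sum_{\vec\alpha\in\mathcal R}\alpha_j d(\vec\alpha)\equiv 0\pmod{r_j}$ for $j=1,\dots,n$. For $m\ge0$ let $\mathcal F_m$ be the set of monic squarefree polynomials of degree $m$ in $\mathbb F_q[X]$. Let $\mathcal F_{\vec d}$ be the set of tuples $(f_{\vec\alpha})_{\vec\alpha\in\mathcal R}$ of pairwise coprime polynomials with $f_{\vec\alpha}\in\mathcal F_{d(\vec\alpha)}$; for $\vec\beta\in\mathcal R$ let $\mathcal F^{\vec\beta}_{\vec d}$ be the set of tuples of pairwise coprime polynomials with $f_{\vec\beta}\in\mathcal F_{d(\vec\beta)-1}$ and $f_{\vec\alpha}\in\mathcal F_{d(\vec\alpha)}$ for $\vec\alpha\neq\vec\beta$. Put $\mathcal F_{[\vec d]}=\mathcal F_{\vec d}\cup\bigcup_{\vec\beta\in\mathcal R}\mathcal F^{\vec\beta}_{\vec d}$ and $\hat{\mathcal F}_{[\vec d]}=(\mathbb F_q^* )^n\times\mathcal F_{[\vec d]}$. To $(\vec c,(f_{\vec\alpha}))\in\hat{\mathcal F}_{[\vec d]}$, $\vec c=(c_1,\dots,c_n)$, associate $F_j=c_j\prod_{\vec\alpha\in\mathcal R}f_{\vec\alpha}^{\alpha_j}$ ($j=1,\dots,n$)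 and the smooth projective curve $C$ over $\mathbb F_q$ with function field $K(\sqrt[r_1]{F_1},\dots,\sqrt[r_n]{F_n})$. $\mathcal H^{\vec d}$ denotes the family of these curves, indexed by $\hat{\mathcal F}_{[\vec d]}$ (so $|\mathcal H^{\vec d}|=|\hat{\mathcal F}_{[\vec d]}|$ and the numerator counts tuples whose curve has $M$ points). $\#C(\mathbb F_q)$ is the number of $\mathbb F_q$-rational points of the projective curve $C$ (written $\#C(\mathbb P^1(\mathbb F_q))$ in the paper). "$\sim$" means the ratio of the two sides tends to $1$. *)

theory Defs
  imports
    "HOL-Probability.Probability"
    "HOL-Algebra.Product_Groups"
    "HOL-Algebra.Multiplicative_Group"
    "HOL-Algebra.Generated_Fields"
    "HOL-Algebra.Algebraic_Closure_Type"
    "HOL-Computational_Algebra.Computational_Algebra"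
    "HOL-Number_Theory.Cong"
begin

definition prod_cyclic_group :: "nat \<Rightarrow> (nat \<Rightarrow> nat) \<Rightarrow> (nat \<Rightarrow> int) monoid" where
  "prod_cyclic_group n r = product_group {1..n} (\<lambda>j. integer_mod_group (r j))"

definition num_elements_of_order :: "('b, 'c) monoid_scheme \<Rightarrow> nat \<Rightarrow> nat" where
  "num_elements_of_order G s = card {g \<in> carrier G. group.ord G g = s}"

text \<open>Vectors \<open>(\<alpha>\<^sub>1, \<dots>, \<alpha>\<^sub>n)\<close> are extensional functions on \<open>{1..n}\<close>.\<close>

definition index_vectors :: "nat \<Rightarrow> (nat \<Rightarrow> nat) \<Rightarrow> (nat \<Rightarrow> nat) set" where
  "index_vectors n r = (\<Pi>\<^sub>E j\<in>{1..n}. {0..<r j}) - {\<lambda>j\<in>{1..n}. 0}"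

definition admissible_degrees :: "nat \<Rightarrow> (nat \<Rightarrow> nat) \<Rightarrow> ((nat \<Rightarrow> nat) \<Rightarrow> nat) set" where
  "admissible_degrees n r =
     {d. \<forall>j\<in>{1..n}. [(\<Sum>\<alpha>\<in>index_vectors n r. \<alpha> j * d \<alpha>) = 0] (mod r j)}"

text \<open>The limit in which \<open>d \<alpha>\<close> tends to infinity for every index vector \<open>\<alpha>\<close>, simultaneously
  and at arbitrary relative rates, with \<open>d\<close> ranging over the admissible vectors only.\<close>

definition degrees_at_top :: "nat \<Rightarrow> (nat \<Rightarrow> nat) \<Rightarrow> ((nat \<Rightarrow> nat) \<Rightarrow> nat) filter" where
  "degrees_at_top n r =
     inf (INF \<alpha>\<in>index_vectors n r. filtercomap (\<lambda>d. d \<alpha>) at_top)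
         (principal (admissible_degrees n r))"

text \<open>Degrees are integers here so that there is no monic squarefree polynomial of
  degree \<open>d \<beta> - 1\<close> when \<open>d \<beta> = 0\<close>.\<close>

definition monic_squarefree :: "int \<Rightarrow> 'a::field poly set" where
  "monic_squarefree m = {f. Polynomial.lead_coeff f = 1 \<and> squarefree f \<and> int (Polynomial.degree f) = m}"

definition coprime_tuples ::
  "nat \<Rightarrow> (nat \<Rightarrow> nat) \<Rightarrow> ((nat \<Rightarrow> nat) \<Rightarrow> int) \<Rightarrow> ((nat \<Rightarrow> nat) \<Rightarrow> 'a::field poly) set" where
  "coprime_tuples n r e =
     {f \<in> (\<Pi>\<^sub>E \<alpha>\<in>index_vectors n r. monic_squarefree (e \<alpha>)).
        pairwise (\<lambda>\<alpha> \<beta>. coprime (f \<alpha>) (f \<beta>)) (index_vectors n r)}"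

definition poly_tuples ::
  "nat \<Rightarrow> (nat \<Rightarrow> nat) \<Rightarrow> ((nat \<Rightarrow> nat) \<Rightarrow> nat) \<Rightarrow> ((nat \<Rightarrow> nat) \<Rightarrow> 'a::field poly) set" where
  "poly_tuples n r d =
     coprime_tuples n r (\<lambda>\<alpha>. int (d \<alpha>)) \<union>
     (\<Union>\<beta>\<in>index_vectors n r. coprime_tuples n r ((\<lambda>\<alpha>. int (d \<alpha>))(\<beta> := int (d \<beta>) - 1)))"

definition curve_params ::
  "nat \<Rightarrow> (nat \<Rightarrow> nat) \<Rightarrow> ((nat \<Rightarrow> nat) \<Rightarrow> nat) \<Rightarrow>
     ((nat \<Rightarrow> 'a::field) \<times> ((nat \<Rightarrow> nat) \<Rightarrow> 'a poly)) set" where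
  "curve_params n r d = (\<Pi>\<^sub>E j\<in>{1..n}. UNIV - {0}) \<times> poly_tuples n r d"

definition radicand ::
  "nat \<Rightarrow> (nat \<Rightarrow> nat) \<Rightarrow> (nat \<Rightarrow> 'a::field) \<times> ((nat \<Rightarrow> nat) \<Rightarrow> 'a poly) \<Rightarrow> nat \<Rightarrow> 'a poly" where
  "radicand n r t j =
     Polynomial.smult (fst t j) (\<Prod>\<alpha>\<in>index_vectors n r. snd t \<alpha> ^ \<alpha> j)"

text \<open>All function fields are taken inside a fixed algebraic closure of the field
  \<open>'a poly fract\<close> of rational functions.\<close>

definition poly_to_closure :: "'a::field poly \<Rightarrow> 'a poly fract alg_closure" where
  "poly_to_closure p = to_ac (Fraction_Field.Fract p 1)"

definition constants :: "'a::field poly fract alg_closure set" where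
  "constants = range (\<lambda>c. poly_to_closure [:c:])"

text \<open>Some \<open>m\<close>-th root. If the base field contains the \<open>m\<close>-th roots of unity, the field
  generated by the root does not depend on the choice.\<close>

definition closure_root :: "nat \<Rightarrow> 'a::field alg_closure \<Rightarrow> 'a alg_closure" where
  "closure_root m x = (SOME y. y ^ m = x)"

definition function_field ::
  "nat \<Rightarrow> (nat \<Rightarrow> nat) \<Rightarrow> (nat \<Rightarrow> 'a::field) \<times> ((nat \<Rightarrow> nat) \<Rightarrow> 'a poly) \<Rightarrow>
     'a poly fract alg_closure set" where
  "function_field n r t =
     generate_field ring_of_type_algebra
       (range to_ac \<union> (\<lambda>j. closure_root (r j) (poly_to_closure (radicand n r t j))) ` {1..n})"

text \<open>The closed points of the smooth projective curve with function field \<open>L\<close> are the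
  valuation rings of \<open>L\<close> over the field of constants. In a function field of one variable
  all of these are discrete.\<close>

definition curve_points ::
  "'a::field poly fract alg_closure set \<Rightarrow> 'a poly fract alg_closure set set" where
  "curve_points L =
     {V. subring V ring_of_type_algebra \<and> constants \<subset> V \<and> V \<subset> L \<and>
         (\<forall>z\<in>L. z \<in> V \<or> inverse z \<in> V)}"

definition valuation_ideal :: "'a::field alg_closure set \<Rightarrow> 'a alg_closure set" where
  "valuation_ideal V = {z \<in> V. z = 0 \<or> inverse z \<notin> V}"

text \<open>A closed point is rational iff its residue field is the field of constants, i.e. iff
  the (always injective) map from the constants to the residue field is surjective.\<close>

definition rational_points ::
  "'a::field poly fract alg_closure set \<Rightarrow> 'a poly fract alg_closure set set" where
  "rational_points L =
     {V \<in> curve_points L. \<forall>z\<in>V. \<exists>c\<in>constants. z - c \<in> valuation_ideal V}"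

end

theory Submission
  imports Defs
begin

text \<open>
  Above a rational place \<open>t = 0\<close> of the line, choose a uniformizer \<open>\<pi>\<close> that is a monomial
  in \<open>t\<close> and the radicals \<open>y\<^sub>j\<close>. A rational place above it is determined by the residues of
  \<open>t \<pi>\<^sup>-\<^sup>s\<close> and of the units \<open>y\<^sub>j \<pi>\<^sup>-\<^sup>k\<close> (\<open>k\<close> the valuation of \<open>y\<^sub>j\<close>), and every
  compatible choice of residues is realised by an embedding into the field of Laurent series.
  Hence the number of rational places above \<open>t = 0\<close> is either \<open>0\<close> or \<open>|G| / s\<close>, where \<open>s\<close> is
  the order in \<open>G\<close> of the vector of orders of the radicands, and it depends only on this vector
  and on the leading coefficients of the radicands. The embeddings exist because the monomials in the
  radicals are linearly independent over \<open>K\<close>: the \<open>q\<close>-th power of such a monomial is the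
  monomial times an element of \<open>K\<close>, so comparing a shortest linear relation with its \<open>q\<close>-th power
  would put the ratio of two monomials into \<open>K\<close>, against the multiplicities of the prime factors.

  A sieve over the prime polynomials shows that the values of \<open>(f\<^sub>\<alpha>)\<close> at the points of the affine
  line are asymptotically independent, with at most one zero value at each point. Counting the value
  vectors and the leading constants that give a prescribed number of points identifies the law at each
  of the \<open>q\<close> affine places and, thanks to the tuples with one lowered degree, the same law at
  infinity.
\<close>

subsection \<open>Finite fields\<close>

text \<open>Instead, every admissible residue datum is realised in Laurent series, where
  discreteness is visible, and a ring with the same datum is then shown to coincide with the
  realised one. The extensions have full degree as soon as all \<open>f \<alpha>\<close> are
  nonconstant: the unit vectors are among the index vectors, so every radicand with
  \<open>r j \<ge> 2\<close> owns a simple prime factor that no other radicand has. The counts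
  therefore hold once \<open>d \<alpha> \<ge> 2\<close>, which leaves positive degrees even after
  lowering one of them. A zero of one \<open>f \<alpha>\<close> at an affine point costs a factor
  \<open>1 / q\<close> in total weight against the nonvanishing vectors, exactly as lowering one
  degree does; this is why infinity obeys the affine law. The density constant of the sieve is never
  evaluated: it only has to be positive, since it cancels in the ratio. If the limiting probability
  is 0, convergence does not yield \<open>\<sim>\<close>; the numerator must vanish eventually,
  which follows from the positivity of all limiting weights.\<close>

lemma card_field_ge2: "CARD('a::{field,finite}) \<ge> 2"
proof -
  have "card {0, 1 :: 'a} \<le> CARD('a)" by (rule card_mono) auto
  then show ?thesis by simp
qed

lemma finite_field_power_card_minus_1:
  fixes x :: "'a::{field,finite}"
  assumes "x \<noteq> 0"
  shows "x ^ (CARD('a) - 1) = 1"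
proof -
  have "bij_betw ((*) x) (UNIV - {0}) (UNIV - {0})"
    by (rule bij_betw_byWitness[where f' = "\<lambda>y. y / x"]) (use assms in auto)
  then have "(\<Prod>y\<in>UNIV - {0}. x * y) = \<Prod>(UNIV - {0})"
    by (rule prod.reindex_bij_betw)
  moreover have "(\<Prod>y\<in>UNIV - {0::'a}. y) \<noteq> 0" by simp
  ultimately show ?thesis
    by (simp add: prod.distrib card_Diff_singleton)
qed

text \<open>Cyclicity of the multiplicative group, moved from the record-based algebra to type
  classes. Limiting the exponent to one period makes discrete logarithms unique.\<close>

lemma finite_field_generator:
  obtains g :: "'a::{field,finite}" where "g \<noteq> 0" "bij_betw (\<lambda>i. g ^ i) {0..<CARD('a) - 1} (UNIV - {0})"
proof -
  let ?R = "ring_of_type_algebra :: 'a ring"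
  interpret R: Ring.field ?R by (rule field_from_type_algebra)
  have carr: "carrier (Multiplicative_Group.mult_of ?R) = UNIV - {0}" by (auto simp: ring_of_type_algebra_def)
  have pow: "x [^]\<^bsub>?R\<^esub> (i::nat) = x ^ i" for x i
    by (induction i) (auto simp: ring_of_type_algebra_def nat_pow_def)
  have "finite (carrier ?R)" by (auto simp: ring_of_type_algebra_def)
  from R.finite_field_mult_group_has_gen[OF this]
  obtain g where g: "g \<in> carrier (Multiplicative_Group.mult_of ?R)"
    "carrier (Multiplicative_Group.mult_of ?R) = {g [^]\<^bsub>?R\<^esub> i | i::nat. i \<in> UNIV}"
    by (elim bexE) (rule that)
  have g0: "g \<noteq> 0" using g(1) unfolding carr by simp
  have g2: "\<exists>i. x = g ^ i" if "x \<noteq> 0" for x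
  proof -
    have "x \<in> {g [^]\<^bsub>?R\<^esub> i | i::nat. i \<in> UNIV}"
      using that unfolding g(2)[symmetric] carr by simp
    then obtain i :: nat where "x = g [^]\<^bsub>?R\<^esub> i" by (elim CollectE exE conjE) (rule that)
    then show ?thesis unfolding pow by (rule exI)
  qed
  let ?q1 = "CARD('a) - 1"
  have q1: "?q1 > 0" using card_field_ge2[where 'a='a] by simp
  have cardU: "card (UNIV - {0::'a}) = ?q1" by (simp add: card_Diff_singleton)
  have ge1: "g ^ ?q1 = 1" by (rule finite_field_power_card_minus_1[OF g0])
  have "UNIV - {0} \<subseteq> (\<lambda>i. g ^ i) ` {0..<?q1}"
  proof
    fix x assume "x \<in> UNIV - {0::'a}"
    then have "x \<noteq> 0" by simp
    from g2[OF this] obtain i where i: "x = g ^ i" by (elim exE) (rule that)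
    have "g ^ i = g ^ (?q1 * (i div ?q1) + i mod ?q1)" by (simp only: mult_div_mod_eq)
    also have "\<dots> = g ^ (i mod ?q1)" by (simp only: power_add power_mult ge1 power_one mult_1)
    finally show "x \<in> (\<lambda>i. g ^ i) ` {0..<?q1}" using i q1 by auto
  qed
  moreover have "(\<lambda>i. g ^ i) ` {0..<?q1} \<subseteq> UNIV - {0}" using g0 by auto
  ultimately have im: "(\<lambda>i. g ^ i) ` {0..<?q1} = UNIV - {0}" by blast
  have "inj_on (\<lambda>i. g ^ i) {0..<?q1}"
    by (rule eq_card_imp_inj_on) (simp_all only: im cardU finite_atLeastLessThan card_atLeastLessThan diff_zero)
  then have "bij_betw (\<lambda>i. g ^ i) {0..<?q1} (UNIV - {0})" using im unfolding bij_betw_def by (rule conjI)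
  with g0 show ?thesis by (rule that)
qed

lemma finite_field_power_card: "(x :: 'a::{field,finite}) ^ CARD('a) = x"
proof (cases "x = 0")
  case False
  have "CARD('a) = Suc (CARD('a) - 1)" using card_field_ge2[where 'a='a] by simp
  then have "x ^ CARD('a) = x * x ^ (CARD('a) - 1)" by (metis power_Suc)
  then show ?thesis using finite_field_power_card_minus_1[OF False] by simp
qed (use card_field_ge2[where 'a='a] in simp)

text \<open>\<open>(1 + X)^q - X^q - 1\<close> vanishes at all \<open>q\<close> elements of the
  field and has degree below \<open>q\<close>, so it is the zero polynomial; its coefficients are
  these binomials. No representation of \<open>q\<close> as a prime power is involved.\<close>

lemma finite_field_binomial_eq_0:
  assumes "0 < i" "i < CARD('a)"
  shows "of_nat (CARD('a) choose i) = (0 :: 'a::{field,finite})"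
proof -
  let ?q = "CARD('a)"
  define p :: "'a poly" where "p = [:1, 1:] ^ ?q - Polynomial.monom 1 ?q - 1"
  have co: "Polynomial.coeff ([:1, 1:] ^ ?q :: 'a poly) j = of_nat (?q choose j)" if "j \<le> ?q" for j
    using that by (simp add: coeff_linear_poly_power)
  have "poly p x = 0" for x
  proof -
    have "poly p x = (1 + x) ^ ?q - x ^ ?q - 1"
      unfolding p_def by (simp add: Polynomial.poly_monom)
    then show ?thesis by (simp only: finite_field_power_card) simp
  qed
  then have roots: "{x. poly p x = 0} = UNIV" by simp
  have "Polynomial.degree p \<le> ?q - 1"
  proof (rule degree_le, intro allI impI)
    fix j assume "?q - 1 < j"
    then have j: "j \<ge> ?q" by simp
    show "Polynomial.coeff p j = 0"
    proof (cases "j = ?q")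
      case True
      have "Polynomial.coeff p ?q = 0"
        using card_field_ge2[where 'a='a] unfolding p_def coeff_diff co[OF order_refl] by simp
      with True show ?thesis by simp
    next
      case False
      have "Polynomial.degree ([:1, 1:] ^ ?q :: 'a poly) \<le> ?q"
        by (rule order_trans[OF degree_power_le]) simp
      then have "Polynomial.coeff ([:1, 1:] ^ ?q :: 'a poly) j = 0"
        using False j by (intro coeff_eq_0) simp
      then show ?thesis using False j card_field_ge2[where 'a='a] unfolding p_def coeff_diff by simp
    qed
  qed
  then have deg: "Polynomial.degree p < ?q" using card_field_ge2[where 'a='a] by linarith
  have "p = 0"
  proof (rule ccontr)
    assume "p \<noteq> 0"
    then have "card {x. poly p x = 0} \<le> Polynomial.degree p" by (rule card_poly_roots_bound)
    with deg show False unfolding roots by linarith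
  qed
  then have "Polynomial.coeff ([:1, 1:] ^ ?q - Polynomial.monom 1 ?q - 1 :: 'a poly) i = 0"
    unfolding p_def[symmetric] by simp
  then show ?thesis using assms unfolding coeff_diff by (simp add: co)
qed

subsection \<open>Power residues in a finite field\<close>

definition is_power :: "nat \<Rightarrow> 'a::field \<Rightarrow> bool" where
  "is_power m x \<longleftrightarrow> (\<exists>z. z ^ m = x)"

context
  fixes g :: "'a::{field,finite}"
  assumes g0: "g \<noteq> 0" and gbij: "bij_betw (\<lambda>i. g ^ i) {0..<CARD('a) - 1} (UNIV - {0})"
begin

lemma generator_obtain:
  assumes "(x::'a) \<noteq> 0"
  obtains i where "i < CARD('a) - 1" "x = g ^ i"
  using gbij assms unfolding bij_betw_def by (metis DiffI UNIV_I atLeastLessThan_iff imageE singletonD)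

text \<open>Exponents are integers because the radicands have negative order at infinity.\<close>

lemma generator_powi_eq_iff:
  "g powi i = g powi j \<longleftrightarrow> int (CARD('a) - 1) dvd i - j"
proof -
  let ?m = "int (CARD('a) - 1)"
  have m: "?m > 0" using card_field_ge2[where 'a='a] by simp
  have red: "g powi i = g ^ nat (i mod ?m)" for i :: int
  proof -
    have "g powi i = g powi (?m * (i div ?m) + i mod ?m)" by (simp only: mult_div_mod_eq)
    also have "\<dots> = g powi (?m * (i div ?m)) * g powi (i mod ?m)"
      using g0 by (intro power_int_add) simp
    also have "\<dots> = (g powi ?m) powi (i div ?m) * g powi (i mod ?m)"
      by (simp only: power_int_mult)
    also have "g powi ?m = 1" using finite_field_power_card_minus_1[OF g0] by (simp only: power_int_of_nat)
    also have "g powi (i mod ?m) = g ^ nat (i mod ?m)"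
      using m by (simp add: power_int_def)
    finally show ?thesis by simp
  qed
  have inj: "inj_on (\<lambda>i. g ^ i) {0..<CARD('a) - 1}" using gbij by (simp add: bij_betw_def)
  have lt: "nat (i mod ?m) \<in> {0..<CARD('a) - 1}" for i
    using m pos_mod_bound[of ?m i] pos_mod_sign[of ?m i] by (simp add: nat_less_iff)
  have "g powi i = g powi j \<longleftrightarrow> nat (i mod ?m) = nat (j mod ?m)"
    unfolding red using inj_onD[OF inj _ lt lt] by metis
  also have "\<dots> \<longleftrightarrow> i mod ?m = j mod ?m" using m by (simp add: eq_nat_nat_iff)
  finally show ?thesis by (simp add: mod_eq_dvd_iff)
qed

text \<open>In discrete logarithms, an \<open>m\<close>-th power is a multiple of \<open>m\<close>
  modulo \<open>q - 1\<close>; since \<open>m\<close> divides \<open>q - 1\<close>, this is a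
  condition modulo \<open>m\<close>.\<close>

lemma is_power_generator_iff:
  assumes "m dvd CARD('a) - 1"
  shows "is_power m (g powi i) \<longleftrightarrow> int m dvd i"
proof
  assume "is_power m (g powi i)"
  then obtain z where z: "z ^ m = g powi i" by (auto simp: is_power_def)
  show "int m dvd i"
  proof (cases "m = 0")
    case True
    then show ?thesis using assms card_field_ge2[where 'a='a] by simp
  next
    case False
    then have "z \<noteq> 0" using z g0 by (metis power_0_left power_int_not_zero)
    then obtain j where "z = g ^ j" by (rule generator_obtain)
    then have "g powi (int (j * m)) = g powi i" using z by (simp add: power_int_of_nat power_mult del: of_nat_mult)
    then have "int (CARD('a) - 1) dvd int (j * m) - i" by (simp only: generator_powi_eq_iff)
    then have "int m dvd int (j * m) - i" using assms by (meson dvd_trans of_nat_dvd_iff)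
    then show ?thesis by (metis dvd_diff_right_iff dvd_triv_right of_nat_mult)
  qed
next
  assume "int m dvd i"
  then obtain k where "i = int m * k" by auto
  then have "(g powi k) ^ m = g powi i" by (simp add: power_int_mult mult.commute[of "int m"] power_int_of_nat)
  then show "is_power m (g powi i)" by (auto simp: is_power_def)
qed

end

lemma is_power_mult:
  assumes "is_power m x" shows "is_power m y \<Longrightarrow> is_power m (x * y)"
  using assms by (auto simp: is_power_def) (metis power_mult_distrib)

lemma is_power_inverse: "is_power m x \<Longrightarrow> is_power m (inverse x)"
  by (auto simp: is_power_def) (metis power_inverse)

lemma is_power_mult_cancel:
  assumes "is_power m x" "x \<noteq> 0"
  shows "is_power m (x * y) \<longleftrightarrow> is_power m y"
proof
  assume "is_power m (x * y)"
  from is_power_mult[OF is_power_inverse[OF assms(1)] this] assms(2)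
  show "is_power m y" by (simp flip: mult.assoc)
qed (use assms is_power_mult in blast)

lemma is_power_powi:
  fixes x :: "'a::field"
  assumes "int m dvd k" shows "is_power m (x powi k)"
proof -
  obtain l where l: "k = int m * l" using assms by auto
  have "(x powi l) ^ m = x powi (int m * l)"
    by (simp add: power_int_mult mult.commute[of "int m"] power_int_of_nat)
  with l show ?thesis by (auto simp: is_power_def)
qed

lemma card_dvd_atLeastLessThan:
  assumes "s dvd (N::nat)" "N > 0"
  shows "card {i\<in>{0..<N}. s dvd i} = N div s"
proof -
  obtain k where k: "N = s * k" using assms by auto
  then have s: "s > 0" using assms by auto
  have "{i\<in>{0..<N}. s dvd i} = (\<lambda>i. s * i) ` {0..<k}"
    using s by (auto simp: k)
  also have "card \<dots> = k" using s by (subst card_image) (auto simp: inj_on_def)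
  finally show ?thesis using s k by simp
qed

text \<open>The conditions on \<open>x\<close> cut out a coset of the subgroup belonging to
  \<open>u = 1\<close>. In discrete logarithms this subgroup is \<open>{i. s dvd i}\<close>, so one
  solution yields \<open>(q - 1) / s\<close> of them.\<close>

lemma card_power_solutions:
  fixes a :: "'i \<Rightarrow> int" and r :: "'i \<Rightarrow> nat"
  assumes r: "\<And>j. j \<in> J \<Longrightarrow> r j dvd CARD('a) - 1"
    and s: "\<And>k. (\<forall>j\<in>J. int (r j) dvd k * a j) \<longleftrightarrow> int s dvd k" "s dvd CARD('a) - 1"
    and u: "\<And>j. j \<in> J \<Longrightarrow> u j \<noteq> 0"
    and ex: "\<exists>x\<noteq>0. \<forall>j\<in>J. is_power (r j) (x powi a j * u j)"
  shows "card {x :: 'a::{field,finite}. x \<noteq> 0 \<and> (\<forall>j\<in>J. is_power (r j) (x powi a j * u j))} = (CARD('a) - 1) div s"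
proof -
  obtain g :: 'a where g: "g \<noteq> 0" "bij_betw (\<lambda>i. g ^ i) {0..<CARD('a) - 1} (UNIV - {0})"
    by (rule finite_field_generator)
  obtain z where z: "z \<noteq> 0" "\<And>j. j \<in> J \<Longrightarrow> is_power (r j) (z powi a j * u j)" using ex by auto
  have q: "CARD('a) - 1 > 0" using card_field_ge2[where 'a='a] by simp
  let ?S = "{x :: 'a. x \<noteq> 0 \<and> (\<forall>j\<in>J. is_power (r j) (x powi a j * u j))}"
  have eq: "(\<forall>j\<in>J. is_power (r j) ((z * x) powi a j * u j)) \<longleftrightarrow> (\<forall>j\<in>J. is_power (r j) (x powi a j))"
    for x
  proof (intro ball_cong refl)
    fix j assume j: "j \<in> J"
    have *: "(z * x) powi a j * u j = (z powi a j * u j) * x powi a j"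
      by (simp add: power_int_mult_distrib)
    show "is_power (r j) ((z * x) powi a j * u j) \<longleftrightarrow> is_power (r j) (x powi a j)"
      using is_power_mult_cancel[OF z(2)[OF j], of "x powi a j"] z(1) u[OF j]
      unfolding * by simp
  qed
  have "bij_betw (\<lambda>i. z * g ^ i) {i\<in>{0..<CARD('a) - 1}. s dvd i} ?S"
  proof (rule bij_betw_imageI)
    have "inj_on (\<lambda>i. g ^ i) {0..<CARD('a) - 1}" using g by (simp add: bij_betw_def)
    then show "inj_on (\<lambda>i. z * g ^ i) {i\<in>{0..<CARD('a) - 1}. s dvd i}"
      using z(1) by (auto simp: inj_on_def)
    have iff: "(\<forall>j\<in>J. is_power (r j) ((g ^ i) powi a j)) \<longleftrightarrow> s dvd i" for i
    proof -
      have "(g ^ i) powi a j = g powi (int i * a j)" for j by (simp add: power_int_mult power_int_of_nat)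
      then have "(\<forall>j\<in>J. is_power (r j) ((g ^ i) powi a j)) \<longleftrightarrow> (\<forall>j\<in>J. int (r j) dvd int i * a j)"
        using is_power_generator_iff[OF g r] by simp
      also have "\<dots> \<longleftrightarrow> int s dvd int i" by (rule s)
      finally show ?thesis by simp
    qed
    show "(\<lambda>i. z * g ^ i) ` {i\<in>{0..<CARD('a) - 1}. s dvd i} = ?S"
    proof (intro equalityI subsetI)
      fix x assume "x \<in> (\<lambda>i. z * g ^ i) ` {i\<in>{0..<CARD('a) - 1}. s dvd i}"
      then show "x \<in> ?S" using z(1) g(1) eq iff by auto
    next
      fix x assume x: "x \<in> ?S"
      then have "x / z \<noteq> 0" using z by auto
      then obtain i where i: "i < CARD('a) - 1" "x / z = g ^ i" by (rule generator_obtain[OF g])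
      then have xi: "x = z * g ^ i" using z by (simp add: field_simps)
      have "s dvd i" using x eq iff unfolding xi by blast
      then show "x \<in> (\<lambda>i. z * g ^ i) ` {i\<in>{0..<CARD('a) - 1}. s dvd i}" using i(1) xi by auto
    qed
  qed
  then have "card ?S = card {i\<in>{0..<CARD('a) - 1}. s dvd i}" by (rule bij_betw_same_card[symmetric])
  then show ?thesis using card_dvd_atLeastLessThan[OF s(2) q] by simp
qed

text \<open>Two roots differ by an \<open>m\<close>-th root of unity, and these are the powers
  \<open>g ^ i\<close> with \<open>i\<close> divisible by \<open>(q - 1) / m\<close>.\<close>

lemma card_roots:
  fixes w :: "'a::{field,finite}"
  assumes "m dvd CARD('a) - 1" "w \<noteq> 0" "is_power m w"
  shows "card {z. z ^ m = w} = m"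
proof -
  have q: "CARD('a) - 1 > 0" using card_field_ge2[where 'a='a] by simp
  obtain k where k: "CARD('a) - 1 = m * k" using assms by auto
  have m: "m > 0" "k > 0" using k q by auto
  obtain g :: 'a where g: "g \<noteq> 0" "bij_betw (\<lambda>i. g ^ i) {0..<CARD('a) - 1} (UNIV - {0})"
    by (rule finite_field_generator)
  obtain z0 where z0: "z0 ^ m = w" using assms by (auto simp: is_power_def)
  then have z00: "z0 \<noteq> 0" using assms m by (metis power_0_left less_numeral_extra(3))
  have one: "(g ^ i) ^ m = 1 \<longleftrightarrow> k dvd i" for i
  proof -
    have "(g ^ i) ^ m = 1 \<longleftrightarrow> g powi (int (i * m)) = g powi 0"
      by (simp add: power_mult power_int_of_nat del: of_nat_mult)
    also have "\<dots> \<longleftrightarrow> m * k dvd i * m"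
      unfolding generator_powi_eq_iff[OF g] k by (simp only: diff_0_right of_nat_dvd_iff)
    finally show ?thesis using m by simp
  qed
  have "bij_betw (\<lambda>i. z0 * g ^ i) {i\<in>{0..<CARD('a) - 1}. k dvd i} {z. z ^ m = w}"
  proof (rule bij_betw_imageI)
    have "inj_on (\<lambda>i. g ^ i) {0..<CARD('a) - 1}" using g by (simp add: bij_betw_def)
    then show "inj_on (\<lambda>i. z0 * g ^ i) {i\<in>{0..<CARD('a) - 1}. k dvd i}"
      using z00 by (auto simp: inj_on_def)
    show "(\<lambda>i. z0 * g ^ i) ` {i\<in>{0..<CARD('a) - 1}. k dvd i} = {z. z ^ m = w}"
    proof (intro equalityI subsetI)
      fix x assume "x \<in> (\<lambda>i. z0 * g ^ i) ` {i\<in>{0..<CARD('a) - 1}. k dvd i}"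
      then show "x \<in> {z. z ^ m = w}" using one z0 by (auto simp: power_mult_distrib)
    next
      fix x assume x: "x \<in> {z. z ^ m = w}"
      then have "x / z0 \<noteq> 0" using z00 assms m by (auto simp: power_0_left)
      then obtain i where i: "i < CARD('a) - 1" "x / z0 = g ^ i" by (rule generator_obtain[OF g])
      then have xi: "x = z0 * g ^ i" using z00 by (simp add: field_simps)
      have "(g ^ i) ^ m = 1" using x z0 assms(2) unfolding xi by (simp add: power_mult_distrib)
      then show "x \<in> (\<lambda>i. z0 * g ^ i) ` {i\<in>{0..<CARD('a) - 1}. k dvd i}" using i(1) xi one by auto
    qed
  qed
  then have "card {z. z ^ m = w} = card {i\<in>{0..<CARD('a) - 1}. k dvd i}" by (rule bij_betw_same_card[symmetric])
  also have "\<dots> = m" using card_dvd_atLeastLessThan[of k "CARD('a) - 1"] q k m by simp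
  finally show ?thesis .
qed

text \<open>The case of a single equation with \<open>a = 1\<close> and \<open>u = 1\<close>, where
  the order \<open>s\<close> is \<open>m\<close> itself.\<close>

lemma card_is_power:
  assumes "m dvd CARD('a::{field,finite}) - 1"
  shows "card {x :: 'a. x \<noteq> 0 \<and> is_power m x} = (CARD('a) - 1) div m"
proof -
  have "is_power m (1 :: 'a)" unfolding is_power_def by (rule exI[of _ 1]) simp
  then have "\<exists>x::'a. x \<noteq> 0 \<and> (\<forall>j\<in>{()}. is_power m (x powi 1 * 1))"
    by (intro exI[of _ 1]) simp
  then have "card {x :: 'a. x \<noteq> 0 \<and> (\<forall>j\<in>{()}. is_power m (x powi 1 * 1))} = (CARD('a) - 1) div m"
    using assms by (intro card_power_solutions) simp_all
  then show ?thesis by simp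
qed

subsection \<open>Field homomorphisms and evaluation of polynomials\<close>

text \<open>Constants, rational functions and their extension live in different types; they are
  linked by embeddings instead of inclusions.\<close>

locale fhom =
  fixes h :: "'k::field \<Rightarrow> 'e::field"
  assumes hom_one: "h 1 = 1"
    and hom_add: "h (x + y) = h x + h y"
    and hom_mult: "h (x * y) = h x * h y"
begin

lemma hom_zero: "h 0 = 0"
proof -
  have "h 0 + h 0 = h 0 + 0" using hom_add[of 0 0] by simp
  then show ?thesis by (simp only: add_left_cancel)
qed

lemma hom_uminus: "h (- x) = - h x"
  using hom_add[of x "- x"] hom_zero by (simp add: eq_neg_iff_add_eq_0 add.commute)

lemma hom_minus: "h (x - y) = h x - h y"
  using hom_add[of x "- y"] hom_uminus by simp

lemma hom_eq_0_iff: "h x = 0 \<longleftrightarrow> x = 0"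
proof
  assume "h x = 0"
  show "x = 0"
  proof (rule ccontr)
    assume "x \<noteq> 0"
    then have "h x * h (inverse x) = 1" by (simp flip: hom_mult add: hom_one)
    with \<open>h x = 0\<close> show False by simp
  qed
qed (simp add: hom_zero)

lemma hom_eq_iff: "h x = h y \<longleftrightarrow> x = y"
  using hom_eq_0_iff[of "x - y"] by (simp add: hom_minus)

lemma hom_inverse: "h (inverse x) = inverse (h x)"
proof (cases "x = 0")
  case False
  then have "h x * h (inverse x) = 1" by (simp flip: hom_mult add: hom_one)
  then show ?thesis by (simp add: inverse_unique)
qed (simp add: hom_zero)

lemma hom_divide: "h (x / y) = h x / h y"
  by (simp add: divide_inverse hom_mult hom_inverse)

lemma hom_power: "h (x ^ n) = h x ^ n"
  by (induction n) (simp_all add: hom_one hom_mult)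

lemma hom_powi: "h (x powi n) = h x powi n"
  by (simp add: power_int_def hom_power hom_inverse)

lemma hom_sum: "h (\<Sum>i\<in>A. f i) = (\<Sum>i\<in>A. h (f i))"
  by (induction A rule: infinite_finite_induct) (simp_all add: hom_zero hom_add)

lemma hom_prod: "h (\<Prod>i\<in>A. f i) = (\<Prod>i\<in>A. h (f i))"
  by (induction A rule: infinite_finite_induct) (simp_all add: hom_one hom_mult)

lemma hom_of_nat: "h (of_nat n) = of_nat n"
  by (induction n) (simp_all add: hom_zero hom_one hom_add)

lemmas hom_simps = hom_zero hom_one hom_add hom_uminus hom_minus hom_mult hom_inverse hom_divide
  hom_power hom_powi hom_sum hom_prod hom_of_nat

end

lemma fhom_compose:
  assumes "fhom f" "fhom g" shows "fhom (\<lambda>x. g (f x))"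
  using assms by (simp add: fhom_def)

definition pev :: "('k::field \<Rightarrow> 'e::field) \<Rightarrow> 'k poly \<Rightarrow> 'e \<Rightarrow> 'e" where
  "pev h p x = poly (map_poly h p) x"

context fhom
begin

lemma pev_0 [simp]: "pev h 0 x = 0"
  by (simp add: pev_def)

lemma pev_pCons [simp]: "pev h (pCons a p) x = h a + x * pev h p x"
  by (simp add: pev_def map_poly_pCons hom_zero)

lemma pev_1 [simp]: "pev h 1 x = 1"
  by (simp add: hom_one one_pCons)

lemma pev_add: "pev h (p + q) x = pev h p x + pev h q x"
  by (induction p q rule: poly_induct2) (simp_all add: hom_add algebra_simps)

lemma pev_smult: "pev h (Polynomial.smult c p) x = h c * pev h p x"
  by (induction p) (simp_all add: hom_mult algebra_simps)

lemma pev_mult: "pev h (p * q) x = pev h p x * pev h q x"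
  by (induction p) (simp_all add: pev_add pev_smult hom_zero algebra_simps)

lemma pev_uminus: "pev h (- p) x = - pev h p x"
  using pev_add[of p "- p"] by (simp add: eq_neg_iff_add_eq_0 add.commute)

lemma pev_diff: "pev h (p - q) x = pev h p x - pev h q x"
  using pev_add[of p "- q"] by (simp add: pev_uminus)

lemma pev_power: "pev h (p ^ n) x = pev h p x ^ n"
  by (induction n) (simp_all add: pev_mult)

lemma pev_prod: "pev h (\<Prod>i\<in>A. f i) x = (\<Prod>i\<in>A. pev h (f i) x)"
  by (induction A rule: infinite_finite_induct) (simp_all add: pev_mult)

lemma pev_pcompose: "pev h (pcompose p q) x = pev h p (pev h q x)"
  by (induction p) (simp_all add: pcompose_pCons pev_add pev_mult hom_zero)

end

lemma pev_compose_hom: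
  assumes "fhom f" "fhom g"
  shows "pev (\<lambda>x. g (f x)) p (g x) = g (pev f p x)"
proof -
  interpret f: fhom f by fact
  interpret g: fhom g by fact
  interpret gf: fhom "\<lambda>x. g (f x)" by (rule fhom_compose[of f g]) fact+
  show ?thesis by (induction p) (simp_all add: g.hom_simps)
qed

subsection \<open>Rational places\<close>

definition field_closed :: "'e::field set \<Rightarrow> bool" where
  "field_closed L \<longleftrightarrow> 1 \<in> L \<and> (\<forall>x\<in>L. \<forall>y\<in>L. x + y \<in> L \<and> x * y \<in> L) \<and> (\<forall>x\<in>L. - x \<in> L \<and> inverse x \<in> L)"

lemma field_closedD:
  assumes "field_closed L"
  shows "1 \<in> L" "0 \<in> L" "x \<in> L \<Longrightarrow> y \<in> L \<Longrightarrow> x + y \<in> L" "x \<in> L \<Longrightarrow> y \<in> L \<Longrightarrow> x * y \<in> L"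
    "x \<in> L \<Longrightarrow> - x \<in> L" "x \<in> L \<Longrightarrow> inverse x \<in> L" "x \<in> L \<Longrightarrow> y \<in> L \<Longrightarrow> x - y \<in> L"
    "x \<in> L \<Longrightarrow> y \<in> L \<Longrightarrow> x / y \<in> L" "x \<in> L \<Longrightarrow> x ^ n \<in> L" "x \<in> L \<Longrightarrow> x powi k \<in> L"
proof -
  note L = assms[unfolded field_closed_def]
  show 1: "1 \<in> L" and 2: "x \<in> L \<Longrightarrow> y \<in> L \<Longrightarrow> x + y \<in> L" and 3: "\<And>x y. x \<in> L \<Longrightarrow> y \<in> L \<Longrightarrow> x * y \<in> L"
    and 4: "\<And>x. x \<in> L \<Longrightarrow> - x \<in> L" and 5: "\<And>x. x \<in> L \<Longrightarrow> inverse x \<in> L" for x y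
    using L by blast+
  show "0 \<in> L" using L 1 by (metis add.right_inverse)
  show "x \<in> L \<Longrightarrow> y \<in> L \<Longrightarrow> x - y \<in> L" using L by (metis diff_conv_add_uminus)
  show "x \<in> L \<Longrightarrow> y \<in> L \<Longrightarrow> x / y \<in> L" using L by (metis divide_inverse)
  show 6: "x \<in> L \<Longrightarrow> x ^ n \<in> L" for x n using 1 3 by (induction n) auto
  show "x \<in> L \<Longrightarrow> x powi k \<in> L" using 5 6 by (auto simp: power_int_def)
qed

lemma field_closed_sum:
  assumes "field_closed L" "\<And>i. i \<in> A \<Longrightarrow> f i \<in> L"
  shows "(\<Sum>i\<in>A. f i) \<in> L"
  using assms(2) by (induction A rule: infinite_finite_induct) (auto intro: field_closedD[OF assms(1)])

lemma field_closed_prod: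
  assumes "field_closed L" "\<And>i. i \<in> A \<Longrightarrow> f i \<in> L"
  shows "(\<Prod>i\<in>A. f i) \<in> L"
  using assms(2) by (induction A rule: infinite_finite_induct) (auto intro: field_closedD[OF assms(1)])

text \<open>A valuation ring together with its residue map to the constants. \<open>res\<close> is
  total, but its values outside \<open>V\<close> carry no meaning. The last three axioms make
  \<open>V\<close> a valuation ring of \<open>L\<close> whose nonunits are the elements of residue
  0.\<close>

locale rational_place = k: fhom k
  for k :: "'a::{field,finite} \<Rightarrow> 'e::field" +
  fixes L V :: "'e set" and res :: "'e \<Rightarrow> 'a"
  assumes L: "field_closed L"
    and V_subset: "V \<subseteq> L"
    and const_V: "k c \<in> V" and res_const: "res (k c) = c"
    and add_V: "x \<in> V \<Longrightarrow> y \<in> V \<Longrightarrow> x + y \<in> V"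
    and mult_V: "x \<in> V \<Longrightarrow> y \<in> V \<Longrightarrow> x * y \<in> V"
    and res_add: "x \<in> V \<Longrightarrow> y \<in> V \<Longrightarrow> res (x + y) = res x + res y"
    and res_mult: "x \<in> V \<Longrightarrow> y \<in> V \<Longrightarrow> res (x * y) = res x * res y"
    and inverse_V: "x \<in> V \<Longrightarrow> res x \<noteq> 0 \<Longrightarrow> inverse x \<in> V"
    and inverse_outside: "x \<in> L \<Longrightarrow> x \<notin> V \<Longrightarrow> inverse x \<in> V"
    and res_inverse_outside: "x \<in> L \<Longrightarrow> x \<notin> V \<Longrightarrow> res (inverse x) = 0"
begin

lemma zero_V: "0 \<in> V" and one_V: "1 \<in> V" and res_zero: "res 0 = 0" and res_one: "res 1 = 1"
  using const_V[of 0] const_V[of 1] res_const[of 0] res_const[of 1] by (simp_all add: k.hom_simps)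

lemma uminus_V: "x \<in> V \<Longrightarrow> - x \<in> V"
  using mult_V[OF const_V[of "-1"]] by (fastforce simp: k.hom_simps)

lemma res_uminus: "x \<in> V \<Longrightarrow> res (- x) = - res x"
  using res_add[of x "- x"] uminus_V[of x] res_zero by (simp add: eq_neg_iff_add_eq_0 add.commute)

lemma diff_V: "x \<in> V \<Longrightarrow> y \<in> V \<Longrightarrow> x - y \<in> V"
  using add_V[of x "- y"] uminus_V by simp

lemma res_diff: "x \<in> V \<Longrightarrow> y \<in> V \<Longrightarrow> res (x - y) = res x - res y"
  using res_add[of x "- y"] uminus_V res_uminus by simp

lemma power_V: "x \<in> V \<Longrightarrow> x ^ n \<in> V"
  by (induction n) (auto intro: mult_V one_V)

lemma res_power: "x \<in> V \<Longrightarrow> res (x ^ n) = res x ^ n"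
  by (induction n) (auto simp: res_mult power_V res_one)

lemma res_inverse:
  assumes "x \<in> V" "res x \<noteq> 0" shows "res (inverse x) = inverse (res x)"
proof -
  have "x \<noteq> 0" using assms res_zero by auto
  then have "res x * res (inverse x) = 1"
    using res_mult[OF assms(1) inverse_V[OF assms]] res_one by simp
  then show ?thesis by (simp add: inverse_unique)
qed

lemma powi_V: "x \<in> V \<Longrightarrow> res x \<noteq> 0 \<Longrightarrow> x powi i \<in> V"
  by (auto simp: power_int_def intro: power_V inverse_V)

lemma res_powi: "x \<in> V \<Longrightarrow> res x \<noteq> 0 \<Longrightarrow> res (x powi i) = res x powi i"
  by (auto simp: power_int_def res_power inverse_V res_inverse)

lemma sum_V: "(\<And>i. i \<in> A \<Longrightarrow> f i \<in> V) \<Longrightarrow> (\<Sum>i\<in>A. f i) \<in> V"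
  by (induction A rule: infinite_finite_induct) (auto intro: add_V zero_V)

lemma res_sum: "(\<And>i. i \<in> A \<Longrightarrow> f i \<in> V) \<Longrightarrow> res (\<Sum>i\<in>A. f i) = (\<Sum>i\<in>A. res (f i))"
  by (induction A rule: infinite_finite_induct) (auto simp: res_add sum_V res_zero)

lemma prod_V: "(\<And>i. i \<in> A \<Longrightarrow> f i \<in> V) \<Longrightarrow> (\<Prod>i\<in>A. f i) \<in> V"
  by (induction A rule: infinite_finite_induct) (auto intro: mult_V one_V)

lemma res_prod: "(\<And>i. i \<in> A \<Longrightarrow> f i \<in> V) \<Longrightarrow> res (\<Prod>i\<in>A. f i) = (\<Prod>i\<in>A. res (f i))"
  by (induction A rule: infinite_finite_induct) (auto simp: res_mult prod_V res_one)

lemma pev_V: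
  assumes "x \<in> V" shows "pev k p x \<in> V" "res (pev k p x) = poly p (res x)"
proof -
  have "pev k p x \<in> V \<and> res (pev k p x) = poly p (res x)"
    by (induction p)
       (auto simp: zero_V res_zero add_V mult_V const_V assms res_add res_mult res_const)
  then show "pev k p x \<in> V" "res (pev k p x) = poly p (res x)" by auto
qed

lemma inverse_notin_V:
  assumes "x \<in> V" "res x = 0" "x \<noteq> 0" shows "inverse x \<notin> V"
proof
  assume "inverse x \<in> V"
  from res_mult[OF assms(1) this] assms show False by (simp add: res_one)
qed

text \<open>Valuation rings are integrally closed: outside \<open>V\<close>, the inverse of
  \<open>x\<close> has residue 0, and \<open>1 = inverse x ^ m * x ^ m\<close> would have residue 0
  as well.\<close>

lemma V_of_power:
  assumes "x \<in> L" "m > 0" "x ^ m \<in> V" shows "x \<in> V"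
proof (rule ccontr)
  assume "x \<notin> V"
  then have x: "inverse x \<in> V" "res (inverse x) = 0" using assms inverse_outside res_inverse_outside by auto
  have x0: "x \<noteq> 0" using \<open>x \<notin> V\<close> zero_V by auto
  have "1 = inverse x ^ m * x ^ m" using x0 by (simp add: power_inverse)
  then have "1 = res (inverse x ^ m) * res (x ^ m)" using res_mult power_V x(1) assms(3) res_one by metis
  then show False using x assms(2) by (simp add: res_power power_0_left)
qed

lemma res_eq_0_of_power:
  assumes "x \<in> L" "m > 0" "x ^ m \<in> V" "res (x ^ m) = 0" shows "res x = 0"
  using assms V_of_power res_power by (metis power_eq_0_iff)

text \<open>If the residues of \<open>x\<close> differ, then \<open>x - k (res x)\<close> is a
  nonunit for one map and a unit for the other, whereas being a unit depends on \<open>V\<close>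
  alone.\<close>

lemma res_unique:
  assumes "rational_place k L V res'" "x \<in> V"
  shows "res' x = res x"
proof (rule ccontr)
  interpret R: rational_place k L V res' by fact
  assume neq: "res' x \<noteq> res x"
  define z where "z = x - k (res x)"
  have z: "z \<in> V" "res z = 0" "res' z \<noteq> 0"
    using neq assms(2) const_V diff_V res_diff res_const R.res_diff R.res_const by (auto simp: z_def)
  then have "z \<noteq> 0" using R.res_zero by auto
  with z show False using R.inverse_V inverse_notin_V by blast
qed

end

text \<open>One of \<open>x / y\<close> and \<open>y / x\<close> lies in \<open>V\<close>. In the
  first case \<open>x + y = (x / y + 1) * y\<close>, so that an inverse of \<open>x + y\<close> in
  \<open>V\<close> would produce an inverse of \<open>y\<close>.\<close>

lemma valuation_ideal_add:
  fixes V :: "'a::field alg_closure set"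
  assumes add: "\<And>x y. x \<in> V \<Longrightarrow> y \<in> V \<Longrightarrow> x + y \<in> V" and mult: "\<And>x y. x \<in> V \<Longrightarrow> y \<in> V \<Longrightarrow> x * y \<in> V"
    and one: "1 \<in> V" and val: "\<And>z. z \<in> L \<Longrightarrow> z \<in> V \<or> inverse z \<in> V" and L: "field_closed L" "V \<subseteq> L"
    and x: "x \<in> valuation_ideal V" and y: "y \<in> valuation_ideal V"
  shows "x + y \<in> valuation_ideal V"
proof -
  have gen: "x + y \<in> valuation_ideal V"
    if x: "x \<in> valuation_ideal V" and y: "y \<in> valuation_ideal V" and "x \<noteq> 0" "y \<noteq> 0" "x / y \<in> V" for x y
  proof -
    have xy: "x + y \<in> V" using x y add by (auto simp: valuation_ideal_def)
    have "inverse (x + y) \<notin> V" if "x + y \<noteq> 0"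
    proof
      assume "inverse (x + y) \<in> V"
      then have "(x / y + 1) * inverse (x + y) \<in> V" using \<open>x / y \<in> V\<close> add mult one by blast
      also have "(x / y + 1) * inverse (x + y) = inverse y"
        using \<open>y \<noteq> 0\<close> that by (simp add: field_simps)
      finally show False using y \<open>y \<noteq> 0\<close> by (auto simp: valuation_ideal_def)
    qed
    then show ?thesis using xy by (auto simp: valuation_ideal_def)
  qed
  show ?thesis
  proof (cases "x = 0 \<or> y = 0")
    case True
    then show ?thesis using x y by auto
  next
    case False
    have "x / y \<in> L" using x y L field_closedD(8) by (fastforce simp: valuation_ideal_def)
    with val consider "x / y \<in> V" | "y / x \<in> V" by fastforce
    then show ?thesis
    proof cases
      case 1 then show ?thesis using gen x y False by auto
    next
      case 2 then show ?thesis using gen[OF y x] False by (auto simp: add.commute)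
    qed
  qed
qed

text \<open>The residue of \<open>z\<close> is the constant \<open>c\<close> with
  \<open>z - k c\<close> in the ideal of nonunits; it is unique because 0 is the only constant in
  that ideal.\<close>

lemma rational_place_of_valuation_ring:
  fixes V :: "'b::field alg_closure set" and k :: "'a::{field,finite} \<Rightarrow> 'b alg_closure"
  assumes k: "fhom k" and L: "field_closed L" "V \<subseteq> L" and kV: "range k \<subseteq> V"
    and add: "\<And>x y. x \<in> V \<Longrightarrow> y \<in> V \<Longrightarrow> x + y \<in> V" and mult: "\<And>x y. x \<in> V \<Longrightarrow> y \<in> V \<Longrightarrow> x * y \<in> V"
    and val: "\<And>z. z \<in> L \<Longrightarrow> z \<in> V \<or> inverse z \<in> V"
    and rat: "\<And>z. z \<in> V \<Longrightarrow> \<exists>c. z - k c \<in> valuation_ideal V"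
  obtains res where "rational_place k L V res"
proof -
  interpret k: fhom k by fact
  have one: "1 \<in> V" using kV k.hom_one by (metis rangeI subsetD)
  have zero: "0 \<in> V" using kV k.hom_zero by (metis rangeI subsetD)
  have neg: "- x \<in> V" if "x \<in> V" for x
  proof -
    have "k (- 1) * x \<in> V" using mult[OF _ that] kV by blast
    then show ?thesis by (simp add: k.hom_uminus k.hom_one)
  qed
  have m_add: "x + y \<in> valuation_ideal V" if "x \<in> valuation_ideal V" "y \<in> valuation_ideal V" for x y
    using add mult one val L that by (rule valuation_ideal_add)
  have m_mult: "x * y \<in> valuation_ideal V" if "x \<in> valuation_ideal V" "y \<in> V" for x y
  proof -
    have "inverse (x * y) \<notin> V" if "x * y \<noteq> 0"
    proof
      assume "inverse (x * y) \<in> V"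
      then have "y * inverse (x * y) \<in> V" using mult \<open>y \<in> V\<close> by blast
      also have "y * inverse (x * y) = inverse x" using that by (simp add: field_simps)
      finally show False using \<open>x \<in> valuation_ideal V\<close> that by (auto simp: valuation_ideal_def)
    qed
    then show ?thesis using that mult by (auto simp: valuation_ideal_def)
  qed
  have m_const: "c = 0" if "k c \<in> valuation_ideal V" for c
  proof (rule ccontr)
    assume "c \<noteq> 0"
    then have "inverse (k c) \<notin> V" using that by (auto simp: valuation_ideal_def k.hom_eq_0_iff)
    moreover have "inverse (k c) = k (inverse c)" by (simp add: k.hom_inverse)
    ultimately show False using kV by auto
  qed
  define res where "res z = (SOME c. z - k c \<in> valuation_ideal V)" for z
  have res: "z - k (res z) \<in> valuation_ideal V" if "z \<in> V" for z
    unfolding res_def using rat[OF that] by (rule someI_ex)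
  have m_neg: "- x \<in> valuation_ideal V" if "x \<in> valuation_ideal V" for x
    using m_mult[OF that neg[OF one]] by simp
  have resI: "res z = c" if z: "z \<in> V" "z - k c \<in> valuation_ideal V" for z c
  proof -
    have "(z - k c) + - (z - k (res z)) \<in> valuation_ideal V"
      using m_add[OF z(2) m_neg[OF res[OF z(1)]]] by blast
    then have "k (res z - c) \<in> valuation_ideal V" by (simp add: k.hom_simps)
    then show ?thesis using m_const by fastforce
  qed
  have m0: "0 \<in> valuation_ideal V" using zero by (simp add: valuation_ideal_def)
  show ?thesis
  proof (rule that, unfold_locales)
    fix c show "k c \<in> V" using kV by auto
    then show "res (k c) = c" using m0 by (intro resI) auto
  next
    fix x y assume xy: "x \<in> V" "y \<in> V"
    show "res (x + y) = res x + res y"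
    proof (rule resI)
      have "x + y - k (res x + res y) = (x - k (res x)) + (y - k (res y))" by (simp add: k.hom_simps)
      then show "x + y - k (res x + res y) \<in> valuation_ideal V" using m_add res xy by metis
    qed (use xy add in auto)
    show "res (x * y) = res x * res y"
    proof (rule resI)
      have "x * y - k (res x * res y) = (x - k (res x)) * y + (y - k (res y)) * k (res x)"
        by (simp add: k.hom_simps algebra_simps)
      then show "x * y - k (res x * res y) \<in> valuation_ideal V"
        using m_add[OF m_mult[OF res[OF xy(1)] xy(2)] m_mult[OF res[OF xy(2)]]] kV by auto
    qed (use xy mult in auto)
  next
    fix x assume x: "x \<in> V" "res x \<noteq> 0"
    show "inverse x \<in> V"
    proof (rule ccontr)
      assume "inverse x \<notin> V"
      then have "x \<in> valuation_ideal V" using x by (simp add: valuation_ideal_def)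
      then show False using resI[of x 0] x by (simp add: k.hom_zero)
    qed
  next
    fix x assume x: "x \<in> L" "x \<notin> V"
    then show i: "inverse x \<in> V" using val by auto
    have "inverse x \<in> valuation_ideal V" using x i by (simp add: valuation_ideal_def)
    then show "res (inverse x) = 0" using i by (intro resI) (auto simp: k.hom_zero)
  qed (use L add mult in auto)
qed

subsection \<open>Rational places of a Kummer extension over a rational place of the base field\<close>

lemma power_int_sum:
  fixes x :: "'a::field"
  assumes "x \<noteq> 0" shows "x powi (\<Sum>i\<in>A. f i) = (\<Prod>i\<in>A. x powi f i)"
  by (induction A rule: infinite_finite_induct) (use assms in \<open>auto simp: power_int_add\<close>)

lemma power_int_power_eq:
  fixes x :: "'a::field"
  shows "(x powi i) ^ m = x powi (i * int m)" "(x ^ m) powi i = x powi (int m * i)"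
  by (simp_all add: power_int_mult)

lemma mult_inverse_cancel_left:
  "(x :: 'a::field) \<noteq> 0 \<Longrightarrow> x * (inverse x * z) = z"
  by (simp add: mult.assoc[symmetric])

text \<open>The base field is \<open>\<kappa>(t)\<close>, embedded by \<open>\<iota>\<close>; the places considered are those with
  \<open>t\<close> in the valuation ideal. The number \<open>s\<close> is the ramification index, \<open>kk j\<close> is the valuation of
  \<open>y j\<close>, and \<open>e0\<close>, \<open>e\<close> are Bezout coefficients that yield a uniformizer.\<close>

locale kummer_place = i: fhom \<iota> + c: fhom \<kappa>
  for \<iota> :: "'k::field \<Rightarrow> 'e::field" and \<kappa> :: "'a::{field,finite} \<Rightarrow> 'k" +
  fixes t :: 'k and J :: "nat set" and r :: "nat \<Rightarrow> nat" and a :: "nat \<Rightarrow> int" and U :: "nat \<Rightarrow> 'a poly"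
    and y :: "nat \<Rightarrow> 'e" and L :: "'e set" and s :: nat and kk :: "nat \<Rightarrow> int" and e0 :: int and e :: "nat \<Rightarrow> int"
  assumes finite_J: "finite J"
    and transcendental: "pev \<kappa> p t = 0 \<Longrightarrow> p = 0"
    and generated: "\<exists>p p'. p' \<noteq> 0 \<and> z = pev \<kappa> p t / pev \<kappa> p' t"
    and r_dvd: "j \<in> J \<Longrightarrow> r j dvd CARD('a) - 1"
    and U_0: "j \<in> J \<Longrightarrow> poly (U j) 0 \<noteq> 0"
    and y_power: "j \<in> J \<Longrightarrow> y j ^ r j = \<iota> (t powi a j * pev \<kappa> (U j) t)"
    and L: "field_closed L" and base_L: "\<iota> z \<in> L" and y_L: "j \<in> J \<Longrightarrow> y j \<in> L"
    and L_span: "x \<in> L \<Longrightarrow> \<exists>c. x = (\<Sum>b\<in>(\<Pi>\<^sub>E j\<in>J. {..<r j}). \<iota> (c b) * (\<Prod>j\<in>J. y j ^ b j))"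
    and indep: "(\<Sum>b\<in>(\<Pi>\<^sub>E j\<in>J. {..<r j}). \<iota> (c b) * (\<Prod>j\<in>J. y j ^ b j)) = 0 \<Longrightarrow>
                  b \<in> (\<Pi>\<^sub>E j\<in>J. {..<r j}) \<Longrightarrow> c b = 0"
    and s_pos: "s > 0" and s_dvd: "s dvd CARD('a) - 1"
    and kk: "j \<in> J \<Longrightarrow> int s * a j = kk j * int (r j)"
    and bezout: "e0 * int s + (\<Sum>j\<in>J. e j * kk j) = 1"
begin

declare finite_J [simp]

definition k :: "'a \<Rightarrow> 'e" where "k x = \<iota> (\<kappa> x)"

sublocale k: fhom k
  unfolding k_def by (rule fhom_compose[of \<kappa> \<iota>]) unfold_locales

text \<open>The uniformizer: its valuation is the left side of \<open>bezout\<close>, hence 1.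
  Relative to it, \<open>w0\<close> and \<open>w j\<close> are the unit parts of \<open>t\<close>
  and of the radicals.\<close>

definition unf :: 'e where "unf = \<iota> t powi e0 * (\<Prod>j\<in>J. y j powi e j)"
definition w0 :: 'e where "w0 = \<iota> t * unf powi (- int s)"
definition w :: "nat \<Rightarrow> 'e" where "w j = y j * unf powi (- kk j)"
text \<open>The unit part of \<open>unf ^ (q - 1)\<close>, an element of the base field because
  every \<open>r j\<close> divides \<open>q - 1\<close>.\<close>

definition Q :: 'k where "Q = (\<Prod>j\<in>J. pev \<kappa> (U j) t powi (e j * int ((CARD('a) - 1) div r j)))"

lemma q1: "CARD('a) - 1 > 0"
  using card_field_ge2[where 'a='a] by simp

lemma t_nz: "t \<noteq> 0"
  using transcendental[of "[:0, 1:]"] by (auto simp: c.hom_simps)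

lemma r_pos: "j \<in> J \<Longrightarrow> r j > 0"
  using r_dvd[of j] q1 by (auto intro: Nat.gr0I)

lemma U_nz: "j \<in> J \<Longrightarrow> pev \<kappa> (U j) t \<noteq> 0"
  using U_0 transcendental by fastforce

lemma y_nz: "j \<in> J \<Longrightarrow> y j \<noteq> 0"
  using y_power[of j] r_pos[of j] t_nz U_nz[of j] by (auto simp: i.hom_eq_0_iff power_0_left)

lemma unf_nz: "unf \<noteq> 0"
  using t_nz y_nz by (auto simp: unf_def i.hom_eq_0_iff)

lemma r_div: "j \<in> J \<Longrightarrow> int (r j) * int ((CARD('a) - 1) div r j) = int (CARD('a) - 1)"
  using r_dvd by (metis dvd_mult_div_cancel of_nat_mult)

lemma s_div: "int s * int ((CARD('a) - 1) div s) = int (CARD('a) - 1)"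
  using s_dvd by (metis dvd_mult_div_cancel of_nat_mult)

lemma y_power_card:
  assumes "j \<in> J"
  shows "y j powi (i * int (CARD('a) - 1)) =
    \<iota> ((t powi a j * pev \<kappa> (U j) t) powi (i * int ((CARD('a) - 1) div r j)))"
proof -
  have "y j powi (i * int (CARD('a) - 1)) = (y j ^ r j) powi (i * int ((CARD('a) - 1) div r j))"
    unfolding power_int_power_eq r_div[OF assms, symmetric] by (simp only: ac_simps)
  then show ?thesis using y_power[OF assms] by (simp only: i.hom_powi)
qed

text \<open>This is the exponent of \<open>t\<close> in \<open>unf ^ (q - 1)\<close>. Multiplied by
  \<open>s\<close> it becomes \<open>q - 1\<close> by the Bezout identity.\<close>

lemma exponent_sum:
  "e0 * int (CARD('a) - 1) + (\<Sum>j\<in>J. a j * (e j * int ((CARD('a) - 1) div r j))) = int ((CARD('a) - 1) div s)"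
proof -
  let ?m = "int (CARD('a) - 1)"
  have "int s * (e0 * ?m + (\<Sum>j\<in>J. a j * (e j * int ((CARD('a) - 1) div r j))))
      = (e0 * int s) * ?m + (\<Sum>j\<in>J. (int s * a j) * e j * int ((CARD('a) - 1) div r j))"
    by (simp add: algebra_simps sum_distrib_left)
  also have "(\<Sum>j\<in>J. (int s * a j) * e j * int ((CARD('a) - 1) div r j)) = (\<Sum>j\<in>J. (e j * kk j) * ?m)"
  proof (rule sum.cong[OF refl])
    fix j assume j: "j \<in> J"
    show "(int s * a j) * e j * int ((CARD('a) - 1) div r j) = (e j * kk j) * ?m"
      unfolding kk[OF j] r_div[OF j, symmetric] by (simp only: ac_simps)
  qed
  also have "(e0 * int s) * ?m + (\<Sum>j\<in>J. (e j * kk j) * ?m) = (e0 * int s + (\<Sum>j\<in>J. e j * kk j)) * ?m"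
    by (simp add: distrib_right sum_distrib_right)
  also have "\<dots> = int s * int ((CARD('a) - 1) div s)" unfolding bezout s_div by simp
  finally show ?thesis using s_pos by simp
qed

text \<open>Passing to \<open>(q - 1)\<close>-th powers takes \<open>unf\<close> and the units into
  the base field, where the behaviour at \<open>t = 0\<close> can be read off. Closure of valuation
  rings under roots carries it back.\<close>

lemma unf_power: "unf ^ (CARD('a) - 1) = \<iota> (t ^ ((CARD('a) - 1) div s) * Q)"
proof -
  let ?m = "CARD('a) - 1"
  have "unf ^ ?m = \<iota> t powi (e0 * int ?m) * (\<Prod>j\<in>J. y j powi (e j * int ?m))"
    unfolding unf_def power_mult_distrib prod_power_distrib power_int_power_eq ..
  also have "\<dots> = \<iota> (t powi (e0 * int ?m) * (\<Prod>j\<in>J. (t powi a j * pev \<kappa> (U j) t) powi (e j * int (?m div r j))))"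
    unfolding i.hom_mult i.hom_prod i.hom_powi[symmetric]
    by (intro arg_cong2[where f = "(*)"] prod.cong refl y_power_card)
  also have "(\<Prod>j\<in>J. (t powi a j * pev \<kappa> (U j) t) powi (e j * int (?m div r j))) =
      (\<Prod>j\<in>J. t powi (a j * (e j * int (?m div r j)))) * Q"
    unfolding Q_def power_int_mult_distrib prod.distrib power_int_mult ..
  also have "t powi (e0 * int ?m) * ((\<Prod>j\<in>J. t powi (a j * (e j * int (?m div r j)))) * Q) =
      t powi (e0 * int ?m + (\<Sum>j\<in>J. a j * (e j * int (?m div r j)))) * Q"
    using t_nz by (simp add: power_int_add power_int_sum mult.assoc del: of_nat_diff)
  finally show ?thesis unfolding exponent_sum power_int_of_nat .
qed

lemma w0_power: "w0 ^ (CARD('a) - 1) = \<iota> (Q powi (- int s))"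
proof -
  let ?m = "CARD('a) - 1"
  have "w0 ^ ?m = \<iota> t ^ ?m * (unf ^ ?m) powi (- int s)"
    unfolding w0_def power_mult_distrib power_int_power_eq by (simp only: ac_simps)
  also have "\<dots> = \<iota> (t ^ ?m * (t ^ (?m div s) * Q) powi (- int s))"
    unfolding unf_power by (simp only: i.hom_mult i.hom_powi i.hom_power)
  also have "(t ^ (?m div s) * Q) powi (- int s) = inverse (t ^ ?m) * Q powi (- int s)"
  proof -
    have "(t ^ (?m div s)) powi (- int s) = inverse (t ^ (?m div s * s))"
      by (simp add: power_int_minus power_mult power_int_of_nat)
    also have "?m div s * s = ?m" using s_dvd by simp
    finally show ?thesis by (simp only: power_int_mult_distrib)
  qed
  finally show ?thesis using t_nz by (simp add: mult.assoc[symmetric])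
qed

lemma w_power:
  assumes "j \<in> J"
  shows "w j ^ (CARD('a) - 1) = \<iota> (pev \<kappa> (U j) t ^ ((CARD('a) - 1) div r j) * Q powi (- kk j))"
proof -
  let ?m = "CARD('a) - 1"
  have "w j ^ ?m = y j powi (1 * int ?m) * (unf ^ ?m) powi (- kk j)"
    unfolding w_def power_mult_distrib power_int_power_eq mult_1 power_int_of_nat by (simp only: ac_simps)
  also have "\<dots> = \<iota> ((t powi a j * pev \<kappa> (U j) t) powi int (?m div r j) * (t ^ (?m div s) * Q) powi (- kk j))"
    unfolding unf_power y_power_card[OF assms, of 1] by (simp only: i.hom_mult i.hom_powi mult_1)
  also have "(t powi a j * pev \<kappa> (U j) t) powi int (?m div r j) =
      t powi (a j * int (?m div r j)) * pev \<kappa> (U j) t ^ (?m div r j)"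
    by (simp only: power_int_mult_distrib power_mult_distrib power_int_mult power_int_of_nat)
  also have "a j * int (?m div r j) = int (?m div s) * kk j"
  proof -
    have "int s * (a j * int (?m div r j)) = kk j * (int (r j) * int (?m div r j))"
      using kk[OF assms] by (simp add: mult.assoc[symmetric])
    also have "\<dots> = int s * (int (?m div s) * kk j)"
      unfolding r_div[OF assms] s_div[symmetric] by (simp only: ac_simps)
    finally show ?thesis using s_pos by simp
  qed
  also have "(t ^ (?m div s) * Q) powi (- kk j) = inverse (t powi (int (?m div s) * kk j)) * Q powi (- kk j)"
    by (simp only: power_int_mult_distrib power_int_power_eq mult_minus_right power_int_minus inverse_mult_distrib)
  finally show ?thesis using t_nz by (simp add: ac_simps mult_inverse_cancel_left)
qed

lemma unf_L: "unf \<in> L"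
  unfolding unf_def using L base_L y_L by (intro field_closedD[OF L] field_closed_prod) auto

lemma w_L: "w0 \<in> L" "j \<in> J \<Longrightarrow> w j \<in> L"
  unfolding w0_def w_def using unf_L base_L y_L by (auto intro!: field_closedD[OF L])

lemma w_relation:
  assumes "j \<in> J"
  shows "w j ^ r j = w0 powi a j * \<iota> (pev \<kappa> (U j) t)"
proof -
  have "w j ^ r j = y j ^ r j * unf powi (- (kk j * int (r j)))"
    unfolding w_def power_mult_distrib power_int_power_eq by (simp only: mult_minus_left)
  also have "\<dots> = \<iota> t powi a j * unf powi (- (int s * a j)) * \<iota> (pev \<kappa> (U j) t)"
    unfolding y_power[OF assms] kk[OF assms] by (simp only: i.hom_mult i.hom_powi ac_simps)
  also have "\<iota> t powi a j * unf powi (- (int s * a j)) = w0 powi a j"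
    unfolding w0_def power_int_mult_distrib by (simp only: power_int_mult[symmetric] mult_minus_left)
  finally show ?thesis .
qed

text \<open>Replacing \<open>unf\<close> by a constant multiple rescales \<open>w0\<close> and all
  \<open>w j\<close>. This relation picks one residue datum among the \<open>q - 1\<close>
  equivalent ones.\<close>

lemma w_normalized: "w0 powi e0 * (\<Prod>j\<in>J. w j powi e j) = 1"
proof -
  have "w0 powi e0 * (\<Prod>j\<in>J. w j powi e j) =
     (\<iota> t powi e0 * (\<Prod>j\<in>J. y j powi e j)) *
       (unf powi (- (int s) * e0) * (\<Prod>j\<in>J. unf powi (- kk j * e j)))"
    unfolding w0_def w_def power_int_mult_distrib prod.distrib power_int_mult
    by (simp only: ac_simps)
  also have "\<dots> = unf * (unf powi (- (int s) * e0) * (\<Prod>j\<in>J. unf powi (- kk j * e j)))"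
    by (subst (3) unf_def) (rule refl)
  also have "\<dots> = unf * unf powi (- (int s) * e0 + (\<Sum>j\<in>J. - kk j * e j))"
    by (simp only: power_int_add[OF disjI1[OF unf_nz]] power_int_sum[OF unf_nz])
  also have "- (int s) * e0 + (\<Sum>j\<in>J. - kk j * e j) = - 1"
    using bezout by (simp add: sum_negf ac_simps)
  finally show ?thesis using unf_nz by (simp add: power_int_minus)
qed

lemma base_pev: "\<iota> (pev \<kappa> p t) = pev k p (\<iota> t)"
  unfolding k_def using pev_compose_hom[of \<kappa> \<iota>] i.fhom_axioms c.fhom_axioms by metis

definition over_t :: "'e set \<Rightarrow> ('e \<Rightarrow> 'a) \<Rightarrow> bool" where
  "over_t V res \<longleftrightarrow> rational_place k L V res \<and> \<iota> t \<in> V \<and> res (\<iota> t) = 0"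

text \<open>Everything is deduced from \<open>(q - 1)\<close>-th powers in the base field, since
  \<open>V\<close> contains the roots in \<open>L\<close> of its elements.\<close>

lemma over_t_units:
  assumes "over_t V res"
  shows "unf \<in> V" "res unf = 0" "w0 \<in> V" "res w0 \<noteq> 0"
    "j \<in> J \<Longrightarrow> w j \<in> V" "j \<in> J \<Longrightarrow> res (w j) \<noteq> 0"
    "\<iota> (pev \<kappa> p t) \<in> V" "res (\<iota> (pev \<kappa> p t)) = poly p 0"
    "\<iota> Q \<in> V" "res (\<iota> Q) \<noteq> 0"
proof -
  interpret rational_place k L V res using assms by (simp add: over_t_def)
  have t: "\<iota> t \<in> V" "res (\<iota> t) = 0" using assms by (auto simp: over_t_def)
  show p: "\<iota> (pev \<kappa> p t) \<in> V" "res (\<iota> (pev \<kappa> p t)) = poly p 0" for p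
    using pev_V[OF t(1)] t(2) by (simp_all add: base_pev)
  have Q: "\<iota> Q = (\<Prod>j\<in>J. \<iota> (pev \<kappa> (U j) t) powi (e j * int ((CARD('a) - 1) div r j)))"
    unfolding Q_def by (simp only: i.hom_prod i.hom_powi)
  show QV: "\<iota> Q \<in> V" "res (\<iota> Q) \<noteq> 0"
    unfolding Q using p U_0 by (auto intro!: prod_V powi_V simp: res_prod powi_V res_powi)
  have m: "unf ^ (CARD('a) - 1) = \<iota> t ^ ((CARD('a) - 1) div s) * \<iota> Q"
    unfolding unf_power by (simp only: i.hom_mult i.hom_power)
  have sm: "(CARD('a) - 1) div s > 0" using s_dvd s_pos q1 by (simp add: div_greater_zero_iff dvd_imp_le)
  have mV: "unf ^ (CARD('a) - 1) \<in> V" "res (unf ^ (CARD('a) - 1)) = 0"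
    unfolding m using t QV sm by (auto intro!: mult_V power_V simp: res_mult res_power power_V)
  show "unf \<in> V" "res unf = 0"
    using V_of_power[OF unf_L q1 mV(1)] res_eq_0_of_power[OF unf_L q1 mV] by auto
  have unit: "z \<in> V \<and> res z \<noteq> 0" if "z \<in> L" "z ^ (CARD('a) - 1) \<in> V" "res (z ^ (CARD('a) - 1)) \<noteq> 0" for z
  proof -
    have "z \<in> V" using V_of_power[OF that(1) q1 that(2)] .
    then show ?thesis using that(3) q1 by (auto simp: res_power power_0_left)
  qed
  have "w0 \<in> V \<and> res w0 \<noteq> 0"
    by (rule unit) (use QV w_L in \<open>auto simp: w0_power[unfolded One_nat_def] i.hom_powi powi_V res_powi\<close>)
  then show "w0 \<in> V" "res w0 \<noteq> 0" by auto
  have "w j \<in> V \<and> res (w j) \<noteq> 0" if j: "j \<in> J"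
    by (rule unit) (use QV w_L p U_0 j in
      \<open>auto simp: w_power[unfolded One_nat_def] i.hom_simps powi_V res_powi res_mult power_V res_power mult_V\<close>)
  then show "j \<in> J \<Longrightarrow> w j \<in> V" "j \<in> J \<Longrightarrow> res (w j) \<noteq> 0" by auto
qed

definition data :: "('e \<Rightarrow> 'a) \<Rightarrow> 'a \<times> (nat \<Rightarrow> 'a)" where
  "data res = (res w0, \<lambda>j\<in>J. res (w j))"

definition solutions :: "('a \<times> (nat \<Rightarrow> 'a)) set" where
  "solutions = {(l, h). l \<noteq> 0 \<and> h \<in> (\<Pi>\<^sub>E j\<in>J. UNIV - {0}) \<and>
     (\<forall>j\<in>J. h j ^ r j = l powi a j * poly (U j) 0)}"

text \<open>Without the last equation every place would be described by \<open>q - 1\<close>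
  solutions, one for each constant multiple of the uniformizer.\<close>

definition normalized :: "('a \<times> (nat \<Rightarrow> 'a)) set" where
  "normalized = {(l, h) \<in> solutions. l powi e0 * (\<Prod>j\<in>J. h j powi e j) = 1}"

lemma data_normalized:
  assumes "over_t V res"
  shows "data res \<in> normalized"
proof -
  interpret rational_place k L V res using assms by (simp add: over_t_def)
  note [simp] = over_t_units[OF assms]
  have "res (w j) ^ r j = res w0 powi a j * poly (U j) 0" if j: "j \<in> J" for j
  proof -
    have "res (w j ^ r j) = res (w0 powi a j * \<iota> (pev \<kappa> (U j) t))" unfolding w_relation[OF j] ..
    then show ?thesis using j by (simp add: res_power res_mult powi_V res_powi)
  qed
  moreover have "res (w0 powi e0 * (\<Prod>j\<in>J. w j powi e j)) = 1" unfolding w_normalized by (rule res_one)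
  then have "res w0 powi e0 * (\<Prod>j\<in>J. res (w j) powi e j) = 1"
    by (simp add: res_mult powi_V res_powi prod_V res_prod)
  ultimately show ?thesis by (auto simp: data_def normalized_def solutions_def)
qed

text \<open>The part of a place that its residue data determine: the ring generated by the
  constants, \<open>t\<close>, the uniformizer and the units, with elements of nonzero residue
  inverted.\<close>

inductive_set local_ring :: "('e \<Rightarrow> 'a) \<Rightarrow> 'e set" for res where
  "k x \<in> local_ring res"
| "\<iota> t \<in> local_ring res"
| "unf \<in> local_ring res"
| "w0 \<in> local_ring res"
| "j \<in> J \<Longrightarrow> w j \<in> local_ring res"
| "x \<in> local_ring res \<Longrightarrow> z \<in> local_ring res \<Longrightarrow> x + z \<in> local_ring res"
| "x \<in> local_ring res \<Longrightarrow> z \<in> local_ring res \<Longrightarrow> x * z \<in> local_ring res"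
| "x \<in> local_ring res \<Longrightarrow> res x \<noteq> 0 \<Longrightarrow> inverse x \<in> local_ring res"

text \<open>Equal data give equal residues of the generators, and every rule determines the residue
  of its result; so an inversion that is allowed for \<open>res\<close> is allowed for
  \<open>res'\<close>.\<close>

lemma local_ring_subset:
  assumes V: "over_t V res" and V': "over_t V' res'" and "data res = data res'" "x \<in> local_ring res"
  shows "x \<in> V'" "res' x = res x" "x \<in> V"
proof -
  interpret V: rational_place k L V res using V by (simp add: over_t_def)
  interpret V': rational_place k L V' res' using V' by (simp add: over_t_def)
  have w: "res w0 = res' w0" "j \<in> J \<Longrightarrow> res (w j) = res' (w j)" for j
    using assms(3) by (auto simp: data_def fun_eq_iff restrict_def split: if_splits)
  note u = over_t_units[OF V] over_t_units[OF V']
  have t: "\<iota> t \<in> V" "res (\<iota> t) = 0" "\<iota> t \<in> V'" "res' (\<iota> t) = 0" using V V' by (auto simp: over_t_def)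
  have "x \<in> V' \<and> res' x = res x \<and> x \<in> V"
    using assms(4)
  proof induction
    case (8 x)
    then show ?case using V'.inverse_V V.inverse_V V.res_inverse V'.res_inverse by metis
  qed (use t u w in \<open>auto simp: V.const_V V.res_const V'.const_V V'.res_const V.add_V V'.add_V
        V.mult_V V'.mult_V V.res_add V'.res_add V.res_mult V'.res_mult\<close>)
  then show "x \<in> V'" "res' x = res x" "x \<in> V" by auto
qed

lemma local_ring_power: "x \<in> local_ring res \<Longrightarrow> x ^ m \<in> local_ring res"
  using local_ring.intros(1)[of 1] by (induction m) (auto simp: k.hom_one intro: local_ring.intros)

text \<open>The nonunits of the local ring are multiples of \<open>unf\<close>, with the cofactor
  again in the ring. The delicate generators are \<open>w0\<close> and \<open>w j\<close>, for which
  the expansion is known at first only for the power \<open>q - 1\<close>.\<close>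

lemma local_ring_expand:
  assumes V: "over_t V res" and "x \<in> local_ring res"
  shows "\<exists>x'\<in>local_ring res. x = k (res x) + unf * x'"
proof -
  interpret V: rational_place k L V res using V by (simp add: over_t_def)
  note u = over_t_units[OF V]
  have t: "\<iota> t \<in> V" "res (\<iota> t) = 0" using V by (auto simp: over_t_def)
  note sub = local_ring_subset[OF V V refl]
  define E where "E = {x \<in> local_ring res. \<exists>x'\<in>local_ring res. x = k (res x) + unf * x'}"
  have EI: "x \<in> E" if "x = k c + unf * x'" "x' \<in> local_ring res" for x c x'
  proof -
    have x: "x \<in> local_ring res" unfolding that(1) using that(2) by (auto intro: local_ring.intros)
    have "res x = c"
      unfolding that(1) using sub[OF that(2)] u V.const_V by (simp add: V.res_add V.res_mult V.mult_V V.res_const)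
    then show ?thesis using x that by (auto simp: E_def)
  qed
  have zero: "0 \<in> local_ring res" using local_ring.intros(1)[of 0] by (simp add: k.hom_zero)
  have const: "k c \<in> E" for c by (rule EI[of _ c 0]) (use zero in auto)
  have unf: "unf \<in> E" by (rule EI[of _ 0 1]) (use local_ring.intros(1)[of 1] in \<open>auto simp: k.hom_simps\<close>)
  have t: "\<iota> t \<in> E"
  proof (rule EI)
    have "\<iota> t = w0 * unf ^ s"
      using unf_nz by (simp add: w0_def power_int_minus power_int_of_nat)
    also have "unf ^ s = unf * unf ^ (s - 1)" using s_pos by (simp flip: power_Suc)
    finally show "\<iota> t = k 0 + unf * (w0 * unf ^ (s - 1))" by (simp add: k.hom_zero)
  qed (auto intro!: local_ring.intros local_ring_power)
  have add: "x + z \<in> E" if "x \<in> E" "z \<in> E" for x z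
  proof -
    obtain x' z' where 1: "x = k (res x) + unf * x'" "z = k (res z) + unf * z'"
      "x' \<in> local_ring res" "z' \<in> local_ring res"
      using \<open>x \<in> E\<close> \<open>z \<in> E\<close> unfolding E_def by blast
    have "x + z = k (res x + res z) + unf * (x' + z')"
      by (subst 1(1), subst 1(2)) (simp add: k.hom_simps algebra_simps)
    then show ?thesis by (rule EI) (use 1 in \<open>auto intro: local_ring.intros\<close>)
  qed
  have mult: "x * z \<in> E" if "x \<in> E" "z \<in> E" for x z
  proof -
    obtain x' z' where 1: "x = k (res x) + unf * x'" "z = k (res z) + unf * z'"
      "x' \<in> local_ring res" "z' \<in> local_ring res"
      using \<open>x \<in> E\<close> \<open>z \<in> E\<close> unfolding E_def by blast
    have "x * z = (k (res x) + unf * x') * z" by (rule arg_cong[OF 1(1), where f = "\<lambda>u. u * z"])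
    also have "\<dots> = k (res x) * z + unf * (x' * z)" by (simp add: algebra_simps)
    also have "k (res x) * z = k (res x) * (k (res z) + unf * z')"
      by (rule arg_cong[OF 1(2), where f = "\<lambda>u. k (res x) * u"])
    also have "\<dots> + unf * (x' * z) = k (res x * res z) + unf * (k (res x) * z' + x' * z)"
      by (simp add: k.hom_simps algebra_simps)
    finally have "x * z = k (res x * res z) + unf * (k (res x) * z' + x' * z)" .
    then show ?thesis by (rule EI) (use 1 that in \<open>auto intro!: local_ring.intros simp: E_def\<close>)
  qed
  have inv: "inverse x \<in> E" if "x \<in> E" "res x \<noteq> 0" for x
  proof -
    obtain x' where 1: "x = k (res x) + unf * x'" "x' \<in> local_ring res" "x \<in> local_ring res"
      using \<open>x \<in> E\<close> unfolding E_def by blast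
    have nz: "x \<noteq> 0" "k (res x) \<noteq> 0" using that V.res_zero by (auto simp: k.hom_eq_0_iff)
    have ux: "unf * x' = x - k (res x)" using 1(1) by (simp add: algebra_simps)
    \<comment> \<open>This is \<open>1 / x = 1 / c - (x - c) / (c * x)\<close> with the constant
      \<open>c = k (res x)\<close>.\<close>
    have "k (inverse (res x)) + unf * (- 1 * (x' * (k (inverse (res x)) * inverse x)))
        = inverse (k (res x)) - (unf * x') * inverse (k (res x)) * inverse x"
      by (simp add: k.hom_inverse mult.assoc)
    also have "\<dots> = inverse x" unfolding ux using nz by (simp add: field_simps)
    finally have eq: "inverse x = k (inverse (res x)) + unf * (- 1 * (x' * (k (inverse (res x)) * inverse x)))" ..
    have "- 1 \<in> local_ring res" using local_ring.intros(1)[of "-1"] by (simp add: k.hom_simps)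
    then show ?thesis
      by (intro EI[OF eq] local_ring.intros 1 that(2))
  qed
  have pow: "x ^ m \<in> E" if "x \<in> E" for x m
    using that const[of 1] by (induction m) (auto simp: k.hom_one mult)
  have powi: "x powi m \<in> E" if "x \<in> E" "res x \<noteq> 0" for x m
    using pow[OF that(1)] pow[OF inv[OF that]] by (simp add: power_int_def)
  have pevE: "\<iota> (pev \<kappa> p t) \<in> E" for p
    unfolding base_pev using const t const[of 0] by (induction p) (auto simp: add mult k.hom_zero)
  have prodE: "(\<Prod>j\<in>A. f j) \<in> E" if "\<And>j. j \<in> A \<Longrightarrow> f j \<in> E" for A :: "nat set" and f
    using that const[of 1] by (induction A rule: infinite_finite_induct) (auto simp: mult k.hom_one)
  have QE: "\<iota> Q \<in> E"
    unfolding Q_def i.hom_prod i.hom_powi using pevE u(8) U_0 by (intro prodE powi) auto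
  \<comment> \<open>With the residue scaled to 1, \<open>v ^ (q - 1) - 1 = (v - 1) * S\<close> for
    the geometric sum \<open>S\<close>. Its residue is \<open>q - 1 = -1\<close>, so
    \<open>S\<close> is invertible and the expansion of \<open>v ^ (q - 1)\<close> gives one of
    \<open>v\<close>.\<close>
  have unit: "x \<in> E" if x: "x \<in> local_ring res" and x0: "res x \<noteq> 0" and xE: "x ^ (CARD('a) - 1) \<in> E" for x
  proof -
    define v where "v = x * k (inverse (res x))"
    have v: "v \<in> local_ring res" using x by (auto simp: v_def intro: local_ring.intros)
    have rv: "res v = 1" using x0 sub(3)[OF x] V.const_V
      unfolding v_def by (simp add: V.res_mult V.res_const)
    have vm: "v ^ (CARD('a) - 1) \<in> E"
      unfolding v_def power_mult_distrib using xE const pow by (auto intro!: mult)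
    have "res (v ^ (CARD('a) - 1)) = 1" using rv V.res_power[OF sub(3)[OF v]] by simp
    with vm obtain z where z: "z \<in> local_ring res" "v ^ (CARD('a) - 1) = 1 + unf * z"
      by (auto simp: E_def k.hom_one)
    define S where "S = (\<Sum>i<CARD('a) - 1. v ^ i)"
    have "S \<in> local_ring res"
    proof -
      have "(\<Sum>i\<in>A. v ^ i) \<in> local_ring res" for A
        by (induction A rule: infinite_finite_induct)
           (use zero v in \<open>auto intro!: local_ring.intros(6) local_ring_power\<close>)
      then show ?thesis by (simp only: S_def)
    qed
    have rS: "res S = - 1"
    proof -
      have "res S = of_nat (CARD('a) - 1)"
        unfolding S_def using V.power_V[OF sub(3)[OF v]] by (subst V.res_sum) (auto simp: V.res_power sub(3)[OF v] rv)
      moreover have "of_nat (CARD('a)) = (0::'a)"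
        using finite_field_binomial_eq_0[where 'a='a, of 1] card_field_ge2[where 'a='a] by simp
      ultimately show ?thesis using card_field_ge2[where 'a='a] by (simp add: of_nat_diff)
    qed
    then have S0: "S \<noteq> 0" using V.res_zero by auto
    have "unf * z = (v - 1) * S" using z(2) power_diff_1_eq[of v "CARD('a) - 1"] unfolding S_def by simp
    then have v1: "v = 1 + unf * (z * inverse S)" using S0 by (simp add: field_simps)
    have "x = v * k (res x)" using x0 by (simp add: v_def k.hom_inverse k.hom_eq_0_iff)
    then have "x = k (res x) + unf * (z * inverse S * k (res x))" by (subst (asm) v1) (simp add: algebra_simps)
    then show ?thesis
      by (rule EI) (use z rS \<open>S \<in> local_ring res\<close> in \<open>auto intro!: local_ring.intros\<close>)
  qed
  have w0E: "w0 \<in> E"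
    by (rule unit) (use u QE in \<open>auto simp: w0_power[unfolded One_nat_def] i.hom_powi intro!: local_ring.intros powi\<close>)
  have wE: "w j \<in> E" if "j \<in> J" for j
    by (rule unit) (use that u QE U_0 pevE in \<open>auto simp: w_power[unfolded One_nat_def] i.hom_simps intro!: local_ring.intros powi mult pow\<close>)
  have "x \<in> E" using assms(2)
    by induction (use const t unf w0E wE add mult inv in auto)
  then show ?thesis by (auto simp: E_def)
qed

text \<open>Every nonzero element of \<open>L\<close> is a unit of the local ring times an integral
  power of \<open>unf\<close>, and membership in a place over \<open>t\<close> depends on the sign
  of the exponent alone. Discreteness, which stops the extraction of factors \<open>unf\<close>, is
  only required of the second place.\<close>

lemma over_t_unique:
  assumes V: "over_t V res" and V': "over_t V' res'" and data: "data res = data res'"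
    and discrete: "\<And>z. z \<in> V' \<Longrightarrow> z \<noteq> 0 \<Longrightarrow> \<exists>N. z * inverse unf ^ N \<notin> V'"
  shows "V = V'"
proof -
  interpret V: rational_place k L V res using V by (simp add: over_t_def)
  interpret V': rational_place k L V' res' using V' by (simp add: over_t_def)
  let ?O = "local_ring res"
  note sub = local_ring_subset[OF V V' data]
  note expand = local_ring_expand[OF V]
  note u = over_t_units[OF V] over_t_units[OF V']
  have zero: "0 \<in> ?O" and one: "1 \<in> ?O" and neg1: "- 1 \<in> ?O"
    using local_ring.intros(1)[of 0] local_ring.intros(1)[of 1] local_ring.intros(1)[of "-1"] by (simp_all add: k.hom_simps)
  note pow = local_ring_power
  \<comment> \<open>The bound \<open>N\<close> from discreteness limits how often \<open>unf\<close>
    can be split off.\<close>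
  have fac: "\<exists>N u. u \<in> ?O \<and> res u \<noteq> 0 \<and> z = unf ^ N * u"
    if "z * inverse unf ^ N \<notin> V'" "z \<in> ?O" for z N
    using that
  proof (induction N arbitrary: z)
    case 0
    then show ?case using sub by auto
  next
    case (Suc N)
    show ?case
    proof (cases "res z = 0")
      case False
      then show ?thesis using Suc.prems by (rule_tac exI[of _ 0], rule_tac exI[of _ z]) auto
    next
      case True
      obtain z' where z': "z' \<in> ?O" "z = unf * z'"
        using expand[OF Suc.prems(2)] True by (auto simp: k.hom_zero)
      have "z * inverse unf ^ Suc N = z' * inverse unf ^ N" using unf_nz z' by simp
      then obtain N' u where "u \<in> ?O \<and> res u \<noteq> 0 \<and> z' = unf ^ N' * u" using Suc z' by metis
      then show ?thesis using z' by (intro exI[of _ "Suc N'"] exI[of _ u]) simp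
    qed
  qed
  \<comment> \<open>The quotient field of the local ring; it contains the base field and the
    radicals, hence all of \<open>L\<close>.\<close>
  define F where "F = {x / z | x z. x \<in> ?O \<and> z \<in> ?O \<and> z \<noteq> 0}"
  have FI: "x / z \<in> F" if "x \<in> ?O" "z \<in> ?O" "z \<noteq> 0" for x z using that by (auto simp: F_def)
  have OF: "x \<in> F" if "x \<in> ?O" for x using FI[OF that one] by simp
  have Fadd: "x + z \<in> F" if "x \<in> F" "z \<in> F" for x z
  proof -
    obtain x1 x2 z1 z2 where 1: "x1 \<in> ?O" "x2 \<in> ?O" "z1 \<in> ?O" "z2 \<in> ?O" "x2 \<noteq> 0" "z2 \<noteq> 0" "x = x1 / x2" "z = z1 / z2"
      using \<open>x \<in> F\<close> \<open>z \<in> F\<close> unfolding F_def by blast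
    have "x + z = (x1 * z2 + z1 * x2) / (x2 * z2)" using 1 by (simp add: field_simps)
    also have "\<dots> \<in> F" by (rule FI) (use 1 in \<open>auto intro!: local_ring.intros\<close>)
    finally show ?thesis .
  qed
  have Fmult: "x * z \<in> F" if "x \<in> F" "z \<in> F" for x z
  proof -
    obtain x1 x2 z1 z2 where 1: "x1 \<in> ?O" "x2 \<in> ?O" "z1 \<in> ?O" "z2 \<in> ?O" "x2 \<noteq> 0" "z2 \<noteq> 0" "x = x1 / x2" "z = z1 / z2"
      using \<open>x \<in> F\<close> \<open>z \<in> F\<close> unfolding F_def by blast
    have "x * z = (x1 * z1) / (x2 * z2)" using 1 by (simp add: field_simps)
    also have "\<dots> \<in> F" by (rule FI) (use 1 in \<open>auto intro!: local_ring.intros\<close>)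
    finally show ?thesis .
  qed
  have Finv: "inverse x \<in> F" if "x \<in> F" for x
  proof -
    obtain x1 x2 where 1: "x1 \<in> ?O" "x2 \<in> ?O" "x2 \<noteq> 0" "x = x1 / x2"
      using \<open>x \<in> F\<close> unfolding F_def by blast
    show ?thesis
    proof (cases "x1 = 0")
      case True then show ?thesis using 1 OF[OF zero] by simp
    next
      case False
      then show ?thesis using 1 FI[of x2 x1] by simp
    qed
  qed
  have Fprod: "(\<Prod>j\<in>A. f j) \<in> F" if "\<And>j. j \<in> A \<Longrightarrow> f j \<in> F" for A :: "nat set" and f
    using that OF[OF one] by (induction A rule: infinite_finite_induct) (auto simp: Fmult)
  have Fsum: "(\<Sum>j\<in>A. f j) \<in> F" if "\<And>j. j \<in> A \<Longrightarrow> f j \<in> F" for A :: "(nat \<Rightarrow> nat) set" and f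
    using that OF[OF zero] by (induction A rule: infinite_finite_induct) (auto simp: Fadd)
  have Fpow: "x ^ m \<in> F" if "x \<in> F" for x m
    using that OF[OF one] by (induction m) (auto simp: Fmult)
  have Fpowi: "x powi m \<in> F" if "x \<in> F" for x m
    using that by (auto simp: power_int_def intro!: Fpow Finv)
  have Fbase: "\<iota> z \<in> F" for z
  proof -
    have p: "\<iota> (pev \<kappa> p t) \<in> F" for p
      unfolding base_pev using OF[OF zero]
      by (induction p)
         (auto simp: k.hom_zero intro!: Fadd[OF OF[OF local_ring.intros(1)] Fmult[OF OF[OF local_ring.intros(2)]]])
    obtain p p' where "z = pev \<kappa> p t / pev \<kappa> p' t" using generated by blast
    then have "\<iota> z = \<iota> (pev \<kappa> p t) * inverse (\<iota> (pev \<kappa> p' t))"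
      by (simp add: i.hom_simps divide_inverse)
    then show ?thesis using p Finv Fmult by metis
  qed
  have Fy: "y j \<in> F" if "j \<in> J" for j
  proof -
    have "y j = w j * unf powi kk j" using unf_nz by (simp add: w_def power_int_minus)
    then show ?thesis using that using OF[OF local_ring.intros(3)] OF[OF local_ring.intros(5)] by (auto intro!: Fmult Fpowi)
  qed
  have LF: "x \<in> F" if "x \<in> L" for x
  proof -
    obtain c where "x = (\<Sum>b\<in>(\<Pi>\<^sub>E j\<in>J. {..<r j}). \<iota> (c b) * (\<Prod>j\<in>J. y j ^ b j))"
      using L_span[OF \<open>x \<in> L\<close>] by blast
    then show ?thesis by (auto intro!: Fsum Fmult Fprod Fpow Fbase Fy)
  qed
  have facL: "\<exists>N M u. u \<in> ?O \<and> res u \<noteq> 0 \<and> z * unf ^ M = unf ^ N * u" if "z \<in> L" "z \<noteq> 0" for z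
  proof -
    obtain z1 z2 where 1: "z1 \<in> ?O" "z2 \<in> ?O" "z2 \<noteq> 0" "z = z1 / z2"
      using LF[OF \<open>z \<in> L\<close>] unfolding F_def by blast
    then have "z1 \<noteq> 0" using that by auto
    obtain N1 u1 where a: "u1 \<in> ?O" "res u1 \<noteq> 0" "z1 = unf ^ N1 * u1"
      using discrete[OF sub(1)[OF 1(1)] \<open>z1 \<noteq> 0\<close>] fac[OF _ 1(1)] by blast
    obtain N2 u2 where b: "u2 \<in> ?O" "res u2 \<noteq> 0" "z2 = unf ^ N2 * u2"
      using discrete[OF sub(1)[OF 1(2)] \<open>z2 \<noteq> 0\<close>] fac[OF _ 1(2)] by blast
    have "u2 \<noteq> 0" using b V.res_zero by auto
    then have eq: "z * unf ^ N2 = unf ^ N1 * (u1 * inverse u2)"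
      using 1 a(3) b(3) unf_nz by (simp add: field_simps)
    have "res (u1 * inverse u2) \<noteq> 0"
      using a b sub(3) by (simp add: V.res_mult V.inverse_V V.res_inverse)
    then show ?thesis using eq a b by (rule_tac exI[of _ N1], rule_tac exI[of _ N2], rule_tac exI[of _ "u1 * inverse u2"])
        (auto intro!: local_ring.intros)
  qed
  \<comment> \<open>Stated for two arbitrary places containing the local ring, so that it serves for
    both inclusions.\<close>
  have main: "z \<in> V2"
    if P1: "over_t V1 res1" and P2: "over_t V2 res2" and O1: "\<And>x. x \<in> ?O \<Longrightarrow> x \<in> V1 \<and> res1 x = res x"
      and O2: "\<And>x. x \<in> ?O \<Longrightarrow> x \<in> V2" and z: "z \<in> V1" for V1 V2 res1 res2 z
  proof (cases "z = 0")
    case True then show ?thesis using O2 zero by blast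
  next
    case False
    interpret V1: rational_place k L V1 res1 using P1 by (simp add: over_t_def)
    interpret V2: rational_place k L V2 res2 using P2 by (simp add: over_t_def)
    have "z \<in> L" using z V1.V_subset by auto
    then obtain N M u where u: "u \<in> ?O" "res u \<noteq> 0" "z * unf ^ M = unf ^ N * u" using facL False by blast
    have unf1: "unf \<in> V1" "res1 unf = 0" using over_t_units[OF P1] by auto
    have "N \<ge> M"
    proof (rule ccontr)
      assume "\<not> N \<ge> M"
      then have "unf ^ M = unf ^ N * unf ^ (M - N)" by (simp flip: power_add)
      then have "unf ^ N * (z * unf ^ (M - N)) = unf ^ N * u" using u by (simp add: ac_simps)
      then have "z * unf ^ (M - N) = u" using unf_nz by simp
      moreover have "res1 (z * unf ^ (M - N)) = 0"
        using z unf1 \<open>\<not> N \<ge> M\<close> by (simp add: V1.res_mult V1.power_V V1.res_power power_0_left)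
      ultimately show False using u O1 by auto
    qed
    then have "unf ^ N = unf ^ M * unf ^ (N - M)" by (simp flip: power_add)
    then have "unf ^ M * z = unf ^ M * (unf ^ (N - M) * u)" using u by (simp add: ac_simps)
    then have "z = unf ^ (N - M) * u" using unf_nz by simp
    then show ?thesis using O2 u(1) pow local_ring.intros(3) V2.mult_V by metis
  qed
  show ?thesis
  proof (intro equalityI subsetI)
    fix z assume z: "z \<in> V" show "z \<in> V'" by (rule main[OF V V' _ _ z]) (use sub in auto)
  next
    fix z assume z: "z \<in> V'" show "z \<in> V" by (rule main[OF V' V _ _ z]) (use sub in auto)
  qed
qed

end

section \<open>Laurent series over the constants: the standard place, roots of units, pullback of
  places\<close>

unbundle no vec_syntax
unbundle fps_syntax

lemma rational_place_fls:
  "rational_place (fls_const :: 'a::{field,finite} \<Rightarrow> 'a fls) UNIV {f. fls_subdegree f \<ge> 0} (\<lambda>f. f $$ 0)"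
proof -
  have h: "fhom (fls_const :: 'a \<Rightarrow> 'a fls)"
    by unfold_locales (simp_all add: fls_plus_const)
  interpret h: fhom "fls_const :: 'a \<Rightarrow> 'a fls" by (rule h)
  have reg: "fps_to_fls (fls_regpart f) = f" if "fls_subdegree f \<ge> 0" for f :: "'a fls"
    using that by simp
  have mult0: "(f * g) $$ 0 = f $$ 0 * g $$ 0" if "fls_subdegree f \<ge> 0" "fls_subdegree g \<ge> 0" for f g :: "'a fls"
  proof -
    have "(f * g) $$ 0 = fps_to_fls (fls_regpart f * fls_regpart g) $$ 0"
      using reg that by (simp add: fls_times_fps_to_fls)
    also have "\<dots> = f $$ 0 * g $$ 0" by simp
    finally show ?thesis .
  qed
  have pos: "fls_subdegree (f :: 'a fls) = 0" if "fls_subdegree f \<ge> 0" "f $$ 0 \<noteq> 0" for f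
    using that by (meson antisym fls_subdegree_leI)
  show ?thesis
  proof (unfold_locales, goal_cases)
    case 1 show ?case by (simp add: field_closed_def)
  next
    case (5 x y) then show ?case by (cases "x = 0"; cases "y = 0"; cases "x + y = 0")
      (auto simp: fls_plus_subdegree intro: order_trans[OF _ fls_plus_subdegree])
  next
    case (6 x y) then show ?case by (cases "x = 0 \<or> y = 0") auto
  next
    case (11 x)
    then have "0 < fls_subdegree (inverse x)" by simp
    then show ?case by (rule fls_eq0_below_subdegree)
  next
    case (8 x y) then show ?case by (simp add: mult0)
  next
    case (9 x) then show ?case using pos[of x] by simp
  qed simp_all
qed

text \<open>Coefficientwise Newton iteration: adding \<open>c X^(N+1)\<close> to an approximation
  \<open>R\<close> changes the next coefficient of \<open>R ^ r\<close> by
  \<open>c * r * h ^ (r - 1)\<close>, and the factor of \<open>c\<close> is nonzero.\<close>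

lemma fps_power_root:
  fixes u :: "'a::field fps"
  assumes r: "of_nat r \<noteq> (0::'a)" and h: "h \<noteq> 0" and u: "u $ 0 = h ^ r"
  obtains R where "R ^ r = u" "R $ 0 = h"
proof -
  define P where "P N R \<longleftrightarrow> R $ 0 = h \<and> (\<forall>i\<le>N. (R ^ r) $ i = u $ i)" for N :: nat and R :: "'a fps"
  have "\<exists>f. \<forall>N. P N (f N) \<and> (\<forall>i\<le>N. f (Suc N) $ i = f N $ i)"
  proof (rule dependent_nat_choice)
    show "\<exists>R. P 0 R" by (rule exI[of _ "fps_const h"]) (simp add: P_def u fps_power_zeroth)
  next
    fix R N assume R: "P N R"
    define S0 where "S0 = of_nat r * h ^ (r - 1)"
    have S0: "S0 \<noteq> 0" using r h by (simp add: S0_def)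
    define c where "c = (u $ Suc N - (R ^ r) $ Suc N) / S0"
    define E where "E = fps_const c * fps_X ^ Suc N"
    define S where "S = (\<Sum>i<r. (R + E) ^ i * R ^ (r - Suc i))"
    have diff: "(R + E) ^ r - R ^ r = E * S"
    proof (cases r)
      case (Suc r')
      then show ?thesis using diff_power_eq_sum[of "R + E" r' R]
        by (simp add: S_def mult.commute)
    qed (simp add: S_def)
    have RE0: "(R + E) $ 0 = h" using R by (simp add: P_def E_def)
    have "S $ 0 = (\<Sum>i<r. h ^ i * h ^ (r - Suc i))"
      using R RE0 by (simp add: S_def fps_sum_nth fps_power_zeroth P_def)
    also have "\<dots> = (\<Sum>i<r. h ^ (r - 1))" by (intro sum.cong refl) (simp flip: power_add)
    finally have SS0: "S $ 0 = S0" by (simp add: S0_def)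
    have co: "((R + E) ^ r) $ i = (R ^ r) $ i + (E * S) $ i" for i
      using arg_cong[OF diff, of "\<lambda>f. f $ i"] by (simp add: algebra_simps)
    have ES: "(E * S) $ i = (if i < Suc N then 0 else c * S $ (i - Suc N))" for i
      unfolding E_def mult.assoc fps_mult_left_const_nth fps_X_power_mult_nth by simp
    have "P (Suc N) (R + E)"
      unfolding P_def
    proof (intro conjI allI impI RE0)
      fix i assume "i \<le> Suc N"
      then consider "i \<le> N" | "i = Suc N" by linarith
      then show "((R + E) ^ r) $ i = u $ i"
      proof cases
        case 1 then show ?thesis using R by (simp add: co ES P_def)
      next
        case 2 then show ?thesis using S0 SS0 by (simp add: co ES c_def)
      qed
    qed
    moreover have "\<forall>i\<le>N. (R + E) $ i = R $ i" unfolding E_def fps_add_nth fps_mult_left_const_nth fps_X_power_nth by simp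
    ultimately show "\<exists>R'. P (Suc N) R' \<and> (\<forall>i\<le>N. R' $ i = R $ i)" by blast
  qed
  then obtain f where f: "\<And>N. P N (f N)" "\<And>N i. i \<le> N \<Longrightarrow> f (Suc N) $ i = f N $ i" by blast
  have f': "f M $ i = f N $ i" if "i \<le> N" "N \<le> M" for M N i
    using that(2) by (induction M rule: dec_induct) (use that(1) f(2) in auto)
  \<comment> \<open>Coefficient \<open>i\<close> is frozen from stage \<open>i\<close> onwards, so
    the diagonal is the limit.\<close>
  define R where "R = Abs_fps (\<lambda>i. f i $ i)"
  have low: "(A ^ m) $ i = (B ^ m) $ i" if "\<And>j. j \<le> i \<Longrightarrow> A $ j = B $ j" for A B :: "'a fps" and m i
    using that
  proof (induction m arbitrary: i)
    case (Suc m)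
    have "(A * A ^ m) $ i = (B * B ^ m) $ i"
      unfolding fps_mult_nth
    proof (rule sum.cong[OF refl])
      fix j assume "j \<in> {0..i}"
      then have "A $ j = B $ j" "(A ^ m) $ (i - j) = (B ^ m) $ (i - j)"
        using Suc.prems by (auto intro!: Suc.IH)
      then show "A $ j * (A ^ m) $ (i - j) = B $ j * (B ^ m) $ (i - j)" by simp
    qed
    then show ?case by simp
  qed simp
  show ?thesis
  proof (rule that)
    show "R ^ r = u"
    proof (rule fps_ext)
      fix i
      have "(R ^ r) $ i = (f i ^ r) $ i" by (rule low) (simp add: R_def f'[of _ _ i, OF order_refl])
      also have "\<dots> = u $ i" using f(1)[of i] by (simp add: P_def)
      finally show "(R ^ r) $ i = u $ i" .
    qed
    show "R $ 0 = h" using f(1)[of 0] by (simp add: R_def P_def)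
  qed
qed

lemma fls_power_root:
  fixes u :: "'a::{field,finite} fls"
  assumes r: "of_nat r \<noteq> (0::'a)" and h: "h \<noteq> 0" and u: "fls_subdegree u \<ge> 0" "u $$ 0 = h ^ r"
  obtains R where "R ^ r = u" "R $$ 0 = h" "fls_subdegree R \<ge> 0"
proof -
  obtain R where R: "R ^ r = fls_regpart u" "R $ 0 = h"
    using fps_power_root[OF r h, of "fls_regpart u"] u(2) by auto
  show ?thesis
  proof (rule that)
    have "fps_to_fls R ^ r = fps_to_fls (fls_regpart u)" by (simp flip: R(1) add: fps_to_fls_power)
    then show "fps_to_fls R ^ r = u" using u(1) by simp
  qed (use R in \<open>auto simp: fls_subdegree_fls_to_fps_gt0\<close>)
qed

text \<open>If the characteristic divided \<open>r\<close>, then \<open>q - 1\<close> would vanish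
  in the field, where it equals \<open>-1\<close>. This admits the \<open>r\<close>-th roots of
  units needed in Laurent series.\<close>

lemma of_nat_dvd_card_minus_1_neq_0:
  assumes "r dvd CARD('a::{field,finite}) - 1"
  shows "of_nat r \<noteq> (0::'a)"
proof
  assume r: "of_nat r = (0::'a)"
  obtain m where m: "CARD('a) - 1 = r * m" using assms by auto
  have "of_nat (CARD('a)) = (0::'a)"
    using finite_field_binomial_eq_0[where 'a='a, of 1] card_field_ge2[where 'a='a] by simp
  then have "of_nat (CARD('a) - 1) = (- 1 :: 'a)" using card_field_ge2[where 'a='a] by (simp add: of_nat_diff)
  with r show False unfolding m by simp
qed

text \<open>\<open>f\<close> is only asked to be a homomorphism on \<open>L\<close>: the embeddings
  it is applied to are arbitrary outside of it.\<close>

lemma rational_place_pullback: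
  assumes V: "rational_place k' UNIV V res" and k: "fhom k" and L: "field_closed L" and kL: "range k \<subseteq> L"
    and const: "\<And>c. f (k c) = k' c"
    and add: "\<And>x y. x \<in> L \<Longrightarrow> y \<in> L \<Longrightarrow> f (x + y) = f x + f y"
    and mult: "\<And>x y. x \<in> L \<Longrightarrow> y \<in> L \<Longrightarrow> f (x * y) = f x * f y"
  shows "rational_place k L {x \<in> L. f x \<in> V} (\<lambda>x. res (f x))"
proof -
  interpret V: rational_place k' UNIV V res by fact
  interpret k: fhom k by fact
  note Lc = field_closedD[OF L]
  have one: "f 1 = 1" using const[of 1] by (simp add: k.hom_one V.k.hom_one)
  have zero: "f 0 = 0" using const[of 0] by (simp add: k.hom_zero V.k.hom_zero)
  have inv: "f (inverse x) = inverse (f x)" if "x \<in> L" for x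
  proof (cases "x = 0")
    case False
    then have "f x * f (inverse x) = 1" using mult[OF that Lc(6)[OF that]] one by simp
    then show ?thesis by (simp add: inverse_unique)
  qed (simp add: zero)
  show ?thesis
  proof (unfold_locales, goal_cases)
    case (3 c) then show ?case using kL const V.const_V by auto
  next
    case (4 c) then show ?case using const V.res_const by simp
  next
    case (5 x y) then show ?case using Lc add V.add_V by auto
  next
    case (6 x y) then show ?case using Lc mult V.mult_V by auto
  next
    case (7 x y) then show ?case using add V.res_add by auto
  next
    case (8 x y) then show ?case using mult V.res_mult by auto
  next
    case (9 x) then show ?case using Lc inv V.inverse_V by auto
  next
    case (10 x) then show ?case using Lc inv V.inverse_outside by auto
  next
    case (11 x) then show ?case using Lc inv V.res_inverse_outside by auto
  qed (use L in auto)
qed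

section \<open>Realising residue data and counting the places over \<open>t = 0\<close>\<close>

context kummer_place
begin

lemma k_L: "k c \<in> L"
  unfolding k_def by (rule base_L)

text \<open>Elements of the base field are quotients of polynomials in \<open>t\<close>. The map
  \<open>t \<mapsto> \<theta>\<close> is well defined because \<open>\<theta>\<close>, having
  positive order, is transcendental over the constants: after removing factors
  \<open>\<theta>\<close>, a nonzero constant term survives.\<close>

lemma base_hom_exists:
  fixes \<theta> :: "'a fls"
  assumes "\<theta> \<noteq> 0" "fls_subdegree \<theta> > 0"
  obtains \<epsilon> where "fhom \<epsilon>" "\<And>p. \<epsilon> (pev \<kappa> p t) = pev fls_const p \<theta>"
proof -
  interpret F: rational_place "fls_const :: 'a \<Rightarrow> 'a fls" UNIV "{f. fls_subdegree f \<ge> 0}" "\<lambda>f. f $$ 0"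
    by (rule rational_place_fls)
  have th: "\<theta> \<in> {f. fls_subdegree f \<ge> 0}" "\<theta> $$ 0 = 0" using assms by auto
  have nz: "pev fls_const p \<theta> \<noteq> 0" if "p \<noteq> 0" for p
    using that
  proof (induction p)
    case (pCons c p)
    show ?case
    proof (cases "c = 0")
      case False
      have "pev fls_const (pCons c p) \<theta> $$ 0 = c" unfolding F.pev_V(2)[OF th(1)] th(2) by simp
      with False show ?thesis by (metis fls_zero_nth)
    next
      case True
      then show ?thesis using pCons assms by simp
    qed
  qed simp
  have nzt: "pev \<kappa> p t \<noteq> 0" if "p \<noteq> 0" for p using transcendental that by blast
  have "\<exists>w p p'. p' \<noteq> 0 \<and> z = pev \<kappa> p t / pev \<kappa> p' t \<and> w = pev fls_const p \<theta> / pev fls_const p' \<theta>" for z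
    using generated[of z] by blast
  then have "\<forall>z. \<exists>w p p'. p' \<noteq> 0 \<and> z = pev \<kappa> p t / pev \<kappa> p' t \<and> w = pev fls_const p \<theta> / pev fls_const p' \<theta>" ..
  then obtain \<epsilon> where e: "\<And>z. \<exists>p p'. p' \<noteq> 0 \<and> z = pev \<kappa> p t / pev \<kappa> p' t \<and> \<epsilon> z = pev fls_const p \<theta> / pev fls_const p' \<theta>"
    by (elim exE[OF choice]) blast
  have eI: "\<epsilon> (pev \<kappa> p t / pev \<kappa> p' t) = pev fls_const p \<theta> / pev fls_const p' \<theta>" if "p' \<noteq> 0" for p p'
  proof -
    obtain p1 p1' where 1: "p1' \<noteq> 0" "pev \<kappa> p t / pev \<kappa> p' t = pev \<kappa> p1 t / pev \<kappa> p1' t"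
      "\<epsilon> (pev \<kappa> p t / pev \<kappa> p' t) = pev fls_const p1 \<theta> / pev fls_const p1' \<theta>"
      using e by blast
    have "pev \<kappa> (p * p1' - p1 * p') t = 0"
      using 1(2) nzt[OF that] nzt[OF 1(1)] by (simp add: c.pev_diff c.pev_mult field_simps)
    then have "p * p1' = p1 * p'" using transcendental by fastforce
    then have "pev fls_const p \<theta> * pev fls_const p1' \<theta> = pev fls_const p1 \<theta> * pev fls_const p' \<theta>"
      by (simp flip: F.k.pev_mult)
    then show ?thesis unfolding 1(3) using nz[OF that] nz[OF 1(1)] by (simp add: field_simps)
  qed
  show ?thesis
  proof (rule that)
    show pv: "\<epsilon> (pev \<kappa> p t) = pev fls_const p \<theta>" for p
      using eI[of 1 p] by simp
    show "fhom \<epsilon>"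
    proof
      show "\<epsilon> 1 = 1" using pv[of 1] by simp
    next
      fix x z
      obtain p p' where 1: "p' \<noteq> 0" "x = pev \<kappa> p t / pev \<kappa> p' t" using generated by blast
      obtain p1 p1' where 2: "p1' \<noteq> 0" "z = pev \<kappa> p1 t / pev \<kappa> p1' t" using generated by blast
      have nn: "p' * p1' \<noteq> 0" using 1 2 by simp
      have "x * z = pev \<kappa> (p * p1) t / pev \<kappa> (p' * p1') t" unfolding 1 2 by (simp add: c.pev_mult)
      then show "\<epsilon> (x * z) = \<epsilon> x * \<epsilon> z"
        using eI[OF nn] eI[OF 1(1)] eI[OF 2(1)] by (simp add: 1 2 F.k.pev_mult)
      have "x + z = pev \<kappa> (p * p1' + p1 * p') t / pev \<kappa> (p' * p1') t"
        unfolding 1 2 using nzt[OF 1(1)] nzt[OF 2(1)] by (simp add: c.pev_mult c.pev_add field_simps)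
      then show "\<epsilon> (x + z) = \<epsilon> x + \<epsilon> z"
        using nz[OF 1(1)] nz[OF 2(1)]
        by (simp add: eI[OF nn] 1(2) 2(2) eI[OF 1(1)] eI[OF 2(1)] F.k.pev_mult F.k.pev_add add_frac_eq)
    qed
  qed
qed

text \<open>The monomials in the radicals form a basis over the base field whose multiplication
  table only uses \<open>y j ^ r j\<close>. Any system of roots \<open>Y j\<close> of the images of
  the radicands therefore defines a homomorphism on \<open>L\<close>.\<close>

lemma extension_hom_exists:
  fixes \<epsilon> :: "'k \<Rightarrow> 'f::field"
  assumes eps: "fhom \<epsilon>" and Y: "\<And>j. j \<in> J \<Longrightarrow> Y j ^ r j = \<epsilon> (t powi a j * pev \<kappa> (U j) t)"
  obtains \<phi> where "\<And>z. \<phi> (\<iota> z) = \<epsilon> z" "\<And>j. j \<in> J \<Longrightarrow> \<phi> (y j) = Y j"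
    "\<And>x z. x \<in> L \<Longrightarrow> z \<in> L \<Longrightarrow> \<phi> (x + z) = \<phi> x + \<phi> z"
    "\<And>x z. x \<in> L \<Longrightarrow> z \<in> L \<Longrightarrow> \<phi> (x * z) = \<phi> x * \<phi> z"
proof -
  interpret e: fhom \<epsilon> by fact
  let ?B = "\<Pi>\<^sub>E j\<in>J. {..<r j}"
  have finB: "finite ?B" by (intro finite_PiE) auto
  define m where "m b = (\<Prod>j\<in>J. y j ^ b j)" for b
  define M where "M b = (\<Prod>j\<in>J. Y j ^ b j)" for b
  define ev where "ev c = (\<Sum>b\<in>?B. \<iota> (c b) * m b)" for c
  define EV where "EV c = (\<Sum>b\<in>?B. \<epsilon> (c b) * M b)" for c
  \<comment> \<open>Coordinates are chosen by \<open>SOME\<close>; independence makes the choice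
    immaterial on \<open>L\<close>, and off \<open>L\<close> the value is arbitrary.\<close>
  define \<phi> where "\<phi> x = EV (SOME c. ev c = x)" for x
  have phi: "\<phi> (ev c) = EV c" for c
  proof -
    define d where "d = (SOME d. ev d = ev c)"
    have "ev d = ev c" unfolding d_def by (rule someI[of _ c]) simp
    then have "(\<Sum>b\<in>?B. \<iota> (d b - c b) * m b) = 0"
      by (simp add: ev_def i.hom_simps left_diff_distrib sum_subtractf)
    then have "d b = c b" if "b \<in> ?B" for b
      using indep[of "\<lambda>b. d b - c b" b] that unfolding m_def by simp
    then have "EV d = EV c" unfolding EV_def by (intro sum.cong refl) simp
    then show ?thesis by (simp add: \<phi>_def d_def)
  qed
  have evL: "ev c \<in> L" for c
    unfolding ev_def m_def
    using base_L y_L by (intro field_closed_sum[OF L] field_closedD[OF L] field_closed_prod[OF L]) auto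
  have span: "\<exists>c. x = ev c" if "x \<in> L" for x using L_span[OF that] unfolding ev_def m_def .
  have add: "\<phi> (x + z) = \<phi> x + \<phi> z" if "x \<in> L" "z \<in> L" for x z
  proof -
    obtain c d where cd: "x = ev c" "z = ev d" using span[OF \<open>x \<in> L\<close>] span[OF \<open>z \<in> L\<close>] by blast
    have "ev c + ev d = ev (\<lambda>b. c b + d b)" by (simp add: ev_def i.hom_simps distrib_right sum.distrib)
    moreover have "EV c + EV d = EV (\<lambda>b. c b + d b)" by (simp add: EV_def e.hom_simps distrib_right sum.distrib)
    ultimately show ?thesis by (simp add: cd phi)
  qed
  have scale: "\<phi> (\<iota> z * x) = \<epsilon> z * \<phi> x" if "x \<in> L" for x z
  proof -
    obtain c where c: "x = ev c" using span[OF \<open>x \<in> L\<close>] by blast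
    have "\<iota> z * ev c = ev (\<lambda>b. z * c b)" by (simp add: ev_def i.hom_simps sum_distrib_left mult.assoc)
    moreover have "\<epsilon> z * EV c = EV (\<lambda>b. z * c b)" by (simp add: EV_def e.hom_simps sum_distrib_left mult.assoc)
    ultimately show ?thesis by (simp add: c phi)
  qed
  have sum: "\<phi> (\<Sum>b\<in>A. x b) = (\<Sum>b\<in>A. \<phi> (x b))" if "\<And>b. b \<in> A \<Longrightarrow> x b \<in> L" for A :: "(nat \<Rightarrow> nat) set" and x
    using that
  proof (induction A rule: infinite_finite_induct)
    case (insert b A)
    then show ?case using field_closed_sum[OF L, of A x] by (simp add: add)
  qed (use scale[of 0 0] field_closedD(2)[OF L] in \<open>simp_all add: i.hom_zero e.hom_zero\<close>)
  have mono: "\<phi> (m b) = M b" and mL: "m b \<in> L" if "b \<in> ?B" for b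
  proof -
    have "m b = ev (\<lambda>b'. if b' = b then 1 else 0)"
      unfolding ev_def using that finB
      by (simp add: if_distrib[of \<iota>] i.hom_simps if_distrib[of "\<lambda>x. x * _"] cong: if_cong)
    moreover have "M b = EV (\<lambda>b'. if b' = b then 1 else 0)"
      unfolding EV_def using that finB
      by (simp add: if_distrib[of \<epsilon>] e.hom_simps if_distrib[of "\<lambda>x. x * _"] cong: if_cong)
    ultimately show "\<phi> (m b) = M b" "m b \<in> L" using evL by (simp_all add: phi)
  qed
  define b0 where "b0 = (\<lambda>j\<in>J. 0::nat)"
  have b0: "b0 \<in> ?B" using r_pos by (auto simp: b0_def)
  have one: "\<phi> 1 = 1" using mono[OF b0] by (simp add: m_def M_def b0_def)
  have base: "\<phi> (\<iota> z) = \<epsilon> z" for z using scale[of 1 z] field_closedD(1)[OF L] one by simp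
  have y_mono: "\<phi> (y i * m b) = Y i * M b" if i: "i \<in> J" and b: "b \<in> ?B" for i b
  proof -
    have split: "m (b(i := l)) = y i ^ l * (\<Prod>j\<in>J - {i}. y j ^ b j)"
      "M (b(i := l)) = Y i ^ l * (\<Prod>j\<in>J - {i}. Y j ^ b j)" for l
      unfolding m_def M_def using i by (simp_all add: prod.remove[of J i])
    have bi_lt: "b i < r i" using b i by auto
    show ?thesis
    proof (cases "Suc (b i) < r i")
      case True
      have "b(i := Suc (b i)) \<in> ?B" using b True i by (auto simp: PiE_iff extensional_def)
      moreover have "m (b(i := Suc (b i))) = y i * m b" "M (b(i := Suc (b i))) = Y i * M b"
        using split(1)[of "Suc (b i)"] split(1)[of "b i"] split(2)[of "Suc (b i)"] split(2)[of "b i"] by simp_all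
      ultimately show ?thesis using mono by metis
    next
      case False
      then have "Suc (b i) = r i" using bi_lt by simp
      \<comment> \<open>The exponent wraps around to 0 and the full power becomes a scalar from the
        base field.\<close>
      let ?b = "b(i := 0)"
      have B: "?b \<in> ?B" using b bi_lt i by (auto simp: PiE_iff extensional_def)
      have "y i * m b = y i ^ Suc (b i) * m ?b" "Y i * M b = Y i ^ Suc (b i) * M ?b"
        using split(1)[of 0] split(1)[of "b i"] split(2)[of 0] split(2)[of "b i"] by simp_all
      then have "y i * m b = \<iota> (t powi a i * pev \<kappa> (U i) t) * m ?b" "Y i * M b = \<epsilon> (t powi a i * pev \<kappa> (U i) t) * M ?b"
        unfolding \<open>Suc (b i) = r i\<close> using y_power[OF i] Y[OF i] by simp_all
      then show ?thesis using scale[OF mL[OF B]] mono[OF B] by simp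
    qed
  qed
  have y_mult: "\<phi> (y i * x) = Y i * \<phi> x" if i: "i \<in> J" and x: "x \<in> L" for i x
  proof -
    obtain c where c: "x = ev c" using span[OF x] by blast
    have "\<phi> (y i * ev c) = \<phi> (\<Sum>b\<in>?B. \<iota> (c b) * (y i * m b))"
      unfolding ev_def by (simp add: sum_distrib_left ac_simps)
    also have "\<dots> = (\<Sum>b\<in>?B. \<phi> (\<iota> (c b) * (y i * m b)))"
      by (rule sum) (use mL base_L y_L[OF i] in \<open>auto intro!: field_closedD[OF L]\<close>)
    also have "\<dots> = (\<Sum>b\<in>?B. \<epsilon> (c b) * (Y i * M b))"
    proof (rule sum.cong[OF refl])
      fix b assume b: "b \<in> ?B"
      have "y i * m b \<in> L" using mL[OF b] y_L[OF i] by (auto intro!: field_closedD[OF L])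
      then show "\<phi> (\<iota> (c b) * (y i * m b)) = \<epsilon> (c b) * (Y i * M b)" using scale y_mono[OF i b] by simp
    qed
    also have "\<dots> = Y i * EV c" unfolding EV_def by (simp add: sum_distrib_left ac_simps)
    finally show ?thesis using phi by (simp add: c)
  qed
  have ypow_mult: "\<phi> (y i ^ l * x) = Y i ^ l * \<phi> x" if i: "i \<in> J" and x: "x \<in> L" for i x l
  proof (induction l)
    case (Suc l)
    have "y i ^ l * x \<in> L" using x y_L[OF i] by (auto intro!: field_closedD[OF L])
    then show ?case using y_mult[OF i] Suc by (simp add: mult.assoc)
  qed simp
  have prod_mult: "\<phi> ((\<Prod>j\<in>A. y j ^ b j) * x) = (\<Prod>j\<in>A. Y j ^ b j) * \<phi> x" if "A \<subseteq> J" "x \<in> L" for A b x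
  proof -
    have "finite A" using that finite_subset finite_J by blast
    then show ?thesis using that
    proof induction
      case (insert i A)
      have "(\<Prod>j\<in>A. y j ^ b j) * x \<in> L"
        using insert y_L by (intro field_closedD[OF L] field_closed_prod[OF L]) auto
      then show ?case using insert ypow_mult[of i] by (simp add: mult.assoc)
    qed simp
  qed
  have mult: "\<phi> (x * z) = \<phi> x * \<phi> z" if x: "x \<in> L" and z: "z \<in> L" for x z
  proof -
    obtain c where c: "x = ev c" using span[OF x] by blast
    have "\<phi> (ev c * z) = \<phi> (\<Sum>b\<in>?B. \<iota> (c b) * (m b * z))"
      unfolding ev_def sum_distrib_right mult.assoc ..
    also have "\<dots> = (\<Sum>b\<in>?B. \<phi> (\<iota> (c b) * (m b * z)))"
      by (rule sum) (use mL base_L z in \<open>auto intro!: field_closedD[OF L]\<close>)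
    also have "\<dots> = (\<Sum>b\<in>?B. \<epsilon> (c b) * (M b * \<phi> z))"
    proof (rule sum.cong[OF refl])
      fix b assume b: "b \<in> ?B"
      have "m b * z \<in> L" using mL[OF b] z by (auto intro!: field_closedD[OF L])
      then show "\<phi> (\<iota> (c b) * (m b * z)) = \<epsilon> (c b) * (M b * \<phi> z)"
        using scale prod_mult[OF order_refl z] by (simp add: m_def M_def)
    qed
    also have "\<dots> = EV c * \<phi> z" unfolding EV_def sum_distrib_right mult.assoc ..
    finally show ?thesis using phi by (simp add: c)
  qed
  show ?thesis
  proof (rule that)
    show "\<phi> (y j) = Y j" if "j \<in> J" for j
      using y_mult[OF that field_closedD(1)[OF L]] one by simp
  qed (use base add mult in auto)
qed

text \<open>The place is realized by \<open>t = l X^s\<close> inside the field of Laurent series in \<open>X\<close>.\<close>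

lemma over_t_exists:
  assumes lh: "(l, h) \<in> normalized"
  obtains W res where "over_t W res" "data res = (l, h)"
    "\<And>z. z \<in> W \<Longrightarrow> z \<noteq> 0 \<Longrightarrow> \<exists>N. z * inverse unf ^ N \<notin> W"
proof -
  interpret F: rational_place "fls_const :: 'a \<Rightarrow> 'a fls" UNIV "{f. fls_subdegree f \<ge> 0}" "\<lambda>f. f $$ 0"
    by (rule rational_place_fls)
  have l: "l \<noteq> 0" and h: "\<And>j. j \<in> J \<Longrightarrow> h j \<noteq> 0" "\<And>j. j \<in> J \<Longrightarrow> h j ^ r j = l powi a j * poly (U j) 0"
    and hJ: "h \<in> (\<Pi>\<^sub>E j\<in>J. UNIV - {0})" and norm: "l powi e0 * (\<Prod>j\<in>J. h j powi e j) = 1"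
    using lh by (auto simp: normalized_def solutions_def)
  define \<tau> :: "'a fls" where "\<tau> = fls_X"
  have \<tau>: "\<tau> \<noteq> 0" "fls_subdegree \<tau> = 1" by (simp_all add: \<tau>_def)
  define \<theta> where "\<theta> = fls_const l * \<tau> ^ s"
  have th: "\<theta> \<noteq> 0" "fls_subdegree \<theta> > 0"
    using l \<tau> s_pos by (simp_all add: \<theta>_def F.k.hom_eq_0_iff fls_subdegree_pow)
  then have th0: "\<theta> $$ 0 = 0" by simp
  obtain \<epsilon> where eps: "fhom \<epsilon>" "\<And>p. \<epsilon> (pev \<kappa> p t) = pev fls_const p \<theta>" by (rule base_hom_exists[OF th]) (rule that)
  interpret e: fhom \<epsilon> by (rule eps(1))
  have eps_t: "\<epsilon> t = \<theta>" using eps(2)[of "[:0, 1:]"] by (simp add: c.hom_simps F.k.hom_simps)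
  have eps_c: "\<epsilon> (\<kappa> c) = fls_const c" for c using eps(2)[of "[:c:]"] by simp
  have "\<exists>R. R ^ r j = fls_const (l powi a j) * pev fls_const (U j) \<theta> \<and> R $$ 0 = h j \<and> fls_subdegree R \<ge> 0"
    if j: "j \<in> J" for j
  proof -
    have pe: "pev fls_const (U j) \<theta> \<in> {f. fls_subdegree f \<ge> 0}" "pev fls_const (U j) \<theta> $$ 0 = poly (U j) 0"
      using F.pev_V[of \<theta> "U j"] th th0 by simp_all
    have "fls_const (l powi a j) * pev fls_const (U j) \<theta> \<in> {f. fls_subdegree f \<ge> 0}"
      using F.mult_V[OF F.const_V pe(1)] .
    moreover have "(fls_const (l powi a j) * pev fls_const (U j) \<theta>) $$ 0 = h j ^ r j"
      using F.res_mult[OF F.const_V pe(1)] pe(2) h(2)[OF j] F.res_const by metis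
    ultimately show ?thesis
      using fls_power_root[OF of_nat_dvd_card_minus_1_neq_0[OF r_dvd[OF j]] h(1)[OF j]] by blast
  qed
  then obtain R where R: "\<And>j. j \<in> J \<Longrightarrow> R j ^ r j = fls_const (l powi a j) * pev fls_const (U j) \<theta>"
    "\<And>j. j \<in> J \<Longrightarrow> R j $$ 0 = h j" "\<And>j. j \<in> J \<Longrightarrow> fls_subdegree (R j) \<ge> 0"
    by metis
  \<comment> \<open>\<open>Y j\<close> has order \<open>kk j\<close>, the valuation of
    \<open>y j\<close>, and its unit part \<open>R j\<close> has the prescribed residue
    \<open>h j\<close>.\<close>
  define Y where "Y j = \<tau> powi kk j * R j" for j
  have Y: "Y j ^ r j = \<epsilon> (t powi a j * pev \<kappa> (U j) t)" if j: "j \<in> J" for j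
  proof -
    have "Y j ^ r j = \<tau> powi (int s * a j) * (fls_const (l powi a j) * pev fls_const (U j) \<theta>)"
      unfolding Y_def power_mult_distrib R(1)[OF j] power_int_power_eq kk[OF j] ..
    also have "\<tau> powi (int s * a j) = (\<tau> ^ s) powi a j" by (simp only: power_int_power_eq)
    also have "(\<tau> ^ s) powi a j * (fls_const (l powi a j) * pev fls_const (U j) \<theta>) =
        \<theta> powi a j * pev fls_const (U j) \<theta>"
      by (simp add: \<theta>_def power_int_mult_distrib F.k.hom_powi)
    finally show ?thesis by (simp add: e.hom_mult e.hom_powi eps_t eps(2))
  qed
  obtain \<phi> where phi: "\<And>z. \<phi> (\<iota> z) = \<epsilon> z" "\<And>j. j \<in> J \<Longrightarrow> \<phi> (y j) = Y j"
    "\<And>x z. x \<in> L \<Longrightarrow> z \<in> L \<Longrightarrow> \<phi> (x + z) = \<phi> x + \<phi> z"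
    "\<And>x z. x \<in> L \<Longrightarrow> z \<in> L \<Longrightarrow> \<phi> (x * z) = \<phi> x * \<phi> z"
    by (rule extension_hom_exists[where Y = Y, OF eps(1)]) (erule Y, rule that)
  define W where "W = {x \<in> L. \<phi> x \<in> {f. fls_subdegree f \<ge> 0}}"
  define res where "res x = \<phi> x $$ 0" for x
  have place: "rational_place k L W res"
    unfolding W_def res_def
  proof (rule rational_place_pullback[OF rational_place_fls])
    show "\<phi> (k c) = fls_const c" for c unfolding k_def phi(1) by (rule eps_c)
  qed (use L phi k_L in \<open>auto intro: k.fhom_axioms\<close>)
  have phi_one: "\<phi> 1 = 1" using phi(1)[of 1] by (simp add: i.hom_one e.hom_one)
  have phi_inv: "\<phi> (inverse x) = inverse (\<phi> x)" if "x \<in> L" for x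
  proof (cases "x = 0")
    case False
    have "inverse x \<in> L" using that by (rule field_closedD[OF L])
    then have "\<phi> x * \<phi> (inverse x) = 1" using phi(4)[OF that, of "inverse x"] False phi_one by simp
    then show ?thesis by (simp add: inverse_unique)
  qed (use phi(1)[of 0] in \<open>simp add: i.hom_zero e.hom_zero\<close>)
  have phi_nz: "\<phi> x \<noteq> 0" if "x \<in> L" "x \<noteq> 0" for x
  proof -
    have "inverse x \<in> L" using that(1) by (rule field_closedD[OF L])
    then have "\<phi> x * \<phi> (inverse x) = 1" using phi(4)[OF that(1), of "inverse x"] that phi_one by simp
    then show ?thesis by auto
  qed
  have phi_pow: "\<phi> (x ^ N) = \<phi> x ^ N" if "x \<in> L" for x N
  proof (induction N)
    case (Suc N)
    have "x ^ N \<in> L" using that by (rule field_closedD[OF L])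
    then show ?case using phi(4)[OF that] Suc by simp
  qed (simp add: phi_one)
  have phi_powi: "\<phi> (x powi N) = \<phi> x powi N" if "x \<in> L" for x N
  proof -
    have "inverse x \<in> L" using that by (rule field_closedD[OF L])
    then show ?thesis by (simp add: power_int_def phi_pow phi_inv that)
  qed
  have phi_prod: "\<phi> (\<Prod>j\<in>A. f j) = (\<Prod>j\<in>A. \<phi> (f j))" if "\<And>j. j \<in> A \<Longrightarrow> f j \<in> L" for A :: "nat set" and f
    using that
  proof (induction A rule: infinite_finite_induct)
    case (insert j A)
    then have "(\<Prod>j\<in>A. f j) \<in> L" by (intro field_closed_prod[OF L]) auto
    then show ?case using insert phi(4) by simp
  qed (simp_all add: phi_one)
  \<comment> \<open>The unit part of the image of \<open>unf\<close>. The normalization of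
    \<open>(l, h)\<close> says that its constant term is 1, so dividing by its powers does not
    disturb the residues \<open>l\<close> and \<open>h j\<close>.\<close>
  define G where "G = fls_const l powi e0 * (\<Prod>j\<in>J. R j powi e j)"
  have Rj: "R j \<in> {f. fls_subdegree f \<ge> 0}" "R j $$ 0 \<noteq> 0" if "j \<in> J" for j using R that h by auto
  have cl: "fls_const l \<in> {f. fls_subdegree f \<ge> 0}" "fls_const l $$ 0 \<noteq> 0" using l by auto
  have prodR: "(\<Prod>j\<in>J. R j powi e j) \<in> {f. fls_subdegree f \<ge> 0}" using Rj by (intro F.prod_V F.powi_V) auto
  have GV: "G \<in> {f. fls_subdegree f \<ge> 0}" unfolding G_def using F.mult_V[OF F.powi_V[OF cl] prodR] .
  have "G $$ 0 = l powi e0 * (\<Prod>j\<in>J. (R j powi e j) $$ 0)"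
    unfolding G_def F.res_mult[OF F.powi_V[OF cl] prodR] F.res_powi[OF cl]
    using F.res_prod[of J "\<lambda>j. R j powi e j"] F.powi_V[OF Rj] by simp
  also have "(\<Prod>j\<in>J. (R j powi e j) $$ 0) = (\<Prod>j\<in>J. h j powi e j)"
    by (intro prod.cong refl) (use F.res_powi[OF Rj] R in simp)
  finally have G0: "G $$ 0 = 1" using norm by simp
  then have Gnz: "G \<noteq> 0" by auto
  have Gdeg: "fls_subdegree G = 0" using G0 GV fls_subdegree_leI[of G 0] by simp
  have G0': "G $$ 0 \<noteq> 0" using G0 by simp
  have phi_unf: "\<phi> unf = \<tau> * G"
  proof -
    have "(\<Prod>j\<in>J. y j powi e j) \<in> L" using y_L by (intro field_closed_prod[OF L] field_closedD[OF L])
    moreover have "\<iota> t powi e0 \<in> L" using base_L by (rule field_closedD[OF L])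
    ultimately have "\<phi> unf = \<theta> powi e0 * (\<Prod>j\<in>J. Y j powi e j)"
      unfolding unf_def using base_L y_L phi
      by (simp add: phi_prod phi_powi field_closedD(10)[OF L] eps_t)
    also have "\<dots> = \<tau> powi (int s * e0) * (\<Prod>j\<in>J. \<tau> powi (kk j * e j)) * G"
      unfolding \<theta>_def Y_def G_def power_int_mult_distrib prod.distrib power_int_power_eq power_int_mult
      by (simp only: ac_simps)
    also have "\<tau> powi (int s * e0) * (\<Prod>j\<in>J. \<tau> powi (kk j * e j)) = \<tau> powi (e0 * int s + (\<Sum>j\<in>J. e j * kk j))"
      by (simp only: power_int_add[OF disjI1[OF \<tau>(1)]] power_int_sum[OF \<tau>(1)] mult.commute)
    finally show ?thesis unfolding bezout by simp
  qed
  have cancel: "\<tau> powi i * (\<tau> * G) powi (- i) = G powi (- i)" for i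
    using \<tau>(1) by (simp add: power_int_mult_distrib power_int_minus mult_inverse_cancel_left)
  have unfpow: "unf powi i \<in> L" for i using unf_L by (rule field_closedD[OF L])
  have phi_w0: "\<phi> w0 = fls_const l * G powi (- int s)"
  proof -
    have "\<phi> w0 = \<theta> * (\<tau> * G) powi (- int s)"
      unfolding w0_def phi(4)[OF base_L unfpow] phi_powi[OF unf_L] phi_unf by (simp add: phi(1) eps_t)
    also have "\<dots> = fls_const l * (\<tau> powi int s * (\<tau> * G) powi (- int s))"
      by (simp add: \<theta>_def power_int_of_nat)
    finally show ?thesis unfolding cancel .
  qed
  have phi_w: "\<phi> (w j) = R j * G powi (- kk j)" if j: "j \<in> J" for j
  proof -
    have "\<phi> (w j) = R j * (\<tau> powi kk j * (\<tau> * G) powi (- kk j))"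
      unfolding w_def phi(4)[OF y_L[OF j] unfpow] phi_powi[OF unf_L] phi_unf phi(2)[OF j] Y_def
      by (simp only: ac_simps)
    then show ?thesis unfolding cancel .
  qed
  show ?thesis
  proof (rule that)
    show "over_t W res"
      unfolding over_t_def using place th th0 base_L by (simp add: W_def res_def phi(1) eps_t)
    have "res w0 = l"
      unfolding res_def phi_w0 F.res_mult[OF cl(1) F.powi_V[OF GV G0']] F.res_powi[OF GV G0'] G0 by simp
    moreover have "res (w j) = h j" if "j \<in> J" for j
      unfolding res_def phi_w[OF that] F.res_mult[OF Rj(1)[OF that] F.powi_V[OF GV G0']] F.res_powi[OF GV G0'] G0
      using R(2)[OF that] by simp
    ultimately show "data res = (l, h)"
      using hJ by (auto simp: data_def fun_eq_iff PiE_iff extensional_def)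
    fix z assume z: "z \<in> W" "z \<noteq> 0"
    \<comment> \<open>One more than the order of the image of \<open>z\<close>, so that the quotient
      acquires a pole.\<close>
    define N where "N = nat (fls_subdegree (\<phi> z)) + 1"
    have zL: "z \<in> L" using z by (simp add: W_def)
    have iu: "inverse unf \<in> L" using unf_L by (rule field_closedD[OF L])
    have iuN: "inverse unf ^ N \<in> L" using iu by (rule field_closedD[OF L])
    have "\<phi> (z * inverse unf ^ N) = \<phi> z * inverse (\<tau> * G) ^ N"
      by (simp add: phi(4)[OF zL iuN] phi_pow[OF iu] phi_inv[OF unf_L] phi_unf)
    moreover have "fls_subdegree (\<phi> z * inverse (\<tau> * G) ^ N) = fls_subdegree (\<phi> z) - int N"
      using phi_nz[OF zL z(2)] \<tau> Gnz Gdeg by (simp add: fls_subdegree_pow)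
    ultimately have "z * inverse unf ^ N \<notin> W" by (simp add: W_def N_def)
    then show "\<exists>N. z * inverse unf ^ N \<notin> W" by blast
  qed
qed

text \<open>Injectivity is proved through the realised place: two places with one datum are both
  equal to it, as discreteness is known there.\<close>

lemma places_over_t_bij: "\<exists>f. bij_betw f {V. \<exists>res. over_t V res} normalized"
proof -
  define f where "f V = data (SOME res. over_t V res)" for V
  have f: "over_t V (SOME res. over_t V res)" if "over_t V res" for V res
    using someI[of "over_t V" res] that by blast
  have f_eq: "f V = data res" if V: "over_t V res" for V res
  proof -
    define res' where "res' = (SOME res. over_t V res)"
    have V': "over_t V res'" unfolding res'_def by (rule f[OF V])
    interpret V: rational_place k L V res using V by (simp add: over_t_def)
    have "rational_place k L V res'" using V' by (simp add: over_t_def)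
    then have "res' z = res z" if "z \<in> V" for z using V.res_unique that by blast
    then show ?thesis
      using over_t_units[OF V] unfolding f_def res'_def[symmetric] data_def by auto
  qed
  have "bij_betw f {V. \<exists>res. over_t V res} normalized"
  proof (rule bij_betw_imageI)
    show "inj_on f {V. \<exists>res. over_t V res}"
    proof (rule inj_onI)
      fix V V' assume "V \<in> {V. \<exists>res. over_t V res}" "V' \<in> {V. \<exists>res. over_t V res}" and eq: "f V = f V'"
      then obtain res res' where V: "over_t V res" and V': "over_t V' res'" by blast
      obtain l h where lh: "f V = (l, h)" by (cases "f V")
      then have "(l, h) \<in> normalized" using data_normalized[OF V] f_eq[OF V] by simp
      then obtain W resW where W: "over_t W resW" "data resW = (l, h)"
        "\<And>z. z \<in> W \<Longrightarrow> z \<noteq> 0 \<Longrightarrow> \<exists>N. z * inverse unf ^ N \<notin> W" by (rule over_t_exists) (rule that)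
      have "V = W" by (rule over_t_unique[OF V W(1) _ W(3)]) (use W lh f_eq[OF V] in auto)
      moreover have "V' = W" by (rule over_t_unique[OF V' W(1) _ W(3)]) (use W lh f_eq[OF V'] eq in auto)
      ultimately show "V = V'" by simp
    qed
    show "f ` {V. \<exists>res. over_t V res} = normalized"
    proof (intro equalityI subsetI)
      fix d assume "d \<in> f ` {V. \<exists>res. over_t V res}"
      then obtain V res where "over_t V res" "d = f V" by blast
      then show "d \<in> normalized" using data_normalized f_eq by metis
    next
      fix d assume d: "d \<in> normalized"
      obtain l h where lh: "d = (l, h)" by (cases d)
      then have "(l, h) \<in> normalized" using d by simp
      then obtain W resW where W: "over_t W resW" "data resW = (l, h)"
        "\<And>z. z \<in> W \<Longrightarrow> z \<noteq> 0 \<Longrightarrow> \<exists>N. z * inverse unf ^ N \<notin> W" by (rule over_t_exists) (rule that)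
      then show "d \<in> f ` {V. \<exists>res. over_t V res}" using f_eq[OF W(1)] lh by (intro image_eqI[of _ _ W]) auto
    qed
  qed
  then show ?thesis by blast
qed

lemma card_places_over_t: "card {V. \<exists>res. over_t V res} = card normalized"
  using places_over_t_bij bij_betw_same_card by blast

lemma finite_places_over_t: "finite {V. \<exists>res. over_t V res}"
proof -
  have "normalized \<subseteq> UNIV \<times> (\<Pi>\<^sub>E j\<in>J. UNIV)" by (auto simp: normalized_def solutions_def)
  then have "finite normalized" by (rule finite_subset) (simp add: finite_PiE)
  then show ?thesis using places_over_t_bij bij_betw_finite by blast
qed

text \<open>A constant \<open>x\<close> acts on solutions by \<open>l \<mapsto> l x^s\<close> and
  \<open>h j \<mapsto> h j x^(kk j)\<close>, the effect of rescaling the uniformizer. By Bezout the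
  normalizing product is multiplied by \<open>x\<close>, so the action is free and each orbit
  contains exactly one normalized solution.\<close>

lemma card_solutions_eq: "card normalized * (CARD('a) - 1) = card solutions"
proof -
  define act where "act = (\<lambda>((l, h), x). (l * x ^ s, \<lambda>j\<in>J. h j * x powi kk j :: 'a))"
  define pr where "pr = (\<lambda>(l, h). l powi e0 * (\<Prod>j\<in>J. h j powi e j) :: 'a)"
  have pr_act: "pr (act ((l, h), x)) = pr (l, h) * x" if "x \<noteq> 0" for l h x
  proof -
    have "pr (act ((l, h), x)) = (l * x ^ s) powi e0 * (\<Prod>j\<in>J. (h j * x powi kk j) powi e j)"
      by (simp add: pr_def act_def)
    also have "\<dots> = pr (l, h) * (x powi (int s * e0) * (\<Prod>j\<in>J. x powi (kk j * e j)))"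
      unfolding pr_def power_int_mult_distrib prod.distrib power_int_power_eq power_int_mult prod.case
      by (simp only: ac_simps)
    also have "x powi (int s * e0) * (\<Prod>j\<in>J. x powi (kk j * e j)) = x powi (e0 * int s + (\<Sum>j\<in>J. e j * kk j))"
      by (simp only: power_int_add[OF disjI1[OF that]] power_int_sum[OF that] mult.commute)
    finally show ?thesis unfolding bezout by simp
  qed
  have act_sol: "act ((l, h), x) \<in> solutions" if "(l, h) \<in> solutions" "x \<noteq> 0" for l h x
  proof -
    have "(h j * x powi kk j) ^ r j = (l * x ^ s) powi a j * poly (U j) 0" if j: "j \<in> J" for j
      using \<open>(l, h) \<in> solutions\<close> j
      by (simp add: solutions_def power_mult_distrib power_int_mult_distrib power_int_power_eq kk)
    then show ?thesis using that by (auto simp: act_def solutions_def)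
  qed
  have act_act: "act (act (d, x), x') = act (d, x * x')" for d x x'
    by (cases d) (auto simp: act_def power_mult_distrib power_int_mult_distrib fun_eq_iff)
  have act_1: "act (d, 1) = d" if "d \<in> solutions" for d
    using that by (cases d) (auto simp: act_def solutions_def fun_eq_iff PiE_iff extensional_def)
  have pr_nz: "pr d \<noteq> 0" if "d \<in> solutions" for d
    using that by (auto simp: pr_def solutions_def PiE_iff power_int_eq_0_iff)
  have norm_iff: "d \<in> normalized \<longleftrightarrow> d \<in> solutions \<and> pr d = 1" for d
    by (cases d) (simp add: normalized_def pr_def)
  have "bij_betw act (normalized \<times> (UNIV - {0})) solutions"
  proof (rule bij_betw_byWitness[where f' = "\<lambda>d. (act (d, inverse (pr d)), pr d)"])
    show "\<forall>p\<in>normalized \<times> (UNIV - {0}). (act (act p, inverse (pr (act p))), pr (act p)) = p"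
    proof
      fix p assume p: "p \<in> normalized \<times> (UNIV - {0::'a})"
      obtain l h x where p_eq: "p = ((l, h), x)" by (cases p) auto
      then have prp: "pr (act ((l, h), x)) = x" using p pr_act[of x l h] by (simp add: norm_iff)
      have "act (act ((l, h), x), inverse x) = (l, h)"
        unfolding act_act using p act_1[of "(l, h)"] by (simp add: p_eq norm_iff)
      then show "(act (act p, inverse (pr (act p))), pr (act p)) = p"
        unfolding p_eq prp by simp
    qed
    show "\<forall>d\<in>solutions. act (act (d, inverse (pr d)), pr d) = d"
      using pr_nz act_1 by (simp add: act_act)
    show "act ` (normalized \<times> (UNIV - {0})) \<subseteq> solutions"
    proof
      fix d assume "d \<in> act ` (normalized \<times> (UNIV - {0}))"
      then obtain l h x where "(l, h) \<in> normalized" "x \<noteq> 0" "d = act ((l, h), x)" by auto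
      then show "d \<in> solutions" using act_sol by (simp add: norm_iff)
    qed
    show "(\<lambda>d. (act (d, inverse (pr d)), pr d)) ` solutions \<subseteq> normalized \<times> (UNIV - {0})"
    proof
      fix p assume "p \<in> (\<lambda>d. (act (d, inverse (pr d)), pr d)) ` solutions"
      then obtain l h where lh: "(l, h) \<in> solutions" "p = (act ((l, h), inverse (pr (l, h))), pr (l, h))" by auto
      then show "p \<in> normalized \<times> (UNIV - {0})"
        using pr_nz[OF lh(1)] act_sol[OF lh(1)] pr_act[of "inverse (pr (l, h))" l h] by (simp add: norm_iff)
    qed
  qed
  then have "card (normalized \<times> (UNIV - {0::'a})) = card solutions" by (rule bij_betw_same_card)
  then show ?thesis by (simp add: card_cartesian_product card_Diff_singleton)
qed

text \<open>Multiplying the Bezout identity by \<open>i\<close> shows that \<open>s\<close> is the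
  exact order of \<open>a\<close> in the product of the cyclic groups, not merely a period.\<close>

lemma ramification_dvd_iff: "(\<forall>j\<in>J. int (r j) dvd i * a j) \<longleftrightarrow> int s dvd i"
proof
  assume *: "\<forall>j\<in>J. int (r j) dvd i * a j"
  have "int s dvd i * (e j * kk j)" if j: "j \<in> J" for j
  proof -
    obtain m where "i * a j = int (r j) * m" using * j by (auto elim: dvdE)
    then have "int (r j) * (i * kk j) = int (r j) * (int s * m)"
      using kk[OF j] by (metis mult.assoc mult.commute)
    then have "i * kk j = int s * m" using r_pos[OF j] by simp
    then have "int s dvd e j * (i * kk j)" by simp
    then show ?thesis by (simp only: mult.left_commute[of i])
  qed
  then have "int s dvd i * (e0 * int s) + (\<Sum>j\<in>J. i * (e j * kk j))" by (intro dvd_add dvd_sum) auto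
  also have "\<dots> = i * (e0 * int s + (\<Sum>j\<in>J. e j * kk j))" by (simp add: distrib_left sum_distrib_left)
  finally show "int s dvd i" unfolding bezout by simp
next
  assume "int s dvd i"
  then obtain m where m: "i = int s * m" by (auto elim: dvdE)
  have "i * a j = int (r j) * (m * kk j)" if "j \<in> J" for j
    using kk[OF that] unfolding m by (metis mult.assoc mult.commute)
  then show "\<forall>j\<in>J. int (r j) dvd i * a j" by simp
qed

text \<open>There are \<open>(q - 1) / s\<close> possible residues \<open>l\<close> if any, and for
  each of them \<open>r j\<close> roots \<open>h j\<close> per index. Passing to normalized
  solutions divides by \<open>q - 1\<close>.\<close>

lemma card_places:
  "card {V. \<exists>res. over_t V res} =
     (if \<exists>l. l \<noteq> 0 \<and> (\<forall>j\<in>J. is_power (r j) (l powi a j * poly (U j) 0)) then (\<Prod>j\<in>J. r j) div s else 0)"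
proof -
  define S where "S = {l. l \<noteq> 0 \<and> (\<forall>j\<in>J. is_power (r j) (l powi a j * poly (U j) 0))}"
  have "solutions = (SIGMA l:S. \<Pi>\<^sub>E j\<in>J. {z. z ^ r j = l powi a j * poly (U j) 0})" (is "_ = ?R")
  proof (intro equalityI subsetI)
    fix d assume "d \<in> solutions"
    then show "d \<in> ?R" by (auto simp: solutions_def S_def is_power_def PiE_iff extensional_def)
  next
    fix d assume d: "d \<in> ?R"
    obtain l h where lh: "d = (l, h)" by (cases d)
    have "h j \<noteq> 0" if j: "j \<in> J" for j
    proof
      assume "h j = 0"
      moreover have "h j ^ r j = l powi a j * poly (U j) 0" "l \<noteq> 0" using d j by (auto simp: lh S_def)
      ultimately show False using U_0[OF j] r_pos[OF j] by (simp add: power_0_left)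
    qed
    then show "d \<in> solutions" using d by (auto simp: lh solutions_def S_def PiE_iff extensional_def)
  qed
  moreover have "card (\<Pi>\<^sub>E j\<in>J. {z. z ^ r j = l powi a j * poly (U j) 0}) = (\<Prod>j\<in>J. r j)" if "l \<in> S" for l
    unfolding card_PiE[OF finite_J]
  proof (rule prod.cong[OF refl])
    fix j assume j: "j \<in> J"
    show "card {z. z ^ r j = l powi a j * poly (U j) 0} = r j"
      by (rule card_roots) (use that j U_0 r_dvd in \<open>auto simp: S_def\<close>)
  qed
  ultimately have sol: "card solutions = card S * (\<Prod>j\<in>J. r j)"
    by (simp add: card_SigmaI finite_PiE)
  show ?thesis
  proof (cases "\<exists>l. l \<noteq> 0 \<and> (\<forall>j\<in>J. is_power (r j) (l powi a j * poly (U j) 0))")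
    case True
    have S: "card S = (CARD('a) - 1) div s"
      unfolding S_def by (rule card_power_solutions) (use r_dvd ramification_dvd_iff s_dvd U_0 True in auto)
    obtain m where m: "CARD('a) - 1 = s * m" using s_dvd by (auto elim: dvdE)
    then have "m > 0" using q1 by (auto intro: Nat.gr0I)
    have "card normalized * (s * m) = m * (\<Prod>j\<in>J. r j)"
      using card_solutions_eq sol S m s_pos by simp
    then have "m * (card normalized * s) = m * (\<Prod>j\<in>J. r j)" by (simp only: ac_simps)
    then have "card normalized * s = (\<Prod>j\<in>J. r j)" using \<open>m > 0\<close> by simp
    then have "card normalized = (\<Prod>j\<in>J. r j) div s" using s_pos by (metis nonzero_mult_div_cancel_right less_not_refl)
    then show ?thesis using True by (simp add: card_places_over_t)
  next
    case False
    then have "S = {}" by (auto simp: S_def)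
    then have "card normalized = 0" using card_solutions_eq sol q1 by simp
    then show ?thesis unfolding card_places_over_t if_not_P[OF False] .
  qed
qed

end

subsection \<open>Linear independence of radicals via the Frobenius map\<close>

context
  fixes k :: "'a::{field,finite} \<Rightarrow> 'e::field"
  assumes k: "fhom k"
begin

interpretation k: fhom k by (rule k)

lemma frobenius_add: "((x::'e) + y) ^ CARD('a) = x ^ CARD('a) + y ^ CARD('a)"
proof -
  let ?q = "CARD('a)"
  have q: "?q \<ge> 2" by (rule card_field_ge2)
  have "of_nat (?q choose i) = (0::'e)" if "0 < i" "i < ?q" for i
    using finite_field_binomial_eq_0[OF that] k.hom_of_nat[of "?q choose i"] k.hom_zero by simp
  then have "(\<Sum>i\<in>{..?q}. of_nat (?q choose i) * x ^ i * y ^ (?q - i)) =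
      (\<Sum>i\<in>{0, ?q}. of_nat (?q choose i) * x ^ i * y ^ (?q - i))"
    by (intro sum.mono_neutral_right) auto
  also have "\<dots> = x ^ ?q + y ^ ?q" using q by simp
  finally show ?thesis unfolding binomial_ring .
qed

lemma frobenius_sum: "(\<Sum>i\<in>A. (f i :: 'e)) ^ CARD('a) = (\<Sum>i\<in>A. f i ^ CARD('a))"
  using card_field_ge2[where 'a='a]
  by (induction A rule: infinite_finite_induct) (auto simp: frobenius_add power_0_left)

text \<open>The \<open>q\<close> constants already exhaust the roots of
  \<open>X^q - X\<close>.\<close>

lemma frobenius_fixed:
  assumes "(z::'e) ^ CARD('a) = z" shows "z \<in> range k"
proof -
  let ?q = "CARD('a)"
  have q: "?q \<ge> 2" by (rule card_field_ge2)
  define p :: "'e poly" where "p = Polynomial.monom 1 ?q - [:0, 1:]"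
  have deg1: "Polynomial.degree [:0, 1 :: 'e:] < Polynomial.degree (Polynomial.monom (1::'e) ?q)"
    using q by (simp add: Polynomial.degree_monom_eq)
  have deg: "Polynomial.degree p = ?q"
    unfolding p_def diff_conv_add_uminus
    using deg1 by (subst degree_add_eq_left) (simp_all add: Polynomial.degree_monom_eq)
  then have p0: "p \<noteq> 0" using q by auto
  have roots: "{x. poly p x = 0} = {x. x ^ ?q = x}" by (simp add: p_def Polynomial.poly_monom)
  have fin: "finite {x::'e. x ^ ?q = x}" using poly_roots_finite[OF p0] roots by simp
  have le: "card {x::'e. x ^ ?q = x} \<le> ?q" using card_poly_roots_bound[OF p0] deg roots by simp
  have sub: "range k \<subseteq> {x. x ^ ?q = x}"
    by (auto simp: finite_field_power_card simp flip: k.hom_power)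
  have "card (range k) = ?q" by (rule card_image) (auto simp: inj_on_def k.hom_eq_iff)
  then have "range k = {x. x ^ ?q = x}" using fin le sub by (intro card_seteq) auto
  then show ?thesis using assms by blast
qed

end

lemma quotient_rescale:
  fixes x y c d :: "'a::field"
  assumes "c \<noteq> 0" "d \<noteq> 0" shows "x / y = (c * x / (d * y)) * (d / c)"
  using assms by simp

lemma radicals_independent:
  fixes \<iota> :: "'k::field \<Rightarrow> 'e::field" and \<kappa> :: "'a::{field,finite} \<Rightarrow> 'k"
  assumes i: "fhom \<iota>" and c: "fhom \<kappa>" and fin: "finite B"
    and m_nz: "\<And>b. b \<in> B \<Longrightarrow> m b \<noteq> 0"
    and m_pow: "\<And>b. b \<in> B \<Longrightarrow> m b ^ (CARD('a) - 1) \<in> range \<iota>"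
    and m_indep: "\<And>b b'. b \<in> B \<Longrightarrow> b' \<in> B \<Longrightarrow> m b / m b' \<in> range \<iota> \<Longrightarrow> b = b'"
    and sum: "(\<Sum>b\<in>B. \<iota> (f b) * m b) = 0" and "b \<in> B"
  shows "f b = 0"
proof -
  interpret i: fhom \<iota> by fact
  interpret c: fhom \<kappa> by fact
  have k: "fhom (\<lambda>x. \<iota> (\<kappa> x))" by (rule fhom_compose[of \<kappa> \<iota>]) fact+
  have qS: "z ^ CARD('a) = z ^ (CARD('a) - 1) * z" for z :: 'e
  proof -
    have "CARD('a) = Suc (CARD('a) - 1)" using card_field_ge2[where 'a='a] by simp
    then have "z ^ CARD('a) = z ^ Suc (CARD('a) - 1)" by (rule arg_cong)
    then show ?thesis by (simp only: power_Suc2)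
  qed
  have "\<forall>b\<in>B. f b = 0"
    using sum
  proof (induction "card {b \<in> B. f b \<noteq> 0}" arbitrary: f rule: less_induct)
    case less
    show ?case
    proof (rule ccontr)
      assume "\<not> (\<forall>b\<in>B. f b = 0)"
      then obtain b0 where b0: "b0 \<in> B" "f b0 \<noteq> 0" by auto
      define z where "z b = \<iota> (f b) * m b" for b
      have z_nz: "z b \<noteq> 0" if "b \<in> B" "f b \<noteq> 0" for b
        using that m_nz by (simp add: z_def i.hom_eq_0_iff)
      have "\<exists>d. z b ^ (CARD('a) - 1) = \<iota> d" if b: "b \<in> B" for b
      proof -
        obtain x where "m b ^ (CARD('a) - 1) = \<iota> x" using m_pow[OF b] by auto
        then have "z b ^ (CARD('a) - 1) = \<iota> (f b ^ (CARD('a) - 1) * x)"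
          by (simp add: z_def power_mult_distrib i.hom_simps)
        then show ?thesis ..
      qed
      then obtain d where d: "\<And>b. b \<in> B \<Longrightarrow> z b ^ (CARD('a) - 1) = \<iota> (d b)" by metis
      have s0: "(\<Sum>b\<in>B. z b) = 0" using less.prems by (simp add: z_def)
      have "(\<Sum>b\<in>B. \<iota> (d b) * z b) = (\<Sum>b\<in>B. z b ^ CARD('a))"
        by (intro sum.cong refl) (simp only: qS d)
      also have "\<dots> = 0"
        using frobenius_sum[OF k, of z B] s0 card_field_ge2[where 'a='a] by (simp add: power_0_left)
      finally have s1: "(\<Sum>b\<in>B. \<iota> (d b) * z b) = 0" .
      \<comment> \<open>Subtracting \<open>d b0\<close> times the relation from its image under
        Frobenius removes the term \<open>b0\<close>.\<close>
      have "(\<Sum>b\<in>B. \<iota> ((d b - d b0) * f b) * m b) = (\<Sum>b\<in>B. \<iota> (d b) * z b) - \<iota> (d b0) * (\<Sum>b\<in>B. z b)"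
        by (simp add: z_def i.hom_simps sum_distrib_left sum_subtractf[symmetric] algebra_simps)
      then have sum0: "(\<Sum>b\<in>B. \<iota> ((d b - d b0) * f b) * m b) = 0" using s0 s1 by simp
      have card: "card {b \<in> B. (d b - d b0) * f b \<noteq> 0} < card {b \<in> B. f b \<noteq> 0}"
        by (rule psubset_card_mono) (use fin b0 in auto)
      have "\<forall>b\<in>B. (d b - d b0) * f b = 0" by (rule less.hyps[OF card sum0])
      then have dd: "d b = d b0" if "b \<in> B" "f b \<noteq> 0" for b using that by auto
      have only: "b = b0" if b: "b \<in> B" "f b \<noteq> 0" for b
      proof (rule m_indep[OF b(1) b0(1)])
        \<comment> \<open>All nonzero terms have the same \<open>(q - 1)\<close>-th power, so their
          ratios are fixed by Frobenius and are constants.\<close>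
        have "(z b / z b0) ^ (CARD('a) - 1) = 1"
        proof -
          have "z b0 ^ (CARD('a) - 1) \<noteq> 0" using z_nz[OF b0] by simp
          then show ?thesis unfolding power_divide d[OF b(1)] d[OF b0(1)] dd[OF b] by (rule divide_self)
        qed
        then have "(z b / z b0) ^ CARD('a) = z b / z b0" by (simp add: qS)
        then obtain x where x: "z b / z b0 = \<iota> (\<kappa> x)" using frobenius_fixed[OF k] by blast
        have "m b / m b0 = \<iota> (\<kappa> x * f b0 / f b)"
        proof -
          have "m b / m b0 = (z b / z b0) * (\<iota> (f b0) / \<iota> (f b))"
            unfolding z_def using b(2) b0(2) by (intro quotient_rescale) (simp_all add: i.hom_eq_0_iff)
          then show ?thesis unfolding x i.hom_mult i.hom_divide by (simp only: times_divide_eq_right)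
        qed
        then show "m b / m b0 \<in> range \<iota>" by simp
      qed
      have "(\<Sum>b\<in>B. z b) = (\<Sum>b\<in>{b0}. z b)"
        using fin b0 by (intro sum.mono_neutral_right) (auto simp: z_def i.hom_zero dest: only)
      then show False using s0 z_nz[OF b0] by simp
    qed
  qed
  then show ?thesis using \<open>b \<in> B\<close> by blast
qed

subsection \<open>Exact divisibility by prime elements\<close>

text \<open>The \<open>p\<close>-adic valuation as a relation, which is enough to multiply and to
  compare valuations.\<close>

definition exact_power :: "'a::idom \<Rightarrow> nat \<Rightarrow> 'a \<Rightarrow> bool" where
  "exact_power p i x \<longleftrightarrow> (\<exists>u. x = p ^ i * u \<and> \<not> p dvd u)"

lemma exact_power_mult:
  assumes "prime_elem p" "exact_power p i x" "exact_power p j y"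
  shows "exact_power p (i + j) (x * y)"
proof -
  obtain u v where uv: "x = p ^ i * u" "\<not> p dvd u" "y = p ^ j * v" "\<not> p dvd v"
    using assms by (auto simp: exact_power_def)
  then have "x * y = p ^ (i + j) * (u * v)" by (simp add: power_add algebra_simps)
  moreover have "\<not> p dvd u * v" using uv assms(1) by (simp add: prime_elem_dvd_mult_iff)
  ultimately show ?thesis by (auto simp: exact_power_def)
qed

lemma exact_power_one: "prime_elem p \<Longrightarrow> exact_power p 0 1"
  by (auto simp: exact_power_def prime_elem_def)

lemma exact_power_power:
  assumes "prime_elem p" "exact_power p i x"
  shows "exact_power p (i * m) (x ^ m)"
  by (induction m) (use assms exact_power_one exact_power_mult in auto)

lemma exact_power_prod:
  assumes "prime_elem p" "\<And>a. a \<in> A \<Longrightarrow> exact_power p (i a) (x a)"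
  shows "exact_power p (\<Sum>a\<in>A. i a) (\<Prod>a\<in>A. x a)"
  using assms(2)
  by (induction A rule: infinite_finite_induct) (auto intro: exact_power_one exact_power_mult assms(1))

lemma exact_power_unique:
  assumes "prime_elem p" "exact_power p i x" "exact_power p j x"
  shows "i = j"
proof -
  have False if lt: "i < j" and e: "exact_power p i x" "exact_power p j x" for i j
  proof -
    obtain u v where uv: "x = p ^ i * u" "\<not> p dvd u" "x = p ^ j * v" using e unfolding exact_power_def by blast
    have "p ^ i * u = p ^ i * (p ^ (j - i) * v)" using uv lt by (simp add: mult.assoc[symmetric] flip: power_add)
    then have "u = p ^ (j - i) * v" using assms(1) by (simp add: prime_elem_def)
    moreover have "p dvd p ^ (j - i)" using lt by (simp add: dvd_power)
    ultimately show False using uv by simp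
  qed
  then show ?thesis using assms by (meson linorder_neqE_nat)
qed

lemma exact_power_exists:
  fixes p x :: "'a::field poly"
  assumes "Polynomial.degree p > 0" "x \<noteq> 0"
  shows "\<exists>i. exact_power p i x"
  using assms(2)
proof (induction "Polynomial.degree x" arbitrary: x rule: less_induct)
  case less
  show ?case
  proof (cases "p dvd x")
    case False
    then show ?thesis by (intro exI[of _ 0]) (auto simp: exact_power_def)
  next
    case True
    then obtain z where z: "x = p * z" by auto
    then have "z \<noteq> 0" "Polynomial.degree z < Polynomial.degree x"
      using less.prems assms(1) by (auto simp: Polynomial.degree_mult_eq)
    with less.hyps obtain i where "exact_power p i z" by blast
    then have "exact_power p (Suc i) x" unfolding z by (auto simp: exact_power_def mult.assoc)
    then show ?thesis ..
  qed
qed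

subsection \<open>The rational function field\<close>

definition ratconst :: "'a::field \<Rightarrow> 'a poly fract" where
  "ratconst c = Fraction_Field.Fract [:c:] 1"

definition ratX :: "'a::field poly fract" where
  "ratX = Fraction_Field.Fract [:0, 1:] 1"

lemma fhom_ratconst: "fhom ratconst"
  by unfold_locales (simp_all add: ratconst_def Fraction_Field.One_fract_def one_pCons mult.commute)

interpretation ratconst: fhom ratconst by (rule fhom_ratconst)

lemma pev_ratX: "pev ratconst p ratX = Fraction_Field.Fract p 1"
proof (induction p)
  case (pCons c p)
  have "ratconst c + ratX * Fraction_Field.Fract p 1 = Fraction_Field.Fract (pCons c p) 1"
    by (simp add: ratconst_def ratX_def)
  then show ?case using pCons by simp
qed (simp add: Fraction_Field.Zero_fract_def)

lemma Fract_eq_0_iff: "Fraction_Field.Fract p 1 = 0 \<longleftrightarrow> (p :: 'a::field poly) = 0"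
  by (simp add: Fraction_Field.Zero_fract_def Fraction_Field.eq_fract)

lemma ratX_nz: "ratX \<noteq> 0"
  by (simp add: ratX_def Fract_eq_0_iff)

text \<open>Turns a polynomial in \<open>X\<close> into one in the parameter \<open>1 / X\<close> at
  infinity, up to a power of that parameter.\<close>

lemma pev_reflect:
  assumes "z \<noteq> 0" "fhom h"
  shows "pev h (reflect_poly p) z = z ^ Polynomial.degree p * pev h p (inverse z)"
proof -
  interpret h: fhom h by fact
  have deg: "Polynomial.degree (map_poly h p) = Polynomial.degree p"
    by (rule degree_map_poly) (simp add: h.hom_eq_0_iff)
  have "map_poly h (reflect_poly p) = reflect_poly (map_poly h p)"
    by (rule poly_eqI) (simp add: coeff_map_poly h.hom_zero coeff_reflect_poly deg)
  then show ?thesis using poly_reflect_poly_nz[OF assms(1), of "map_poly h p"] by (simp add: pev_def deg)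
qed

lemma transcendental_finite:
  fixes p :: "'a::field poly"
  assumes "pev ratconst p (ratX - ratconst x) = 0" shows "p = 0"
proof -
  have "pev ratconst (pcompose p [:- x, 1:]) ratX = 0"
    using assms unfolding ratconst.pev_pcompose by (simp add: ratconst.hom_simps)
  then have "pcompose p [:- x, 1:] = 0" by (simp only: pev_ratX Fract_eq_0_iff)
  then show ?thesis by (rule pcompose_eq_0) simp
qed

lemma transcendental_infinite:
  fixes p :: "'a::field poly"
  assumes "pev ratconst p (inverse ratX) = 0" shows "p = 0"
proof -
  have "pev ratconst (reflect_poly p) ratX = 0"
    using assms by (simp add: pev_reflect[OF ratX_nz fhom_ratconst])
  then show ?thesis by (simp add: pev_ratX Fract_eq_0_iff)
qed

text \<open>The quotients of polynomials in \<open>t\<close> form a field containing the constants,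
  so it suffices that \<open>X\<close> is among them.\<close>

lemma generated_by:
  fixes t :: "'a::field poly fract"
  assumes trans: "\<And>p. pev ratconst p t = 0 \<Longrightarrow> p = 0"
    and X: "\<exists>p p'. p' \<noteq> 0 \<and> ratX = pev ratconst p t / pev ratconst p' t"
  shows "\<exists>p p'. p' \<noteq> 0 \<and> z = pev ratconst p t / pev ratconst p' t"
proof -
  define G where "G = {z. \<exists>p p'. p' \<noteq> 0 \<and> z = pev ratconst p t / pev ratconst p' t}"
  have GI: "pev ratconst p t / pev ratconst p' t \<in> G" if "p' \<noteq> 0" for p p'
    using that by (auto simp: G_def)
  have nz: "pev ratconst p t \<noteq> 0" if "p \<noteq> 0" for p using trans that by blast
  have const: "ratconst c \<in> G" for c using GI[of 1 "[:c:]"] by simp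
  have add: "x + y \<in> G" if xy: "x \<in> G" "y \<in> G" for x y
  proof -
    obtain a b c d where 1: "b \<noteq> 0" "d \<noteq> 0" "x = pev ratconst a t / pev ratconst b t" "y = pev ratconst c t / pev ratconst d t"
      using xy unfolding G_def by blast
    have "x + y = pev ratconst (a * d + c * b) t / pev ratconst (b * d) t"
      unfolding 1 using nz[OF 1(1)] nz[OF 1(2)] by (simp add: ratconst.pev_add ratconst.pev_mult add_frac_eq)
    also have "\<dots> \<in> G" by (rule GI) (use 1 in simp)
    finally show ?thesis .
  qed
  have mult: "x * y \<in> G" if xy: "x \<in> G" "y \<in> G" for x y
  proof -
    obtain a b c d where 1: "b \<noteq> 0" "d \<noteq> 0" "x = pev ratconst a t / pev ratconst b t" "y = pev ratconst c t / pev ratconst d t"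
      using xy unfolding G_def by blast
    have "x * y = pev ratconst (a * c) t / pev ratconst (b * d) t"
      unfolding 1 by (simp add: ratconst.pev_mult)
    also have "\<dots> \<in> G" by (rule GI) (use 1 in simp)
    finally show ?thesis .
  qed
  have inv: "inverse x \<in> G" if "x \<in> G" for x
  proof -
    obtain a b where 1: "b \<noteq> 0" "x = pev ratconst a t / pev ratconst b t" using \<open>x \<in> G\<close> unfolding G_def by blast
    show ?thesis
    proof (cases "a = 0")
      case True then show ?thesis using 1 const[of 0] by (simp add: ratconst.hom_zero)
    next
      case False then show ?thesis using 1 GI[of a b] by simp
    qed
  qed
  have XG: "ratX \<in> G" using X by (simp add: G_def)
  have pG: "pev ratconst p ratX \<in> G" for p
    by (induction p) (use const XG add mult const[of 0] in \<open>auto simp: ratconst.hom_zero\<close>)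
  obtain a b where "z = Fraction_Field.Fract a b" "b \<noteq> 0" by (cases z) auto
  then have "z = pev ratconst a ratX * inverse (pev ratconst b ratX)" by (simp add: pev_ratX)
  then have "z \<in> G" using pG inv mult by simp
  then show ?thesis by (simp add: G_def)
qed

lemma generated_finite: "\<exists>p p'. p' \<noteq> 0 \<and> z = pev ratconst p (ratX - ratconst x) / pev ratconst p' (ratX - ratconst x)"
  by (rule generated_by[OF transcendental_finite], assumption)
     (rule exI[of _ "[:x, 1:]"], rule exI[of _ 1], simp add: ratconst.hom_one)

lemma generated_infinite: "\<exists>p p'. p' \<noteq> 0 \<and> z = pev ratconst p (inverse ratX) / pev ratconst p' (inverse ratX)"
  by (rule generated_by[OF transcendental_infinite], assumption)
     (rule exI[of _ 1], rule exI[of _ "[:0, 1:]"], simp add: ratconst.hom_simps divide_inverse)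

subsection \<open>Kummer extensions of the rational function field\<close>

lemma fhom_to_ac: "fhom to_ac"
  by unfold_locales simp_all

interpretation to_ac: fhom to_ac by (rule fhom_to_ac)

lemma ring_of_type_algebra_inv:
  fixes x :: "'a::field"
  shows "\<ominus>\<^bsub>ring_of_type_algebra\<^esub> x = - x" "x \<noteq> 0 \<Longrightarrow> inv\<^bsub>ring_of_type_algebra\<^esub> x = inverse x"
proof -
  interpret R: Ring.field "ring_of_type_algebra :: 'a ring" by (rule field_from_type_algebra)
  have carr: "carrier (ring_of_type_algebra :: 'a ring) = UNIV" by (simp add: ring_of_type_algebra_def)
  show "\<ominus>\<^bsub>ring_of_type_algebra\<^esub> x = - x"
    by (rule R.minus_equality) (simp_all add: ring_of_type_algebra_def)
  show "inv\<^bsub>ring_of_type_algebra\<^esub> x = inverse x" if "x \<noteq> 0"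
    by (rule R.inv_char) (use that in \<open>simp_all add: ring_of_type_algebra_def\<close>)
qed

lemma field_closed_generate_field: "field_closed (generate_field ring_of_type_algebra (H :: 'a::field set))"
proof -
  let ?R = "ring_of_type_algebra :: 'a ring"
  let ?L = "generate_field ?R H"
  have one: "1 \<in> ?L" using generate_field.one[of ?R H] by (simp add: ring_of_type_algebra_def)
  have neg: "- x \<in> ?L" if "x \<in> ?L" for x
    using generate_field.a_inv[OF that] by (simp only: ring_of_type_algebra_inv)
  have add: "x + y \<in> ?L" if "x \<in> ?L" "y \<in> ?L" for x y
    using generate_field.eng_add[OF that] by (simp add: ring_of_type_algebra_def)
  have mult: "x * y \<in> ?L" if "x \<in> ?L" "y \<in> ?L" for x y
    using generate_field.eng_mult[OF that] by (simp add: ring_of_type_algebra_def)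
  have inv: "inverse x \<in> ?L" if "x \<in> ?L" for x
  proof (cases "x = 0")
    case False
    then have "x \<noteq> \<zero>\<^bsub>?R\<^esub>" by (simp add: ring_of_type_algebra_def)
    then show ?thesis using generate_field.m_inv[OF that] ring_of_type_algebra_inv(2)[OF False] by simp
  qed (use that in simp)
  show ?thesis using one neg add mult inv by (simp add: field_closed_def)
qed

lemma generate_field_subset:
  assumes S: "field_closed S" "H \<subseteq> S"
  shows "generate_field ring_of_type_algebra H \<subseteq> (S :: 'a::field set)"
proof
  fix x assume "x \<in> generate_field ring_of_type_algebra H"
  then show "x \<in> S"
  proof induction
    case one then show ?case using field_closedD(1)[OF S(1)] by (simp add: ring_of_type_algebra_def)
  next
    case (incl h) then show ?case using S(2) by auto
  next
    case (a_inv h) then show ?case using field_closedD(5)[OF S(1)] by (simp add: ring_of_type_algebra_inv)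
  next
    case (m_inv h)
    then have "h \<noteq> 0" by (simp add: ring_of_type_algebra_def)
    then show ?case using m_inv field_closedD(6)[OF S(1)] by (simp add: ring_of_type_algebra_inv)
  next
    case (eng_add x y) then show ?case using field_closedD(3)[OF S(1)] by (simp add: ring_of_type_algebra_def)
  next
    case (eng_mult x y) then show ?case using field_closedD(4)[OF S(1)] by (simp add: ring_of_type_algebra_def)
  qed
qed

text \<open>Inverses are polynomials in the algebraic element itself, so a ring between the base
  field and its algebraic closure is already a field.\<close>

lemma alg_closure_inverse_poly:
  fixes z :: "'k::field alg_closure"
  assumes "z \<noteq> 0"
  shows "\<exists>p. inverse z = pev to_ac p z"
proof -
  obtain p :: "'k poly" where p: "p \<noteq> 0" "pev to_ac p z = 0"
    using alg_closure_algebraic[of z] unfolding pev_def by blast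
  then have "\<exists>p. z * pev to_ac p z = 1"
  proof (induction p)
    case (pCons c p)
    show ?case
    proof (cases "c = 0")
      case True
      then show ?thesis using pCons assms by auto
    next
      case False
      have "z * pev to_ac p z = - to_ac c" using pCons.prems by (simp add: eq_neg_iff_add_eq_0 add.commute)
      have "z * pev to_ac (Polynomial.smult (- inverse c) p) z = to_ac (- inverse c) * (z * pev to_ac p z)"
        by (simp only: to_ac.pev_smult mult.left_commute)
      also have "\<dots> = 1" using False \<open>z * pev to_ac p z = - to_ac c\<close> by simp
      finally have "z * pev to_ac (Polynomial.smult (- inverse c) p) z = 1" .
      then show ?thesis ..
    qed
  qed simp
  then obtain p where "z * pev to_ac p z = 1" by blast
  then show ?thesis using inverse_unique[of z] by metis
qed

text \<open>The axiom \<open>ramified\<close> gives each nontrivial radicand a simple prime factor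
  that divides no other radicand; it forces the extension to have the full degree
  \<open>\<Prod>j\<in>J. r j\<close>. The roots \<open>y j\<close> may be chosen
  arbitrarily.\<close>

locale kummer_extension =
  fixes J :: "nat set" and r :: "nat \<Rightarrow> nat" and F :: "nat \<Rightarrow> 'a::{field,finite} poly"
    and y :: "nat \<Rightarrow> 'a poly fract alg_closure"
  assumes finite_J: "finite J" and r_dvd: "j \<in> J \<Longrightarrow> r j dvd CARD('a) - 1"
    and F_nz: "j \<in> J \<Longrightarrow> F j \<noteq> 0"
    and y_power: "j \<in> J \<Longrightarrow> y j ^ r j = to_ac (Fraction_Field.Fract (F j) 1)"
    and ramified: "i \<in> J \<Longrightarrow> r i \<ge> 2 \<Longrightarrow>
      \<exists>p. prime_elem p \<and> (\<forall>j\<in>J. exact_power p (if j = i then 1 else 0) (F j))"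
begin

definition L where "L = generate_field ring_of_type_algebra (range to_ac \<union> y ` J)"
definition B where "B = (\<Pi>\<^sub>E j\<in>J. {..<r j})"
definition mono where "mono b = (\<Prod>j\<in>J. y j ^ b j)" for b :: "nat \<Rightarrow> nat"

lemma q1: "CARD('a) - 1 > 0"
  using card_field_ge2[where 'a='a] by simp

lemma r_pos: "j \<in> J \<Longrightarrow> r j > 0"
  using r_dvd[of j] q1 by (auto intro: Nat.gr0I)

lemma finite_B: "finite B"
  unfolding B_def using finite_J by (intro finite_PiE) auto

lemma L: "field_closed L"
  unfolding L_def by (rule field_closed_generate_field)

lemma base_L: "to_ac z \<in> L" and y_L: "j \<in> J \<Longrightarrow> y j \<in> L"
  unfolding L_def by (auto intro: generate_field.incl)

lemma y_nz: "j \<in> J \<Longrightarrow> y j \<noteq> 0"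
  using y_power[of j] r_pos[of j] F_nz[of j] by (auto simp: power_0_left Fract_eq_0_iff)

lemma mono_nz: "mono b \<noteq> 0"
  using y_nz finite_J by (auto simp: mono_def)

lemma Fract_prod: "(\<Prod>i\<in>A. Fraction_Field.Fract (f i) 1 ^ e i) = Fraction_Field.Fract (\<Prod>i\<in>A. f i ^ e i) (1 :: 'a poly)"
  by (simp flip: pev_ratX add: ratconst.pev_prod ratconst.pev_power)

lemma mono_power: "mono b ^ (CARD('a) - 1) =
    to_ac (Fraction_Field.Fract (\<Prod>j\<in>J. F j ^ (b j * ((CARD('a) - 1) div r j))) 1)"
proof -
  have "mono b ^ (CARD('a) - 1) = (\<Prod>j\<in>J. (y j ^ b j) ^ (CARD('a) - 1))"
    by (simp add: mono_def prod_power_distrib)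
  also have "\<dots> = (\<Prod>j\<in>J. to_ac (Fraction_Field.Fract (F j) 1) ^ (b j * ((CARD('a) - 1) div r j)))"
  proof (rule prod.cong[OF refl])
    fix j assume j: "j \<in> J"
    have "(y j ^ b j) ^ (CARD('a) - 1) = y j ^ (r j * (b j * ((CARD('a) - 1) div r j)))"
      unfolding power_mult[symmetric] using r_dvd[OF j] by (simp add: mult.left_commute[of "r j"])
    then show "(y j ^ b j) ^ (CARD('a) - 1) = to_ac (Fraction_Field.Fract (F j) 1) ^ (b j * ((CARD('a) - 1) div r j))"
      unfolding power_mult[of _ "r j"] y_power[OF j] .
  qed
  also have "\<dots> = to_ac (\<Prod>j\<in>J. Fraction_Field.Fract (F j) 1 ^ (b j * ((CARD('a) - 1) div r j)))"
    by (simp add: to_ac.hom_simps)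
  finally show ?thesis unfolding Fract_prod .
qed

text \<open>In the \<open>(q - 1)\<close>-th power of the quotient, the valuation at the prime
  belonging to index \<open>i\<close> is \<open>(q - 1) / r i\<close> times
  \<open>b i - b' i\<close>. For a \<open>(q - 1)\<close>-th power in the base field it is a
  multiple of \<open>q - 1\<close>. So \<open>r i\<close> divides \<open>b i - b' i\<close>, and
  both exponents are below \<open>r i\<close>.\<close>

lemma mono_quotient_in_base:
  assumes b: "b \<in> B" "b' \<in> B" and "mono b / mono b' \<in> range to_ac"
  shows "b = b'"
proof (rule ext)
  fix i
  show "b i = b' i"
  proof (cases "i \<in> J \<and> r i \<ge> 2")
    case False
    show ?thesis
    proof (cases "i \<in> J")
      case True
      then have "r i = 1" using False r_pos[OF True] by simp
      moreover have "b i < r i" "b' i < r i" using b True by (auto simp: B_def)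
      ultimately show ?thesis by simp
    qed (use b in \<open>auto simp: B_def PiE_iff extensional_def\<close>)
  next
    case True
    then obtain p where p: "prime_elem p" "\<And>j. j \<in> J \<Longrightarrow> exact_power p (if j = i then 1 else 0) (F j)"
      using ramified by blast
    let ?m = "CARD('a) - 1"
    obtain g where g: "mono b / mono b' = to_ac g" using assms(3) by auto
    obtain u v where uv: "g = Fraction_Field.Fract u v" "v \<noteq> 0" by (cases g) auto
    have "u \<noteq> 0"
    proof
      assume "u = 0"
      then have "g = 0" using uv by (simp add: Fraction_Field.Zero_fract_def Fraction_Field.eq_fract)
      then show False using g mono_nz by simp
    qed
    have dp: "Polynomial.degree p > 0"
      using p(1) by (metis gr0I is_unit_iff_degree prime_elem_def)
    define P where "P b = (\<Prod>j\<in>J. F j ^ (b j * (?m div r j)))" for b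
    have fuv: "g = Fraction_Field.Fract u 1 / Fraction_Field.Fract v 1" using uv by simp
    have "mono b = to_ac g * mono b'" using g mono_nz by (simp add: field_simps)
    then have "mono b ^ ?m = to_ac (g ^ ?m) * mono b' ^ ?m" by (simp add: power_mult_distrib)
    then have "to_ac (Fraction_Field.Fract (P b) 1) = to_ac (g ^ ?m * Fraction_Field.Fract (P b') 1)"
      unfolding mono_power P_def by simp
    then have "Fraction_Field.Fract (P b) 1 = g ^ ?m * Fraction_Field.Fract (P b') 1"
      by (simp only: to_ac_eq_iff)
    then have "Fraction_Field.Fract v 1 ^ ?m * Fraction_Field.Fract (P b) 1 =
        Fraction_Field.Fract u 1 ^ ?m * Fraction_Field.Fract (P b') 1"
    proof -
      have "Fraction_Field.Fract v 1 * g = Fraction_Field.Fract u 1"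
        using uv(2) unfolding fuv by (simp add: Fraction_Field.eq_fract)
      then have "Fraction_Field.Fract v 1 ^ ?m * g ^ ?m = Fraction_Field.Fract u 1 ^ ?m"
        by (simp only: power_mult_distrib[symmetric])
      with \<open>Fraction_Field.Fract (P b) 1 = _\<close> show ?thesis by (simp only: mult.assoc[symmetric])
    qed
    then have "pev ratconst (v ^ ?m * P b - u ^ ?m * P b') ratX = 0"
      unfolding ratconst.pev_diff ratconst.pev_mult ratconst.pev_power
      unfolding pev_ratX by simp
    then have eq: "v ^ ?m * P b = u ^ ?m * P b'" by (simp add: pev_ratX Fract_eq_0_iff)
    have P: "exact_power p (b i * (?m div r i)) (P b)" for b
    proof -
      have "exact_power p (\<Sum>j\<in>J. (if j = i then 1 else 0) * (b j * (?m div r j))) (P b)"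
        unfolding P_def by (intro exact_power_prod exact_power_power p)
      also have "(\<Sum>j\<in>J. (if j = i then 1 else 0) * (b j * (?m div r j))) =
          (\<Sum>j\<in>J. (if j = i then b j * (?m div r j) else 0))" by (intro sum.cong) auto
      also have "\<dots> = b i * (?m div r i)" using True finite_J by simp
      finally show ?thesis .
    qed
    obtain x x' where x: "exact_power p x u" "exact_power p x' v"
      using exact_power_exists[OF dp \<open>u \<noteq> 0\<close>] exact_power_exists[OF dp uv(2)] by blast
    note e1 = exact_power_mult[OF p(1) exact_power_power[OF p(1) x(2), of ?m] P[of b]]
    note e2 = exact_power_mult[OF p(1) exact_power_power[OF p(1) x(1), of ?m] P[of b']]
    have eq1: "x' * ?m + b i * (?m div r i) = x * ?m + b' i * (?m div r i)"
      by (rule exact_power_unique[OF p(1) e1[unfolded eq] e2])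
    obtain m where m: "?m = r i * m" using r_dvd True by (auto elim: dvdE)
    then have "m > 0" "?m div r i = m" using q1 True by (auto intro: Nat.gr0I)
    then have "m * (r i * x' + b i) = m * (r i * x + b' i)" using eq1 unfolding m by (simp add: algebra_simps)
    then have "r i * x' + b i = r i * x + b' i" using \<open>m > 0\<close> by simp
    moreover have "b i < r i" "b' i < r i" using b True by (auto simp: B_def)
    ultimately show "b i = b' i"
      by (metis add.commute mod_less mod_mult_self2)
  qed
qed

lemma indep:
  assumes "(\<Sum>b\<in>B. to_ac (f b) * mono b) = 0" "b \<in> B"
  shows "f b = 0"
proof (rule radicals_independent[OF fhom_to_ac fhom_ratconst finite_B _ _ _ assms])
  show "mono b ^ (CARD('a) - 1) \<in> range to_ac" for b unfolding mono_power by blast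
qed (use mono_nz mono_quotient_in_base in auto)

text \<open>The span of the monomials is closed under multiplication because exponents wrap around,
  and under inverses because its elements are algebraic; so it is a field containing all generators
  of \<open>L\<close>.\<close>

lemma L_span:
  assumes "x \<in> L" shows "\<exists>c. x = (\<Sum>b\<in>B. to_ac (c b) * mono b)"
proof -
  define S where "S = {x. \<exists>c. x = (\<Sum>b\<in>B. to_ac (c b) * mono b)}"
  have SI: "(\<Sum>b\<in>B. to_ac (c b) * mono b) \<in> S" for c unfolding S_def by blast
  have add: "x + z \<in> S" if xz: "x \<in> S" "z \<in> S" for x z
  proof -
    obtain c d where "x = (\<Sum>b\<in>B. to_ac (c b) * mono b)" "z = (\<Sum>b\<in>B. to_ac (d b) * mono b)"
      using xz by (auto simp: S_def)
    then have "x + z = (\<Sum>b\<in>B. to_ac (c b + d b) * mono b)" by (simp add: distrib_right sum.distrib)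
    then show ?thesis by (simp only: SI)
  qed
  have scale: "to_ac g * x \<in> S" if x: "x \<in> S" for g x
  proof -
    obtain c where "x = (\<Sum>b\<in>B. to_ac (c b) * mono b)" using x by (auto simp: S_def)
    then have "to_ac g * x = (\<Sum>b\<in>B. to_ac (g * c b) * mono b)" by (simp add: sum_distrib_left mult.assoc)
    then show ?thesis by (simp only: SI)
  qed
  have zero: "0 \<in> S" unfolding S_def by (auto intro!: exI[of _ "\<lambda>_. 0"])
  have sum: "(\<Sum>b\<in>A. f b) \<in> S" if "\<And>b. b \<in> A \<Longrightarrow> f b \<in> S" for A :: "(nat \<Rightarrow> nat) set" and f
    using that by (induction A rule: infinite_finite_induct) (auto simp: zero add)
  have mono: "mono b \<in> S" if "b \<in> B" for b
  proof -
    have "mono b = (\<Sum>b'\<in>B. to_ac (if b' = b then 1 else 0) * mono b')"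
      using that finite_B by (simp add: if_distrib[of to_ac] if_distrib[of "\<lambda>x. x * _"] cong: if_cong)
    then show ?thesis by (simp only: SI)
  qed
  have y_mono: "y i * mono b \<in> S" if i: "i \<in> J" and b: "b \<in> B" for i b
  proof -
    have split: "mono (b(i := l)) = y i ^ l * (\<Prod>j\<in>J - {i}. y j ^ b j)" for l
      unfolding mono_def using i finite_J by (simp add: prod.remove[of J i])
    have bi_lt: "b i < r i" using b i by (auto simp: B_def)
    show ?thesis
    proof (cases "Suc (b i) < r i")
      case True
      have "b(i := Suc (b i)) \<in> B" using b True i by (auto simp: B_def PiE_iff extensional_def)
      moreover have "mono (b(i := Suc (b i))) = y i * mono b"
        using split[of "Suc (b i)"] split[of "b i"] by simp
      ultimately show ?thesis using mono by metis
    next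
      case False
      then have eq: "Suc (b i) = r i" using bi_lt by simp
      let ?b = "b(i := 0)"
      have B: "?b \<in> B" using b bi_lt i by (auto simp: B_def PiE_iff extensional_def)
      have "y i * mono b = y i ^ Suc (b i) * mono ?b"
        using split[of 0] split[of "b i"] by simp
      then have "y i * mono b = to_ac (Fraction_Field.Fract (F i) 1) * mono ?b"
        unfolding eq y_power[OF i] .
      then show ?thesis using scale[OF mono[OF B]] by simp
    qed
  qed
  have y_mult: "y i * x \<in> S" if i: "i \<in> J" and x: "x \<in> S" for i x
  proof -
    obtain c where "x = (\<Sum>b\<in>B. to_ac (c b) * mono b)" using x by (auto simp: S_def)
    then have "y i * x = (\<Sum>b\<in>B. to_ac (c b) * (y i * mono b))" by (simp add: sum_distrib_left mult.left_commute)
    then show ?thesis using sum scale y_mono[OF i] by simp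
  qed
  have ypow_mult: "y i ^ l * x \<in> S" if i: "i \<in> J" and x: "x \<in> S" for i x l
    by (induction l) (use x y_mult[OF i] in \<open>auto simp: mult.assoc\<close>)
  have prod_mult: "(\<Prod>j\<in>A. y j ^ b j) * x \<in> S" if A: "A \<subseteq> J" and x: "x \<in> S" for A b x
  proof -
    have "finite A" using A finite_subset finite_J by blast
    then show ?thesis using A by induction (use x ypow_mult in \<open>auto simp: mult.assoc\<close>)
  qed
  have mult: "x * z \<in> S" if x: "x \<in> S" and z: "z \<in> S" for x z
  proof -
    obtain c where "x = (\<Sum>b\<in>B. to_ac (c b) * mono b)" using x by (auto simp: S_def)
    then have "x * z = (\<Sum>b\<in>B. to_ac (c b) * (mono b * z))" by (simp add: sum_distrib_right mult.assoc)
    then show ?thesis using sum scale prod_mult[OF order_refl z] by (simp add: mono_def)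
  qed
  have "(\<lambda>j\<in>J. 0::nat) \<in> B" using r_pos by (auto simp: B_def)
  then have one: "1 \<in> S" using mono[of "\<lambda>j\<in>J. 0"] by (simp add: mono_def)
  have base: "to_ac g \<in> S" for g using scale[OF one] by simp
  have yS: "y j \<in> S" if "j \<in> J" for j using y_mult[OF that one] by simp
  have inv: "inverse x \<in> S" if "x \<in> S" for x
  proof (cases "x = 0")
    case False
    then obtain p where p: "inverse x = pev to_ac p x" using alg_closure_inverse_poly by blast
    have "pev to_ac p x \<in> S" by (induction p) (use zero base add mult that in auto)
    then show ?thesis by (simp add: p)
  qed (use zero in simp)
  have neg: "- x \<in> S" if "x \<in> S" for x using scale[OF that, of "- 1"] by simp
  have "field_closed S" using one add mult neg inv by (simp add: field_closed_def)
  then have "L \<subseteq> S" unfolding L_def by (rule generate_field_subset) (use base yS in auto)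
  then show ?thesis using assms by (auto simp: S_def)
qed

end

subsection \<open>The number of rational points of a Kummer cover of the line\<close>

text \<open>The order of the class of the vector \<open>a\<close> in the product of the groups \<open>\<int>/r j\<close>.\<close>

definition vector_order :: "'i set \<Rightarrow> ('i \<Rightarrow> nat) \<Rightarrow> ('i \<Rightarrow> int) \<Rightarrow> nat" where
  "vector_order J r a = (LEAST s. s > 0 \<and> (\<forall>j\<in>J. int (r j) dvd int s * a j))"

text \<open>\<open>N\<close> is any positive common multiple of the \<open>r j\<close>; it
  guarantees that a period exists. A nonzero remainder modulo the least period would be a smaller
  one.\<close>

lemma vector_order:
  assumes "\<And>j. j \<in> J \<Longrightarrow> r j dvd N" "N > 0"
  shows "vector_order J r a > 0" "(\<forall>j\<in>J. int (r j) dvd k * a j) \<longleftrightarrow> int (vector_order J r a) dvd k"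
    "vector_order J r a dvd N"
proof -
  let ?s = "vector_order J r a"
  have N: "int (r j) dvd int N * a j" if "j \<in> J" for j using assms(1)[OF that] by simp
  have s: "?s > 0 \<and> (\<forall>j\<in>J. int (r j) dvd int ?s * a j)"
    unfolding vector_order_def by (rule LeastI[of _ N]) (use assms N in auto)
  then show "?s > 0" ..
  show iff: "(\<forall>j\<in>J. int (r j) dvd k * a j) \<longleftrightarrow> int ?s dvd k" for k
  proof
    assume k: "\<forall>j\<in>J. int (r j) dvd k * a j"
    have "int (r j) dvd (k mod int ?s) * a j" if "j \<in> J" for j
    proof -
      have "(k mod int ?s) * a j = k * a j - (k div int ?s) * (int ?s * a j)"
        by (simp add: minus_div_mult_eq_mod[symmetric] algebra_simps)
      then show ?thesis using k s that by (metis dvd_diff dvd_mult)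
    qed
    then have "\<not> nat (k mod int ?s) < ?s \<or> \<not> nat (k mod int ?s) > 0"
      using not_less_Least[of "nat (k mod int ?s)" "\<lambda>s. s > 0 \<and> (\<forall>j\<in>J. int (r j) dvd int s * a j)"] s
      unfolding vector_order_def[symmetric] by (auto simp: pos_mod_sign)
    moreover have "nat (k mod int ?s) < ?s" using s by (simp add: nat_less_iff)
    ultimately have "k mod int ?s = 0" using s pos_mod_sign[of "int ?s" k] by linarith
    then show "int ?s dvd k" by (rule dvd_eq_mod_eq_0[THEN iffD2])
  next
    assume "int ?s dvd k"
    then obtain m where "k = int ?s * m" by (auto elim: dvdE)
    then have "k * a j = m * (int ?s * a j)" for j by simp
    then show "\<forall>j\<in>J. int (r j) dvd k * a j" using s by (metis dvd_mult)
  qed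
  have "int ?s dvd int N" using iff[of "int N"] N by blast
  then show "?s dvd N" by simp
qed

lemma vector_order_cong:
  assumes "\<And>j. j \<in> J \<Longrightarrow> int (r j) dvd a j - b j"
  shows "vector_order J r a = vector_order J r b"
proof -
  have "int (r j) dvd int s * a j \<longleftrightarrow> int (r j) dvd int s * b j" if "j \<in> J" for s j
  proof -
    have "int (r j) dvd int s * (a j - b j)" using assms[OF that] by simp
    then show ?thesis by (metis dvd_diff_left_iff dvd_diff_right_iff right_diff_distrib)
  qed
  then show ?thesis unfolding vector_order_def by (intro arg_cong[where f = Least] ext) auto
qed

text \<open>The integer combinations of \<open>s\<close> and the \<open>kk j\<close> are the
  multiples of some \<open>g\<close>. Dividing \<open>s\<close> by \<open>g\<close> would still give
  a period of \<open>a\<close>, so \<open>g = 1\<close> by minimality.\<close>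

lemma vector_order_bezout:
  assumes "finite J" "\<And>j. j \<in> J \<Longrightarrow> r j dvd N" "N > 0"
  obtains kk e0 e where "\<And>j. j \<in> J \<Longrightarrow> int (vector_order J r a) * a j = kk j * int (r j)"
    "e0 * int (vector_order J r a) + (\<Sum>j\<in>J. e j * kk j) = 1"
proof -
  let ?s = "vector_order J r a"
  note s = vector_order[of J r N, OF assms(2,3), where a = a]
  have "\<forall>j\<in>J. \<exists>m. int ?s * a j = m * int (r j)"
    using s(2)[of "int ?s"] by (metis dvd_def dvd_refl mult.commute)
  then obtain kk where kk: "\<And>j. j \<in> J \<Longrightarrow> int ?s * a j = kk j * int (r j)" by metis
  define I where "I = {e0 * int ?s + (\<Sum>j\<in>J. e j * kk j) | e0 e. True}"
  have comb: "x - m * y \<in> I" if xy: "x \<in> I" "y \<in> I" for x y m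
  proof -
    obtain e0 e where 1: "x = e0 * int ?s + (\<Sum>j\<in>J. e j * kk j)" using xy by (auto simp: I_def)
    obtain f0 f where 2: "y = f0 * int ?s + (\<Sum>j\<in>J. f j * kk j)" using xy by (auto simp: I_def)
    have "x - m * y = (e0 - m * f0) * int ?s + (\<Sum>j\<in>J. (e j - m * f j) * kk j)"
      unfolding 1 2 by (simp add: algebra_simps sum_subtractf sum_distrib_left)
    then show ?thesis unfolding I_def by (auto intro!: exI[of _ "e0 - m * f0"] exI[of _ "\<lambda>j. e j - m * f j"])
  qed
  have s_I: "int ?s \<in> I" unfolding I_def by (auto intro!: exI[of _ 1] exI[of _ "\<lambda>_. 0"])
  have k_I: "kk i \<in> I" if "i \<in> J" for i
  proof -
    have "(\<Sum>j\<in>J. (if j = i then 1 else 0) * kk j) = (\<Sum>j\<in>J. if j = i then kk j else 0)" by (intro sum.cong) auto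
    also have "\<dots> = kk i" using that assms(1) by simp
    finally show ?thesis unfolding I_def
      by (auto intro!: exI[of _ 0] exI[of _ "\<lambda>j. if j = i then 1 else 0"])
  qed
  define g where "g = (LEAST g. g > 0 \<and> int g \<in> I)"
  have g: "g > 0 \<and> int g \<in> I" unfolding g_def by (rule LeastI[of _ ?s]) (use s(1) s_I in auto)
  have g_dvd: "int g dvd x" if "x \<in> I" for x
  proof -
    have "x mod int g \<in> I" using comb[OF that, of "int g" "x div int g"] g by (simp add: minus_div_mult_eq_mod)
    then have "\<not> (nat (x mod int g) < g \<and> nat (x mod int g) > 0)"
      using not_less_Least[of "nat (x mod int g)" "\<lambda>g. g > 0 \<and> int g \<in> I"] g
      unfolding g_def[symmetric] by (auto simp: pos_mod_sign)
    moreover have "nat (x mod int g) < g" using g by (simp add: nat_less_iff)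
    ultimately have "x mod int g = 0" using g pos_mod_sign[of "int g" x] by linarith
    then show ?thesis by (rule dvd_eq_mod_eq_0[THEN iffD2])
  qed
  obtain m where m: "int ?s = int g * m" using g_dvd[OF s_I] unfolding dvd_def by blast
  have "int (r j) dvd m * a j" if j: "j \<in> J" for j
  proof -
    obtain l where l: "kk j = int g * l" using g_dvd[OF k_I[OF j]] by (auto elim: dvdE)
    have "int g * (m * a j) = int g * (l * int (r j))" using kk[OF j] unfolding m l by (simp add: mult.assoc)
    then show ?thesis using g by simp
  qed
  then have "int ?s dvd m" using s(2) by blast
  then have "int g * m dvd 1 * m" using m by simp
  moreover have "m \<noteq> 0" using m s(1) by auto
  ultimately have "g = 1" by (simp only: dvd_mult_cancel_right) simp
  then have "1 \<in> I" using g by simp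
  then obtain e0 e where "e0 * int ?s + (\<Sum>j\<in>J. e j * kk j) = 1" by (auto simp: I_def)
  then show ?thesis using that kk by blast
qed

text \<open>The number of rational places above a rational place at which the \<open>j\<close>-th radicand has
  order \<open>a j\<close> and leading coefficient \<open>u j\<close>.\<close>

definition local_points :: "nat set \<Rightarrow> (nat \<Rightarrow> nat) \<Rightarrow> (nat \<Rightarrow> int) \<Rightarrow> (nat \<Rightarrow> 'a::field) \<Rightarrow> nat" where
  "local_points J r a u =
     (if \<exists>l. l \<noteq> 0 \<and> (\<forall>j\<in>J. is_power (r j) (l powi a j * u j))
      then (\<Prod>j\<in>J. r j) div vector_order J r a else 0)"

text \<open>Changing the order by a multiple of \<open>r j\<close> multiplies by an
  \<open>r j\<close>-th power. This lets the degrees at infinity be replaced by their residues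
  modulo \<open>r j\<close>.\<close>

lemma local_points_mod:
  fixes u :: "nat \<Rightarrow> 'a::field"
  assumes d: "\<And>j. j \<in> J \<Longrightarrow> int (r j) dvd a j - b j"
  shows "local_points J r a u = local_points J r b u"
proof -
  have "is_power (r j) (l powi a j * u j) \<longleftrightarrow> is_power (r j) (l powi b j * u j)" if j: "j \<in> J" and l: "l \<noteq> 0" for j l
  proof -
    have eq: "l powi a j * u j = l powi (a j - b j) * (l powi b j * u j)"
      using l by (simp flip: power_int_add mult.assoc)
    have "l powi (a j - b j) \<noteq> 0" using l by simp
    then show ?thesis unfolding eq by (rule is_power_mult_cancel[OF is_power_powi[OF d[OF j]]])
  qed
  then have "(\<exists>l. l \<noteq> 0 \<and> (\<forall>j\<in>J. is_power (r j) (l powi a j * u j))) \<longleftrightarrow>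
      (\<exists>l. l \<noteq> 0 \<and> (\<forall>j\<in>J. is_power (r j) (l powi b j * u j)))" by blast
  moreover have "vector_order J r a = vector_order J r b" using d by (rule vector_order_cong)
  ultimately show ?thesis by (simp only: local_points_def)
qed

text \<open>The factor is absorbed by replacing \<open>l\<close> with \<open>l * g\<close>: the
  count does not depend on the constant by which the local parameter is scaled.\<close>

lemma local_points_rescale:
  fixes u :: "nat \<Rightarrow> 'a::field"
  assumes g: "g \<noteq> 0"
  shows "local_points J r a (\<lambda>j. g powi a j * u j) = local_points J r a u"
proof -
  have "(\<exists>l. l \<noteq> 0 \<and> (\<forall>j\<in>J. is_power (r j) (l powi a j * (g powi a j * u j)))) \<longleftrightarrow>
     (\<exists>l. l \<noteq> 0 \<and> (\<forall>j\<in>J. is_power (r j) (l powi a j * u j)))" (is "?A \<longleftrightarrow> ?B")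
  proof
    assume ?A
    then obtain l where l: "l \<noteq> 0" "\<forall>j\<in>J. is_power (r j) (l powi a j * (g powi a j * u j))" by blast
    then show ?B using g by (intro exI[of _ "l * g"]) (simp add: power_int_mult_distrib mult.assoc)
  next
    assume ?B
    then obtain l where l: "l \<noteq> 0" "\<forall>j\<in>J. is_power (r j) (l powi a j * u j)" by blast
    have "(l / g) powi a j * (g powi a j * u j) = l powi a j * u j" for j
      using g by (simp add: power_int_divide_distrib)
    then show ?A using g l(1) l(2) by (intro exI[of _ "l / g"] conjI) (simp_all only: divide_eq_0_iff, simp_all)
  qed
  then show ?thesis by (simp only: local_points_def)
qed

context kummer_extension
begin

abbreviation kconst :: "'a \<Rightarrow> 'a poly fract alg_closure" where
  "kconst c \<equiv> to_ac (ratconst c)"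

definition places_over :: "'a poly fract \<Rightarrow> 'a poly fract alg_closure set set" where
  "places_over t = {V. \<exists>res. rational_place kconst L V res \<and> to_ac t \<in> V \<and> res (to_ac t) = 0}"

lemma places_over_card:
  assumes trans: "\<And>p. pev ratconst p t = 0 \<Longrightarrow> p = 0"
    and gen: "\<And>z. \<exists>p p'. p' \<noteq> 0 \<and> z = pev ratconst p t / pev ratconst p' t"
    and U: "\<And>j. j \<in> J \<Longrightarrow> poly (U j) 0 \<noteq> 0"
    and F: "\<And>j. j \<in> J \<Longrightarrow> Fraction_Field.Fract (F j) 1 = t powi a j * pev ratconst (U j) t"
  shows "finite (places_over t)" "card (places_over t) = local_points J r a (\<lambda>j. poly (U j) 0)"
proof -
  let ?s = "vector_order J r a"
  note s = vector_order[of J r "CARD('a) - 1", OF r_dvd q1, where a = a]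
  obtain kk e0 e where kk: "\<And>j. j \<in> J \<Longrightarrow> int ?s * a j = kk j * int (r j)"
    "e0 * int ?s + (\<Sum>j\<in>J. e j * kk j) = 1"
    by (rule vector_order_bezout[where r = r and a = a, OF finite_J r_dvd q1]) (assumption, rule that)
  interpret kp: kummer_place to_ac ratconst t J r a U y L ?s kk e0 e
  proof (unfold_locales, goal_cases)
    case (6 j) then show ?case using y_power F by simp
  next
    case (10 x) then show ?case using L_span unfolding B_def mono_def by blast
  next
    case (11 c b) then show ?case using indep unfolding B_def mono_def by blast
  qed (use finite_J trans gen r_dvd U L base_L y_L s kk in auto)
  have k: "kp.k = kconst" by (simp add: fun_eq_iff kp.k_def)
  have "places_over t = {V. \<exists>res. kp.over_t V res}"
    by (simp add: places_over_def kp.over_t_def k)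
  then show "finite (places_over t)" "card (places_over t) = local_points J r a (\<lambda>j. poly (U j) 0)"
    using kp.finite_places_over_t kp.card_places by (simp_all add: local_points_def)
qed

lemma constants_eq: "constants = range kconst"
  by (simp add: constants_def poly_to_closure_def ratconst_def)

lemma fhom_kconst: "fhom kconst"
  by (rule fhom_compose[of ratconst to_ac]) (rule fhom_ratconst fhom_to_ac)+

lemma rational_place_of_rational_point:
  assumes "V \<in> rational_points L"
  obtains res where "rational_place kconst L V res"
proof (rule rational_place_of_valuation_ring[OF fhom_kconst L, of V])
  have sub: "subring V ring_of_type_algebra" and V: "constants \<subset> V" "V \<subset> L"
    "\<And>z. z \<in> L \<Longrightarrow> z \<in> V \<or> inverse z \<in> V" "\<And>z. z \<in> V \<Longrightarrow> \<exists>c\<in>constants. z - c \<in> valuation_ideal V"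
    using assms by (auto simp: rational_points_def curve_points_def)
  show "V \<subseteq> L" "range kconst \<subseteq> V" using V by (auto simp: constants_eq)
  show "x + y \<in> V" if "x \<in> V" "y \<in> V" for x y
    using subringE(7)[OF sub that] by (simp add: ring_of_type_algebra_def)
  show "x * y \<in> V" if "x \<in> V" "y \<in> V" for x y
    using subringE(6)[OF sub that] by (simp add: ring_of_type_algebra_def)
  show "z \<in> V \<or> inverse z \<in> V" if "z \<in> L" for z using V(3) that by blast
  show "\<exists>c. z - kconst c \<in> valuation_ideal V" if "z \<in> V" for z using V(4)[OF that] by (auto simp: constants_eq)
qed (use that in blast)

text \<open>The strict inclusions in the definition of a point come from \<open>t\<close>: its
  residue 0 makes it nonconstant, and its inverse lies outside \<open>V\<close>.\<close>

lemma rational_point_of_place: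
  assumes V: "V \<in> places_over t" and t: "t \<noteq> 0"
  shows "V \<in> rational_points L"
proof -
  obtain res where res: "rational_place kconst L V res" "to_ac t \<in> V" "res (to_ac t) = 0"
    using V by (auto simp: places_over_def)
  interpret rational_place kconst L V res by (rule res)
  let ?R = "ring_of_type_algebra :: 'a poly fract alg_closure ring"
  interpret R: Ring.field ?R by (rule field_from_type_algebra)
  have "subring V ?R"
  proof (rule R.subringI)
    show "V \<subseteq> carrier ?R" by (simp add: ring_of_type_algebra_def)
    show "\<one>\<^bsub>?R\<^esub> \<in> V" using one_V by (simp add: ring_of_type_algebra_def)
    show "\<ominus>\<^bsub>?R\<^esub> h \<in> V" if "h \<in> V" for h using uminus_V[OF that] by (simp add: ring_of_type_algebra_inv)
    show "x \<otimes>\<^bsub>?R\<^esub> z \<in> V" "x \<oplus>\<^bsub>?R\<^esub> z \<in> V" if "x \<in> V" "z \<in> V" for x z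
      using mult_V[OF that] add_V[OF that] by (simp_all add: ring_of_type_algebra_def)
  qed
  moreover have "to_ac t \<notin> constants"
  proof
    assume "to_ac t \<in> constants"
    then obtain c where c: "to_ac t = kconst c" by (auto simp: constants_eq)
    then have "c = 0" using res(3) res_const by metis
    then show False using c t by (simp add: ratconst.hom_zero)
  qed
  then have "constants \<subset> V" using const_V res(2) by (auto simp: constants_eq)
  moreover have "inverse (to_ac t) \<notin> V" using inverse_notin_V[OF res(2,3)] t by simp
  then have "V \<subset> L" using V_subset field_closedD(6)[OF L base_L[of t]] by blast
  moreover have "z \<in> V \<or> inverse z \<in> V" if "z \<in> L" for z using inverse_outside[OF that] by blast
  moreover have "\<exists>c\<in>constants. z - c \<in> valuation_ideal V" if z: "z \<in> V" for z
  proof (intro bexI)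
    let ?x = "z - kconst (res z)"
    have "?x \<in> V" "res ?x = 0" using z const_V res_const by (auto simp: diff_V res_diff)
    then show "?x \<in> valuation_ideal V" using inverse_notin_V[of ?x] unfolding valuation_ideal_def by blast
  qed (simp add: constants_eq)
  ultimately show ?thesis by (simp add: rational_points_def curve_points_def)
qed

text \<open>Either \<open>X\<close> lies in the valuation ring and its residue \<open>x\<close>
  names the affine point below, or \<open>1 / X\<close> lies in it with residue 0.\<close>

lemma rational_points_eq:
  "rational_points L = (\<Union>x. places_over (ratX - ratconst x)) \<union> places_over (inverse ratX)"
proof (intro equalityI subsetI)
  fix V assume "V \<in> rational_points L"
  then obtain res where "rational_place kconst L V res" by (rule rational_place_of_rational_point)
  then interpret rational_place kconst L V res .
  show "V \<in> (\<Union>x. places_over (ratX - ratconst x)) \<union> places_over (inverse ratX)"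
  proof (cases "to_ac ratX \<in> V")
    case True
    define x where "x = res (to_ac ratX)"
    have "to_ac (ratX - ratconst x) \<in> V" "res (to_ac (ratX - ratconst x)) = 0"
      using True const_V res_const by (auto simp: diff_V res_diff x_def)
    then have "V \<in> places_over (ratX - ratconst x)"
      using rational_place_axioms unfolding places_over_def by blast
    then show ?thesis by blast
  next
    case False
    have "to_ac (inverse ratX) \<in> V" "res (to_ac (inverse ratX)) = 0"
      using inverse_outside[OF base_L False] res_inverse_outside[OF base_L False] by simp_all
    then show ?thesis using rational_place_axioms unfolding places_over_def by blast
  qed
next
  fix V assume "V \<in> (\<Union>x. places_over (ratX - ratconst x)) \<union> places_over (inverse ratX)"
  moreover have "ratX - ratconst x \<noteq> 0" for x using transcendental_finite[of "[:0, 1:]" x]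
    by (auto simp: ratconst.hom_simps)
  moreover have "inverse ratX \<noteq> 0" using ratX_nz by simp
  ultimately show "V \<in> rational_points L" using rational_point_of_place by blast
qed

lemma places_over_disjoint:
  assumes "V \<in> places_over (ratX - ratconst x)"
  shows "V \<in> places_over (ratX - ratconst x') \<Longrightarrow> x = x'" "V \<notin> places_over (inverse ratX)"
proof -
  obtain res where res: "rational_place kconst L V res" "to_ac (ratX - ratconst x) \<in> V"
    "res (to_ac (ratX - ratconst x)) = 0" using assms by (auto simp: places_over_def)
  interpret rational_place kconst L V res by (rule res)
  have X: "to_ac ratX \<in> V" "res (to_ac ratX) = x"
  proof -
    have "to_ac ratX = to_ac (ratX - ratconst x) + kconst x" by simp
    then show "to_ac ratX \<in> V" "res (to_ac ratX) = x"
      using add_V[OF res(2) const_V[of x]] res_add[OF res(2) const_V[of x]] res(3) res_const[of x] by (simp_all only: add_0_left)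
  qed
  show "x = x'" if V': "V \<in> places_over (ratX - ratconst x')"
  proof -
    obtain res' where res': "rational_place kconst L V res'" "to_ac (ratX - ratconst x') \<in> V"
      "res' (to_ac (ratX - ratconst x')) = 0" using V' by (auto simp: places_over_def)
    then have "res (to_ac (ratX - ratconst x')) = 0" using res_unique by metis
    then have "x - x' = 0" using X const_V res_const by (simp add: res_diff)
    then show ?thesis by simp
  qed
  show "V \<notin> places_over (inverse ratX)"
  proof
    assume "V \<in> places_over (inverse ratX)"
    then obtain res' where res': "rational_place kconst L V res'" "to_ac (inverse ratX) \<in> V"
      "res' (to_ac (inverse ratX)) = 0" by (auto simp: places_over_def)
    then have "res (to_ac (inverse ratX)) = 0" using res_unique by metis
    moreover have "to_ac (inverse ratX) * to_ac ratX = (1 :: 'a poly fract alg_closure)" using ratX_nz[where 'a='a] by simp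
    ultimately show False using res_mult[OF res'(2) X(1)] res_one by simp
  qed
qed

text \<open>The local parameters are \<open>X - x\<close> and \<open>1 / X\<close>. At infinity the
  unit part of a radicand is its reflected polynomial, whose value at 0 is the leading coefficient,
  and the order is minus the degree.\<close>

theorem card_rational_points:
  assumes V: "\<And>x j. j \<in> J \<Longrightarrow> F j = [:- x, 1:] ^ A x j * V x j" "\<And>x j. j \<in> J \<Longrightarrow> poly (V x j) x \<noteq> 0"
  shows "card (rational_points L) =
    (\<Sum>x\<in>UNIV. local_points J r (\<lambda>j. int (A x j)) (\<lambda>j. poly (V x j) x)) +
    local_points J r (\<lambda>j. - int (Polynomial.degree (F j))) (\<lambda>j. Polynomial.lead_coeff (F j))"
proof -
  have 1: "finite (places_over (ratX - ratconst x)) \<and> card (places_over (ratX - ratconst x)) =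
      local_points J r (\<lambda>j. int (A x j)) (\<lambda>j. poly (V x j) x)" for x
  proof -
    have U: "poly (pcompose (V x j) [:x, 1:]) 0 = poly (V x j) x" for j by (simp add: poly_pcompose)
    have F: "Fraction_Field.Fract (F j) 1 =
        (ratX - ratconst x) powi int (A x j) * pev ratconst (pcompose (V x j) [:x, 1:]) (ratX - ratconst x)"
      if j: "j \<in> J" for j
    proof -
      have "pev ratconst [:- x, 1:] ratX = ratX - ratconst x" by (simp add: ratconst.hom_simps)
      moreover have "pev ratconst [:x, 1:] (ratX - ratconst x) = ratX" by (simp add: ratconst.hom_simps)
      ultimately show ?thesis
        unfolding pev_ratX[symmetric] by (subst V(1)[OF j, of x])
          (simp only: ratconst.pev_mult ratconst.pev_power ratconst.pev_pcompose power_int_of_nat)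
    qed
    have nz: "poly (pcompose (V x j) [:x, 1:]) 0 \<noteq> 0" if "j \<in> J" for j using V(2)[OF that] unfolding U .
    show ?thesis
      using places_over_card[where U = "\<lambda>j. pcompose (V x j) [:x, 1:]" and a = "\<lambda>j. int (A x j)",
        OF transcendental_finite[where x = x] generated_finite[where x = x] nz F] unfolding U by blast
  qed
  have 2: "finite (places_over (inverse ratX)) \<and> card (places_over (inverse ratX)) =
      local_points J r (\<lambda>j. - int (Polynomial.degree (F j))) (\<lambda>j. Polynomial.lead_coeff (F j))"
  proof -
    have U: "poly (reflect_poly (F j)) 0 = Polynomial.lead_coeff (F j)" for j by simp
    have nz: "poly (reflect_poly (F j)) 0 \<noteq> 0" if "j \<in> J" for j using F_nz[OF that] by simp
    have F: "Fraction_Field.Fract (F j) 1 =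
        (inverse ratX) powi (- int (Polynomial.degree (F j))) * pev ratconst (reflect_poly (F j)) (inverse ratX)"
      if j: "j \<in> J" for j
    proof -
      have "pev ratconst (reflect_poly (F j)) (inverse ratX) = inverse ratX ^ Polynomial.degree (F j) * pev ratconst (F j) ratX"
        using pev_reflect[of "inverse ratX" ratconst "F j"] ratX_nz fhom_ratconst by simp
      then show ?thesis using ratX_nz[where 'a='a]
        by (simp add: pev_ratX power_int_minus power_int_of_nat mult.assoc[symmetric] power_inverse)
    qed
    show ?thesis
      using places_over_card[where U = "\<lambda>j. reflect_poly (F j)" and a = "\<lambda>j. - int (Polynomial.degree (F j))",
        OF transcendental_infinite generated_infinite nz F] unfolding U by blast
  qed
  have "card (rational_points L) = card (\<Union>x. places_over (ratX - ratconst x)) + card (places_over (inverse ratX))"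
    unfolding rational_points_eq
    by (rule card_Un_disjoint) (use 1 2 places_over_disjoint in auto)
  also have "card (\<Union>x. places_over (ratX - ratconst x)) = (\<Sum>x\<in>UNIV. card (places_over (ratX - ratconst x)))"
    by (rule card_UN_disjoint) (use 1 places_over_disjoint in auto)
  finally show ?thesis using 1 2 by simp
qed

end

section \<open>From coprime squarefree tuples to point counts\<close>

lemma prime_factor_exists:
  fixes f :: "'a::field poly"
  assumes "Polynomial.degree f > 0"
  obtains p where "prime_elem p" "p dvd f" "Polynomial.degree p > 0"
proof -
  \<comment> \<open>A divisor of least positive degree is irreducible.\<close>
  define P where "P d \<longleftrightarrow> (\<exists>p. p dvd f \<and> Polynomial.degree p = d \<and> d > 0)" for d
  have "P (Polynomial.degree f)" using assms by (auto simp: P_def intro!: exI[of _ f])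
  then have "P (LEAST d. P d)" by (rule LeastI)
  then obtain p where p: "p dvd f" "Polynomial.degree p = (LEAST d. P d)" "Polynomial.degree p > 0"
    by (auto simp: P_def)
  have "f \<noteq> 0" using assms by auto
  have "Factorial_Ring.irreducible p"
  proof (rule Factorial_Ring.irreducibleI)
    show "p \<noteq> 0" using p by auto
    show "\<not> is_unit p" using p(3) by (metis is_unit_iff_degree less_numeral_extra(3) Polynomial.degree_0)
    fix a b assume ab: "p = a * b"
    show "is_unit a \<or> is_unit b"
    proof (rule ccontr)
      assume "\<not> (is_unit a \<or> is_unit b)"
      moreover have nz: "a \<noteq> 0" "b \<noteq> 0" using ab p by auto
      ultimately have "Polynomial.degree a > 0" "Polynomial.degree b > 0"
        by (auto simp: is_unit_iff_degree)
      moreover have "Polynomial.degree p = Polynomial.degree a + Polynomial.degree b"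
        unfolding ab using nz by (rule Polynomial.degree_mult_eq)
      moreover have "a dvd f" using p(1) ab by (meson dvd_mult_left)
      ultimately have "P (Polynomial.degree a)" "Polynomial.degree a < (LEAST d. P d)"
        using p(2) by (auto simp: P_def)
      then show False using not_less_Least by blast
    qed
  qed
  then show ?thesis using that field_poly_irreducible_imp_prime p by blast
qed

lemma exact_power_0: "\<not> p dvd x \<Longrightarrow> exact_power p 0 x"
  by (simp add: exact_power_def)

lemma exact_power_1_of_squarefree:
  assumes "prime_elem p" "p dvd f" "squarefree f"
  shows "exact_power p 1 f"
proof -
  obtain g where g: "f = p * g" using assms by auto
  have "\<not> p dvd g"
  proof
    assume "p dvd g"
    then have "p ^ 2 dvd f" unfolding g by (auto simp: power2_eq_square)
    then have "p dvd 1" using assms(3) squarefreeD by blast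
    then show False using assms(1) by (simp add: prime_elem_def)
  qed
  then show ?thesis using g by (auto simp: exact_power_def)
qed

lemma finite_index_vectors: "finite (index_vectors n r)"
  unfolding index_vectors_def by (intro finite_Diff finite_PiE) auto

definition unit_vector :: "nat \<Rightarrow> nat \<Rightarrow> nat \<Rightarrow> nat" where
  "unit_vector n i = (\<lambda>j\<in>{1..n}. if j = i then 1 else 0)"

lemma unit_vector_in_index_vectors:
  assumes "i \<in> {1..n}" "r i \<ge> 2" "\<And>j. j \<in> {1..n} \<Longrightarrow> r j > 0"
  shows "unit_vector n i \<in> index_vectors n r"
proof -
  have "unit_vector n i i \<noteq> (\<lambda>j\<in>{1..n}. 0) i" using assms by (simp add: unit_vector_def)
  then have "unit_vector n i \<noteq> (\<lambda>j\<in>{1..n}. 0)" by metis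
  moreover have "unit_vector n i \<in> (\<Pi>\<^sub>E j\<in>{1..n}. {0..<r j})"
    using assms by (auto simp: unit_vector_def)
  ultimately show ?thesis by (simp add: index_vectors_def)
qed

text \<open>The number of points above a finite rational place at which \<open>f\<^sub>\<alpha>\<close> takes the value \<open>v \<alpha>\<close>.\<close>

definition value_points :: "nat \<Rightarrow> (nat \<Rightarrow> nat) \<Rightarrow> (nat \<Rightarrow> 'a::field) \<Rightarrow> ((nat \<Rightarrow> nat) \<Rightarrow> 'a) \<Rightarrow> nat" where
  "value_points n r c v = local_points {1..n} r
     (\<lambda>j. \<Sum>\<alpha>\<in>{\<alpha>\<in>index_vectors n r. v \<alpha> = 0}. int (\<alpha> j))
     (\<lambda>j. c j * (\<Prod>\<alpha>\<in>{\<alpha>\<in>index_vectors n r. v \<alpha> \<noteq> 0}. v \<alpha> ^ \<alpha> j))"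

lemma coprime_tuples_zero_unique:
  assumes f: "f \<in> coprime_tuples n r e" and ab: "\<alpha> \<in> index_vectors n r" "\<beta> \<in> index_vectors n r"
    "poly (f \<alpha>) x = 0" "poly (f \<beta>) x = 0"
  shows "\<alpha> = \<beta>"
proof (rule ccontr)
  assume "\<alpha> \<noteq> \<beta>"
  then have "coprime (f \<alpha>) (f \<beta>)" using f ab by (auto simp: coprime_tuples_def pairwise_def)
  moreover have "[:- x, 1:] dvd f \<alpha>" "[:- x, 1:] dvd f \<beta>" using ab by (simp_all add: poly_eq_0_iff_dvd)
  ultimately have "is_unit [:- x, 1:]" by (rule coprime_common_divisor)
  then show False by (simp add: is_unit_iff_degree)
qed

text \<open>\<open>e \<alpha> \<ge> 1\<close> makes the polynomial at each unit vector nonconstant,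
  and a prime factor of it divides only one radicand, exactly once. At a given point at most one
  \<open>f \<beta>\<close> vanishes; the unknown value of its cofactor enters as a factor
  \<open>g ^ \<beta> j\<close> and is removed by \<open>local_points_rescale\<close>, so the values
  of the \<open>f \<alpha>\<close> suffice.\<close>

theorem function_field_points:
  fixes f :: "(nat \<Rightarrow> nat) \<Rightarrow> 'a::{field,finite} poly"
  assumes r: "\<And>j. j \<in> {1..n} \<Longrightarrow> r j dvd CARD('a) - 1"
    and c: "\<And>j. j \<in> {1..n} \<Longrightarrow> c j \<noteq> 0"
    and f: "f \<in> coprime_tuples n r e" and e: "\<And>\<alpha>. \<alpha> \<in> index_vectors n r \<Longrightarrow> e \<alpha> \<ge> 1"
  shows "card (rational_points (function_field n r (c, f))) =
    (\<Sum>x\<in>UNIV. value_points n r c (\<lambda>\<alpha>. poly (f \<alpha>) x)) +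
    local_points {1..n} r (\<lambda>j. - (\<Sum>\<alpha>\<in>index_vectors n r. int (\<alpha> j) * e \<alpha>)) c"
proof -
  let ?R = "index_vectors n r" and ?J = "{1..n}"
  have fin: "finite ?R" by (rule finite_index_vectors)
  have fa: "Polynomial.lead_coeff (f \<alpha>) = 1" "squarefree (f \<alpha>)" "int (Polynomial.degree (f \<alpha>)) = e \<alpha>" "f \<alpha> \<noteq> 0"
    if "\<alpha> \<in> ?R" for \<alpha>
  proof -
    have "f \<alpha> \<in> monic_squarefree (e \<alpha>)" using f that by (auto simp: coprime_tuples_def)
    then show "Polynomial.lead_coeff (f \<alpha>) = 1" "squarefree (f \<alpha>)" "int (Polynomial.degree (f \<alpha>)) = e \<alpha>" "f \<alpha> \<noteq> 0"
      by (auto simp: monic_squarefree_def)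
  qed
  define F where "F = radicand n r (c, f)"
  have F: "F j = Polynomial.smult (c j) (\<Prod>\<alpha>\<in>?R. f \<alpha> ^ \<alpha> j)" for j by (simp add: F_def radicand_def)
  have r_pos: "r j > 0" if "j \<in> ?J" for j
    using r[OF that] card_field_ge2[where 'a='a] by (auto intro: Nat.gr0I)
  define y where "y j = closure_root (r j) (poly_to_closure (F j))" for j
  have y: "y j ^ r j = to_ac (Fraction_Field.Fract (F j) 1)" if "j \<in> ?J" for j
  proof -
    have "\<exists>z. z ^ r j = poly_to_closure (F j)" using nth_root_exists[OF r_pos[OF that]] .
    then have "y j ^ r j = poly_to_closure (F j)" unfolding y_def closure_root_def by (rule someI_ex)
    then show ?thesis by (simp add: poly_to_closure_def)
  qed
  have ram: "\<exists>p. prime_elem p \<and> (\<forall>j\<in>?J. exact_power p (if j = i then 1 else 0) (F j))"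
    if i: "i \<in> ?J" "r i \<ge> 2" for i
  proof -
    let ?a = "unit_vector n i"
    have a: "?a \<in> ?R" using unit_vector_in_index_vectors i r_pos by blast
    have "Polynomial.degree (f ?a) > 0" using fa(3)[OF a] e[OF a] by linarith
    then obtain p where p: "prime_elem p" "p dvd f ?a" by (rule prime_factor_exists)
    have ex: "exact_power p (if \<alpha> = ?a then 1 else 0) (f \<alpha>)" if \<alpha>: "\<alpha> \<in> ?R" for \<alpha>
    proof (cases "\<alpha> = ?a")
      case True
      then show ?thesis using exact_power_1_of_squarefree[OF p fa(2)[OF a]] by simp
    next
      case False
      then have "coprime (f \<alpha>) (f ?a)" using f \<alpha> a by (auto simp: coprime_tuples_def pairwise_def)
      then have "\<not> p dvd f \<alpha>" using p by (meson coprime_common_divisor prime_elem_def)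
      then show ?thesis using False by (simp add: exact_power_0)
    qed
    have "exact_power p (if j = i then 1 else 0) (F j)" if j: "j \<in> ?J" for j
    proof -
      have "\<not> p dvd [:c j:]"
      proof
        assume "p dvd [:c j:]"
        moreover have "[:c j:] dvd 1" using c[OF j] by (simp add: is_unit_const_poly_iff dvd_field_iff)
        ultimately have "p dvd 1" by (rule dvd_trans)
        then show False using p by (simp add: prime_elem_def)
      qed
      then have "exact_power p (0 + (\<Sum>\<alpha>\<in>?R. (if \<alpha> = ?a then 1 else 0) * \<alpha> j)) ([:c j:] * (\<Prod>\<alpha>\<in>?R. f \<alpha> ^ \<alpha> j))"
        by (intro exact_power_mult exact_power_0 exact_power_prod exact_power_power p(1) ex)
      moreover have "(\<Sum>\<alpha>\<in>?R. (if \<alpha> = ?a then 1 else 0) * \<alpha> j) = (\<Sum>\<alpha>\<in>?R. if \<alpha> = ?a then \<alpha> j else 0)"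
        by (intro sum.cong) auto
      moreover have "\<dots> = ?a j" using a fin by simp
      moreover have "?a j = (if j = i then 1 else 0)" using j by (simp add: unit_vector_def)
      ultimately show ?thesis by (simp add: F)
    qed
    then show ?thesis using p(1) by blast
  qed
  have Fnz: "F j \<noteq> 0" if "j \<in> ?J" for j using c[OF that] fa(4) fin by (simp add: F)
  interpret K: kummer_extension ?J r F y
    by unfold_locales (use r Fnz y ram in auto)
  have L: "function_field n r (c, f) = K.L"
    unfolding function_field_def K.L_def unfolding y_def[abs_def] F_def ..
  have g_ex: "\<exists>g. f \<alpha> = [:- x, 1:] ^ (if poly (f \<alpha>) x = 0 then 1 else 0) * g \<and> poly g x \<noteq> 0" if "\<alpha> \<in> ?R" for x \<alpha>
  proof (cases "poly (f \<alpha>) x = 0")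
    case True
    then obtain g where g: "f \<alpha> = [:- x, 1:] * g" by (auto simp: poly_eq_0_iff_dvd)
    have "poly g x \<noteq> 0"
    proof
      assume "poly g x = 0"
      then have "[:- x, 1:] dvd g" by (simp add: poly_eq_0_iff_dvd)
      then have "[:- x, 1:] ^ 2 dvd f \<alpha>" unfolding g power2_eq_square by (intro mult_dvd_mono dvd_refl)
      then have "is_unit [:- x, 1:]" using fa(2)[OF that] squarefreeD by blast
      then show False by (simp add: is_unit_iff_degree)
    qed
    then show ?thesis unfolding if_P[OF True] power_one_right using g by blast
  next
    case False
    then show ?thesis unfolding if_not_P[OF False] power_0 mult_1 by blast
  qed
  define g where "g x \<alpha> = (SOME g. f \<alpha> = [:- x, 1:] ^ (if poly (f \<alpha>) x = 0 then 1 else 0) * g \<and> poly g x \<noteq> 0)" for x \<alpha>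
  have g: "f \<alpha> = [:- x, 1:] ^ (if poly (f \<alpha>) x = 0 then 1 else 0) * g x \<alpha>" "poly (g x \<alpha>) x \<noteq> 0"
    if "\<alpha> \<in> ?R" for x \<alpha>
    using someI_ex[OF g_ex[OF that, of x]] unfolding g_def by blast+
  define Z where "Z x = {\<alpha>\<in>?R. poly (f \<alpha>) x = 0}" for x
  define A where "A x j = (\<Sum>\<alpha>\<in>Z x. \<alpha> j)" for x and j :: nat
  define V where "V x j = Polynomial.smult (c j) (\<Prod>\<alpha>\<in>?R. g x \<alpha> ^ \<alpha> j)" for x j
  have FV: "F j = [:- x, 1:] ^ A x j * V x j" for x j
  proof -
    have "(\<Prod>\<alpha>\<in>?R. f \<alpha> ^ \<alpha> j) = (\<Prod>\<alpha>\<in>?R. [:- x, 1:] ^ (if poly (f \<alpha>) x = 0 then \<alpha> j else 0) * g x \<alpha> ^ \<alpha> j)"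
    proof (rule prod.cong[OF refl])
      fix \<alpha> assume \<alpha>: "\<alpha> \<in> ?R"
      show "f \<alpha> ^ \<alpha> j = [:- x, 1:] ^ (if poly (f \<alpha>) x = 0 then \<alpha> j else 0) * g x \<alpha> ^ \<alpha> j"
        using arg_cong[OF g(1)[OF \<alpha>, of x], of "\<lambda>p. p ^ \<alpha> j"] by (simp add: power_mult_distrib split: if_splits)
    qed
    also have "\<dots> = [:- x, 1:] ^ (\<Sum>\<alpha>\<in>?R. if poly (f \<alpha>) x = 0 then \<alpha> j else 0) * (\<Prod>\<alpha>\<in>?R. g x \<alpha> ^ \<alpha> j)"
      by (simp add: prod.distrib power_sum)
    also have "(\<Sum>\<alpha>\<in>?R. if poly (f \<alpha>) x = 0 then \<alpha> j else 0) = A x j"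
      unfolding A_def Z_def using fin by (simp add: sum.inter_filter)
    finally show ?thesis by (simp add: F V_def)
  qed
  have V0: "poly (V x j) x \<noteq> 0" if "j \<in> ?J" for x j
    using c[OF that] g(2) fin by (simp add: V_def poly_prod)
  have pts: "local_points ?J r (\<lambda>j. int (A x j)) (\<lambda>j. poly (V x j) x) = value_points n r c (\<lambda>\<alpha>. poly (f \<alpha>) x)" for x
  proof -
    let ?N = "{\<alpha>\<in>?R. poly (f \<alpha>) x \<noteq> 0}"
    have Vx: "poly (V x j) x = (\<Prod>\<alpha>\<in>Z x. poly (g x \<alpha>) x ^ \<alpha> j) * (c j * (\<Prod>\<alpha>\<in>?N. poly (f \<alpha>) x ^ \<alpha> j))" for j
    proof -
      have U: "?R = Z x \<union> ?N" and dis: "Z x \<inter> ?N = {}" by (auto simp: Z_def)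
      have fin': "finite (Z x)" "finite ?N" using fin by (simp_all add: Z_def)
      have "(\<Prod>\<alpha>\<in>?R. poly (g x \<alpha>) x ^ \<alpha> j) = (\<Prod>\<alpha>\<in>Z x \<union> ?N. poly (g x \<alpha>) x ^ \<alpha> j)"
        by (rule arg_cong[OF U, where f = "prod (\<lambda>\<alpha>. poly (g x \<alpha>) x ^ \<alpha> j)"])
      also have "\<dots> = (\<Prod>\<alpha>\<in>Z x. poly (g x \<alpha>) x ^ \<alpha> j) * (\<Prod>\<alpha>\<in>?N. poly (g x \<alpha>) x ^ \<alpha> j)"
        by (rule prod.union_disjoint[OF fin' dis])
      also have "(\<Prod>\<alpha>\<in>?N. poly (g x \<alpha>) x ^ \<alpha> j) = (\<Prod>\<alpha>\<in>?N. poly (f \<alpha>) x ^ \<alpha> j)"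
      proof (rule prod.cong[OF refl])
        fix \<alpha> assume \<alpha>: "\<alpha> \<in> ?N"
        then have \<alpha>R: "\<alpha> \<in> ?R" and nz: "poly (f \<alpha>) x \<noteq> 0" by auto
        have "f \<alpha> = g x \<alpha>" using g(1)[OF \<alpha>R, of x] unfolding if_not_P[OF nz] power_0 mult_1 .
        then show "poly (g x \<alpha>) x ^ \<alpha> j = poly (f \<alpha>) x ^ \<alpha> j" by simp
      qed
      finally show ?thesis by (simp add: V_def poly_prod)
    qed
    have A: "int (A x j) = (\<Sum>\<alpha>\<in>Z x. int (\<alpha> j))" for j by (simp add: A_def)
    show ?thesis
    proof (cases "Z x = {}")
      case True
      then show ?thesis unfolding value_points_def Vx A Z_def[symmetric] by simp
    next
      case False
      then obtain \<beta> where b: "\<beta> \<in> Z x" by auto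
      then have Zb: "Z x = {\<beta>}" using coprime_tuples_zero_unique[OF f] by (auto simp: Z_def)
      have gb: "poly (g x \<beta>) x \<noteq> 0" using b g(2) by (simp add: Z_def)
      show ?thesis
        unfolding value_points_def Vx A Z_def[symmetric]
        unfolding Zb using local_points_rescale[OF gb, of ?J r "\<lambda>j. int (\<beta> j)"]
        by simp
    qed
  qed
  have deg: "int (Polynomial.degree (F j)) = (\<Sum>\<alpha>\<in>?R. int (\<alpha> j) * e \<alpha>)" if j: "j \<in> ?J" for j
  proof -
    have "Polynomial.degree (F j) = (\<Sum>\<alpha>\<in>?R. Polynomial.degree (f \<alpha> ^ \<alpha> j))"
      using c[OF j] fa(4) by (simp add: F degree_prod_eq_sum_degree)
    also have "\<dots> = (\<Sum>\<alpha>\<in>?R. \<alpha> j * Polynomial.degree (f \<alpha>))"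
      using fa(4) by (intro sum.cong) (auto simp: degree_power_eq)
    also have "int \<dots> = (\<Sum>\<alpha>\<in>?R. int (\<alpha> j) * e \<alpha>)" using fa(3) by simp
    finally show ?thesis .
  qed
  have lead: "Polynomial.lead_coeff (F j) = c j" for j
    using fa(1) by (simp add: F lead_coeff_prod lead_coeff_power)
  have "card (rational_points K.L) = (\<Sum>x\<in>UNIV. local_points ?J r (\<lambda>j. int (A x j)) (\<lambda>j. poly (V x j) x)) +
    local_points ?J r (\<lambda>j. - int (Polynomial.degree (F j))) (\<lambda>j. Polynomial.lead_coeff (F j))"
    by (rule K.card_rational_points) (use FV V0 in auto)
  also have "local_points ?J r (\<lambda>j. - int (Polynomial.degree (F j))) (\<lambda>j. Polynomial.lead_coeff (F j)) =
      local_points ?J r (\<lambda>j. - (\<Sum>\<alpha>\<in>?R. int (\<alpha> j) * e \<alpha>)) c"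
    unfolding lead by (rule local_points_mod) (simp add: deg)
  finally show ?thesis unfolding L pts .
qed

subsection \<open>Counting polynomials with prescribed residues\<close>

text \<open>The remainders modulo a polynomial of degree \<open>n\<close>. The condition on
  coefficients admits 0 also for \<open>n = 0\<close>, where a strict bound on the degree would
  exclude it.\<close>

definition res_polys :: "nat \<Rightarrow> 'a::zero poly set" where
  "res_polys n = {g. \<forall>i\<ge>n. Polynomial.coeff g i = 0}"

definition monics :: "nat \<Rightarrow> 'a::{zero,one} poly set" where
  "monics d = {f. Polynomial.lead_coeff f = 1 \<and> Polynomial.degree f = d}"

lemma card_res_polys:
  "finite (res_polys n :: 'a::{field,finite} poly set)" "card (res_polys n :: 'a poly set) = CARD('a) ^ n"
proof -
  let ?f = "\<lambda>a. \<Sum>i<n. Polynomial.monom (a i :: 'a) i"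
  have co: "Polynomial.coeff (?f a) i = (if i < n then a i else 0)" for a i
    by (simp add: Polynomial.coeff_sum Polynomial.coeff_monom)
  have "bij_betw ?f (\<Pi>\<^sub>E i\<in>{..<n}. UNIV) (res_polys n)"
  proof (rule bij_betwI[where g = "\<lambda>g. restrict (Polynomial.coeff g) {..<n}"])
    show "?f \<in> (\<Pi>\<^sub>E i\<in>{..<n}. UNIV) \<rightarrow> res_polys n" by (auto simp: res_polys_def co)
    show "restrict (Polynomial.coeff (?f a)) {..<n} = a" if "a \<in> (\<Pi>\<^sub>E i\<in>{..<n}. UNIV)" for a
      using that by (auto simp: co fun_eq_iff PiE_iff extensional_def)
    show "?f (restrict (Polynomial.coeff g) {..<n}) = g" if "g \<in> res_polys n" for g
      by (rule poly_eqI) (use that in \<open>auto simp: co res_polys_def\<close>)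
  qed auto
  then have "card (res_polys n :: 'a poly set) = card (\<Pi>\<^sub>E i\<in>{..<n}. UNIV :: 'a set)"
    and "finite (res_polys n :: 'a poly set)"
    by (auto simp: bij_betw_finite[symmetric] finite_PiE dest: bij_betw_same_card)
  then show "finite (res_polys n :: 'a poly set)" "card (res_polys n :: 'a poly set) = CARD('a) ^ n"
    by (simp_all add: card_PiE)
qed

lemma monics_iff: "f \<in> monics d \<longleftrightarrow> f - Polynomial.monom 1 d \<in> res_polys d" for f :: "'a::field poly"
proof
  assume "f \<in> monics d"
  then show "f - Polynomial.monom 1 d \<in> res_polys d"
    by (auto simp: monics_def res_polys_def Polynomial.coeff_monom coeff_eq_0)
next
  assume f: "f - Polynomial.monom 1 d \<in> res_polys d"
  have co: "Polynomial.coeff f i = (if i = d then 1 else 0)" if "i \<ge> d" for i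
    using f that by (auto simp: res_polys_def Polynomial.coeff_monom split: if_splits)
  have "Polynomial.degree f = d"
  proof (rule antisym)
    show "Polynomial.degree f \<le> d" by (rule degree_le) (auto simp: co)
    show "d \<le> Polynomial.degree f" by (rule le_degree) (simp add: co)
  qed
  then show "f \<in> monics d" using co[of d] by (simp add: monics_def)
qed

lemma card_monics:
  "finite (monics d :: 'a::{field,finite} poly set)" "card (monics d :: 'a poly set) = CARD('a) ^ d"
proof -
  have "bij_betw (\<lambda>g. g + Polynomial.monom 1 d) (res_polys d :: 'a poly set) (monics d)"
    by (rule bij_betwI[where g = "\<lambda>f. f - Polynomial.monom 1 d"]) (auto simp: monics_iff)
  then show "finite (monics d :: 'a poly set)" "card (monics d :: 'a poly set) = CARD('a) ^ d"
    using bij_betw_same_card[of _ "res_polys d :: 'a poly set" "monics d"] bij_betw_finite card_res_polys by metis+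
qed

lemma res_polys_iff_degree: "g \<in> res_polys n \<longleftrightarrow> g = 0 \<or> Polynomial.degree g < n"
proof
  assume g: "g \<in> res_polys n"
  show "g = 0 \<or> Polynomial.degree g < n"
  proof (rule ccontr)
    assume "\<not> (g = 0 \<or> Polynomial.degree g < n)"
    then have "g \<noteq> 0" "n \<le> Polynomial.degree g" by auto
    then have "Polynomial.lead_coeff g = 0" using g by (simp add: res_polys_def)
    with \<open>g \<noteq> 0\<close> show False by simp
  qed
next
  assume "g = 0 \<or> Polynomial.degree g < n"
  then show "g \<in> res_polys n" by (auto simp: res_polys_def intro: coeff_eq_0)
qed

lemma mod_in_res_polys: "m \<noteq> 0 \<Longrightarrow> f mod m \<in> res_polys (Polynomial.degree m)" for m :: "'a::field poly"
  using degree_mod_less[of m f] by (auto simp: res_polys_iff_degree)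

lemma res_polys_mod: "g \<in> res_polys (Polynomial.degree m) \<Longrightarrow> g mod m = g" for m :: "'a::field poly"
  by (auto simp: res_polys_iff_degree mod_poly_less)

text \<open>Division with remainder by a monic polynomial; surjectivity follows by comparing
  cardinalities.\<close>

lemma monics_division:
  fixes m :: "'a::{field,finite} poly"
  assumes m: "m \<in> monics M" and "M \<le> d"
  shows "bij_betw (\<lambda>(h, g). m * h + g) (monics (d - M) \<times> res_polys M) (monics d)"
proof -
  let ?f = "\<lambda>(h, g). m * h + g"
  have m0: "m \<noteq> 0" and deg: "Polynomial.degree m = M" and lc: "Polynomial.lead_coeff m = 1" using m by (auto simp: monics_def)
  have inj: "inj_on ?f (monics (d - M) \<times> res_polys M)"
  proof (rule inj_onI, clarify)
    fix h g h' g' :: "'a poly" assume g: "g \<in> res_polys M" "g' \<in> res_polys M" and eq: "m * h + g = m * h' + g'"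
    have "(m * h + g) mod m = (m * h' + g') mod m" by (simp only: eq)
    then have "g = g'" using g by (simp add: res_polys_mod deg)
    then show "h = h' \<and> g = g'" using eq m0 by simp
  qed
  have sub: "?f ` (monics (d - M) \<times> res_polys M) \<subseteq> monics d"
  proof clarify
    fix h g :: "'a poly" assume h: "h \<in> monics (d - M)" and g: "g \<in> res_polys M"
    have hh: "Polynomial.degree h = d - M" "Polynomial.lead_coeff h = 1" using h unfolding monics_def by blast+
    then have h0: "h \<noteq> 0" by (metis Polynomial.coeff_0 zero_neq_one)
    have "Polynomial.degree (m * h) = d"
      using Polynomial.degree_mult_eq[OF m0 h0] hh(1) deg \<open>M \<le> d\<close> by linarith
    moreover have "Polynomial.lead_coeff (m * h) = 1" unfolding lead_coeff_mult lc hh(2) by simp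
    ultimately have "m * h \<in> monics d" unfolding monics_def by blast
    then have "m * h - Polynomial.monom 1 d \<in> res_polys d" by (simp add: monics_iff)
    then show "m * h + g \<in> monics d" using g \<open>M \<le> d\<close>
      by (auto simp: monics_iff res_polys_def)
  qed
  have "?f ` (monics (d - M) \<times> res_polys M) = monics d"
  proof (rule card_seteq[OF card_monics(1) sub])
    have "card (?f ` (monics (d - M) \<times> res_polys M)) = CARD('a) ^ (d - M) * CARD('a) ^ M"
      by (simp add: card_image[OF inj] card_cartesian_product card_monics card_res_polys)
    then show "card (monics d :: 'a poly set) \<le> card (?f ` (monics (d - M) \<times> res_polys M))"
      using \<open>M \<le> d\<close> by (simp add: card_monics flip: power_add)
  qed
  with inj show ?thesis by (simp add: bij_betw_def)
qed

section \<open>Residues modulo squares of primes\<close>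

definition monic_primes :: "'a::field poly set" where
  "monic_primes = {p. prime_elem p \<and> Polynomial.lead_coeff p = 1}"

lemma monic_primesD:
  assumes "p \<in> monic_primes"
  shows "prime_elem p" "Polynomial.lead_coeff p = 1" "p \<noteq> 0" "Polynomial.degree p > 0"
proof -
  show p: "prime_elem p" "Polynomial.lead_coeff p = 1" "p \<noteq> 0" using assms by (auto simp: monic_primes_def)
  show "Polynomial.degree p > 0" using p(1) by (metis gr0I is_unit_iff_degree prime_elem_def)
qed

lemma monic_primes_dvd_eq:
  assumes "p \<in> monic_primes" "l \<in> monic_primes" "p dvd l"
  shows "p = l"
proof -
  note p = monic_primesD[OF assms(1)] and l = monic_primesD[OF assms(2)]
  obtain u where u: "l = p * u" using assms(3) by auto
  then have "l dvd p \<or> l dvd u" using l(1) prime_elem_dvd_multD by (metis dvd_refl)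
  moreover have "\<not> l dvd u"
  proof
    assume "l dvd u"
    then obtain w where "u = l * w" by auto
    then have "l * 1 = l * (p * w)" using u by (simp add: mult.left_commute)
    then have "p dvd 1" using l(3) by (metis dvd_triv_left mult_cancel_left)
    then show False using p(1) by (simp add: prime_elem_def)
  qed
  ultimately have "l dvd p" by blast
  then have "Polynomial.degree l = Polynomial.degree p"
    using assms(3) p(3) l(3) by (metis antisym dvd_imp_degree_le)
  moreover have "u \<noteq> 0" using u l(3) by auto
  ultimately have "Polynomial.degree u = 0" using u p(3) by (simp add: Polynomial.degree_mult_eq)
  then obtain c where c: "u = [:c:]" by (rule degree_eq_zeroE)
  have "Polynomial.lead_coeff l = Polynomial.lead_coeff p * c" unfolding u lead_coeff_mult c by simp
  then have "c = 1" using p(2) l(2) by simp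
  then show ?thesis using u c by simp
qed

lemma prime_elem_dvd_prodE:
  assumes "prime_elem p" "p dvd (\<Prod>a\<in>A. f a)"
  obtains a where "a \<in> A" "p dvd f a"
proof -
  have p1: "\<not> p dvd 1" using assms(1) by (simp add: prime_elem_def)
  have "\<exists>a\<in>A. p dvd f a"
    using assms(2)
  proof (induction A rule: infinite_finite_induct)
    case (insert a A)
    then have "p dvd f a \<or> p dvd (\<Prod>a\<in>A. f a)" using prime_elem_dvd_multD[OF assms(1)] by simp
    then show ?case using insert.IH by blast
  qed (use p1 in simp_all)
  then show ?thesis using that by blast
qed

lemma prime_square_dvd_mult:
  fixes p :: "'a::idom"
  assumes "prime_elem p" "\<not> p dvd a" "p ^ 2 dvd a * b"
  shows "p ^ 2 dvd b"
proof -
  have p0: "p \<noteq> 0" using assms by (simp add: prime_elem_def)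
  have "p dvd a * b" using assms(3) by (metis dvd_mult_left power2_eq_square)
  then have "p dvd b" using assms prime_elem_dvd_multD by blast
  then obtain c where c: "b = p * c" by auto
  have "p * p dvd p * (a * c)" using assms(3) by (simp add: c power2_eq_square mult.left_commute)
  then have "p dvd a * c" using p0 by simp
  then have "p dvd c" using assms prime_elem_dvd_multD by blast
  then show ?thesis by (simp add: c power2_eq_square mult_dvd_mono)
qed

lemma prod_prime_squares_dvd:
  assumes "finite S" "S \<subseteq> monic_primes" "\<And>p. p \<in> S \<Longrightarrow> p ^ 2 dvd f"
  shows "(\<Prod>p\<in>S. p ^ 2) dvd f"
  using assms
proof (induction S)
  case (insert p S)
  then obtain h where h: "f = (\<Prod>p\<in>S. p ^ 2) * h" by (auto elim: dvdE)
  have p: "prime_elem p" using insert.prems monic_primesD by blast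
  have "\<not> p dvd (\<Prod>p\<in>S. p ^ 2)"
  proof
    assume "p dvd (\<Prod>p\<in>S. p ^ 2)"
    then obtain l where "l \<in> S" "p dvd l ^ 2" by (rule prime_elem_dvd_prodE[OF p])
    then have "p dvd l" using p prime_elem_dvd_power by blast
    then have "p = l" using insert.prems \<open>l \<in> S\<close> monic_primes_dvd_eq by blast
    then show False using insert.hyps \<open>l \<in> S\<close> by blast
  qed
  then have "p ^ 2 dvd h" using prime_square_dvd_mult[OF p] insert.prems h by blast
  then show ?case using insert.hyps unfolding h by (simp add: mult.commute mult_dvd_mono)
qed simp

lemma degree_prime_square: "p \<in> monic_primes \<Longrightarrow> Polynomial.degree (p ^ 2) = 2 * Polynomial.degree p"
  by (simp add: degree_power_eq monic_primesD(3))

lemma prod_prime_squares_monic: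
  assumes "finite S" "S \<subseteq> monic_primes"
  shows "(\<Prod>p\<in>S. p ^ 2) \<in> monics (\<Sum>p\<in>S. 2 * Polynomial.degree p)"
proof -
  have "Polynomial.degree (\<Prod>p\<in>S. p ^ 2) = (\<Sum>p\<in>S. Polynomial.degree (p ^ 2))"
    using assms monic_primesD by (intro degree_prod_eq_sum_degree) auto
  also have "\<dots> = (\<Sum>p\<in>S. 2 * Polynomial.degree p)"
    using assms degree_prime_square by (intro sum.cong) auto
  finally have deg: "Polynomial.degree (\<Prod>p\<in>S. p ^ 2) = (\<Sum>p\<in>S. 2 * Polynomial.degree p)" .
  have "Polynomial.lead_coeff (\<Prod>p\<in>S. p ^ 2) = (\<Prod>p\<in>S. Polynomial.lead_coeff p ^ 2)"
    by (simp only: lead_coeff_prod lead_coeff_power)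
  also have "\<dots> = 1"
  proof -
    have "\<forall>p\<in>S. Polynomial.lead_coeff p = 1" using assms monic_primesD(2) by blast
    then show ?thesis by simp
  qed
  finally show ?thesis using deg by (simp add: monics_def)
qed

text \<open>The Chinese remainder theorem, obtained from injectivity by counting both sides.\<close>

lemma residues_bij:
  fixes S :: "'a::{field,finite} poly set"
  assumes S: "finite S" "S \<subseteq> monic_primes"
  shows "bij_betw (\<lambda>g. \<lambda>p\<in>S. g mod p ^ 2) (res_polys (\<Sum>p\<in>S. 2 * Polynomial.degree p))
    (\<Pi>\<^sub>E p\<in>S. res_polys (2 * Polynomial.degree p))"
proof -
  let ?M = "\<Sum>p\<in>S. 2 * Polynomial.degree p" and ?m = "\<Prod>p\<in>S. p ^ 2"
  let ?f = "\<lambda>g. \<lambda>p\<in>S. g mod p ^ 2"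
  have m: "?m \<in> monics ?M" by (rule prod_prime_squares_monic[OF S])
  then have mdeg: "Polynomial.degree ?m = ?M" by (simp add: monics_def)
  have inj: "inj_on ?f (res_polys ?M)"
  proof (rule inj_onI)
    fix g h assume gh: "g \<in> res_polys ?M" "h \<in> res_polys ?M" and eq: "?f g = ?f h"
    have "p ^ 2 dvd g - h" if "p \<in> S" for p
      using fun_cong[OF eq, of p] that by (simp add: mod_eq_dvd_iff)
    then have "?m dvd g - h" by (rule prod_prime_squares_dvd[OF S])
    then have "g mod ?m = h mod ?m" by (simp add: mod_eq_dvd_iff)
    then show "g = h" using gh res_polys_mod[of _ ?m] unfolding mdeg by simp
  qed
  have sub: "?f ` res_polys ?M \<subseteq> (\<Pi>\<^sub>E p\<in>S. res_polys (2 * Polynomial.degree p))"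
  proof -
    have "g mod p ^ 2 \<in> res_polys (2 * Polynomial.degree p)" if "p \<in> S" for g p
      using mod_in_res_polys[of "p ^ 2" g] that S monic_primesD(3) degree_prime_square by (metis power_not_zero subsetD)
    then show ?thesis by auto
  qed
  have "?f ` res_polys ?M = (\<Pi>\<^sub>E p\<in>S. res_polys (2 * Polynomial.degree p))"
  proof (rule card_seteq[OF _ sub])
    show "finite (\<Pi>\<^sub>E p\<in>S. res_polys (2 * Polynomial.degree p) :: 'a poly set)"
      by (intro finite_PiE S card_res_polys)
    show "card (\<Pi>\<^sub>E p\<in>S. res_polys (2 * Polynomial.degree p) :: 'a poly set) \<le> card (?f ` res_polys ?M)"
      by (simp add: card_image[OF inj] card_res_polys card_PiE S power_sum)
  qed
  with inj show ?thesis by (simp add: bij_betw_def)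
qed

text \<open>The prescribed residues fix the remainder modulo the product of the squares and leave
  the monic quotient free. The count is exact because the degree is at least that of the
  product.\<close>

lemma card_monics_residues:
  fixes S :: "'a::{field,finite} poly set"
  assumes S: "finite S" "S \<subseteq> monic_primes" and d: "(\<Sum>p\<in>S. 2 * Polynomial.degree p) \<le> d"
    and a: "a \<in> (\<Pi>\<^sub>E p\<in>S. res_polys (2 * Polynomial.degree p))"
  shows "card {f \<in> monics d. \<forall>p\<in>S. f mod p ^ 2 = a p} = CARD('a) ^ (d - (\<Sum>p\<in>S. 2 * Polynomial.degree p))"
proof -
  let ?M = "\<Sum>p\<in>S. 2 * Polynomial.degree p" and ?m = "\<Prod>p\<in>S. p ^ 2"
  note m = prod_prime_squares_monic[OF S]
  note div = monics_division[OF m d]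
  have m0: "?m \<noteq> 0" using m by (auto simp: monics_def)
  have "a \<in> (\<lambda>g. \<lambda>p\<in>S. g mod p ^ 2) ` res_polys ?M" using residues_bij[OF S] a by (simp add: bij_betw_def)
  then obtain g where g: "g \<in> res_polys ?M" "a = (\<lambda>p\<in>S. g mod p ^ 2)" by blast
  have mod_p: "(?m * h + g') mod p ^ 2 = g' mod p ^ 2" if "p \<in> S" for h g' p
  proof -
    have "p ^ 2 dvd ?m * h" using that S by (meson dvd_mult2 dvd_prod_eqI dvd_refl dvd_prodI)
    then show ?thesis by (metis add.commute dvd_imp_mod_0 mod_add_right_eq add.right_neutral)
  qed
  have "{f \<in> monics d. \<forall>p\<in>S. f mod p ^ 2 = a p} = (\<lambda>h. ?m * h + g) ` monics (d - ?M)"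
  proof (intro equalityI subsetI)
    fix f assume f: "f \<in> {f \<in> monics d. \<forall>p\<in>S. f mod p ^ 2 = a p}"
    then have "f \<in> (\<lambda>(h, g). ?m * h + g) ` (monics (d - ?M) \<times> res_polys ?M)" using div by (simp add: bij_betw_def)
    then obtain h g' where h: "h \<in> monics (d - ?M)" "g' \<in> res_polys ?M" "f = ?m * h + g'" by auto
    have "(\<lambda>p\<in>S. g' mod p ^ 2) = (\<lambda>p\<in>S. g mod p ^ 2)"
      using f mod_p unfolding h(3) g(2) by (auto simp: fun_eq_iff restrict_def)
    then have "g' = g" using residues_bij[OF S] h(2) g(1) unfolding bij_betw_def inj_on_def by blast
    then show "f \<in> (\<lambda>h. ?m * h + g) ` monics (d - ?M)" using h by blast
  next
    fix f assume "f \<in> (\<lambda>h. ?m * h + g) ` monics (d - ?M)"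
    then obtain h where h: "h \<in> monics (d - ?M)" "f = ?m * h + g" by blast
    have "f \<in> monics d" using bij_betw_apply[OF div, of "(h, g)"] h g by simp
    then show "f \<in> {f \<in> monics d. \<forall>p\<in>S. f mod p ^ 2 = a p}" using mod_p g(2) h(2) by simp
  qed
  also have "card \<dots> = card (monics (d - ?M) :: 'a poly set)"
    by (rule card_image) (use m0 in \<open>auto simp: inj_on_def\<close>)
  finally show ?thesis by (simp add: card_monics)
qed

text \<open>Coprimality couples the entries of a tuple, so the condition at \<open>p\<close> is a
  set \<open>A p\<close> of residue tuples. The modulus is \<open>p ^ 2\<close> because
  squarefreeness at \<open>p\<close> cannot be seen modulo \<open>p\<close>.\<close>

lemma card_tuples_residues:
  fixes S :: "'a::{field,finite} poly set" and R :: "'i set"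
  assumes S: "finite S" "S \<subseteq> monic_primes" and R: "finite R"
    and e: "\<And>\<alpha>. \<alpha> \<in> R \<Longrightarrow> (\<Sum>p\<in>S. 2 * Polynomial.degree p) \<le> e \<alpha>"
    and A: "\<And>p. p \<in> S \<Longrightarrow> A p \<subseteq> (\<Pi>\<^sub>E \<alpha>\<in>R. res_polys (2 * Polynomial.degree p))"
  shows "card {f \<in> (\<Pi>\<^sub>E \<alpha>\<in>R. monics (e \<alpha>)). \<forall>p\<in>S. (\<lambda>\<alpha>\<in>R. f \<alpha> mod p ^ 2) \<in> A p} =
    (\<Prod>\<alpha>\<in>R. CARD('a) ^ (e \<alpha> - (\<Sum>p\<in>S. 2 * Polynomial.degree p))) * (\<Prod>p\<in>S. card (A p))"
proof -
  let ?M = "\<Sum>p\<in>S. 2 * Polynomial.degree p"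
  define C where "C a = (\<Pi>\<^sub>E \<alpha>\<in>R. {f \<in> monics (e \<alpha>). \<forall>p\<in>S. f mod p ^ 2 = a p \<alpha>})"
    for a :: "'a poly \<Rightarrow> 'i \<Rightarrow> 'a poly"
  have fin_A: "finite (A p)" if "p \<in> S" for p
    using finite_subset[OF A[OF that] finite_PiE[OF R card_res_polys(1)]] .
  have "{f \<in> (\<Pi>\<^sub>E \<alpha>\<in>R. monics (e \<alpha>)). \<forall>p\<in>S. (\<lambda>\<alpha>\<in>R. f \<alpha> mod p ^ 2) \<in> A p} = (\<Union>a\<in>(\<Pi>\<^sub>E p\<in>S. A p). C a)"
  proof (intro equalityI subsetI)
    fix f assume f: "f \<in> {f \<in> (\<Pi>\<^sub>E \<alpha>\<in>R. monics (e \<alpha>)). \<forall>p\<in>S. (\<lambda>\<alpha>\<in>R. f \<alpha> mod p ^ 2) \<in> A p}"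
    let ?a = "\<lambda>p\<in>S. \<lambda>\<alpha>\<in>R. f \<alpha> mod p ^ 2"
    have "?a \<in> (\<Pi>\<^sub>E p\<in>S. A p)" "f \<in> C ?a" using f by (auto simp: C_def PiE_iff)
    then show "f \<in> (\<Union>a\<in>(\<Pi>\<^sub>E p\<in>S. A p). C a)" by blast
  next
    fix f assume "f \<in> (\<Union>a\<in>(\<Pi>\<^sub>E p\<in>S. A p). C a)"
    then obtain a where a: "a \<in> (\<Pi>\<^sub>E p\<in>S. A p)" "f \<in> C a" by blast
    have "(\<lambda>\<alpha>\<in>R. f \<alpha> mod p ^ 2) = a p" if p: "p \<in> S" for p
    proof -
      have "a p \<in> (\<Pi>\<^sub>E \<alpha>\<in>R. res_polys (2 * Polynomial.degree p))" using a(1) A[OF p] p by blast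
      then show ?thesis using a(2) p by (auto simp: C_def fun_eq_iff PiE_iff extensional_def)
    qed
    then show "f \<in> {f \<in> (\<Pi>\<^sub>E \<alpha>\<in>R. monics (e \<alpha>)). \<forall>p\<in>S. (\<lambda>\<alpha>\<in>R. f \<alpha> mod p ^ 2) \<in> A p}"
      using a by (auto simp: C_def PiE_iff)
  qed
  also have "card \<dots> = (\<Sum>a\<in>(\<Pi>\<^sub>E p\<in>S. A p). card (C a))"
  proof (rule card_UN_disjoint)
    show "finite (\<Pi>\<^sub>E p\<in>S. A p)" by (rule finite_PiE[OF S(1) fin_A])
    show "\<forall>a\<in>(\<Pi>\<^sub>E p\<in>S. A p). finite (C a)"
      unfolding C_def by (intro ballI finite_PiE R finite_subset[OF _ card_monics(1)]) auto
    show "\<forall>a\<in>(\<Pi>\<^sub>E p\<in>S. A p). \<forall>b\<in>(\<Pi>\<^sub>E p\<in>S. A p). a \<noteq> b \<longrightarrow> C a \<inter> C b = {}"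
    proof (intro ballI impI, rule ccontr)
      fix a b assume ab: "a \<in> (\<Pi>\<^sub>E p\<in>S. A p)" "b \<in> (\<Pi>\<^sub>E p\<in>S. A p)" "a \<noteq> b" "C a \<inter> C b \<noteq> {}"
      then obtain f where f: "f \<in> C a" "f \<in> C b" by blast
      have "a p = b p" for p
      proof (cases "p \<in> S")
        case True
        then have *: "a p \<in> (\<Pi>\<^sub>E \<alpha>\<in>R. res_polys (2 * Polynomial.degree p))"
          "b p \<in> (\<Pi>\<^sub>E \<alpha>\<in>R. res_polys (2 * Polynomial.degree p))" using ab(1,2) A[OF True] by blast+
        show ?thesis
        proof (rule PiE_ext[OF *])
          fix \<alpha> assume "\<alpha> \<in> R"
          then have "f \<alpha> mod p ^ 2 = a p \<alpha>" "f \<alpha> mod p ^ 2 = b p \<alpha>" using f True unfolding C_def by auto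
          then show "a p \<alpha> = b p \<alpha>" by simp
        qed
      qed (use ab in \<open>auto simp: PiE_iff extensional_def\<close>)
      then show False using ab(3) by blast
    qed
  qed
  also have "\<dots> = (\<Sum>a\<in>(\<Pi>\<^sub>E p\<in>S. A p). \<Prod>\<alpha>\<in>R. CARD('a) ^ (e \<alpha> - ?M))"
  proof (rule sum.cong[OF refl])
    fix a assume a: "a \<in> (\<Pi>\<^sub>E p\<in>S. A p)"
    show "card (C a) = (\<Prod>\<alpha>\<in>R. CARD('a) ^ (e \<alpha> - ?M))"
      unfolding C_def card_PiE[OF R]
    proof (rule prod.cong[OF refl])
      fix \<alpha> assume \<alpha>: "\<alpha> \<in> R"
      have "(\<lambda>p\<in>S. a p \<alpha>) \<in> (\<Pi>\<^sub>E p\<in>S. res_polys (2 * Polynomial.degree p))"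
      proof -
        have "a p \<alpha> \<in> res_polys (2 * Polynomial.degree p)" if "p \<in> S" for p
          using a A[OF that] that \<alpha> by (meson PiE_mem subsetD)
        then show ?thesis by simp
      qed
      from card_monics_residues[OF S e[OF \<alpha>] this]
      show "card {f \<in> monics (e \<alpha>). \<forall>p\<in>S. f mod p ^ 2 = a p \<alpha>} = CARD('a) ^ (e \<alpha> - ?M)"
        by (simp cong: conj_cong ball_cong)
    qed
  qed
  also have "\<dots> = (\<Prod>\<alpha>\<in>R. CARD('a) ^ (e \<alpha> - ?M)) * (\<Prod>p\<in>S. card (A p))"
    by (simp add: card_PiE S mult.commute)
  finally show ?thesis .
qed

subsection \<open>A sieve for coprime squarefree tuples\<close>

definition value_tuples ::
  "'i set \<Rightarrow> ('i \<Rightarrow> nat) \<Rightarrow> ('a \<Rightarrow> 'i \<Rightarrow> 'a) \<Rightarrow> ('i \<Rightarrow> 'a::{field,finite} poly) set" where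
  "value_tuples R e v = {f \<in> (\<Pi>\<^sub>E \<alpha>\<in>R. {p \<in> monics (e \<alpha>). squarefree p}).
     pairwise (\<lambda>\<alpha> \<beta>. coprime (f \<alpha>) (f \<beta>)) R \<and> (\<forall>x. \<forall>\<alpha>\<in>R. poly (f \<alpha>) x = v x \<alpha>)}"

definition single_zero :: "'i set \<Rightarrow> ('i \<Rightarrow> 'a::zero) \<Rightarrow> bool" where
  "single_zero R w \<longleftrightarrow> (\<forall>\<alpha>\<in>R. \<forall>\<beta>\<in>R. w \<alpha> = 0 \<longrightarrow> w \<beta> = 0 \<longrightarrow> \<alpha> = \<beta>)"

text \<open>The share of the residues modulo \<open>(X - x)^2\<close> with a prescribed value at
  \<open>x\<close>: \<open>q\<close> of \<open>q ^ 2\<close> for a nonzero value,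
  \<open>q - 1\<close> for the value 0, since the zero residue is excluded by
  squarefreeness.\<close>

definition local_density :: "'i set \<Rightarrow> ('i \<Rightarrow> 'a::{field,finite}) \<Rightarrow> real" where
  "local_density R w = (\<Prod>\<alpha>\<in>R. if w \<alpha> = 0 then (real CARD('a) - 1) / real CARD('a) ^ 2 else 1 / real CARD('a))"

text \<open>The trace of squarefreeness and coprimality modulo \<open>p ^ 2\<close>.\<close>

definition good_residues :: "'i set \<Rightarrow> 'a::{field,finite} poly \<Rightarrow> ('i \<Rightarrow> 'a poly) set" where
  "good_residues R p = {g \<in> (\<Pi>\<^sub>E \<alpha>\<in>R. res_polys (2 * Polynomial.degree p)).
     (\<forall>\<alpha>\<in>R. g \<alpha> \<noteq> 0) \<and> (\<forall>\<alpha>\<in>R. \<forall>\<beta>\<in>R. p dvd g \<alpha> \<longrightarrow> p dvd g \<beta> \<longrightarrow> \<alpha> = \<beta>)}"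

text \<open>Replaces \<open>good_residues\<close> at the linear prime \<open>X - x\<close>; that at
  most one value is 0 is then a property of \<open>w\<close>.\<close>

definition good_values :: "'i set \<Rightarrow> 'a::{field,finite} \<Rightarrow> ('i \<Rightarrow> 'a) \<Rightarrow> ('i \<Rightarrow> 'a poly) set" where
  "good_values R x w = (\<Pi>\<^sub>E \<alpha>\<in>R. {g \<in> res_polys 2. g \<noteq> 0 \<and> poly g x = w \<alpha>})"

lemma finite_monic_primes: "finite {p \<in> monic_primes. Polynomial.degree (p :: 'a::{field,finite} poly) \<le> D}"
proof -
  have "{p \<in> monic_primes. Polynomial.degree (p :: 'a poly) \<le> D} \<subseteq> (\<Union>d\<in>{..D}. monics d)"
    by (auto simp: monics_def monic_primes_def)
  then show ?thesis by (rule finite_subset) (simp add: card_monics)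
qed

lemma linear_monic_prime: "[:- x, 1:] \<in> monic_primes" for x :: "'a::field"
  by (simp add: monic_primes_def prime_elem_linear_field_poly)

lemma linear_monic_primes_eq:
  "{p \<in> monic_primes. Polynomial.degree p = 1} = range (\<lambda>x. [:- x, 1:] :: 'a::field poly)"
proof (intro equalityI subsetI)
  fix p :: "'a poly" assume p: "p \<in> {p \<in> monic_primes. Polynomial.degree p = 1}"
  then have deg: "Polynomial.degree p = 1" and lc: "Polynomial.lead_coeff p = 1" by (auto simp: monic_primes_def)
  then have c1: "Polynomial.coeff p 1 = 1" by simp
  have "p = [:- (- Polynomial.coeff p 0), 1:]"
  proof (rule poly_eqI)
    fix i
    show "Polynomial.coeff p i = Polynomial.coeff [:- (- Polynomial.coeff p 0), 1:] i"
    proof (cases "i > 1")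
      case True
      then show ?thesis using deg by (simp add: coeff_eq_0 coeff_pCons split: nat.split)
    next
      case False
      then consider "i = 0" | "i = 1" by linarith
      then show ?thesis using c1 by cases auto
    qed
  qed
  then show "p \<in> range (\<lambda>x. [:- x, 1:])" by blast
qed (use linear_monic_prime in auto)

text \<open>A residue of degree below 2 with value \<open>w\<close> at \<open>x\<close> is
  determined by its linear coefficient, which must be nonzero if \<open>w = 0\<close>.\<close>

lemma card_value_residues:
  fixes x w :: "'a::{field,finite}"
  shows "card {g \<in> res_polys 2. g \<noteq> 0 \<and> poly g x = w} = (if w = 0 then CARD('a) - 1 else CARD('a))"
proof -
  let ?f = "\<lambda>b. [:w - b * x, b:]"
  have "bij_betw ?f (if w = 0 then UNIV - {0} else UNIV) {g \<in> res_polys 2. g \<noteq> 0 \<and> poly g x = w}"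
  proof (rule bij_betwI[where g = "\<lambda>g. Polynomial.coeff g 1"])
    show "?f \<in> (if w = 0 then UNIV - {0} else UNIV) \<rightarrow> {g \<in> res_polys 2. g \<noteq> 0 \<and> poly g x = w}"
      by (auto simp: res_polys_iff_degree mult.commute split: if_splits)
    have g_eq: "g = ?f (Polynomial.coeff g 1)" if g: "g \<in> res_polys 2" "poly g x = w" for g
    proof -
      have eq: "g = [:Polynomial.coeff g 0, Polynomial.coeff g 1:]"
      proof (rule poly_eqI)
        fix i show "Polynomial.coeff g i = Polynomial.coeff [:Polynomial.coeff g 0, Polynomial.coeff g 1:] i"
          using g(1) by (cases i; cases "i - 1") (auto simp: res_polys_def)
      qed
      have "poly [:Polynomial.coeff g 0, Polynomial.coeff g 1:] x = w" using g(2) eq by simp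
      then have "Polynomial.coeff g 0 = w - Polynomial.coeff g 1 * x" by (simp add: algebra_simps)
      with eq show ?thesis by simp
    qed
    show "?f (Polynomial.coeff g 1) = g" if "g \<in> {g \<in> res_polys 2. g \<noteq> 0 \<and> poly g x = w}" for g
      using g_eq[of g] that by simp
    show "(\<lambda>g. Polynomial.coeff g 1) \<in> {g \<in> res_polys 2. g \<noteq> 0 \<and> poly g x = w} \<rightarrow> (if w = 0 then UNIV - {0} else UNIV)"
    proof
      fix g assume g: "g \<in> {g \<in> res_polys 2. g \<noteq> 0 \<and> poly g x = w}"
      have "Polynomial.coeff g 1 \<noteq> 0" if "w = 0"
      proof
        assume "Polynomial.coeff g 1 = 0"
        then have "?f (Polynomial.coeff g 1) = 0" using that by simp
        then show False using g_eq[of g] g by simp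
      qed
      then show "Polynomial.coeff g 1 \<in> (if w = 0 then UNIV - {0} else UNIV)" by simp
    qed
  qed auto
  then have "card {g \<in> res_polys 2. g \<noteq> 0 \<and> poly g x = w} = card (if w = 0 then UNIV - {0} else UNIV :: 'a set)"
    by (rule bij_betw_same_card[symmetric])
  then show ?thesis by (simp add: card_Diff_singleton)
qed

lemma card_good_values:
  fixes w :: "'i \<Rightarrow> 'a::{field,finite}"
  assumes "finite R"
  shows "real (card (good_values R x w)) / (real CARD('a) ^ 2) ^ card R = local_density R w"
proof -
  have q: "CARD('a) \<ge> 2" by (rule card_field_ge2)
  have "real (card (good_values R x w)) / (real CARD('a) ^ 2) ^ card R =
      (\<Prod>\<alpha>\<in>R. real (if w \<alpha> = 0 then CARD('a) - 1 else CARD('a)) / real CARD('a) ^ 2)"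
    unfolding good_values_def card_PiE[OF assms] card_value_residues by (simp add: prod_dividef)
  also have "\<dots> = local_density R w"
    unfolding local_density_def using q by (intro prod.cong refl) (simp add: of_nat_diff power2_eq_square)
  finally show ?thesis .
qed

lemma card_PiE_ratio_le:
  assumes "finite R" "\<And>\<alpha>. \<alpha> \<in> R \<Longrightarrow> real (card (A \<alpha>)) \<le> b \<alpha> * c \<alpha>"
  shows "real (card (\<Pi>\<^sub>E \<alpha>\<in>R. A \<alpha>)) \<le> (\<Prod>\<alpha>\<in>R. b \<alpha>) * (\<Prod>\<alpha>\<in>R. c \<alpha> :: real)"
proof -
  have "real (card (\<Pi>\<^sub>E \<alpha>\<in>R. A \<alpha>)) = (\<Prod>\<alpha>\<in>R. real (card (A \<alpha>)))" by (simp add: card_PiE assms(1))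
  also have "\<dots> \<le> (\<Prod>\<alpha>\<in>R. b \<alpha> * c \<alpha>)" by (rule prod_mono) (use assms(2) in auto)
  finally show ?thesis by (simp add: prod.distrib)
qed

text \<open>A union bound over the two ways to fail: one entry has a square factor, or two entries
  have a common factor. It is the origin of the constant \<open>card R + card R ^ 2\<close>.\<close>

lemma card_single_pair_union_le:
  fixes E1 :: "'i \<Rightarrow> 'x set"
  assumes R: "finite R" and E1: "\<And>\<alpha>. \<alpha> \<in> R \<Longrightarrow> real (card (E1 \<alpha>)) \<le> b" "\<And>\<alpha>. \<alpha> \<in> R \<Longrightarrow> finite (E1 \<alpha>)"
    and E2: "\<And>\<alpha> \<beta>. \<alpha> \<in> R \<Longrightarrow> \<beta> \<in> R \<Longrightarrow> \<alpha> \<noteq> \<beta> \<Longrightarrow> real (card (E2 \<alpha> \<beta>)) \<le> b"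
    "\<And>\<alpha> \<beta>. \<alpha> \<in> R \<Longrightarrow> \<beta> \<in> R \<Longrightarrow> \<alpha> \<noteq> \<beta> \<Longrightarrow> finite (E2 \<alpha> \<beta>)" and b: "b \<ge> 0"
  shows "real (card ((\<Union>\<alpha>\<in>R. E1 \<alpha>) \<union> (\<Union>(\<alpha>, \<beta>)\<in>{(\<alpha>, \<beta>) \<in> R \<times> R. \<alpha> \<noteq> \<beta>}. E2 \<alpha> \<beta>))) \<le>
    (real (card R) + real (card R) ^ 2) * b"
proof -
  let ?P = "{(\<alpha>, \<beta>) \<in> R \<times> R. \<alpha> \<noteq> \<beta>}"
  have P: "finite ?P" "card ?P \<le> card R ^ 2"
  proof -
    show "finite ?P" by (rule finite_subset[of _ "R \<times> R"]) (use R in auto)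
    have "card ?P \<le> card (R \<times> R)" by (rule card_mono) (use R in auto)
    then show "card ?P \<le> card R ^ 2" by (simp add: card_cartesian_product power2_eq_square)
  qed
  have "card ((\<Union>\<alpha>\<in>R. E1 \<alpha>) \<union> (\<Union>(\<alpha>, \<beta>)\<in>?P. E2 \<alpha> \<beta>)) \<le> card (\<Union>\<alpha>\<in>R. E1 \<alpha>) + card (\<Union>(\<alpha>, \<beta>)\<in>?P. E2 \<alpha> \<beta>)"
    by (rule card_Un_le)
  also have "\<dots> \<le> (\<Sum>\<alpha>\<in>R. card (E1 \<alpha>)) + (\<Sum>(\<alpha>, \<beta>)\<in>?P. card (E2 \<alpha> \<beta>))"
    using card_UN_le[OF R, of E1] card_UN_le[OF P(1), of "\<lambda>(\<alpha>, \<beta>). E2 \<alpha> \<beta>"]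
    by (simp add: case_prod_beta)
  finally have "real (card ((\<Union>\<alpha>\<in>R. E1 \<alpha>) \<union> (\<Union>(\<alpha>, \<beta>)\<in>?P. E2 \<alpha> \<beta>))) \<le>
      (\<Sum>\<alpha>\<in>R. real (card (E1 \<alpha>))) + (\<Sum>(\<alpha>, \<beta>)\<in>?P. real (card (E2 \<alpha> \<beta>)))"
    unfolding of_nat_le_iff[symmetric, where 'a=real] by (simp add: case_prod_beta)
  also have "\<dots> \<le> (\<Sum>\<alpha>\<in>R. b) + (\<Sum>p\<in>?P. b)"
  proof (intro add_mono sum_mono)
    show "real (card (E1 \<alpha>)) \<le> b" if "\<alpha> \<in> R" for \<alpha> by (rule E1(1)[OF that])
    show "(case p of (\<alpha>, \<beta>) \<Rightarrow> real (card (E2 \<alpha> \<beta>))) \<le> b" if p: "p \<in> ?P" for p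
    proof -
      obtain \<alpha> \<beta> where eq: "p = (\<alpha>, \<beta>)" by (cases p)
      then have "\<alpha> \<in> R" "\<beta> \<in> R" "\<alpha> \<noteq> \<beta>" using p by auto
      then have "real (card (E2 \<alpha> \<beta>)) \<le> b" by (rule E2(1))
      then show ?thesis unfolding eq prod.case .
    qed
  qed
  also have "\<dots> = real (card R) * b + real (card ?P) * b" by simp
  also have "\<dots> \<le> real (card R) * b + real (card R) ^ 2 * b"
  proof -
    have "real (card ?P) \<le> real (card R) ^ 2" using P(2) by (simp only: of_nat_power[symmetric] of_nat_le_iff)
    then show ?thesis using b by (simp add: mult_right_mono)
  qed
  finally show ?thesis by (simp add: algebra_simps)
qed

lemma prod_two_indices:
  assumes "finite R" "\<alpha> \<in> R" "\<beta> \<in> R" "\<alpha> \<noteq> \<beta>"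
  shows "(\<Prod>\<gamma>\<in>R. if \<gamma> \<in> {\<alpha>, \<beta>} then x else 1) = (x :: real) ^ 2"
proof -
  have "(\<Prod>\<gamma>\<in>R. if \<gamma> \<in> {\<alpha>, \<beta>} then x else 1) = (\<Prod>\<gamma>\<in>{\<alpha>, \<beta>}. if \<gamma> \<in> {\<alpha>, \<beta>} then x else 1)"
    by (rule prod.mono_neutral_right) (use assms in auto)
  then show ?thesis using assms(4) by (simp add: power2_eq_square)
qed

text \<open>With \<open>n\<close> the degree of \<open>p\<close>, a given entry is the zero residue
  with probability \<open>q^(-2n)\<close>, and two given entries are both divisible by
  \<open>p\<close> with probability at most \<open>q^(-2n)\<close>. The constant tuple 1 is good,
  hence the positivity.\<close>

lemma good_residues_density:
  fixes p :: "'a::{field,finite} poly"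
  assumes R: "finite R" and p: "p \<in> monic_primes"
  defines "c \<equiv> real (card (good_residues R p)) / (real CARD('a) ^ (2 * Polynomial.degree p)) ^ card R"
  shows "c > 0" "c \<le> 1" "c \<ge> 1 - (real (card R) + real (card R) ^ 2) * (1 / real CARD('a)) ^ (2 * Polynomial.degree p)"
proof -
  note pp = monic_primesD[OF p]
  define n where "n = Polynomial.degree p"
  have n: "n > 0" using pp(4) by (simp add: n_def)
  let ?q = "real CARD('a)"
  have q: "?q \<ge> 2" using card_field_ge2[where 'a='a] by simp
  let ?Res = "res_polys (2 * n) :: 'a poly set"
  let ?All = "\<Pi>\<^sub>E \<alpha>\<in>R. ?Res"
  have fin: "finite ?All" by (intro finite_PiE R card_res_polys)
  have card_All: "real (card ?All) = (?q ^ (2 * n)) ^ card R" by (simp add: card_PiE R card_res_polys)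
  have c: "c = real (card (good_residues R p)) / (?q ^ (2 * n)) ^ card R" by (simp add: c_def n_def)
  have good: "good_residues R p = {g \<in> ?All. (\<forall>\<alpha>\<in>R. g \<alpha> \<noteq> 0) \<and> (\<forall>\<alpha>\<in>R. \<forall>\<beta>\<in>R. p dvd g \<alpha> \<longrightarrow> p dvd g \<beta> \<longrightarrow> \<alpha> = \<beta>)}"
    by (simp add: good_residues_def n_def)
  have gsub: "good_residues R p \<subseteq> ?All" unfolding good by (rule Collect_restrict)
  have "real (card (good_residues R p)) \<le> real (card ?All)" using card_mono[OF fin gsub] by simp
  then show "c \<le> 1" unfolding c card_All using q by (simp add: divide_le_eq)
  have "\<not> p dvd 1" using pp(1) by (simp add: prime_elem_def)
  then have "(\<lambda>\<alpha>\<in>R. 1) \<in> good_residues R p" unfolding good using n by (auto simp: res_polys_iff_degree)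
  then have "card (good_residues R p) > 0" using finite_subset[OF gsub fin] card_gt_0_iff by blast
  then show "c > 0" unfolding c using q by simp
  let ?b = "(?q ^ (2 * n)) ^ card R * (1 / ?q) ^ (2 * n)"
  define E1 where "E1 \<alpha> = (\<Pi>\<^sub>E \<gamma>\<in>R. if \<gamma> = \<alpha> then {0} else ?Res)" for \<alpha>
  define E2 where "E2 \<alpha> \<beta> = (\<Pi>\<^sub>E \<gamma>\<in>R. if \<gamma> \<in> {\<alpha>, \<beta>} then {g \<in> ?Res. p dvd g} else ?Res)" for \<alpha> \<beta>
  have prodq: "(\<Prod>\<gamma>\<in>R. ?q ^ (2 * n)) = (?q ^ (2 * n)) ^ card R" by simp
  have "?All - good_residues R p \<subseteq> (\<Union>\<alpha>\<in>R. E1 \<alpha>) \<union> (\<Union>(\<alpha>, \<beta>)\<in>{(\<alpha>, \<beta>) \<in> R \<times> R. \<alpha> \<noteq> \<beta>}. E2 \<alpha> \<beta>)"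
  proof
    fix g assume g: "g \<in> ?All - good_residues R p"
    then consider \<alpha> where "\<alpha> \<in> R" "g \<alpha> = 0"
      | \<alpha> \<beta> where "\<alpha> \<in> R" "\<beta> \<in> R" "\<alpha> \<noteq> \<beta>" "p dvd g \<alpha>" "p dvd g \<beta>" unfolding good by blast
    then show "g \<in> (\<Union>\<alpha>\<in>R. E1 \<alpha>) \<union> (\<Union>(\<alpha>, \<beta>)\<in>{(\<alpha>, \<beta>) \<in> R \<times> R. \<alpha> \<noteq> \<beta>}. E2 \<alpha> \<beta>)"
    proof cases
      case 1
      then have "g \<in> E1 \<alpha>" using g by (auto simp: E1_def PiE_iff)
      then show ?thesis using 1 by blast
    next
      case 2
      then have "g \<in> E2 \<alpha> \<beta>" using g by (auto simp: E2_def PiE_iff)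
      then show ?thesis using 2 by blast
    qed
  qed
  moreover have finE: "finite (E1 \<alpha>)" "finite (E2 \<alpha> \<beta>)" for \<alpha> \<beta>
    unfolding E1_def E2_def by (intro finite_PiE R; simp add: card_res_polys)+
  ultimately have "card (?All - good_residues R p) \<le> card ((\<Union>\<alpha>\<in>R. E1 \<alpha>) \<union> (\<Union>(\<alpha>, \<beta>)\<in>{(\<alpha>, \<beta>) \<in> R \<times> R. \<alpha> \<noteq> \<beta>}. E2 \<alpha> \<beta>))"
    by (intro card_mono finite_UnI finite_UN_I) (use R finE in \<open>auto intro: finite_subset[of _ "R \<times> R"]\<close>)
  also have "real \<dots> \<le> (real (card R) + real (card R) ^ 2) * ?b"
  proof (rule card_single_pair_union_le[OF R])
    fix \<alpha> assume \<alpha>: "\<alpha> \<in> R"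
    have "real (card (E1 \<alpha>)) \<le> (\<Prod>\<gamma>\<in>R. ?q ^ (2 * n)) * (\<Prod>\<gamma>\<in>R. if \<gamma> = \<alpha> then (1 / ?q) ^ (2 * n) else 1)"
      unfolding E1_def by (rule card_PiE_ratio_le[OF R]) (use q in \<open>auto simp: card_res_polys power_divide\<close>)
    also have "(\<Prod>\<gamma>\<in>R. if \<gamma> = \<alpha> then (1 / ?q) ^ (2 * n) else 1) = (1 / ?q) ^ (2 * n)" using R \<alpha> by simp
    finally show "real (card (E1 \<alpha>)) \<le> ?b" unfolding prodq .
  next
    fix \<alpha> \<beta> assume ab: "\<alpha> \<in> R" "\<beta> \<in> R" "\<alpha> \<noteq> \<beta>"
    have "{g \<in> ?Res. p dvd g} \<subseteq> (\<lambda>h. p * h) ` res_polys n"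
    proof
      fix g assume "g \<in> {g \<in> ?Res. p dvd g}"
      then obtain h where h: "g = p * h" "g \<in> ?Res" by auto
      have "h \<in> res_polys n"
      proof (cases "h = 0")
        case False
        then have "Polynomial.degree g = n + Polynomial.degree h" using h pp(3) by (simp add: Polynomial.degree_mult_eq n_def)
        then show ?thesis using h False pp(3) by (auto simp: res_polys_iff_degree)
      qed (simp add: res_polys_def)
      then show "g \<in> (\<lambda>h. p * h) ` res_polys n" using h by blast
    qed
    then have "card {g \<in> ?Res. p dvd g} \<le> card ((\<lambda>h. p * h) ` (res_polys n :: 'a poly set))"
      by (intro card_mono finite_imageI card_res_polys)
    also have "\<dots> \<le> CARD('a) ^ n" using card_image_le[OF card_res_polys(1)] card_res_polys(2) by metis
    finally have "real (card {g \<in> ?Res. p dvd g}) \<le> ?q ^ n" by (simp flip: of_nat_power)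
    also have "?q ^ n = ?q ^ (2 * n) * (1 / ?q) ^ n"
      using q by (simp add: power_divide mult_2 power_add)
    finally have le: "real (card {g \<in> ?Res. p dvd g}) \<le> ?q ^ (2 * n) * (1 / ?q) ^ n" .
    have "real (card (E2 \<alpha> \<beta>)) \<le> (\<Prod>\<gamma>\<in>R. ?q ^ (2 * n)) * (\<Prod>\<gamma>\<in>R. if \<gamma> \<in> {\<alpha>, \<beta>} then (1 / ?q) ^ n else 1)"
      unfolding E2_def
    proof (rule card_PiE_ratio_le[OF R])
      fix \<gamma> assume "\<gamma> \<in> R"
      show "real (card (if \<gamma> \<in> {\<alpha>, \<beta>} then {g \<in> ?Res. p dvd g} else ?Res)) \<le>
          ?q ^ (2 * n) * (if \<gamma> \<in> {\<alpha>, \<beta>} then (1 / ?q) ^ n else 1)"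
        by (cases "\<gamma> \<in> {\<alpha>, \<beta>}") (simp_all only: if_True if_False le card_res_polys of_nat_power mult_1_right order_refl)
    qed
    also have "\<dots> = ?b" unfolding prodq prod_two_indices[OF R ab] by (simp add: power_mult[symmetric] mult.commute)
    finally show "real (card (E2 \<alpha> \<beta>)) \<le> ?b" .
  qed (use finE q in auto)
  finally have bad: "real (card (?All - good_residues R p)) \<le> (real (card R) + real (card R) ^ 2) * ?b" by simp
  have "real (card (good_residues R p)) = real (card ?All) - real (card (?All - good_residues R p))"
    using card_Diff_subset[OF finite_subset[OF gsub fin] gsub] card_mono[OF fin gsub] by (simp add: of_nat_diff)
  then have "real (card (good_residues R p)) \<ge> (?q ^ (2 * n)) ^ card R - (real (card R) + real (card R) ^ 2) * ?b"
    using bad card_All by linarith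
  then have "c \<ge> ((?q ^ (2 * n)) ^ card R - (real (card R) + real (card R) ^ 2) * ?b) / (?q ^ (2 * n)) ^ card R"
    unfolding c using q by (intro divide_right_mono) auto
  also have "((?q ^ (2 * n)) ^ card R - (real (card R) + real (card R) ^ 2) * ?b) / (?q ^ (2 * n)) ^ card R =
      1 - (real (card R) + real (card R) ^ 2) * (1 / ?q) ^ (2 * n)"
    using q by (simp add: field_simps)
  finally show "c \<ge> 1 - (real (card R) + real (card R) ^ 2) * (1 / ?q) ^ (2 * Polynomial.degree p)"
    by (simp add: n_def)
qed

lemma geometric_tail_le:
  fixes x :: real
  assumes "0 \<le> x" "x \<le> 1 / 2"
  shows "(\<Sum>n\<in>{D<..E}. x ^ n) \<le> x ^ D"
proof -
  have "(\<Sum>n\<in>{D<..D + m}. x ^ n) \<le> x ^ D - x ^ (D + m)" for m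
  proof (induction m)
    case (Suc m)
    have "{D<..D + Suc m} = insert (D + Suc m) {D<..D + m}" by auto
    then have "(\<Sum>n\<in>{D<..D + Suc m}. x ^ n) = x ^ (D + Suc m) + (\<Sum>n\<in>{D<..D + m}. x ^ n)" by simp
    moreover have "2 * x ^ (D + Suc m) \<le> x ^ (D + m)"
      using assms mult_right_mono[of "2 * x" 1 "x ^ (D + m)"] by simp
    ultimately show ?case using Suc by linarith
  qed simp
  moreover have "x ^ (D + m) \<ge> 0" for m using assms by simp
  ultimately have "(\<Sum>n\<in>{D<..D + m}. x ^ n) \<le> x ^ D" for m by (smt (verit))
  then show ?thesis using assms by (cases "D \<le> E") (metis le_Suc_ex, simp)
qed

lemma card_monic_primes_degree_le:
  "real (card {p \<in> monic_primes. Polynomial.degree (p :: 'a::{field,finite} poly) = n}) \<le> real CARD('a) ^ n"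
proof -
  have "card {p \<in> monic_primes. Polynomial.degree (p :: 'a poly) = n} \<le> card (monics n :: 'a poly set)"
    by (rule card_mono[OF card_monics(1)]) (auto simp: monics_def monic_primes_def)
  then show ?thesis by (simp add: card_monics flip: of_nat_power)
qed

text \<open>There are at most \<open>q ^ n\<close> monic primes of degree \<open>n\<close>, and each
  contributes \<open>q^(-2n)\<close>; a geometric series with ratio at most 1/2 remains.\<close>

lemma sum_monic_primes_le:
  assumes "finite A" "\<And>p. p \<in> A \<Longrightarrow> p \<in> monic_primes \<and> Polynomial.degree p > D"
  shows "(\<Sum>p\<in>A. (1 / real CARD('a)) ^ (2 * Polynomial.degree (p :: 'a::{field,finite} poly))) \<le> (1 / real CARD('a)) ^ D"
proof -
  let ?q = "real CARD('a)"
  have q: "?q \<ge> 2" using card_field_ge2[where 'a='a] by simp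
  define E where "E = (\<Sum>p\<in>A. Polynomial.degree p)"
  have deg: "Polynomial.degree p \<in> {D<..E}" if "p \<in> A" for p
    using assms that member_le_sum[OF that _ assms(1), of Polynomial.degree] by (simp add: E_def)
  have "(\<Sum>p\<in>A. (1 / ?q) ^ (2 * Polynomial.degree p)) = (\<Sum>n\<in>{D<..E}. \<Sum>p\<in>{p\<in>A. Polynomial.degree p = n}. (1 / ?q) ^ (2 * Polynomial.degree p))"
    by (rule sum.group[symmetric]) (use assms deg in auto)
  also have "\<dots> \<le> (\<Sum>n\<in>{D<..E}. (1 / ?q) ^ n)"
  proof (rule sum_mono)
    fix n
    have "(\<Sum>p\<in>{p\<in>A. Polynomial.degree p = n}. (1 / ?q) ^ (2 * Polynomial.degree p)) = real (card {p\<in>A. Polynomial.degree p = n}) * (1 / ?q) ^ (2 * n)"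
      by simp
    also have "\<dots> \<le> ?q ^ n * (1 / ?q) ^ (2 * n)"
    proof (rule mult_right_mono)
      have "card {p\<in>A. Polynomial.degree p = n} \<le> card {p \<in> monic_primes. Polynomial.degree (p :: 'a poly) = n}"
        by (rule card_mono[OF finite_subset[OF _ finite_monic_primes[of n]]]) (use assms in auto)
      then show "real (card {p\<in>A. Polynomial.degree p = n}) \<le> ?q ^ n"
        using card_monic_primes_degree_le[of n, where 'a='a] by linarith
    qed (use q in simp)
    also have "\<dots> = (1 / ?q) ^ n" using q by (simp add: mult_2 power_add power_divide)
    finally show "(\<Sum>p\<in>{p\<in>A. Polynomial.degree p = n}. (1 / ?q) ^ (2 * Polynomial.degree p)) \<le> (1 / ?q) ^ n" .
  qed
  also have "\<dots> \<le> (1 / ?q) ^ D" using q by (intro geometric_tail_le) auto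
  finally show ?thesis .
qed

text \<open>Weierstrass' product inequality; it keeps the tail of the sieve product away from
  0.\<close>

lemma prod_ge_1_minus_sum:
  assumes "finite A" "\<And>a. a \<in> A \<Longrightarrow> f a \<ge> 1 - x a" "\<And>a. a \<in> A \<Longrightarrow> 0 \<le> f a" "\<And>a. a \<in> A \<Longrightarrow> f a \<le> 1"
  shows "(\<Prod>a\<in>A. f a) \<ge> 1 - (\<Sum>a\<in>A. x a :: real)"
  using assms
proof (induction A)
  case (insert a A)
  have P: "0 \<le> (\<Prod>a\<in>A. f a)" "(\<Prod>a\<in>A. f a) \<le> 1" using insert.prems by (auto intro: prod_nonneg prod_le_1)
  have "f a * (\<Prod>a\<in>A. f a) \<ge> f a + (\<Prod>a\<in>A. f a) - 1"
    using mult_nonneg_nonneg[of "1 - f a" "1 - (\<Prod>a\<in>A. f a)"] P insert.prems(3)[of a] by (simp add: algebra_simps)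
  moreover have "(\<Prod>a\<in>A. f a) \<ge> 1 - (\<Sum>a\<in>A. x a)" using insert.IH insert.prems by simp
  moreover have "f a \<ge> 1 - x a" using insert.prems(1) by simp
  ultimately have "f a * (\<Prod>a\<in>A. f a) \<ge> 1 - (x a + (\<Sum>a\<in>A. x a))" by linarith
  then show ?case using insert.hyps by simp
qed simp

text \<open>A truncated Euler product without the linear primes, whose contribution is the product
  of the \<open>local_density\<close> factors.\<close>

definition sieve_product :: "'i set \<Rightarrow> 'a::{field,finite} itself \<Rightarrow> nat \<Rightarrow> real" where
  "sieve_product R _ D = (\<Prod>p\<in>{p \<in> monic_primes. 2 \<le> Polynomial.degree p \<and> Polynomial.degree p \<le> D}.
     real (card (good_residues R (p :: 'a poly))) / (real CARD('a) ^ (2 * Polynomial.degree p)) ^ card R)"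

text \<open>The factors are at most 1, so the products decrease; beyond \<open>D0\<close> the
  remaining factors multiply to at least 1/2, so the limit is positive.\<close>

lemma sieve_product_converges:
  assumes R: "finite R"
  obtains B where "B > 0" "sieve_product R TYPE('a::{field,finite}) \<longlonglongrightarrow> B"
proof -
  let ?B = "sieve_product R TYPE('a)"
  let ?q = "real CARD('a)"
  have q: "?q \<ge> 2" using card_field_ge2[where 'a='a] by simp
  define c where "c p = real (card (good_residues R (p :: 'a poly))) / (?q ^ (2 * Polynomial.degree p)) ^ card R" for p
  define K where "K = real (card R) + real (card R) ^ 2"
  define P where "P D = {p :: 'a poly. p \<in> monic_primes \<and> 2 \<le> Polynomial.degree p \<and> Polynomial.degree p \<le> D}" for D
  have finP: "finite (P D)" for D by (rule finite_subset[OF _ finite_monic_primes[of D]]) (auto simp: P_def)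
  have c: "c p > 0" "c p \<le> 1" "c p \<ge> 1 - K * (1 / ?q) ^ (2 * Polynomial.degree p)" if "p \<in> monic_primes" for p
    using good_residues_density[OF R that] by (simp_all add: c_def K_def)
  have B: "?B D = (\<Prod>p\<in>P D. c p)" for D by (simp add: sieve_product_def c_def P_def)
  have pos: "?B D > 0" for D unfolding B by (rule prod_pos) (auto simp: P_def intro: c)
  have split: "?B D' = ?B D * (\<Prod>p\<in>P D' - P D. c p)" if "D \<le> D'" for D D'
    unfolding B using finP that by (subst mult.commute, intro prod.subset_diff) (auto simp: P_def)
  have dec: "decseq ?B"
  proof (rule decseq_SucI)
    fix D
    have "(\<Prod>p\<in>P (Suc D) - P D. c p) \<le> 1" by (rule prod_le_1) (auto simp: P_def intro: c less_imp_le)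
    then show "?B (Suc D) \<le> ?B D" unfolding split[of D "Suc D", OF le_SucI[OF order_refl]]
      using pos[of D] by (simp add: mult_le_cancel_left1)
  qed
  have "(\<lambda>D. K * (1 / ?q) ^ D) \<longlonglongrightarrow> K * 0"
    using q by (intro tendsto_mult tendsto_const LIMSEQ_realpow_zero) auto
  then have "eventually (\<lambda>D. K * (1 / ?q) ^ D < 1 / 2) sequentially" by (rule order_tendstoD) simp
  then obtain D0 where D0: "K * (1 / ?q) ^ D0 < 1 / 2" by (auto simp: eventually_sequentially)
  define b where "b = ?B D0 / 2"
  have b: "b > 0" using pos[of D0] by (simp add: b_def)
  have K0: "K \<ge> 0" by (simp add: K_def)
  have lower: "b \<le> ?B D" for D
  proof (cases "D \<ge> D0")
    case True
    have "(\<Prod>p\<in>P D - P D0. c p) \<ge> 1 - (\<Sum>p\<in>P D - P D0. K * (1 / ?q) ^ (2 * Polynomial.degree p))"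
      by (rule prod_ge_1_minus_sum) (use finP in \<open>auto simp: P_def intro: c less_imp_le\<close>)
    moreover have "(\<Sum>p\<in>P D - P D0. K * (1 / ?q) ^ (2 * Polynomial.degree p)) \<le> K * (1 / ?q) ^ D0"
      unfolding sum_distrib_left[symmetric]
      by (intro mult_left_mono sum_monic_primes_le) (use finP K0 in \<open>auto simp: P_def\<close>)
    ultimately have "(\<Prod>p\<in>P D - P D0. c p) \<ge> 1 / 2" using D0 by linarith
    then show ?thesis unfolding split[OF True] b_def using pos[of D0] mult_left_mono[of "1/2" _ "?B D0"] by simp
  next
    case False
    then have "?B D0 \<le> ?B D" using dec by (simp add: decseq_def)
    then show ?thesis using pos[of D0] by (simp add: b_def)
  qed
  obtain L where L: "?B \<longlonglongrightarrow> L" "\<forall>i. L \<le> ?B i" using decseq_convergent[OF dec, of b] lower by blast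
  have "b \<le> L" by (rule LIMSEQ_le_const[OF L(1)]) (use lower in auto)
  then show ?thesis using that[of L] b L(1) by auto
qed

lemma monic_prime_factor_exists:
  fixes f :: "'a::field poly"
  assumes "Polynomial.degree f > 0"
  obtains p where "p \<in> monic_primes" "p dvd f"
proof -
  obtain p where p: "prime_elem p" "p dvd f" by (rule prime_factor_exists[OF assms])
  have p0: "p \<noteq> 0" using p by (simp add: prime_elem_def)
  let ?u = "[:inverse (Polynomial.lead_coeff p):]"
  have u: "is_unit ?u" using p0 by (simp add: is_unit_iff_degree)
  have "?u * p dvd f" using p(2) u by (simp only: mult_unit_dvd_iff')
  moreover have "prime_elem (?u * p)" using p(1) u by (simp only: prime_elem_mult_unit_left)
  moreover have "Polynomial.lead_coeff (?u * p) = 1" using p0 by simp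
  ultimately show ?thesis using that[of "?u * p"] unfolding monic_primes_def by blast
qed

text \<open>For \<open>M > d\<close> the set is empty and the bound is trivial; hence it applies to
  primes of any degree.\<close>

lemma card_monics_dvd_le:
  fixes m :: "'a::{field,finite} poly"
  assumes m: "m \<in> monics M"
  shows "real (card {g \<in> monics d. m dvd g}) \<le> real CARD('a) ^ d * (1 / real CARD('a)) ^ M"
proof (cases "M \<le> d")
  case True
  have m0: "m \<noteq> 0" "Polynomial.degree m = M" "Polynomial.lead_coeff m = 1" using m unfolding monics_def by auto
  have "{g \<in> monics d. m dvd g} \<subseteq> (\<lambda>h. m * h) ` monics (d - M)"
  proof
    fix g assume "g \<in> {g \<in> monics d. m dvd g}"
    then obtain h where h: "g = m * h" "Polynomial.degree g = d" "Polynomial.lead_coeff g = 1" by (auto simp: monics_def)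
    then have "h \<noteq> 0" by auto
    then have "Polynomial.degree h = d - M"
      using h m0 Polynomial.degree_mult_eq[of m h] by simp
    moreover have "Polynomial.lead_coeff h = 1"
      using h(3) m0(3) unfolding h(1) lead_coeff_mult by simp
    ultimately have "h \<in> monics (d - M)" unfolding monics_def by blast
    then show "g \<in> (\<lambda>h. m * h) ` monics (d - M)" using h by blast
  qed
  then have "card {g \<in> monics d. m dvd g} \<le> card ((\<lambda>h. m * h) ` (monics (d - M) :: 'a poly set))"
    by (intro card_mono finite_imageI card_monics)
  also have "\<dots> \<le> CARD('a) ^ (d - M)" using card_image_le[OF card_monics(1)] card_monics(2) by metis
  finally have "real (card {g \<in> monics d. m dvd g}) \<le> real CARD('a) ^ (d - M)" by (simp flip: of_nat_power)
  also have "\<dots> = real CARD('a) ^ d * (1 / real CARD('a)) ^ M"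
    using True card_field_ge2[where 'a='a] by (simp add: power_diff power_divide)
  finally show ?thesis .
next
  case False
  have eq: "{g \<in> monics d. m dvd g} = {}"
  proof (rule ccontr)
    assume "{g \<in> monics d. m dvd g} \<noteq> {}"
    then obtain g where g: "g \<in> monics d" "m dvd g" by blast
    then have "g \<noteq> 0" "Polynomial.degree g = d" by (auto simp: monics_def)
    then show False using dvd_imp_degree_le[OF g(2)] m False by (auto simp: monics_def)
  qed
  show ?thesis unfolding eq by simp
qed

text \<open>\<open>T\<close> imposes the local conditions at primes of degree at most
  \<open>D\<close> and is counted exactly by Chinese remainders. It exceeds the wanted set only by
  tuples that fail at a prime of degree above \<open>D\<close>, and the union bound over these
  primes gives the error.\<close>

lemma value_tuples_approx:
  fixes v :: "'a::{field,finite} \<Rightarrow> 'i \<Rightarrow> 'a"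
  assumes R: "finite R" and D: "D \<ge> 1" and v: "\<And>x. single_zero R (v x)"
    and e: "\<And>\<alpha>. \<alpha> \<in> R \<Longrightarrow> (\<Sum>p\<in>{p \<in> monic_primes. Polynomial.degree (p :: 'a poly) \<le> D}. 2 * Polynomial.degree p) \<le> e \<alpha>"
  shows "\<bar>real (card (value_tuples R e v)) -
      real CARD('a) ^ (\<Sum>\<alpha>\<in>R. e \<alpha>) * ((\<Prod>x\<in>UNIV. local_density R (v x)) * sieve_product R TYPE('a) D)\<bar> \<le>
    real CARD('a) ^ (\<Sum>\<alpha>\<in>R. e \<alpha>) * ((real (card R) + real (card R) ^ 2) * (1 / real CARD('a)) ^ D)"
proof -
  let ?q = "real CARD('a)"
  have q: "?q \<ge> 2" using card_field_ge2[where 'a='a] by simp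
  let ?E = "\<Sum>\<alpha>\<in>R. e \<alpha>"
  define S where "S = {p :: 'a poly. p \<in> monic_primes \<and> Polynomial.degree p \<le> D}"
  define M where "M = (\<Sum>p\<in>S. 2 * Polynomial.degree p)"
  have S: "finite S" "S \<subseteq> monic_primes" using finite_monic_primes[of D] by (auto simp: S_def)
  have eM: "M \<le> e \<alpha>" if "\<alpha> \<in> R" for \<alpha> using e[OF that] by (simp add: M_def S_def)
  define A where "A p = (if Polynomial.degree p = 1 then good_values R (- Polynomial.coeff p 0) (v (- Polynomial.coeff p 0))
      else good_residues R p)" for p :: "'a poly"
  have A_lin: "A [:- x, 1:] = good_values R x (v x)" for x by (simp add: A_def)
  have A_big: "A p = good_residues R p" if "Polynomial.degree p \<noteq> 1" for p using that by (simp add: A_def)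
  have A_sub: "A p \<subseteq> (\<Pi>\<^sub>E \<alpha>\<in>R. res_polys (2 * Polynomial.degree p))" for p
  proof (cases "Polynomial.degree p = 1")
    case True
    then show ?thesis unfolding A_def good_values_def by (auto intro!: PiE_mono)
  next
    case False
    then show ?thesis unfolding A_big[OF False] good_residues_def by (auto intro: Collect_restrict)
  qed
  have A_nz: "g \<alpha> \<noteq> 0" if "g \<in> A p" "\<alpha> \<in> R" for g p \<alpha>
    using that by (auto simp: A_def good_values_def good_residues_def PiE_iff split: if_splits)
  define T where "T = {f \<in> (\<Pi>\<^sub>E \<alpha>\<in>R. monics (e \<alpha>)). \<forall>p\<in>S. (\<lambda>\<alpha>\<in>R. f \<alpha> mod p ^ 2) \<in> A p}"
  have finPi: "finite (\<Pi>\<^sub>E \<alpha>\<in>R. monics (e \<alpha>) :: 'a poly set)" by (intro finite_PiE R card_monics)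
  have finT: "finite T" unfolding T_def using finPi by simp
  have lin: "{p \<in> S. Polynomial.degree p = 1} = range (\<lambda>x. [:- x, 1:])"
    using linear_monic_primes_eq[where 'a='a] D by (auto simp: S_def)
  have linS: "[:- x, 1:] \<in> S" for x using lin by blast
  have cardT: "real (card T) = ?q ^ ?E * ((\<Prod>x\<in>UNIV. local_density R (v x)) * sieve_product R TYPE('a) D)"
  proof -
    define c where "c p = real (card (A p)) / (?q ^ (2 * Polynomial.degree p)) ^ card R" for p
    have "card T = (\<Prod>\<alpha>\<in>R. CARD('a) ^ (e \<alpha> - M)) * (\<Prod>p\<in>S. card (A p))"
      unfolding T_def M_def by (rule card_tuples_residues[OF S R _ A_sub]) (use eM in \<open>simp add: M_def\<close>)
    then have "real (card T) = (\<Prod>\<alpha>\<in>R. ?q ^ (e \<alpha> - M)) * (\<Prod>p\<in>S. real (card (A p)))" by simp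
    also have "(\<Prod>\<alpha>\<in>R. ?q ^ (e \<alpha> - M)) = (\<Prod>\<alpha>\<in>R. ?q ^ e \<alpha> / ?q ^ M)"
      by (intro prod.cong refl) (use q eM in \<open>simp add: power_diff\<close>)
    also have "\<dots> = ?q ^ ?E / (?q ^ M) ^ card R" by (simp add: prod_dividef power_sum)
    also have "(?q ^ M) ^ card R = (\<Prod>p\<in>S. (?q ^ (2 * Polynomial.degree p)) ^ card R)"
      unfolding M_def power_sum prod_power_distrib ..
    also have "?q ^ ?E / (\<Prod>p\<in>S. (?q ^ (2 * Polynomial.degree p)) ^ card R) * (\<Prod>p\<in>S. real (card (A p))) = ?q ^ ?E * (\<Prod>p\<in>S. c p)"
      unfolding c_def prod_dividef by simp
    also have "(\<Prod>p\<in>S. c p) = (\<Prod>p\<in>{p\<in>S. Polynomial.degree p = 1}. c p) * (\<Prod>p\<in>{p\<in>S. Polynomial.degree p \<noteq> 1}. c p)"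
      using S(1) by (subst prod.union_disjoint[symmetric]) (auto intro!: prod.cong)
    also have "(\<Prod>p\<in>{p\<in>S. Polynomial.degree p = 1}. c p) = (\<Prod>x\<in>UNIV. c [:- x, 1:])"
      unfolding lin by (subst prod.reindex) (auto simp: inj_on_def)
    also have "\<dots> = (\<Prod>x\<in>UNIV. local_density R (v x))"
      using card_good_values[OF R] by (intro prod.cong refl) (simp add: c_def A_lin)
    also have "(\<Prod>p\<in>{p\<in>S. Polynomial.degree p \<noteq> 1}. c p) = sieve_product R TYPE('a) D"
      unfolding sieve_product_def
    proof (rule prod.cong)
      have "Polynomial.degree p \<noteq> 1 \<longleftrightarrow> 2 \<le> Polynomial.degree p" if "p \<in> monic_primes" for p :: "'a poly"
        using monic_primesD(4)[OF that] by linarith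
      then show "{p \<in> S. Polynomial.degree p \<noteq> 1} = {p \<in> monic_primes. 2 \<le> Polynomial.degree p \<and> Polynomial.degree p \<le> D}"
        by (auto simp: S_def)
    qed (simp add: c_def A_big)
    finally show ?thesis .
  qed
  have in_res: "f mod p ^ 2 \<in> res_polys (2 * Polynomial.degree p)" if "p \<in> monic_primes" for f p :: "'a poly"
    using mod_in_res_polys[of "p ^ 2" f] monic_primesD(3)[OF that] degree_prime_square[OF that] by simp
  have lin_val: "poly (f mod [:- x, 1:] ^ 2) x = poly f x" for f :: "'a poly" and x
  proof -
    have "f = f div [:- x, 1:] ^ 2 * [:- x, 1:] ^ 2 + f mod [:- x, 1:] ^ 2" by (rule div_mult_mod_eq[symmetric])
    then have "poly f x = poly (f div [:- x, 1:] ^ 2 * [:- x, 1:] ^ 2 + f mod [:- x, 1:] ^ 2) x" by (rule arg_cong)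
    then show ?thesis by (simp only: poly_add poly_mult poly_power) simp
  qed
  have dvd_mod: "p dvd f mod p ^ 2 \<longleftrightarrow> p dvd f" for f p :: "'a poly"
    by (rule dvd_mod_iff) (simp add: power2_eq_square)
  have sub: "value_tuples R e v \<subseteq> T"
  proof
    fix f assume f: "f \<in> value_tuples R e v"
    then have fm: "f \<in> (\<Pi>\<^sub>E \<alpha>\<in>R. monics (e \<alpha>))" and sq: "\<And>\<alpha>. \<alpha> \<in> R \<Longrightarrow> squarefree (f \<alpha>)"
      and co: "\<And>\<alpha> \<beta>. \<alpha> \<in> R \<Longrightarrow> \<beta> \<in> R \<Longrightarrow> \<alpha> \<noteq> \<beta> \<Longrightarrow> coprime (f \<alpha>) (f \<beta>)"
      and val: "\<And>x \<alpha>. \<alpha> \<in> R \<Longrightarrow> poly (f \<alpha>) x = v x \<alpha>"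
      by (auto simp: value_tuples_def PiE_iff pairwise_def)
    have "(\<lambda>\<alpha>\<in>R. f \<alpha> mod p ^ 2) \<in> A p" if p: "p \<in> S" for p
    proof -
      have pm: "p \<in> monic_primes" using p S by blast
      have pu: "\<not> p dvd 1" using monic_primesD(1)[OF pm] by (simp add: prime_elem_def)
      have nz: "f \<alpha> mod p ^ 2 \<noteq> 0" if "\<alpha> \<in> R" for \<alpha>
        using squarefreeD[OF sq[OF that], of p] pu by (auto simp: dvd_eq_mod_eq_0)
      show ?thesis
      proof (cases "Polynomial.degree p = 1")
        case True
        then obtain x where x: "p = [:- x, 1:]" using p lin by blast
        have "f \<alpha> mod p ^ 2 \<in> {g \<in> res_polys 2. g \<noteq> 0 \<and> poly g x = v x \<alpha>}" if "\<alpha> \<in> R" for \<alpha>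
          using in_res[OF pm, of "f \<alpha>"] True nz[OF that] lin_val[of "f \<alpha>" x] val[OF that] x by simp
        then show ?thesis unfolding x A_lin good_values_def by (simp add: x)
      next
        case False
        have "\<alpha> = \<beta>" if "\<alpha> \<in> R" "\<beta> \<in> R" "p dvd f \<alpha>" "p dvd f \<beta>" for \<alpha> \<beta>
          using co[OF that(1,2)] coprime_common_divisor[of "f \<alpha>" "f \<beta>" p] that(3,4) pu by blast
        then show ?thesis unfolding A_big[OF False] good_residues_def using in_res[OF pm] nz by (simp add: dvd_mod)
      qed
    qed
    then show "f \<in> T" using fm by (simp add: T_def)
  qed
  \<comment> \<open>A prime at which a tuple fails divides one of its entries, so its degree is
    bounded by \<open>?E\<close>.\<close>
  define Big where "Big = {p :: 'a poly. p \<in> monic_primes \<and> D < Polynomial.degree p \<and> Polynomial.degree p \<le> ?E}"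
  have finBig: "finite Big" by (rule finite_subset[OF _ finite_monic_primes[of ?E]]) (auto simp: Big_def)
  define E1 where "E1 p \<alpha> = (\<Pi>\<^sub>E \<gamma>\<in>R. {g \<in> monics (e \<gamma>). (if \<gamma> = \<alpha> then p ^ 2 else 1) dvd g})" for p :: "'a poly" and \<alpha>
  define E2 where "E2 p \<alpha> \<beta> = (\<Pi>\<^sub>E \<gamma>\<in>R. {g \<in> monics (e \<gamma>). (if \<gamma> \<in> {\<alpha>, \<beta>} then p else 1) dvd g})" for p :: "'a poly" and \<alpha> \<beta>
  define W where "W p = (\<Union>\<alpha>\<in>R. E1 p \<alpha>) \<union> (\<Union>(\<alpha>, \<beta>)\<in>{(\<alpha>, \<beta>) \<in> R \<times> R. \<alpha> \<noteq> \<beta>}. E2 p \<alpha> \<beta>)" for p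
  have finE: "finite (E1 p \<alpha>)" "finite (E2 p \<alpha> \<beta>)" for p \<alpha> \<beta>
    unfolding E1_def E2_def by (intro finite_PiE R; simp add: card_monics)+
  have finP: "finite {(\<alpha>, \<beta>) \<in> R \<times> R. \<alpha> \<noteq> \<beta>}" by (rule finite_subset[of _ "R \<times> R"]) (use R in auto)
  have finW: "finite (W p)" for p unfolding W_def using finE R finP by (intro finite_UnI finite_UN_I) auto
  have "T - value_tuples R e v \<subseteq> (\<Union>p\<in>Big. W p)"
  proof
    fix f assume f: "f \<in> T - value_tuples R e v"
    then have fm: "f \<in> (\<Pi>\<^sub>E \<alpha>\<in>R. monics (e \<alpha>))" and fA: "\<And>p. p \<in> S \<Longrightarrow> (\<lambda>\<alpha>\<in>R. f \<alpha> mod p ^ 2) \<in> A p"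
      by (auto simp: T_def)
    have f0: "f \<alpha> \<noteq> 0" and fdeg: "Polynomial.degree (f \<alpha>) \<le> ?E" if "\<alpha> \<in> R" for \<alpha>
    proof -
      have "f \<alpha> \<in> monics (e \<alpha>)" using fm that by blast
      then show "f \<alpha> \<noteq> 0" "Polynomial.degree (f \<alpha>) \<le> ?E"
        using member_le_sum[OF that _ R, of e] by (auto simp: monics_def)
    qed
    have val: "poly (f \<alpha>) x = v x \<alpha>" if "\<alpha> \<in> R" for x \<alpha>
    proof -
      have "(\<lambda>\<alpha>\<in>R. f \<alpha> mod [:- x, 1:] ^ 2) \<in> good_values R x (v x)" using fA[OF linS[of x]] unfolding A_lin .
      then have "(\<lambda>\<alpha>\<in>R. f \<alpha> mod [:- x, 1:] ^ 2) \<alpha> \<in> {g \<in> res_polys 2. g \<noteq> 0 \<and> poly g x = v x \<alpha>}"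
        unfolding good_values_def using that by (rule PiE_mem)
      then show ?thesis using that lin_val[of "f \<alpha>" x] by simp
    qed
    have small1: False if "p \<in> monic_primes" "Polynomial.degree p \<le> D" "\<alpha> \<in> R" "p ^ 2 dvd f \<alpha>" for p \<alpha>
    proof -
      have "p \<in> S" using that by (simp add: S_def)
      from A_nz[OF fA[OF this] that(3)] that(3,4) show False by (simp add: dvd_eq_mod_eq_0)
    qed
    \<comment> \<open>At linear primes the claim comes from \<open>single_zero\<close>, since there
      \<open>A p\<close> only prescribes values.\<close>
    have small2: "\<alpha> = \<beta>" if p: "p \<in> monic_primes" "Polynomial.degree p \<le> D" and ab: "\<alpha> \<in> R" "\<beta> \<in> R"
      "p dvd f \<alpha>" "p dvd f \<beta>" for p \<alpha> \<beta>
    proof -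
      have pS: "p \<in> S" using p by (simp add: S_def)
      show ?thesis
      proof (cases "Polynomial.degree p = 1")
        case True
        then obtain x where x: "p = [:- x, 1:]" using pS lin by blast
        then have "poly (f \<alpha>) x = 0" "poly (f \<beta>) x = 0" using ab by (simp_all add: poly_eq_0_iff_dvd)
        then show ?thesis using v[of x] ab val by (auto simp: single_zero_def)
      next
        case False
        have "(\<lambda>\<alpha>\<in>R. f \<alpha> mod p ^ 2) \<in> good_residues R p" using fA[OF pS] unfolding A_big[OF False] .
        then show ?thesis using ab by (auto simp: good_residues_def dvd_mod)
      qed
    qed
    have big: "p \<in> Big" if "p \<in> monic_primes" "\<not> Polynomial.degree p \<le> D" "\<alpha> \<in> R" "p dvd f \<alpha>" for p \<alpha>
      using that dvd_imp_degree_le[OF that(4) f0[OF that(3)]] fdeg[OF that(3)] by (simp add: Big_def)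
    have pos: "Polynomial.degree x > 0" if "\<not> is_unit x" "x dvd f \<alpha>" "\<alpha> \<in> R" for x \<alpha>
      using that f0[OF that(3)] by (metis dvd_0_left_iff gr0I is_unit_iff_degree)
    consider \<alpha> where "\<alpha> \<in> R" "\<not> squarefree (f \<alpha>)" | \<alpha> \<beta> where "\<alpha> \<in> R" "\<beta> \<in> R" "\<alpha> \<noteq> \<beta>" "\<not> coprime (f \<alpha>) (f \<beta>)"
      using f fm val unfolding value_tuples_def by (auto simp: PiE_iff pairwise_def)
    then show "f \<in> (\<Union>p\<in>Big. W p)"
    proof cases
      case 1
      then obtain x where x: "x ^ 2 dvd f \<alpha>" "\<not> x dvd 1" unfolding squarefree_def by blast
      then have "x dvd f \<alpha>" by (metis dvd_mult_left power2_eq_square)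
      then obtain p where p: "p \<in> monic_primes" "p dvd x" using pos[of x \<alpha>] x(2) 1(1) monic_prime_factor_exists by blast
      then have p2: "p ^ 2 dvd f \<alpha>" using x(1) by (meson dvd_power_same dvd_trans)
      then have "p dvd f \<alpha>" by (metis dvd_mult_left power2_eq_square)
      then have "p \<in> Big" using big[OF p(1) _ 1(1)] small1[OF p(1) _ 1(1) p2] by blast
      moreover have "f \<in> E1 p \<alpha>" using fm p2 by (auto simp: E1_def PiE_iff)
      ultimately show ?thesis using 1(1) by (auto simp: W_def)
    next
      case 2
      then obtain x where x: "x dvd f \<alpha>" "x dvd f \<beta>" "\<not> is_unit x" by (rule_tac not_coprimeE)
      then obtain p where p: "p \<in> monic_primes" "p dvd x" using pos[of x \<alpha>] 2(1) monic_prime_factor_exists by blast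
      then have pd: "p dvd f \<alpha>" "p dvd f \<beta>" using x by (meson dvd_trans)+
      then have "p \<in> Big" using big[OF p(1) _ 2(1)] small2[OF p(1) _ 2(1,2)] 2(3) by blast
      moreover have "f \<in> E2 p \<alpha> \<beta>" using fm pd by (auto simp: E2_def PiE_iff)
      ultimately show ?thesis using 2 by (auto simp: W_def)
    qed
  qed
  then have "card (T - value_tuples R e v) \<le> card (\<Union>p\<in>Big. W p)" using finBig finW by (intro card_mono) auto
  also have "\<dots> \<le> (\<Sum>p\<in>Big. card (W p))" by (rule card_UN_le[OF finBig])
  finally have "real (card (T - value_tuples R e v)) \<le> real (\<Sum>p\<in>Big. card (W p))" by (simp only: of_nat_le_iff)
  also have "\<dots> \<le> (\<Sum>p\<in>Big. (real (card R) + real (card R) ^ 2) * (?q ^ ?E * (1 / ?q) ^ (2 * Polynomial.degree p)))"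
    unfolding of_nat_sum
  proof (rule sum_mono)
    fix p assume "p \<in> Big"
    then have p: "p \<in> monic_primes" by (simp add: Big_def)
    have pm: "p \<in> monics (Polynomial.degree p)" using monic_primesD(2)[OF p] by (simp add: monics_def)
    have p2m: "p ^ 2 \<in> monics (2 * Polynomial.degree p)"
      using prod_prime_squares_monic[of "{p}"] p by simp
    have one: "(1 :: 'a poly) \<in> monics 0" by (simp add: monics_def)
    have prodq: "(\<Prod>\<gamma>\<in>R. ?q ^ e \<gamma>) = ?q ^ ?E" by (simp add: power_sum)
    show "real (card (W p)) \<le> (real (card R) + real (card R) ^ 2) * (?q ^ ?E * (1 / ?q) ^ (2 * Polynomial.degree p))"
      unfolding W_def
    proof (rule card_single_pair_union_le[OF R])
      fix \<alpha> assume \<alpha>: "\<alpha> \<in> R"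
      have "real (card (E1 p \<alpha>)) \<le> (\<Prod>\<gamma>\<in>R. ?q ^ e \<gamma>) * (\<Prod>\<gamma>\<in>R. if \<gamma> = \<alpha> then (1 / ?q) ^ (2 * Polynomial.degree p) else 1)"
        unfolding E1_def
      proof (rule card_PiE_ratio_le[OF R])
        fix \<gamma>
        show "real (card {g \<in> monics (e \<gamma>). (if \<gamma> = \<alpha> then p ^ 2 else 1) dvd g}) \<le>
            ?q ^ e \<gamma> * (if \<gamma> = \<alpha> then (1 / ?q) ^ (2 * Polynomial.degree p) else 1)"
          using card_monics_dvd_le[OF p2m, of "e \<gamma>"] card_monics_dvd_le[OF one, of "e \<gamma>"]
          by (cases "\<gamma> = \<alpha>") auto
      qed
      also have "(\<Prod>\<gamma>\<in>R. if \<gamma> = \<alpha> then (1 / ?q) ^ (2 * Polynomial.degree p) else 1) = (1 / ?q) ^ (2 * Polynomial.degree p)"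
        using R \<alpha> by simp
      finally show "real (card (E1 p \<alpha>)) \<le> ?q ^ ?E * (1 / ?q) ^ (2 * Polynomial.degree p)" unfolding prodq .
    next
      fix \<alpha> \<beta> assume ab: "\<alpha> \<in> R" "\<beta> \<in> R" "\<alpha> \<noteq> \<beta>"
      have "real (card (E2 p \<alpha> \<beta>)) \<le> (\<Prod>\<gamma>\<in>R. ?q ^ e \<gamma>) * (\<Prod>\<gamma>\<in>R. if \<gamma> \<in> {\<alpha>, \<beta>} then (1 / ?q) ^ Polynomial.degree p else 1)"
        unfolding E2_def
      proof (rule card_PiE_ratio_le[OF R])
        fix \<gamma>
        show "real (card {g \<in> monics (e \<gamma>). (if \<gamma> \<in> {\<alpha>, \<beta>} then p else 1) dvd g}) \<le>
            ?q ^ e \<gamma> * (if \<gamma> \<in> {\<alpha>, \<beta>} then (1 / ?q) ^ Polynomial.degree p else 1)"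
          using card_monics_dvd_le[OF pm, of "e \<gamma>"] card_monics_dvd_le[OF one, of "e \<gamma>"] by simp
      qed
      also have "\<dots> = ?q ^ ?E * (1 / ?q) ^ (2 * Polynomial.degree p)"
        unfolding prodq prod_two_indices[OF R ab] by (simp only: power_mult[symmetric] mult.commute[of 2])
      finally show "real (card (E2 p \<alpha> \<beta>)) \<le> ?q ^ ?E * (1 / ?q) ^ (2 * Polynomial.degree p)" .
    qed (use finE q in auto)
  qed
  also have "\<dots> = ?q ^ ?E * ((real (card R) + real (card R) ^ 2) * (\<Sum>p\<in>Big. (1 / ?q) ^ (2 * Polynomial.degree p)))"
    unfolding sum_distrib_left by (intro sum.cong refl) (simp only: ac_simps)
  also have "\<dots> \<le> ?q ^ ?E * ((real (card R) + real (card R) ^ 2) * (1 / ?q) ^ D)"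
    using q by (intro mult_left_mono sum_monic_primes_le finBig) (auto simp: Big_def)
  finally have bad: "real (card (T - value_tuples R e v)) \<le> ?q ^ ?E * ((real (card R) + real (card R) ^ 2) * (1 / ?q) ^ D)" .
  have "real (card T) - real (card (value_tuples R e v)) = real (card (T - value_tuples R e v))"
    using card_Diff_subset[OF finite_subset[OF sub finT] sub] card_mono[OF finT sub] by (simp add: of_nat_diff)
  then show ?thesis using bad cardT by linarith
qed

lemma local_density_bounds: "0 \<le> local_density R w" "local_density R w \<le> 1" for w :: "'i \<Rightarrow> 'a::{field,finite}"
proof -
  let ?q = "real CARD('a)"
  have q: "?q \<ge> 2" using card_field_ge2[where 'a='a] by simp
  have "1 * ?q \<le> ?q * ?q" using q by (intro mult_right_mono) linarith+
  then have "?q - 1 \<le> ?q ^ 2" unfolding power2_eq_square by linarith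
  then have "0 \<le> (?q - 1) / ?q ^ 2" "(?q - 1) / ?q ^ 2 \<le> 1" using q by (simp_all add: divide_le_eq_1)
  moreover have "0 \<le> 1 / ?q" "1 / ?q \<le> 1" using q by simp_all
  ultimately show "0 \<le> local_density R w" "local_density R w \<le> 1"
    unfolding local_density_def by (auto intro!: prod_nonneg prod_le_1)
qed

text \<open>The threshold \<open>N\<close> is uniform in the values \<open>v\<close>, and
  \<open>B\<close> does not depend on them. \<open>D\<close> is chosen to make both the sieve error
  and the truncation of the Euler product small, then \<open>N\<close> to make the count by
  remainders exact.\<close>

theorem value_tuples_density:
  assumes R: "finite R"
  obtains B where "B > 0" "\<And>\<epsilon>. \<epsilon> > 0 \<Longrightarrow> \<exists>N. \<forall>e v. (\<forall>\<alpha>\<in>R. N \<le> e \<alpha>) \<longrightarrow> (\<forall>x :: 'a::{field,finite}. single_zero R (v x)) \<longrightarrow>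
    \<bar>real (card (value_tuples R e v)) / real CARD('a) ^ (\<Sum>\<alpha>\<in>R. e \<alpha>) - (\<Prod>x\<in>UNIV. local_density R (v x)) * B\<bar> \<le> \<epsilon>"
proof -
  obtain B where B: "B > 0" "sieve_product R TYPE('a) \<longlonglongrightarrow> B" by (rule sieve_product_converges[OF R])
  let ?q = "real CARD('a)"
  have q: "?q \<ge> 2" using card_field_ge2[where 'a='a] by simp
  define K where "K = real (card R) + real (card R) ^ 2"
  show ?thesis
  proof (rule that[OF B(1)])
    fix \<epsilon> :: real assume eps: "\<epsilon> > 0"
    have "(\<lambda>D. K * (1 / ?q) ^ D) \<longlonglongrightarrow> K * 0"
      using q by (intro tendsto_mult tendsto_const LIMSEQ_realpow_zero) auto
    then have "eventually (\<lambda>D. K * (1 / ?q) ^ D < \<epsilon> / 2) sequentially" by (rule order_tendstoD) (use eps in simp)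
    moreover have "eventually (\<lambda>D. dist (sieve_product R TYPE('a) D) B < \<epsilon> / 2) sequentially"
      by (rule tendstoD[OF B(2)]) (use eps in simp)
    moreover have "eventually (\<lambda>D. D \<ge> 1) sequentially" by (rule eventually_ge_at_top)
    ultimately have "eventually (\<lambda>D. K * (1 / ?q) ^ D < \<epsilon> / 2 \<and> dist (sieve_product R TYPE('a) D) B < \<epsilon> / 2 \<and> D \<ge> 1) sequentially"
      by eventually_elim simp
    then obtain D where D: "K * (1 / ?q) ^ D < \<epsilon> / 2" "\<bar>sieve_product R TYPE('a) D - B\<bar> < \<epsilon> / 2" "D \<ge> 1"
      by (auto simp: eventually_sequentially dist_real_def)
    define N where "N = (\<Sum>p\<in>{p \<in> monic_primes. Polynomial.degree (p :: 'a poly) \<le> D}. 2 * Polynomial.degree p)"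
    show "\<exists>N. \<forall>e v. (\<forall>\<alpha>\<in>R. N \<le> e \<alpha>) \<longrightarrow> (\<forall>x :: 'a. single_zero R (v x)) \<longrightarrow>
      \<bar>real (card (value_tuples R e v)) / ?q ^ (\<Sum>\<alpha>\<in>R. e \<alpha>) - (\<Prod>x\<in>UNIV. local_density R (v x)) * B\<bar> \<le> \<epsilon>"
    proof (intro exI[of _ N] allI impI)
      fix e and v :: "'a \<Rightarrow> 'b \<Rightarrow> 'a"
      assume e: "\<forall>\<alpha>\<in>R. N \<le> e \<alpha>" and v: "\<forall>x. single_zero R (v x)"
      let ?Q = "?q ^ (\<Sum>\<alpha>\<in>R. e \<alpha>)" and ?l = "\<Prod>x\<in>UNIV. local_density R (v x)"
      have Q: "?Q > 0" using q by simp
      have l: "0 \<le> ?l" "?l \<le> 1" by (auto intro!: prod_nonneg prod_le_1 local_density_bounds)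
      have "\<bar>real (card (value_tuples R e v)) - ?Q * (?l * sieve_product R TYPE('a) D)\<bar> \<le> ?Q * (K * (1 / ?q) ^ D)"
        unfolding K_def by (rule value_tuples_approx[OF R D(3)]) (use v e in \<open>auto simp: N_def\<close>)
      also have "real (card (value_tuples R e v)) - ?Q * (?l * sieve_product R TYPE('a) D) =
          ?Q * (real (card (value_tuples R e v)) / ?Q - ?l * sieve_product R TYPE('a) D)"
        using Q by (simp add: algebra_simps)
      also have "\<bar>\<dots>\<bar> = ?Q * \<bar>real (card (value_tuples R e v)) / ?Q - ?l * sieve_product R TYPE('a) D\<bar>"
        using Q by (simp only: abs_mult abs_of_pos)
      finally have 1: "\<bar>real (card (value_tuples R e v)) / ?Q - ?l * sieve_product R TYPE('a) D\<bar> \<le> \<epsilon> / 2"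
        using Q D(1) by (simp add: mult_le_cancel_left_pos)
      have "\<bar>?l * sieve_product R TYPE('a) D - ?l * B\<bar> = ?l * \<bar>sieve_product R TYPE('a) D - B\<bar>"
        using l by (simp only: right_diff_distrib[symmetric] abs_mult abs_of_nonneg)
      also have "\<dots> \<le> 1 * \<bar>sieve_product R TYPE('a) D - B\<bar>" by (rule mult_right_mono) (use l in auto)
      also have "\<dots> \<le> \<epsilon> / 2" using D(2) by simp
      finally have 2: "\<bar>?l * sieve_product R TYPE('a) D - ?l * B\<bar> \<le> \<epsilon> / 2" .
      show "\<bar>real (card (value_tuples R e v)) / ?Q - ?l * B\<bar> \<le> \<epsilon>" using 1 2 by linarith
    qed
  qed
qed

subsection \<open>Element orders in the product of cyclic groups\<close>

lemma card_index_vectors: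
  assumes "\<And>j. j \<in> {1..n} \<Longrightarrow> r j > 0"
  shows "card (index_vectors n r) + 1 = (\<Prod>j\<in>{1..n}. r j)"
proof -
  have "(\<lambda>j\<in>{1..n}. 0) \<in> (\<Pi>\<^sub>E j\<in>{1..n}. {0..<r j})" using assms by auto
  moreover have "card (\<Pi>\<^sub>E j\<in>{1..n}. {0..<r j}) = (\<Prod>j\<in>{1..n}. r j)" by (simp add: card_PiE)
  moreover have "finite (\<Pi>\<^sub>E j\<in>{1..n}. {0..<r j})" by (intro finite_PiE) auto
  ultimately show ?thesis unfolding index_vectors_def
    by (metis One_nat_def Suc_eq_plus1 card_Suc_Diff1)
qed

lemma order_prod_cyclic_group:
  assumes "\<And>j. j \<in> {1..n} \<Longrightarrow> r j > 0"
  shows "Coset.order (prod_cyclic_group n r) = (\<Prod>j\<in>{1..n}. r j)"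
proof -
  have "card (carrier (integer_mod_group (r j))) = r j" if "j \<in> {1..n}" for j
    using assms[OF that] by (simp add: carrier_integer_mod_group)
  then show ?thesis by (simp add: Coset.order_def prod_cyclic_group_def card_PiE)
qed

lemma pow_product_group:
  assumes "\<And>i. i \<in> I \<Longrightarrow> group (G i)" "x \<in> carrier (product_group I G)"
  shows "x [^]\<^bsub>product_group I G\<^esub> (m::nat) = (\<lambda>i\<in>I. x i [^]\<^bsub>G i\<^esub> m)"
proof (induction m)
  case 0
  then show ?case by (simp add: nat_pow_def)
next
  case (Suc m)
  have "x [^]\<^bsub>product_group I G\<^esub> Suc m = (\<lambda>i\<in>I. (\<lambda>i\<in>I. x i [^]\<^bsub>G i\<^esub> m) i \<otimes>\<^bsub>G i\<^esub> x i)"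
    using Suc by (simp add: nat_pow_def)
  also have "\<dots> = (\<lambda>i\<in>I. x i [^]\<^bsub>G i\<^esub> Suc m)" by (simp add: fun_eq_iff nat_pow_def)
  finally show ?case .
qed

lemma ord_prod_cyclic_group:
  assumes r: "\<And>j. j \<in> {1..n} \<Longrightarrow> r j > 0" and x: "x \<in> carrier (prod_cyclic_group n r)"
  shows "group.ord (prod_cyclic_group n r) x = vector_order {1..n} r x"
proof -
  let ?G = "prod_cyclic_group n r"
  interpret G: Group.group ?G unfolding prod_cyclic_group_def by (intro product_group) simp
  have N: "(\<Prod>j\<in>{1..n}. r j) > 0" using r by (intro prod_pos) auto
  have d: "r j dvd (\<Prod>j\<in>{1..n}. r j)" if "j \<in> {1..n}" for j using that by (intro dvd_prodI) auto
  have "G.ord x dvd m \<longleftrightarrow> vector_order {1..n} r x dvd m" for m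
  proof -
    have "G.ord x dvd m \<longleftrightarrow> x [^]\<^bsub>?G\<^esub> m = \<one>\<^bsub>?G\<^esub>" using G.pow_eq_id[OF x] by simp
    also have "\<dots> \<longleftrightarrow> (\<forall>j\<in>{1..n}. (int m * x j) mod int (r j) = 0)"
      using x unfolding prod_cyclic_group_def by (subst pow_product_group) (auto simp: fun_eq_iff)
    also have "\<dots> \<longleftrightarrow> (\<forall>j\<in>{1..n}. int (r j) dvd int m * x j)" by (simp add: dvd_eq_mod_eq_0)
    also have "\<dots> \<longleftrightarrow> int (vector_order {1..n} r x) dvd int m" by (rule vector_order(2)[OF d N])
    finally show ?thesis by simp
  qed
  then show ?thesis by (metis dvd_antisym dvd_refl)
qed

definition index_order :: "nat \<Rightarrow> (nat \<Rightarrow> nat) \<Rightarrow> (nat \<Rightarrow> nat) \<Rightarrow> nat" where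
  "index_order n r \<alpha> = vector_order {1..n} r (\<lambda>j. int (\<alpha> j))"

lemma index_order:
  assumes r: "\<And>j. j \<in> {1..n} \<Longrightarrow> r j dvd N" "N > 0"
  shows "index_order n r \<alpha> > 0" "index_order n r \<alpha> dvd N"
  unfolding index_order_def
  using vector_order(1,3)[of "{1..n}" r N "\<lambda>j. int (\<alpha> j)"] r by blast+

lemma index_order_neq_1:
  assumes r: "\<And>j. j \<in> {1..n} \<Longrightarrow> r j > 0" and a: "\<alpha> \<in> index_vectors n r"
  shows "index_order n r \<alpha> \<noteq> 1"
proof
  assume 1: "index_order n r \<alpha> = 1"
  have N: "(\<Prod>j\<in>{1..n}. r j) > 0" using r by (intro prod_pos) auto
  have d: "r j dvd (\<Prod>j\<in>{1..n}. r j)" if "j \<in> {1..n}" for j using that by (intro dvd_prodI) auto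
  have "int (vector_order {1..n} r (\<lambda>j. int (\<alpha> j))) dvd 1" unfolding 1[unfolded index_order_def] by simp
  then have "\<forall>j\<in>{1..n}. int (r j) dvd 1 * int (\<alpha> j)"
    using vector_order(2)[where r = r and k = 1 and a = "\<lambda>j. int (\<alpha> j)", OF d N] by blast
  then have "r j dvd \<alpha> j" if "j \<in> {1..n}" for j using that by simp
  moreover have "\<alpha> j < r j" if "j \<in> {1..n}" for j using a that by (auto simp: index_vectors_def)
  ultimately have "\<alpha> j = 0" if "j \<in> {1..n}" for j using that by (metis dvd_imp_le gr0I not_le)
  then have "\<alpha> = (\<lambda>j\<in>{1..n}. 0)" using a by (auto simp: index_vectors_def fun_eq_iff PiE_iff extensional_def)
  then show False using a by (simp add: index_vectors_def)
qed

text \<open>Index vectors are the nonneutral elements of the group, written with natural numbers;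
  the neutral element is the only one of order 1.\<close>

lemma num_elements_of_order_eq:
  assumes r: "\<And>j. j \<in> {1..n} \<Longrightarrow> r j > 0" and s: "s \<noteq> 1"
  shows "num_elements_of_order (prod_cyclic_group n r) s = card {\<alpha> \<in> index_vectors n r. index_order n r \<alpha> = s}"
proof -
  let ?G = "prod_cyclic_group n r"
  have carr: "carrier ?G = (\<Pi>\<^sub>E j\<in>{1..n}. {0..<int (r j)})"
    unfolding prod_cyclic_group_def carrier_product_group
    by (intro PiE_cong) (use r in \<open>auto simp: carrier_integer_mod_group\<close>)
  let ?f = "\<lambda>\<alpha>. \<lambda>j\<in>{1..n}. int (\<alpha> j)" and ?h = "\<lambda>x. \<lambda>j\<in>{1..n}. nat (x j)"
  have ord_f: "vector_order {1..n} r (?f \<alpha>) = index_order n r \<alpha>" for \<alpha>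
    unfolding index_order_def by (rule vector_order_cong) simp
  have zero: "vector_order {1..n} r x = 1" if "\<And>j. j \<in> {1..n} \<Longrightarrow> x j = 0" for x
    unfolding vector_order_def by (rule Least_equality) (use that in auto)
  have "bij_betw ?f {\<alpha> \<in> index_vectors n r. index_order n r \<alpha> = s} {x \<in> carrier ?G. group.ord ?G x = s}"
  proof (rule bij_betwI[where g = ?h])
    show "?f \<in> {\<alpha> \<in> index_vectors n r. index_order n r \<alpha> = s} \<rightarrow> {x \<in> carrier ?G. group.ord ?G x = s}"
    proof
      fix \<alpha> assume a: "\<alpha> \<in> {\<alpha> \<in> index_vectors n r. index_order n r \<alpha> = s}"
      then have "?f \<alpha> \<in> carrier ?G" unfolding carr by (auto simp: index_vectors_def)
      then show "?f \<alpha> \<in> {x \<in> carrier ?G. group.ord ?G x = s}" using a ord_f ord_prod_cyclic_group[OF r] by simp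
    qed
    show "?h \<in> {x \<in> carrier ?G. group.ord ?G x = s} \<rightarrow> {\<alpha> \<in> index_vectors n r. index_order n r \<alpha> = s}"
    proof
      fix x assume x: "x \<in> {x \<in> carrier ?G. group.ord ?G x = s}"
      then have xr: "0 \<le> x j" "x j < int (r j)" if "j \<in> {1..n}" for j using that unfolding carr by (auto simp: PiE_iff)
      have ox: "vector_order {1..n} r x = s" using x ord_prod_cyclic_group[OF r] by auto
      have "vector_order {1..n} r (\<lambda>j. int (?h x j)) = vector_order {1..n} r x"
        by (rule vector_order_cong) (use xr in auto)
      then have "index_order n r (?h x) = s" using ox by (simp add: index_order_def)
      moreover have "?h x \<noteq> (\<lambda>j\<in>{1..n}. 0)"
      proof
        assume eq: "?h x = (\<lambda>j\<in>{1..n}. 0)"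
        have "x j = 0" if "j \<in> {1..n}" for j using fun_cong[OF eq, of j] xr[OF that] that by simp
        then show False using zero ox s by blast
      qed
      moreover have "?h x \<in> (\<Pi>\<^sub>E j\<in>{1..n}. {0..<r j})" using xr by (auto simp: nat_less_iff)
      ultimately show "?h x \<in> {\<alpha> \<in> index_vectors n r. index_order n r \<alpha> = s}" by (simp add: index_vectors_def)
    qed
    show "?h (?f \<alpha>) = \<alpha>" if "\<alpha> \<in> {\<alpha> \<in> index_vectors n r. index_order n r \<alpha> = s}" for \<alpha>
      using that by (auto simp: index_vectors_def fun_eq_iff PiE_iff extensional_def)
    show "?f (?h x) = x" if "x \<in> {x \<in> carrier ?G. group.ord ?G x = s}" for x
      using that unfolding carr by (auto simp: fun_eq_iff PiE_iff extensional_def)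
  qed
  then show ?thesis unfolding num_elements_of_order_def by (rule bij_betw_same_card[symmetric])
qed

subsection \<open>The distribution of the local point counts\<close>

lemma double_count:
  assumes "finite A" "finite B"
  shows "(\<Sum>a\<in>A. card {b\<in>B. P a b}) = (\<Sum>b\<in>B. card {a\<in>A. P a b})"
  using sum.swap_restrict[OF assms, of "\<lambda>_ _. 1::nat" P] by simp

lemma card_is_power_scaled:
  fixes u :: "'a::{field,finite}"
  assumes "m dvd CARD('a) - 1" "u \<noteq> 0"
  shows "card {x. x \<noteq> 0 \<and> is_power m (u * x)} = (CARD('a) - 1) div m"
proof -
  have "bij_betw (\<lambda>x. u * x) {x. x \<noteq> 0 \<and> is_power m (u * x)} {x. x \<noteq> 0 \<and> is_power m x}"
    by (rule bij_betwI[where g = "\<lambda>x. x / u"]) (use assms(2) in auto)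
  from bij_betw_same_card[OF this] card_is_power[OF assms(1)] show ?thesis by simp
qed

lemma card_scaled_power_tuples:
  fixes u :: "nat \<Rightarrow> 'a::{field,finite}"
  assumes J: "finite J" and r: "\<And>j. j \<in> J \<Longrightarrow> r j dvd CARD('a) - 1" and u: "\<And>j. j \<in> J \<Longrightarrow> u j \<noteq> 0"
  shows "card {c \<in> (\<Pi>\<^sub>E j\<in>J. UNIV - {0}). \<forall>j\<in>J. is_power (r j) (u j * c j)} * (\<Prod>j\<in>J. r j) = (CARD('a) - 1) ^ card J"
proof -
  have "{c \<in> (\<Pi>\<^sub>E j\<in>J. UNIV - {0}). \<forall>j\<in>J. is_power (r j) (u j * c j)} = (\<Pi>\<^sub>E j\<in>J. {x. x \<noteq> 0 \<and> is_power (r j) (u j * x)})"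
    by (auto simp: PiE_iff extensional_def)
  then have "card {c \<in> (\<Pi>\<^sub>E j\<in>J. UNIV - {0}). \<forall>j\<in>J. is_power (r j) (u j * c j)} = (\<Prod>j\<in>J. (CARD('a) - 1) div r j)"
    using r u J by (simp add: card_PiE card_is_power_scaled)
  then have "card {c \<in> (\<Pi>\<^sub>E j\<in>J. UNIV - {0}). \<forall>j\<in>J. is_power (r j) (u j * c j)} * (\<Prod>j\<in>J. r j) =
      (\<Prod>j\<in>J. (CARD('a) - 1) div r j * r j)" by (simp add: prod.distrib)
  also have "\<dots> = (\<Prod>j\<in>J. CARD('a) - 1)" by (rule prod.cong[OF refl]) (use r in simp)
  finally show ?thesis by simp
qed

lemma local_points_neq_0_iff:
  assumes "finite J" "\<And>j. j \<in> J \<Longrightarrow> r j > 0"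
  shows "local_points J r a u \<noteq> 0 \<longleftrightarrow> (\<exists>l. l \<noteq> 0 \<and> (\<forall>j\<in>J. is_power (r j) (l powi a j * u j)))"
    "local_points J r a u \<noteq> 0 \<Longrightarrow> local_points J r a u = (\<Prod>j\<in>J. r j) div vector_order J r a"
    "(\<Prod>j\<in>J. r j) div vector_order J r a > 0"
proof -
  have N: "(\<Prod>j\<in>J. r j) > 0" using assms by (intro prod_pos) auto
  have d: "r j dvd (\<Prod>j\<in>J. r j)" if "j \<in> J" for j using that assms by (intro dvd_prodI) auto
  show pos: "(\<Prod>j\<in>J. r j) div vector_order J r a > 0"
    using vector_order(1,3)[OF d N, where a = a] N by (simp add: div_greater_zero_iff dvd_imp_le)
  show "local_points J r a u \<noteq> 0 \<longleftrightarrow> (\<exists>l. l \<noteq> 0 \<and> (\<forall>j\<in>J. is_power (r j) (l powi a j * u j)))"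
    using pos by (simp add: local_points_def)
  show "local_points J r a u = (\<Prod>j\<in>J. r j) div vector_order J r a" if "local_points J r a u \<noteq> 0"
    using that by (auto simp: local_points_def split: if_splits)
qed

text \<open>In the next two lemmas the pairs \<open>(l, c)\<close> resp. \<open>(l, w)\<close> with
  \<open>l^(a j) * \<dots>\<close> an \<open>r j\<close>-th power for all \<open>j\<close> are counted in two ways.\<close>

lemma card_good_constants:
  assumes J: "finite J" and r: "\<And>j. j \<in> J \<Longrightarrow> r j dvd CARD('a) - 1"
  shows "card {c \<in> (\<Pi>\<^sub>E j\<in>J. UNIV - {0 :: 'a::{field,finite}}). local_points J r a c \<noteq> 0} * (\<Prod>j\<in>J. r j) =
    vector_order J r a * (CARD('a) - 1) ^ card J"
proof -
  let ?q1 = "CARD('a) - 1"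
  have q1: "?q1 > 0" using card_field_ge2[where 'a='a] by simp
  let ?s = "vector_order J r a"
  note s = vector_order[of J r ?q1, OF r q1, where a = a]
  have r_pos: "r j > 0" if "j \<in> J" for j using r[OF that] q1 by (auto intro: Nat.gr0I)
  let ?A = "\<Pi>\<^sub>E j\<in>J. UNIV - {0 :: 'a}" and ?B = "UNIV - {0 :: 'a}"
  let ?P = "\<lambda>c l. \<forall>j\<in>J. is_power (r j) (l powi a j * c j)"
  have finA: "finite ?A" by (intro finite_PiE J) auto
  obtain m where m: "?q1 = ?s * m" using s(3) by (auto elim: dvdE)
  then have "m > 0" using q1 by (auto intro: Nat.gr0I)
  have sol: "card {l \<in> ?B. ?P c l} = (if local_points J r a c \<noteq> 0 then m else 0)" if c: "c \<in> ?A" for c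
  proof (cases "local_points J r a c \<noteq> 0")
    case True
    then have ex: "\<exists>l. l \<noteq> 0 \<and> ?P c l" using local_points_neq_0_iff(1)[where r = r, OF J r_pos] by blast
    have "card {l. l \<noteq> 0 \<and> ?P c l} = ?q1 div ?s"
      by (rule card_power_solutions[OF r s(2,3) _ ex]) (use c in auto)
    then show ?thesis using True m s(1) by (simp add: conj_commute)
  next
    case False
    then have "\<not> (\<exists>l. l \<noteq> 0 \<and> ?P c l)" using local_points_neq_0_iff(1)[where r = r, OF J r_pos] by blast
    then have "{l \<in> ?B. ?P c l} = {}" by blast
    then show ?thesis using False by simp
  qed
  have S12: "(\<Sum>c\<in>?A. card {l\<in>?B. ?P c l}) = (\<Sum>l\<in>?B. card {c\<in>?A. ?P c l})" by (rule double_count[OF finA]) simp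
  have S1: "(\<Sum>c\<in>?A. card {l\<in>?B. ?P c l}) = m * card {c\<in>?A. local_points J r a c \<noteq> 0}"
  proof -
    have "(\<Sum>c\<in>?A. card {l\<in>?B. ?P c l}) = (\<Sum>c\<in>?A. if local_points J r a c \<noteq> 0 then m else 0)"
      by (rule sum.cong[OF refl sol])
    also have "\<dots> = (\<Sum>c\<in>{c\<in>?A. local_points J r a c \<noteq> 0}. m)" by (rule sum.inter_filter[OF finA, symmetric])
    finally show ?thesis by simp
  qed
  have S2: "(\<Sum>l\<in>?B. card {c\<in>?A. ?P c l}) * (\<Prod>j\<in>J. r j) = (\<Sum>l\<in>?B. ?q1 ^ card J)"
    unfolding sum_distrib_right by (intro sum.cong refl card_scaled_power_tuples J r) auto
  have S3: "(\<Sum>l\<in>?B. ?q1 ^ card J) = ?q1 * ?q1 ^ card J" by (simp add: card_Diff_singleton)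
  have "m * card {c\<in>?A. local_points J r a c \<noteq> 0} * (\<Prod>j\<in>J. r j) = ?q1 * ?q1 ^ card J" unfolding S1[symmetric] S12 S2 S3 ..
  also have "\<dots> = ?s * m * ?q1 ^ card J" by (rule arg_cong[OF m, of "\<lambda>x. x * ?q1 ^ card J"])
  finally have "m * (card {c\<in>?A. local_points J r a c \<noteq> 0} * (\<Prod>j\<in>J. r j)) = m * (?s * ?q1 ^ card J)"
    by (simp only: ac_simps)
  then show ?thesis using \<open>m > 0\<close> by simp
qed

text \<open>Spreading \<open>c\<close> over the unit vectors realises \<open>c i\<close> as a
  product of values. Only indices with \<open>r i \<ge> 2\<close> are treated, since otherwise the
  unit vector is not an index vector.\<close>

lemma prod_unit_vectors:
  fixes c :: "nat \<Rightarrow> 'a::field"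
  assumes r: "\<And>j. j \<in> {1..n} \<Longrightarrow> r j > 0" and i: "i \<in> {1..n}" "r i \<ge> 2"
  shows "(\<Prod>\<gamma>\<in>index_vectors n r. (\<Prod>j\<in>{j\<in>{1..n}. r j \<ge> 2 \<and> \<gamma> = unit_vector n j}. c j) ^ \<gamma> i) = c i"
proof -
  let ?R = "index_vectors n r" and ?e = "unit_vector n i"
  have e: "?e \<in> ?R" using unit_vector_in_index_vectors i r by blast
  have inj: "j = j'" if "unit_vector n j = unit_vector n j'" "j \<in> {1..n}" for j j'
  proof (rule ccontr)
    assume "j \<noteq> j'"
    then have "unit_vector n j j = 1" "unit_vector n j' j = 0" using that(2) unfolding unit_vector_def by auto
    then show False using fun_cong[OF that(1), of j] by (metis zero_neq_one)
  qed
  have "(\<Prod>j\<in>{j\<in>{1..n}. r j \<ge> 2 \<and> \<gamma> = unit_vector n j}. c j) ^ \<gamma> i = (if \<gamma> = ?e then c i else 1)" for \<gamma>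
  proof (cases "\<exists>j\<in>{1..n}. r j \<ge> 2 \<and> \<gamma> = unit_vector n j")
    case True
    then obtain j where j: "j \<in> {1..n}" "r j \<ge> 2" "\<gamma> = unit_vector n j" by blast
    then have set: "{j\<in>{1..n}. r j \<ge> 2 \<and> \<gamma> = unit_vector n j} = {j}" using inj by blast
    have "\<gamma> i = (if i = j then 1 else 0)" using j(3) i by (simp add: unit_vector_def)
    moreover have "\<gamma> = ?e \<longleftrightarrow> i = j" using inj j i by metis
    ultimately show ?thesis unfolding set by simp
  next
    case False
    then have set: "{j\<in>{1..n}. r j \<ge> 2 \<and> \<gamma> = unit_vector n j} = {}" and "\<gamma> \<noteq> ?e" using i by blast+
    then show ?thesis unfolding set by simp
  qed
  then show ?thesis using e finite_index_vectors[of n r] by simp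
qed

text \<open>The count does not depend on \<open>c\<close>, because \<open>c\<close> can be absorbed
  into the values at the unit vectors. It is then found by summing over all \<open>c\<close> and
  interchanging the sums.\<close>

lemma card_good_values_nonzero:
  fixes c :: "nat \<Rightarrow> 'a::{field,finite}"
  assumes r: "\<And>j. j \<in> {1..n} \<Longrightarrow> r j dvd CARD('a) - 1" and c: "\<And>j. j \<in> {1..n} \<Longrightarrow> c j \<noteq> 0"
  shows "card {w \<in> (\<Pi>\<^sub>E \<gamma>\<in>index_vectors n r. UNIV - {0 :: 'a}).
      \<forall>j\<in>{1..n}. is_power (r j) (c j * (\<Prod>\<gamma>\<in>index_vectors n r. w \<gamma> ^ \<gamma> j))} * (\<Prod>j\<in>{1..n}. r j) =
    (CARD('a) - 1) ^ card (index_vectors n r)"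
proof -
  let ?R = "index_vectors n r" and ?J = "{1..n}"
  let ?q1 = "CARD('a) - 1"
  have q1: "?q1 > 0" using card_field_ge2[where 'a='a] by simp
  have r_pos: "r j > 0" if "j \<in> ?J" for j using r[OF that] q1 by (auto intro: Nat.gr0I)
  let ?A = "\<Pi>\<^sub>E j\<in>?J. UNIV - {0 :: 'a}" and ?B = "\<Pi>\<^sub>E \<gamma>\<in>?R. UNIV - {0 :: 'a}"
  define W where "W c = {w \<in> ?B. \<forall>j\<in>?J. is_power (r j) (c j * (\<Prod>\<gamma>\<in>?R. w \<gamma> ^ \<gamma> j))}" for c
  have finA: "finite ?A" by (intro finite_PiE) auto
  have finB: "finite ?B" by (intro finite_PiE finite_index_vectors) auto
  have W_const: "card (W c) = card (W (\<lambda>_. 1))" if c: "\<And>j. j \<in> ?J \<Longrightarrow> c j \<noteq> 0" for c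
  proof -
    define h where "h \<gamma> = (\<Prod>j\<in>{j\<in>?J. r j \<ge> 2 \<and> \<gamma> = unit_vector n j}. c j)" for \<gamma>
    have h: "h \<gamma> \<noteq> 0" for \<gamma> using c by (auto simp: h_def)
    have eq: "is_power (r j) (1 * (\<Prod>\<gamma>\<in>?R. (\<lambda>\<gamma>\<in>?R. w \<gamma> * h \<gamma>) \<gamma> ^ \<gamma> j)) \<longleftrightarrow>
        is_power (r j) (c j * (\<Prod>\<gamma>\<in>?R. w \<gamma> ^ \<gamma> j))" if j: "j \<in> ?J" for w j
    proof (cases "r j \<ge> 2")
      case True
      have "(\<Prod>\<gamma>\<in>?R. (\<lambda>\<gamma>\<in>?R. w \<gamma> * h \<gamma>) \<gamma> ^ \<gamma> j) = (\<Prod>\<gamma>\<in>?R. w \<gamma> ^ \<gamma> j * h \<gamma> ^ \<gamma> j)"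
        by (intro prod.cong refl) (simp add: power_mult_distrib)
      also have "\<dots> = (\<Prod>\<gamma>\<in>?R. w \<gamma> ^ \<gamma> j) * c j"
      proof -
        have "(\<Prod>\<gamma>\<in>?R. h \<gamma> ^ \<gamma> j) = c j"
          unfolding h_def by (rule prod_unit_vectors) (use r_pos j True in auto)
        then show ?thesis unfolding prod.distrib by (rule arg_cong)
      qed
      finally show ?thesis by (simp only: mult_1 mult.commute)
    next
      case False
      \<comment> \<open>No unit vector is available for this index, but every element is a first
        power.\<close>
      then have "r j = 1" using r_pos[OF j] by simp
      then show ?thesis by (simp add: is_power_def)
    qed
    have "bij_betw (\<lambda>w. \<lambda>\<gamma>\<in>?R. w \<gamma> * h \<gamma>) (W c) (W (\<lambda>_. 1))"
    proof (rule bij_betwI[where g = "\<lambda>w. \<lambda>\<gamma>\<in>?R. w \<gamma> / h \<gamma>"])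
      show "(\<lambda>w. \<lambda>\<gamma>\<in>?R. w \<gamma> * h \<gamma>) \<in> W c \<rightarrow> W (\<lambda>_. 1)"
      proof
        fix w assume w: "w \<in> W c"
        then have "(\<lambda>\<gamma>\<in>?R. w \<gamma> * h \<gamma>) \<in> ?B" using h by (auto simp: W_def PiE_iff)
        then show "(\<lambda>\<gamma>\<in>?R. w \<gamma> * h \<gamma>) \<in> W (\<lambda>_. 1)" using w eq unfolding W_def by blast
      qed
      have inv1: "(\<lambda>\<gamma>\<in>?R. (\<lambda>\<gamma>\<in>?R. w \<gamma> * h \<gamma>) \<gamma> / h \<gamma>) = w" if "w \<in> ?B" for w
        using that h by (auto simp: fun_eq_iff PiE_iff extensional_def)
      have inv2: "(\<lambda>\<gamma>\<in>?R. (\<lambda>\<gamma>\<in>?R. w \<gamma> / h \<gamma>) \<gamma> * h \<gamma>) = w" if "w \<in> ?B" for w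
        using that h by (auto simp: fun_eq_iff PiE_iff extensional_def)
      show "(\<lambda>\<gamma>\<in>?R. (\<lambda>\<gamma>\<in>?R. w \<gamma> * h \<gamma>) \<gamma> / h \<gamma>) = w" if "w \<in> W c" for w using inv1 that by (simp add: W_def)
      show "(\<lambda>\<gamma>\<in>?R. (\<lambda>\<gamma>\<in>?R. w \<gamma> / h \<gamma>) \<gamma> * h \<gamma>) = w" if "w \<in> W (\<lambda>_. 1)" for w using inv2 that by (simp add: W_def)
      show "(\<lambda>w. \<lambda>\<gamma>\<in>?R. w \<gamma> / h \<gamma>) \<in> W (\<lambda>_. 1) \<rightarrow> W c"
      proof
        fix w assume w: "w \<in> W (\<lambda>_. 1)"
        let ?w = "\<lambda>\<gamma>\<in>?R. w \<gamma> / h \<gamma>"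
        have "w \<in> ?B" and w': "\<forall>j\<in>?J. is_power (r j) (1 * (\<Prod>\<gamma>\<in>?R. w \<gamma> ^ \<gamma> j))" using w unfolding W_def by blast+
        have "\<forall>j\<in>?J. is_power (r j) (1 * (\<Prod>\<gamma>\<in>?R. (\<lambda>\<gamma>\<in>?R. ?w \<gamma> * h \<gamma>) \<gamma> ^ \<gamma> j))"
          unfolding inv2[OF \<open>w \<in> ?B\<close>] by (rule w')
        then have "\<forall>j\<in>?J. is_power (r j) (c j * (\<Prod>\<gamma>\<in>?R. ?w \<gamma> ^ \<gamma> j))" using eq by blast
        moreover have "?w \<in> ?B" using \<open>w \<in> ?B\<close> h by (auto simp: PiE_iff)
        ultimately show "?w \<in> W c" unfolding W_def by blast
      qed
    qed
    then show ?thesis by (rule bij_betw_same_card)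
  qed
  let ?P = "\<lambda>c w. \<forall>j\<in>?J. is_power (r j) (c j * (\<Prod>\<gamma>\<in>?R. w \<gamma> ^ \<gamma> j))"
  have "(\<Sum>c\<in>?A. card {w\<in>?B. ?P c w}) = (\<Sum>w\<in>?B. card {c\<in>?A. ?P c w})" by (rule double_count[OF finA finB])
  moreover have "(\<Sum>c\<in>?A. card {w\<in>?B. ?P c w}) = (\<Sum>c\<in>?A. card (W (\<lambda>_. 1)))"
    unfolding W_def[symmetric] by (intro sum.cong refl W_const) auto
  moreover have "(\<Sum>w\<in>?B. card {c\<in>?A. ?P c w}) * (\<Prod>j\<in>?J. r j) = (\<Sum>w\<in>?B. ?q1 ^ n)"
    unfolding sum_distrib_right
  proof (rule sum.cong[OF refl])
    fix w assume w: "w \<in> ?B"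
    have "(\<Prod>\<gamma>\<in>?R. w \<gamma> ^ \<gamma> j) \<noteq> 0" for j using w finite_index_vectors by (auto simp: PiE_iff)
    then have "card {c\<in>?A. \<forall>j\<in>?J. is_power (r j) ((\<Prod>\<gamma>\<in>?R. w \<gamma> ^ \<gamma> j) * c j)} * (\<Prod>j\<in>?J. r j) = ?q1 ^ card ?J"
      using r by (intro card_scaled_power_tuples) auto
    then show "card {c\<in>?A. ?P c w} * (\<Prod>j\<in>?J. r j) = ?q1 ^ n" by (simp add: mult.commute)
  qed
  moreover have "card ?A = ?q1 ^ n" "card ?B = ?q1 ^ card ?R"
    using finite_index_vectors by (simp_all add: card_PiE card_Diff_singleton)
  ultimately have "?q1 ^ n * (card (W (\<lambda>_. 1)) * (\<Prod>j\<in>?J. r j)) = ?q1 ^ n * ?q1 ^ card ?R"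
    using q1 by (simp add: mult.commute mult.assoc)
  then have "card (W (\<lambda>_. 1)) * (\<Prod>j\<in>?J. r j) = ?q1 ^ card ?R" using q1 by simp
  then show ?thesis using W_const[OF c] unfolding W_def by simp
qed

text \<open>The law at a place of ramification index \<open>s\<close>: \<open>g / s\<close> points
  with probability \<open>s / g\<close>. Its mean is 1 when \<open>s\<close> divides
  \<open>g\<close>.\<close>

definition two_point_law :: "nat \<Rightarrow> nat \<Rightarrow> nat \<Rightarrow> real" where
  "two_point_law g s m = real s / real g * of_bool (m = g div s) + (1 - real s / real g) * of_bool (m = 0)"

lemma two_point_count:
  assumes "finite W" and N: "\<And>w. w \<in> W \<Longrightarrow> N w \<noteq> 0 \<Longrightarrow> N w = g div s" and pos: "g div s > 0"
    and good: "card {w\<in>W. N w \<noteq> 0} * g = s * card W"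
  shows "real (card {w\<in>W. N w = m}) = real (card W) * two_point_law g s m"
proof -
  have g: "real g > 0" using pos by (cases "g = 0") auto
  have nz: "real (card {w\<in>W. N w \<noteq> 0}) = real (card W) * (real s / real g)"
  proof -
    have "real (card {w\<in>W. N w \<noteq> 0}) * real g = real s * real (card W)"
      using arg_cong[OF good, of real] by simp
    then show ?thesis using g by (simp add: field_simps)
  qed
  consider "m = g div s" | "m = 0" "m \<noteq> g div s" | "m \<noteq> 0" "m \<noteq> g div s" by blast
  then show ?thesis
  proof cases
    case 1
    have "N w = m \<longleftrightarrow> N w \<noteq> 0" if "w \<in> W" for w
      unfolding 1 using N[OF that] pos by linarith
    then have "{w\<in>W. N w = m} = {w\<in>W. N w \<noteq> 0}" by blast
    then show ?thesis using nz 1 pos by (simp add: two_point_law_def)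
  next
    case 2
    have "{w\<in>W. N w = m} = W - {w\<in>W. N w \<noteq> 0}" using 2 by auto
    then have "card {w\<in>W. N w = m} = card W - card {w\<in>W. N w \<noteq> 0}"
      using assms(1) by (simp add: card_Diff_subset)
    moreover have "card {w\<in>W. N w \<noteq> 0} \<le> card W" using assms(1) by (intro card_mono) auto
    ultimately have "real (card {w\<in>W. N w = m}) = real (card W) - real (card {w\<in>W. N w \<noteq> 0})" by simp
    then show ?thesis using nz 2 by (simp add: two_point_law_def algebra_simps)
  next
    case 3
    then have "{w\<in>W. N w = m} = {}" using N by auto
    then show ?thesis using 3 by (simp only: two_point_law_def) simp
  qed
qed

text \<open>A mixture in which the unramified case has weight \<open>q\<close> and each index vector
  has weight 1; the total weight is \<open>q + |G| - 1\<close>, the factor in the denominators of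
  the theorem.\<close>

definition point_law :: "nat \<Rightarrow> (nat \<Rightarrow> nat) \<Rightarrow> nat \<Rightarrow> nat \<Rightarrow> real" where
  "point_law n r q m = (real q * two_point_law (\<Prod>j\<in>{1..n}. r j) 1 m +
     (\<Sum>\<alpha>\<in>index_vectors n r. two_point_law (\<Prod>j\<in>{1..n}. r j) (index_order n r \<alpha>) m)) /
     (real q + real (card (index_vectors n r)))"

text \<open>The behaviour at infinity: \<open>None\<close> stands for an unramified place, \<open>Some \<beta>\<close> for the tuples
  in which the degree of \<open>f\<^sub>\<beta>\<close> is lowered by one; the latter are rarer by a factor \<open>q\<close>.\<close>

definition infinite_points :: "nat \<Rightarrow> (nat \<Rightarrow> nat) \<Rightarrow> (nat \<Rightarrow> nat) option \<Rightarrow> (nat \<Rightarrow> 'a::field) \<Rightarrow> nat" where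
  "infinite_points n r \<beta> c = local_points {1..n} r (case \<beta> of None \<Rightarrow> \<lambda>_. 0 | Some \<alpha> \<Rightarrow> \<lambda>j. int (\<alpha> j)) c"

definition infinite_weight :: "nat \<Rightarrow> 'x option \<Rightarrow> real" where
  "infinite_weight q \<beta> = (case \<beta> of None \<Rightarrow> 1 | Some _ \<Rightarrow> 1 / real q)"

lemma vector_order_zero: "(\<And>j. j \<in> J \<Longrightarrow> a j = 0) \<Longrightarrow> vector_order J r a = 1"
  unfolding vector_order_def by (rule Least_equality) auto

text \<open>For fixed behaviour at infinity only the leading constants matter. Summing over the
  options with weights 1 and \<open>1 / q\<close> reproduces the mixture \<open>point_law\<close>,
  multiplied by the total mass.\<close>

lemma mass_infinite:
  assumes r: "\<And>j. j \<in> {1..n} \<Longrightarrow> r j dvd CARD('a::{field,finite}) - 1"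
  shows "(\<Sum>\<beta>\<in>insert None (Some ` index_vectors n r). infinite_weight CARD('a) \<beta> *
      real (card {c \<in> (\<Pi>\<^sub>E j\<in>{1..n}. UNIV - {0 :: 'a}). infinite_points n r \<beta> c = m})) =
    (real CARD('a) - 1) ^ n * ((real CARD('a) + real (card (index_vectors n r))) / real CARD('a)) * point_law n r CARD('a) m"
proof -
  let ?R = "index_vectors n r" and ?J = "{1..n}" and ?q = "real CARD('a)"
  let ?A = "\<Pi>\<^sub>E j\<in>{1..n}. UNIV - {0 :: 'a}" and ?g = "\<Prod>j\<in>{1..n}. r j"
  have q: "?q \<ge> 2" using card_field_ge2[where 'a='a] by simp
  have r_pos: "r j > 0" if "j \<in> ?J" for j using r[OF that] card_field_ge2[where 'a='a] by (auto intro: Nat.gr0I)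
  have finA: "finite ?A" by (intro finite_PiE) auto
  have cardA: "card ?A = (CARD('a) - 1) ^ n" by (simp add: card_PiE card_Diff_singleton)
  have cardA': "real (card ?A) = (?q - 1) ^ n" unfolding cardA using card_field_ge2[where 'a='a] by (simp add: of_nat_diff)
  have gen: "real (card {c\<in>?A. local_points ?J r a c = m}) = (?q - 1) ^ n * two_point_law ?g (vector_order ?J r a) m" for a
    unfolding cardA'[symmetric]
  proof (rule two_point_count[OF finA])
    show "local_points ?J r a c = ?g div vector_order ?J r a" if "local_points ?J r a c \<noteq> 0" for c :: "nat \<Rightarrow> 'a"
      by (rule local_points_neq_0_iff(2)) (use r_pos that in auto)
    show "?g div vector_order ?J r a > 0" by (rule local_points_neq_0_iff(3)) (use r_pos in auto)
    show "card {c\<in>?A. local_points ?J r a c \<noteq> 0} * ?g = vector_order ?J r a * card ?A"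
      using card_good_constants[where J = ?J and r = r and a = a, OF _ r] unfolding cardA by simp
  qed
  have none: "real (card {c\<in>?A. infinite_points n r None c = m}) = (?q - 1) ^ n * two_point_law ?g 1 m"
    using gen[of "\<lambda>_. 0"] vector_order_zero[of ?J "\<lambda>_. 0" r] by (simp only: infinite_points_def option.case)
  have some: "real (card {c\<in>?A. infinite_points n r (Some \<alpha>) c = m}) = (?q - 1) ^ n * two_point_law ?g (index_order n r \<alpha>) m" for \<alpha>
    using gen[of "\<lambda>j. int (\<alpha> j)"] by (simp only: infinite_points_def option.case index_order_def)
  have "(\<Sum>\<beta>\<in>insert None (Some ` ?R). infinite_weight CARD('a) \<beta> * real (card {c\<in>?A. infinite_points n r \<beta> c = m})) =
      (?q - 1) ^ n * two_point_law ?g 1 m + (\<Sum>\<alpha>\<in>?R. 1 / ?q * ((?q - 1) ^ n * two_point_law ?g (index_order n r \<alpha>) m))"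
  proof -
    have "(\<Sum>\<beta>\<in>insert None (Some ` ?R). infinite_weight CARD('a) \<beta> * real (card {c\<in>?A. infinite_points n r \<beta> c = m})) =
        infinite_weight CARD('a) (None :: (nat \<Rightarrow> nat) option) * real (card {c\<in>?A. infinite_points n r None c = m}) +
        (\<Sum>\<alpha>\<in>?R. infinite_weight CARD('a) (Some \<alpha>) * real (card {c\<in>?A. infinite_points n r (Some \<alpha>) c = m}))"
      using finite_index_vectors[of n r] by (subst sum.insert) (auto simp: sum.reindex)
    then show ?thesis unfolding none some infinite_weight_def option.case by simp
  qed
  also have "\<dots> = (?q - 1) ^ n * ((?q * two_point_law ?g 1 m + (\<Sum>\<alpha>\<in>?R. two_point_law ?g (index_order n r \<alpha>) m)) / ?q)"
  proof -
    have *: "a * b + 1 / x * (a * c) = a * ((x * b + c) / x)" if "x \<noteq> 0" for a b c x :: real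
      using that by (simp add: add_divide_distrib distrib_left)
    show ?thesis unfolding sum_distrib_left[symmetric] by (rule *) (use q in simp)
  qed
  also have "\<dots> = (?q - 1) ^ n * ((?q + real (card ?R)) / ?q) * point_law n r CARD('a) m"
  proof -
    have *: "a * (b / x) = a * (y / x) * (b / y)" if "x \<noteq> 0" "y \<noteq> 0" for a b x y :: real using that by simp
    show ?thesis unfolding point_law_def by (rule *) (use q in auto)
  qed
  finally show ?thesis .
qed

text \<open>The unknown \<open>l\<close> takes the place of the vanishing value:
  \<open>(w, l)\<close> satisfies the conditions at a zero of index \<open>\<alpha>\<close> iff
  \<open>w(\<alpha> := l)\<close> is a good vector without zeros. Those vectors are already counted,
  and each good \<open>w\<close> has \<open>(q - 1) / s\<close> partners \<open>l\<close>, with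
  \<open>s\<close> the order of \<open>\<alpha>\<close>.\<close>

lemma card_good_values_zero:
  fixes c :: "nat \<Rightarrow> 'a::{field,finite}"
  assumes r: "\<And>j. j \<in> {1..n} \<Longrightarrow> r j dvd CARD('a) - 1" and c: "\<And>j. j \<in> {1..n} \<Longrightarrow> c j \<noteq> 0"
    and \<alpha>: "\<alpha> \<in> index_vectors n r"
  defines "Z \<equiv> {w \<in> (\<Pi>\<^sub>E \<gamma>\<in>index_vectors n r. UNIV :: 'a set). w \<alpha> = 0 \<and> (\<forall>\<gamma>\<in>index_vectors n r. \<gamma> \<noteq> \<alpha> \<longrightarrow> w \<gamma> \<noteq> 0)}"
  shows "card Z = (CARD('a) - 1) ^ (card (index_vectors n r) - 1)"
    "card {w\<in>Z. value_points n r c w \<noteq> 0} * (\<Prod>j\<in>{1..n}. r j) = index_order n r \<alpha> * card Z"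
    "w \<in> Z \<Longrightarrow> value_points n r c w \<noteq> 0 \<Longrightarrow> value_points n r c w = (\<Prod>j\<in>{1..n}. r j) div index_order n r \<alpha>"
proof -
  let ?R = "index_vectors n r" and ?J = "{1..n}" and ?q1 = "CARD('a) - 1" and ?g = "\<Prod>j\<in>{1..n}. r j"
  have q1: "?q1 > 0" using card_field_ge2[where 'a='a] by simp
  have r_pos: "r j > 0" if "j \<in> ?J" for j using r[OF that] q1 by (auto intro: Nat.gr0I)
  have finR: "finite ?R" by (rule finite_index_vectors)
  let ?B = "UNIV - {0 :: 'a}"
  let ?s = "index_order n r \<alpha>"
  have s: "?s > 0" "?s dvd ?q1" using index_order[OF r q1] by auto
  obtain m where m: "?q1 = ?s * m" using s(2) by (auto elim: dvdE)
  then have m0: "m > 0" using q1 by (auto intro: Nat.gr0I)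
  have Zbij: "bij_betw (\<lambda>w. restrict w (?R - {\<alpha>})) Z (\<Pi>\<^sub>E \<gamma>\<in>?R - {\<alpha>}. ?B)"
  proof (rule bij_betwI[where g = "\<lambda>w. w(\<alpha> := 0)"])
    show "(\<lambda>w. restrict w (?R - {\<alpha>})) \<in> Z \<rightarrow> (\<Pi>\<^sub>E \<gamma>\<in>?R - {\<alpha>}. ?B)" by (auto simp: Z_def)
    show "(\<lambda>w. w(\<alpha> := 0)) \<in> (\<Pi>\<^sub>E \<gamma>\<in>?R - {\<alpha>}. ?B) \<rightarrow> Z" using \<alpha> by (auto simp: Z_def PiE_iff extensional_def)
    show "(restrict w (?R - {\<alpha>}))(\<alpha> := 0) = w" if "w \<in> Z" for w
    proof
      fix \<gamma>
      have "w \<alpha> = 0" "\<gamma> \<notin> ?R \<Longrightarrow> w \<gamma> = undefined" using that by (auto simp: Z_def PiE_iff extensional_def)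
      then show "((restrict w (?R - {\<alpha>}))(\<alpha> := 0)) \<gamma> = w \<gamma>" by (cases "\<gamma> = \<alpha>") (auto simp: restrict_def)
    qed
    show "restrict (w(\<alpha> := 0)) (?R - {\<alpha>}) = w" if "w \<in> (\<Pi>\<^sub>E \<gamma>\<in>?R - {\<alpha>}. ?B)" for w
      using that by (auto simp: fun_eq_iff PiE_iff extensional_def)
  qed
  have "card Z = card (\<Pi>\<^sub>E \<gamma>\<in>?R - {\<alpha>}. ?B)" by (rule bij_betw_same_card[OF Zbij])
  also have "\<dots> = ?q1 ^ (card ?R - 1)"
    using finR \<alpha> by (simp add: card_PiE card_Diff_singleton)
  finally show cardZ: "card Z = ?q1 ^ (card ?R - 1)" .
  have finZ: "finite Z" using bij_betw_finite[OF Zbij] finR by (simp add: finite_PiE)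
  define u where "u w j = c j * (\<Prod>\<gamma>\<in>?R - {\<alpha>}. w \<gamma> ^ \<gamma> j)" for w :: "(nat \<Rightarrow> nat) \<Rightarrow> 'a" and j
  have vp: "value_points n r c w = local_points ?J r (\<lambda>j. int (\<alpha> j)) (u w)" if "w \<in> Z" for w
  proof -
    have "{\<gamma>\<in>?R. w \<gamma> = 0} = {\<alpha>}" "{\<gamma>\<in>?R. w \<gamma> \<noteq> 0} = ?R - {\<alpha>}" using that \<alpha> by (auto simp: Z_def)
    then show ?thesis unfolding value_points_def u_def by (simp only: sum.insert_if finite.emptyI sum.empty) simp
  qed
  show "value_points n r c w = ?g div ?s" if "w \<in> Z" "value_points n r c w \<noteq> 0"
    using that(2) unfolding vp[OF that(1)] index_order_def by (rule local_points_neq_0_iff(2)[rotated 2]) (use r_pos in auto)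
  have u0: "u w j \<noteq> 0" if "w \<in> Z" "j \<in> ?J" for w j
    using c[OF that(2)] that(1) finR by (auto simp: u_def Z_def)
  let ?P = "\<lambda>w l. \<forall>j\<in>?J. is_power (r j) (l powi int (\<alpha> j) * u w j)"
  have vpP: "value_points n r c w \<noteq> 0 \<longleftrightarrow> (\<exists>l. l \<noteq> 0 \<and> ?P w l)" if "w \<in> Z" for w
    unfolding vp[OF that] by (rule local_points_neq_0_iff(1)) (use r_pos in auto)
  have sol: "card {l\<in>?B. ?P w l} = (if value_points n r c w \<noteq> 0 then m else 0)" if w: "w \<in> Z" for w
  proof (cases "value_points n r c w \<noteq> 0")
    case True
    then have ex: "\<exists>l. l \<noteq> 0 \<and> ?P w l" by (rule vpP[OF w, THEN iffD1])
    have "card {l. l \<noteq> 0 \<and> ?P w l} = ?q1 div ?s"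
    proof (rule card_power_solutions[OF r _ s(2) _ ex])
      show "(\<forall>j\<in>?J. int (r j) dvd k * int (\<alpha> j)) \<longleftrightarrow> int ?s dvd k" for k
        unfolding index_order_def by (rule vector_order(2)[OF r q1])
    qed (use u0[OF w] in auto)
    then show ?thesis using True m s(1) by (simp add: conj_commute)
  next
    case False
    then have "\<not> (\<exists>l. l \<noteq> 0 \<and> ?P w l)" unfolding vpP[OF w] by blast
    then have "{l \<in> ?B. ?P w l} = {}" by blast
    then show ?thesis using False by simp
  qed
  define W where "W = {w \<in> (\<Pi>\<^sub>E \<gamma>\<in>?R. ?B). \<forall>j\<in>?J. is_power (r j) (c j * (\<Prod>\<gamma>\<in>?R. w \<gamma> ^ \<gamma> j))}"
  have P_iff: "?P (w(\<alpha> := x)) l \<longleftrightarrow> (\<forall>j\<in>?J. is_power (r j) (c j * (\<Prod>\<gamma>\<in>?R. (w(\<alpha> := l)) \<gamma> ^ \<gamma> j)))" for w l x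
  proof (intro ball_cong refl)
    fix j
    have "(\<Prod>\<gamma>\<in>?R. (w(\<alpha> := l)) \<gamma> ^ \<gamma> j) = l ^ \<alpha> j * (\<Prod>\<gamma>\<in>?R - {\<alpha>}. w \<gamma> ^ \<gamma> j)"
      using finR \<alpha> by (simp add: prod.remove[of ?R \<alpha>])
    moreover have "u (w(\<alpha> := x)) j = c j * (\<Prod>\<gamma>\<in>?R - {\<alpha>}. w \<gamma> ^ \<gamma> j)" by (simp add: u_def)
    ultimately show "is_power (r j) (l powi int (\<alpha> j) * u (w(\<alpha> := x)) j) \<longleftrightarrow>
        is_power (r j) (c j * (\<Prod>\<gamma>\<in>?R. (w(\<alpha> := l)) \<gamma> ^ \<gamma> j))"
      by (simp add: power_int_of_nat mult.left_commute)
  qed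
  have upd: "w(\<alpha> := w \<alpha>) = w" for w :: "(nat \<Rightarrow> nat) \<Rightarrow> 'a" by simp
  have "bij_betw (\<lambda>(w, l). w(\<alpha> := l)) (SIGMA w:Z. {l\<in>?B. ?P w l}) W"
  proof (rule bij_betwI[where g = "\<lambda>w. (w(\<alpha> := 0), w \<alpha>)"])
    show "(\<lambda>(w, l). w(\<alpha> := l)) \<in> (SIGMA w:Z. {l\<in>?B. ?P w l}) \<rightarrow> W"
    proof
      fix p assume p: "p \<in> (SIGMA w:Z. {l\<in>?B. ?P w l})"
      obtain w l where wl: "p = (w, l)" by (cases p)
      then have w: "w \<in> Z" "l \<noteq> 0" "?P w l" using p by auto
      have "w(\<alpha> := l) \<in> (\<Pi>\<^sub>E \<gamma>\<in>?R. ?B)" using w(1,2) \<alpha> by (auto simp: Z_def PiE_iff extensional_def)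
      moreover have "?P (w(\<alpha> := w \<alpha>)) l" unfolding upd by (rule w(3))
      ultimately show "(\<lambda>(w, l). w(\<alpha> := l)) p \<in> W" unfolding wl W_def P_iff by simp
    qed
    show "(\<lambda>w. (w(\<alpha> := 0), w \<alpha>)) \<in> W \<rightarrow> (SIGMA w:Z. {l\<in>?B. ?P w l})"
    proof
      fix w assume w: "w \<in> W"
      then have wB: "w \<in> (\<Pi>\<^sub>E \<gamma>\<in>?R. ?B)" by (simp add: W_def)
      then have "w(\<alpha> := 0) \<in> Z" using \<alpha> by (auto simp: Z_def PiE_iff extensional_def)
      moreover have "w \<alpha> \<noteq> 0" using wB \<alpha> by auto
      moreover have "?P (w(\<alpha> := 0)) (w \<alpha>)" unfolding P_iff upd using w by (simp add: W_def)
      ultimately show "(w(\<alpha> := 0), w \<alpha>) \<in> (SIGMA w:Z. {l\<in>?B. ?P w l})" by simp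
    qed
    fix p assume "p \<in> (SIGMA w:Z. {l\<in>?B. ?P w l})"
    then obtain w l where wl: "p = (w, l)" "w \<in> Z" by auto
    then have "w \<alpha> = 0" by (simp add: Z_def)
    then show "(\<lambda>w. (w(\<alpha> := 0), w \<alpha>)) ((\<lambda>(w, l). w(\<alpha> := l)) p) = p" unfolding wl(1) by (simp add: fun_upd_idem)
  qed simp
  then have "card W = card (SIGMA w:Z. {l\<in>?B. ?P w l})" by (rule bij_betw_same_card[symmetric])
  also have "\<dots> = (\<Sum>w\<in>Z. card {l\<in>?B. ?P w l})" using finZ by simp
  also have "\<dots> = (\<Sum>w\<in>Z. if value_points n r c w \<noteq> 0 then m else 0)" by (rule sum.cong[OF refl sol])
  also have "\<dots> = (\<Sum>w\<in>{w\<in>Z. value_points n r c w \<noteq> 0}. m)" by (rule sum.inter_filter[OF finZ, symmetric])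
  finally have cardW: "card W = m * card {w\<in>Z. value_points n r c w \<noteq> 0}" by simp
  have "card W * ?g = ?q1 ^ card ?R" unfolding W_def by (rule card_good_values_nonzero[OF r c])
  also have "?q1 ^ card ?R = ?q1 * card Z"
  proof -
    have "card ?R = Suc (card ?R - 1)" using finR \<alpha> by (metis One_nat_def Suc_pred card_gt_0_iff empty_iff)
    then have "?q1 ^ card ?R = ?q1 ^ Suc (card ?R - 1)" by (rule arg_cong)
    then show ?thesis unfolding cardZ power_Suc .
  qed
  also have "?q1 * card Z = ?s * m * card Z" by (rule arg_cong[OF m, of "\<lambda>x. x * card Z"])
  finally have "m * (card {w\<in>Z. value_points n r c w \<noteq> 0} * ?g) = m * (?s * card Z)"
    unfolding cardW by (simp only: ac_simps)
  then show "card {w\<in>Z. value_points n r c w \<noteq> 0} * ?g = ?s * card Z" using m0 by simp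
qed

text \<open>The nonvanishing vectors have total density \<open>((q - 1) / q) ^ k\<close>, the
  vectors whose only zero is at a given index the same divided by \<open>q\<close>; this is the
  proportion of \<open>point_law\<close>. The result does not depend on \<open>c\<close>, which
  makes affine places and infinity independent.\<close>

lemma mass_finite:
  fixes c :: "nat \<Rightarrow> 'a::{field,finite}"
  assumes r: "\<And>j. j \<in> {1..n} \<Longrightarrow> r j dvd CARD('a) - 1" and c: "\<And>j. j \<in> {1..n} \<Longrightarrow> c j \<noteq> 0"
  defines "k \<equiv> card (index_vectors n r)" and "q \<equiv> real CARD('a)"
  shows "(\<Sum>w\<in>{w \<in> (\<Pi>\<^sub>E \<gamma>\<in>index_vectors n r. UNIV). single_zero (index_vectors n r) w \<and> value_points n r c w = m}.
      local_density (index_vectors n r) w) = ((q - 1) / q) ^ k * ((q + real k) / q) * point_law n r CARD('a) m"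
proof -
  let ?R = "index_vectors n r" and ?J = "{1..n}" and ?g = "\<Prod>j\<in>{1..n}. r j"
  have q: "q \<ge> 2" using card_field_ge2[where 'a='a] by (simp add: q_def)
  have qc: "real (CARD('a) - 1) = q - 1" using card_field_ge2[where 'a='a] by (simp add: of_nat_diff q_def)
  have r_pos: "r j > 0" if "j \<in> ?J" for j using r[OF that] card_field_ge2[where 'a='a] by (auto intro: Nat.gr0I)
  have finR: "finite ?R" by (rule finite_index_vectors)
  define Z0 where "Z0 = (\<Pi>\<^sub>E \<gamma>\<in>?R. UNIV - {0 :: 'a})"
  define Z where "Z \<alpha> = {w \<in> (\<Pi>\<^sub>E \<gamma>\<in>?R. UNIV :: 'a set). w \<alpha> = 0 \<and> (\<forall>\<gamma>\<in>?R. \<gamma> \<noteq> \<alpha> \<longrightarrow> w \<gamma> \<noteq> 0)}" for \<alpha>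
  have finAll: "finite (\<Pi>\<^sub>E \<gamma>\<in>?R. UNIV :: 'a set)" using finR by (intro finite_PiE) auto
  have fin0: "finite Z0" unfolding Z0_def using finR by (intro finite_PiE) auto
  have finZ: "finite (Z \<alpha>)" for \<alpha> using finAll by (simp add: Z_def)
  let ?N = "value_points n r c"
  have split: "{w \<in> (\<Pi>\<^sub>E \<gamma>\<in>?R. UNIV). single_zero ?R w \<and> ?N w = m} =
      {w\<in>Z0. ?N w = m} \<union> (\<Union>\<alpha>\<in>?R. {w\<in>Z \<alpha>. ?N w = m})"
  proof (intro equalityI subsetI)
    fix w assume w: "w \<in> {w \<in> (\<Pi>\<^sub>E \<gamma>\<in>?R. UNIV). single_zero ?R w \<and> ?N w = m}"
    show "w \<in> {w\<in>Z0. ?N w = m} \<union> (\<Union>\<alpha>\<in>?R. {w\<in>Z \<alpha>. ?N w = m})"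
    proof (cases "\<exists>\<alpha>\<in>?R. w \<alpha> = 0")
      case True
      then obtain \<alpha> where "\<alpha> \<in> ?R" "w \<alpha> = 0" by blast
      then have "w \<in> Z \<alpha>" using w by (auto simp: Z_def single_zero_def)
      then show ?thesis using w \<open>\<alpha> \<in> ?R\<close> by blast
    next
      case False
      then have "w \<in> Z0" using w by (auto simp: Z0_def PiE_iff)
      then show ?thesis using w by blast
    qed
  next
    fix w assume "w \<in> {w\<in>Z0. ?N w = m} \<union> (\<Union>\<alpha>\<in>?R. {w\<in>Z \<alpha>. ?N w = m})"
    then show "w \<in> {w \<in> (\<Pi>\<^sub>E \<gamma>\<in>?R. UNIV). single_zero ?R w \<and> ?N w = m}"
      by (auto simp: Z0_def Z_def single_zero_def PiE_iff) metis
  qed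
  have dens0: "local_density ?R w = (1 / q) ^ k" if "w \<in> Z0" for w
  proof -
    have "local_density ?R w = (\<Prod>\<alpha>\<in>?R. 1 / q)"
      unfolding local_density_def q_def[symmetric] by (rule prod.cong[OF refl]) (use that in \<open>auto simp: Z0_def\<close>)
    then show ?thesis by (simp add: k_def)
  qed
  have densZ: "local_density ?R w = (q - 1) / q ^ 2 * (1 / q) ^ (k - 1)" if "w \<in> Z \<alpha>" "\<alpha> \<in> ?R" for w \<alpha>
  proof -
    have "local_density ?R w = (q - 1) / q ^ 2 * (\<Prod>\<gamma>\<in>?R - {\<alpha>}. 1 / q)"
      unfolding local_density_def q_def[symmetric] prod.remove[OF finR that(2)]
      by (intro arg_cong2[where f = "(*)"] prod.cong refl) (use that in \<open>auto simp: Z_def\<close>)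
    then show ?thesis using that finR by (simp add: k_def card_Diff_singleton)
  qed
  have count0: "real (card {w\<in>Z0. ?N w = m}) = (q - 1) ^ k * two_point_law ?g 1 m"
  proof -
    have cZ0: "card Z0 = (CARD('a) - 1) ^ k" unfolding Z0_def using finR by (simp add: card_PiE card_Diff_singleton k_def)
    have vp: "?N w = local_points ?J r (\<lambda>_. 0) (\<lambda>j. c j * (\<Prod>\<gamma>\<in>?R. w \<gamma> ^ \<gamma> j))" if "w \<in> Z0" for w
    proof -
      have "{\<gamma>\<in>?R. w \<gamma> = 0} = {}" "{\<gamma>\<in>?R. w \<gamma> \<noteq> 0} = ?R" using that by (auto simp: Z0_def PiE_iff)
      then show ?thesis unfolding value_points_def by (simp only: sum.empty)
    qed
    have iff: "?N w \<noteq> 0 \<longleftrightarrow> (\<forall>j\<in>?J. is_power (r j) (c j * (\<Prod>\<gamma>\<in>?R. w \<gamma> ^ \<gamma> j)))" if "w \<in> Z0" for w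
    proof -
      have "local_points ?J r (\<lambda>_. 0) u \<noteq> 0 \<longleftrightarrow> (\<forall>j\<in>?J. is_power (r j) (u j))" for u :: "nat \<Rightarrow> 'a"
      proof -
        have "local_points ?J r (\<lambda>_. 0) u \<noteq> 0 \<longleftrightarrow> (\<exists>l. l \<noteq> 0 \<and> (\<forall>j\<in>?J. is_power (r j) (l powi 0 * u j)))"
          by (rule local_points_neq_0_iff(1)) (use r_pos in auto)
        also have "\<dots> \<longleftrightarrow> (\<forall>j\<in>?J. is_power (r j) (u j))" by (auto intro: exI[of _ 1])
        finally show ?thesis .
      qed
      then show ?thesis unfolding vp[OF that] .
    qed
    have "real (card {w\<in>Z0. ?N w = m}) = real (card Z0) * two_point_law ?g 1 m"
    proof (rule two_point_count[OF fin0])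
      have vo: "vector_order ?J r (\<lambda>_. 0) = 1" by (rule vector_order_zero) simp
      show "?N w = ?g div 1" if "w \<in> Z0" "?N w \<noteq> 0" for w
        using local_points_neq_0_iff(2)[where J = ?J and r = r and a = "\<lambda>_. 0", OF _ r_pos] that(2)
        unfolding vp[OF that(1)] vo by blast
      show "?g div 1 > 0" using r_pos by (auto intro!: prod_pos)
      have "{w\<in>Z0. ?N w \<noteq> 0} = {w\<in>Z0. \<forall>j\<in>?J. is_power (r j) (c j * (\<Prod>\<gamma>\<in>?R. w \<gamma> ^ \<gamma> j))}" using iff by blast
      moreover have "card {w\<in>Z0. \<forall>j\<in>?J. is_power (r j) (c j * (\<Prod>\<gamma>\<in>?R. w \<gamma> ^ \<gamma> j))} * ?g = (CARD('a) - 1) ^ k"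
        unfolding Z0_def k_def by (rule card_good_values_nonzero) (use r c in auto)
      ultimately show "card {w\<in>Z0. ?N w \<noteq> 0} * ?g = 1 * card Z0" unfolding cZ0 by presburger
    qed
    then show ?thesis by (simp only: cZ0 of_nat_power qc)
  qed
  have countZ: "real (card {w\<in>Z \<alpha>. ?N w = m}) = (q - 1) ^ (k - 1) * two_point_law ?g (index_order n r \<alpha>) m" if a: "\<alpha> \<in> ?R" for \<alpha>
  proof -
    note z = card_good_values_zero[where n = n and r = r and c = c and \<alpha> = \<alpha>, OF r c a, folded Z_def]
    have "real (card {w\<in>Z \<alpha>. ?N w = m}) = real (card (Z \<alpha>)) * two_point_law ?g (index_order n r \<alpha>) m"
    proof (rule two_point_count[OF finZ])
      show "?g div index_order n r \<alpha> > 0" unfolding index_order_def by (rule local_points_neq_0_iff(3)) (use r_pos in auto)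
    qed (use z in auto)
    also have "real (card (Z \<alpha>)) = (q - 1) ^ (k - 1)" using z(1) by (simp only: of_nat_power qc k_def)
    finally show ?thesis .
  qed
  have disj0: "{w\<in>Z0. ?N w = m} \<inter> (\<Union>\<alpha>\<in>?R. {w\<in>Z \<alpha>. ?N w = m}) = {}"
    by (auto simp: Z0_def Z_def PiE_iff)
  have disjZ: "\<forall>\<alpha>\<in>?R. \<forall>\<beta>\<in>?R. \<alpha> \<noteq> \<beta> \<longrightarrow> {w\<in>Z \<alpha>. ?N w = m} \<inter> {w\<in>Z \<beta>. ?N w = m} = {}"
    by (auto simp: Z_def)
  have "(\<Sum>w\<in>{w \<in> (\<Pi>\<^sub>E \<gamma>\<in>?R. UNIV). single_zero ?R w \<and> ?N w = m}. local_density ?R w) =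
      (\<Sum>w\<in>{w\<in>Z0. ?N w = m}. local_density ?R w) + (\<Sum>\<alpha>\<in>?R. \<Sum>w\<in>{w\<in>Z \<alpha>. ?N w = m}. local_density ?R w)"
    unfolding split using disj0 disjZ finR fin0 finZ
    by (subst sum.union_disjoint) (auto simp: sum.UNION_disjoint)
  also have "(\<Sum>w\<in>{w\<in>Z0. ?N w = m}. local_density ?R w) = (1 / q) ^ k * ((q - 1) ^ k * two_point_law ?g 1 m)"
    unfolding count0[symmetric] by (simp add: dens0)
  also have "(\<Sum>\<alpha>\<in>?R. \<Sum>w\<in>{w\<in>Z \<alpha>. ?N w = m}. local_density ?R w) =
      (\<Sum>\<alpha>\<in>?R. ((q - 1) / q) ^ k * (1 / q) * two_point_law ?g (index_order n r \<alpha>) m)"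
  proof (rule sum.cong[OF refl])
    fix \<alpha> assume a: "\<alpha> \<in> ?R"
    have "(\<Sum>w\<in>{w\<in>Z \<alpha>. ?N w = m}. local_density ?R w) =
        real (card {w\<in>Z \<alpha>. ?N w = m}) * ((q - 1) / q ^ 2 * (1 / q) ^ (k - 1))"
      using densZ[OF _ a] by simp
    also have "\<dots> = (q - 1) ^ (k - 1) * two_point_law ?g (index_order n r \<alpha>) m * ((q - 1) / q ^ 2 * (1 / q) ^ (k - 1))"
      unfolding countZ[OF a] ..
    also have "\<dots> = ((q - 1) / q) ^ Suc (k - 1) * (1 / q) * two_point_law ?g (index_order n r \<alpha>) m"
      using q by (simp add: power_divide power2_eq_square field_simps)
    also have "Suc (k - 1) = k" unfolding k_def using finR a by (metis One_nat_def Suc_pred card_gt_0_iff empty_iff)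
    finally show "(\<Sum>w\<in>{w\<in>Z \<alpha>. ?N w = m}. local_density ?R w) =
        ((q - 1) / q) ^ k * (1 / q) * two_point_law ?g (index_order n r \<alpha>) m" .
  qed
  also have "(1 / q) ^ k * ((q - 1) ^ k * two_point_law ?g 1 m) +
      (\<Sum>\<alpha>\<in>?R. ((q - 1) / q) ^ k * (1 / q) * two_point_law ?g (index_order n r \<alpha>) m) =
      ((q - 1) / q) ^ k * ((q * two_point_law ?g 1 m + (\<Sum>\<alpha>\<in>?R. two_point_law ?g (index_order n r \<alpha>) m)) / q)"
  proof -
    have *: "a * b + a * (1 / x) * c = a * ((x * b + c) / x)" if "x \<noteq> 0" for a b c x :: real
      using that by (simp add: add_divide_distrib distrib_left)
    have "(1 / q) ^ k * (q - 1) ^ k = ((q - 1) / q) ^ k" by (simp flip: power_mult_distrib)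
    then show ?thesis unfolding sum_distrib_left[symmetric] mult.assoc[symmetric, of "(1 / q) ^ k"]
      using *[of q] q by simp
  qed
  also have "\<dots> = ((q - 1) / q) ^ k * ((q + real k) / q) * point_law n r CARD('a) m"
  proof -
    have *: "a * (b / x) = a * (y / x) * (b / y)" if "x \<noteq> 0" "y \<noteq> 0" for a b x y :: real using that by simp
    show ?thesis unfolding point_law_def q_def[symmetric] k_def[symmetric] by (rule *) (use q in auto)
  qed
  finally show ?thesis .
qed

subsection \<open>Sums of independent variables\<close>

text \<open>The \<open>k\<close>-fold convolution power of the weights \<open>p\<close> on
  \<open>V\<close>, evaluated at \<open>m\<close>. The bound \<open>v \<le> m\<close> guards the
  subtraction of natural numbers.\<close>

fun convolution :: "(nat \<Rightarrow> real) \<Rightarrow> nat set \<Rightarrow> nat \<Rightarrow> nat \<Rightarrow> real" where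
  "convolution p V 0 m = of_bool (m = 0)"
| "convolution p V (Suc k) m = (\<Sum>v\<in>{v\<in>V. v \<le> m}. p v * convolution p V k (m - v))"

text \<open>Used for the affine places, with \<open>z\<close> the mass of one place, and for the
  random variables, with \<open>z = 1\<close>; so both sides of the theorem become values of
  \<open>convolution\<close>.\<close>

lemma sum_PiE_convolution:
  fixes W :: "'w \<Rightarrow> real" and N :: "'w \<Rightarrow> nat"
  assumes "finite I" and fin: "finite \<Omega>" "finite V"
    and N: "\<And>w. w \<in> \<Omega> \<Longrightarrow> N w \<in> V" and mass: "\<And>v. v \<in> V \<Longrightarrow> (\<Sum>w\<in>{w\<in>\<Omega>. N w = v}. W w) = z * p v"
  shows "(\<Sum>v\<in>(\<Pi>\<^sub>E i\<in>I. \<Omega>). (\<Prod>i\<in>I. W (v i)) * of_bool ((\<Sum>i\<in>I. N (v i)) = m)) = z ^ card I * convolution p V (card I) m"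
  using assms(1)
proof (induction I arbitrary: m)
  case empty
  then show ?case by (auto simp: PiE_empty_domain)
next
  case (insert i I)
  let ?S = "\<lambda>m. \<Sum>v\<in>(\<Pi>\<^sub>E i\<in>I. \<Omega>). (\<Prod>i\<in>I. W (v i)) * of_bool ((\<Sum>i\<in>I. N (v i)) = m)"
  have upd: "(\<Prod>j\<in>I. W ((v(i := w)) j)) = (\<Prod>j\<in>I. W (v j))" "(\<Sum>j\<in>I. N ((v(i := w)) j)) = (\<Sum>j\<in>I. N (v j))" for v w
    using insert.hyps by (auto intro!: prod.cong sum.cong)
  have "(\<Sum>v\<in>(\<Pi>\<^sub>E i\<in>insert i I. \<Omega>). (\<Prod>i\<in>insert i I. W (v i)) * of_bool ((\<Sum>i\<in>insert i I. N (v i)) = m)) =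
      (\<Sum>(w, v)\<in>\<Omega> \<times> (\<Pi>\<^sub>E i\<in>I. \<Omega>). W w * (\<Prod>i\<in>I. W (v i)) * of_bool (N w + (\<Sum>i\<in>I. N (v i)) = m))"
    unfolding PiE_insert_eq using insert.hyps
    by (subst sum.reindex[OF inj_combinator]) (auto simp: upd fun_upd_same simp del: fun_upd_apply intro!: sum.cong)
  also have "\<dots> = (\<Sum>w\<in>\<Omega>. \<Sum>v\<in>(\<Pi>\<^sub>E i\<in>I. \<Omega>). W w * (\<Prod>i\<in>I. W (v i)) * of_bool (N w + (\<Sum>i\<in>I. N (v i)) = m))"
    by (rule sum.cartesian_product[symmetric])
  also have "\<dots> = (\<Sum>w\<in>\<Omega>. if N w \<le> m then W w * ?S (m - N w) else 0)"
  proof (rule sum.cong[OF refl])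
    fix w
    show "(\<Sum>v\<in>(\<Pi>\<^sub>E i\<in>I. \<Omega>). W w * (\<Prod>i\<in>I. W (v i)) * of_bool (N w + (\<Sum>i\<in>I. N (v i)) = m)) =
        (if N w \<le> m then W w * ?S (m - N w) else 0)"
    proof (cases "N w \<le> m")
      case True
      have "N w + x = m \<longleftrightarrow> x = m - N w" for x using True by linarith
      then show ?thesis using True by (simp add: sum_distrib_left mult.assoc)
    next
      case False
      then have "N w + x \<noteq> m" for x by linarith
      then show ?thesis using False by simp
    qed
  qed
  also have "\<dots> = (\<Sum>w\<in>\<Omega>. if N w \<le> m then W w * (z ^ card I * convolution p V (card I) (m - N w)) else 0)"
    unfolding insert.IH ..
  also have "\<dots> = (\<Sum>v\<in>V. \<Sum>w\<in>{w\<in>\<Omega>. N w = v}. if N w \<le> m then W w * (z ^ card I * convolution p V (card I) (m - N w)) else 0)"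
    by (rule sum.group[symmetric]) (use fin N in auto)
  also have "\<dots> = (\<Sum>v\<in>V. if v \<le> m then z * p v * (z ^ card I * convolution p V (card I) (m - v)) else 0)"
  proof (rule sum.cong[OF refl])
    fix v assume v: "v \<in> V"
    have "(\<Sum>w\<in>{w\<in>\<Omega>. N w = v}. if N w \<le> m then W w * (z ^ card I * convolution p V (card I) (m - N w)) else 0) =
        (\<Sum>w\<in>{w\<in>\<Omega>. N w = v}. W w * (if v \<le> m then z ^ card I * convolution p V (card I) (m - v) else 0))"
      by (rule sum.cong) auto
    also have "\<dots> = z * p v * (if v \<le> m then z ^ card I * convolution p V (card I) (m - v) else 0)"
      unfolding sum_distrib_right[symmetric] mass[OF v] ..
    finally show "(\<Sum>w\<in>{w\<in>\<Omega>. N w = v}. if N w \<le> m then W w * (z ^ card I * convolution p V (card I) (m - N w)) else 0) =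
        (if v \<le> m then z * p v * (z ^ card I * convolution p V (card I) (m - v)) else 0)" by simp
  qed
  also have "\<dots> = (\<Sum>v\<in>{v\<in>V. v \<le> m}. z * p v * (z ^ card I * convolution p V (card I) (m - v)))"
    by (rule sum.inter_filter[OF fin(2), symmetric])
  also have "\<dots> = z ^ card (insert i I) * convolution p V (card (insert i I)) m"
    using insert.hyps by (simp add: sum_distrib_left ac_simps)
  finally show ?case .
qed

text \<open>The point probabilities sum to 1 over \<open>V\<close>, so the variables take their
  values in \<open>V\<close> almost surely, and the event splits into the finitely many value
  patterns.\<close>

lemma (in prob_space) prob_sum_eq_convolution:
  assumes indep: "indep_vars (\<lambda>_. borel) Y I" and I: "finite I" "I \<noteq> {}" and V: "finite V"
    and p: "\<And>i v. i \<in> I \<Longrightarrow> v \<in> V \<Longrightarrow> prob {\<omega> \<in> space M. Y i \<omega> = real v} = p v" and total: "(\<Sum>v\<in>V. p v) = 1"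
  shows "prob {\<omega> \<in> space M. (\<Sum>i\<in>I. Y i \<omega>) = real m} = convolution p V (card I) m"
proof -
  have Y [measurable]: "random_variable borel (Y i)" if "i \<in> I" for i using indep that by (auto simp: indep_vars_def)
  define E where "E y = {\<omega> \<in> space M. \<forall>i\<in>I. Y i \<omega> = real (y i)}" for y :: "'b \<Rightarrow> nat"
  have E_ev: "E y \<in> events" for y
  proof -
    have "E y = (\<Inter>i\<in>I. Y i -` {real (y i)} \<inter> space M)" using I by (auto simp: E_def)
    then show ?thesis using I Y by (auto intro!: sets.finite_INT measurable_sets)
  qed
  have E_prob: "prob (E y) = (\<Prod>i\<in>I. p (y i))" if "y \<in> (\<Pi>\<^sub>E i\<in>I. V)" for y
  proof -
    have "E y = (\<Inter>i\<in>I. Y i -` {real (y i)} \<inter> space M)" using I by (auto simp: E_def)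
    then have "prob (E y) = (\<Prod>i\<in>I. prob (Y i -` {real (y i)} \<inter> space M))"
      using indep_varsD_finite[OF indep I(2,1), of "\<lambda>i. {real (y i)}"] by simp
    also have "\<dots> = (\<Prod>i\<in>I. p (y i))"
    proof (rule prod.cong[OF refl])
      fix i assume i: "i \<in> I"
      have "Y i -` {real (y i)} \<inter> space M = {\<omega> \<in> space M. Y i \<omega> = real (y i)}" by auto
      then show "prob (Y i -` {real (y i)} \<inter> space M) = p (y i)" using p[OF i] that i by auto
    qed
    finally show ?thesis .
  qed
  have finP: "finite (\<Pi>\<^sub>E i\<in>I. V)" by (intro finite_PiE I V)
  have disj: "disjoint_family_on E (\<Pi>\<^sub>E i\<in>I. V)"
    unfolding disjoint_family_on_def
  proof (intro ballI impI, rule ccontr)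
    fix y y' assume y: "y \<in> (\<Pi>\<^sub>E i\<in>I. V)" "y' \<in> (\<Pi>\<^sub>E i\<in>I. V)" "y \<noteq> y'" "E y \<inter> E y' \<noteq> {}"
    then obtain \<omega> where "\<omega> \<in> E y" "\<omega> \<in> E y'" by blast
    then have "y i = y' i" if "i \<in> I" for i using that by (auto simp: E_def)
    then have "y = y'" by (rule PiE_ext[OF y(1,2)])
    then show False using y(3) by blast
  qed
  have U: "prob (\<Union>y\<in>(\<Pi>\<^sub>E i\<in>I. V). E y) = 1"
  proof -
    have "prob (\<Union>y\<in>(\<Pi>\<^sub>E i\<in>I. V). E y) = (\<Sum>y\<in>(\<Pi>\<^sub>E i\<in>I. V). prob (E y))"
      by (rule finite_measure_finite_Union[OF finP _ disj]) (use E_ev in auto)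
    also have "\<dots> = (\<Sum>y\<in>(\<Pi>\<^sub>E i\<in>I. V). \<Prod>i\<in>I. p (y i))" by (rule sum.cong[OF refl E_prob])
    also have "\<dots> = (\<Prod>i\<in>I. \<Sum>v\<in>V. p v)" by (rule prod_sum_PiE[symmetric]) (use I V in auto)
    finally show ?thesis using total by simp
  qed
  let ?A = "{\<omega> \<in> space M. (\<Sum>i\<in>I. Y i \<omega>) = real m}"
  have "random_variable borel (\<lambda>\<omega>. \<Sum>i\<in>I. Y i \<omega>)" by (intro borel_measurable_sum Y)
  moreover have "?A = (\<lambda>\<omega>. \<Sum>i\<in>I. Y i \<omega>) -` {real m} \<inter> space M" by auto
  ultimately have A_ev: "?A \<in> events" by (auto intro: measurable_sets)
  have U_ev: "(\<Union>y\<in>(\<Pi>\<^sub>E i\<in>I. V). E y) \<in> events" using finP E_ev by blast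
  have "prob ?A = prob (?A \<inter> (\<Union>y\<in>(\<Pi>\<^sub>E i\<in>I. V). E y))"
  proof -
    have "AE \<omega> in M. \<omega> \<in> (\<Union>y\<in>(\<Pi>\<^sub>E i\<in>I. V). E y)" using U prob_eq_1[OF U_ev] by blast
    then show ?thesis by (intro finite_measure_eq_AE) (use A_ev U_ev in auto)
  qed
  also have "?A \<inter> (\<Union>y\<in>(\<Pi>\<^sub>E i\<in>I. V). E y) = (\<Union>y\<in>{y \<in> (\<Pi>\<^sub>E i\<in>I. V). (\<Sum>i\<in>I. y i) = m}. E y)"
  proof -
    have "(\<Sum>i\<in>I. Y i \<omega>) = real (\<Sum>i\<in>I. y i)" if "\<omega> \<in> E y" for \<omega> y using that by (simp add: E_def)
    then show ?thesis by (auto simp: E_def simp del: of_nat_sum) 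
  qed
  also have "prob \<dots> = (\<Sum>y\<in>{y \<in> (\<Pi>\<^sub>E i\<in>I. V). (\<Sum>i\<in>I. y i) = m}. prob (E y))"
    by (rule finite_measure_finite_Union) (use finP E_ev disj in \<open>auto simp: disjoint_family_on_def\<close>)
  also have "\<dots> = (\<Sum>y\<in>{y \<in> (\<Pi>\<^sub>E i\<in>I. V). (\<Sum>i\<in>I. y i) = m}. \<Prod>i\<in>I. p (y i))"
    by (rule sum.cong[OF refl]) (simp add: E_prob)
  also have "\<dots> = (\<Sum>y\<in>(\<Pi>\<^sub>E i\<in>I. V). (\<Prod>i\<in>I. p (y i)) * of_bool ((\<Sum>i\<in>I. y i) = m))"
    unfolding sum.inter_filter[OF finP] by (rule sum.cong[OF refl]) simp
  also have "\<dots> = 1 ^ card I * convolution p V (card I) m"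
  proof (rule sum_PiE_convolution[OF I(1) V V])
    fix v assume "v \<in> V"
    then have "{w\<in>V. w = v} = {v}" by auto
    then show "(\<Sum>w\<in>{w\<in>V. w = v}. p w) = 1 * p v" by simp
  qed
  finally show ?thesis by simp
qed

subsection \<open>Counting the curves\<close>

text \<open>Both kinds of degree vectors in one notation: \<open>None\<close> leaves the degrees
  unchanged. Natural subtraction agrees with the integer \<open>d \<beta> - 1\<close> once
  \<open>d \<beta> \<ge> 1\<close>.\<close>

definition lowered :: "('i \<Rightarrow> nat) \<Rightarrow> 'i option \<Rightarrow> 'i \<Rightarrow> nat" where
  "lowered d \<beta> = (case \<beta> of None \<Rightarrow> d | Some \<alpha> \<Rightarrow> d(\<alpha> := d \<alpha> - 1))"

lemma lowered_apply: "lowered d \<beta> \<alpha> = (if \<beta> = Some \<alpha> then d \<alpha> - 1 else d \<alpha>)"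
  by (cases \<beta>) (auto simp: lowered_def)

lemma lowered_ge: "d \<alpha> - 1 \<le> lowered d \<beta> \<alpha>"
  by (simp add: lowered_apply)

text \<open>The degree vector reveals which entry was lowered, so the union defining the family is
  disjoint.\<close>

lemma lowered_inj:
  assumes "\<beta> \<in> insert None (Some ` R)" "\<gamma> \<in> insert None (Some ` R)" and d: "\<And>\<alpha>. \<alpha> \<in> R \<Longrightarrow> d \<alpha> \<ge> 1"
    and eq: "\<And>\<alpha>. \<alpha> \<in> R \<Longrightarrow> lowered d \<beta> \<alpha> = lowered d \<gamma> \<alpha>"
  shows "\<beta> = \<gamma>"
proof -
  have pos: "d \<alpha> - 1 \<noteq> d \<alpha>" if "\<alpha> \<in> R" for \<alpha> using d[OF that] by simp
  have *: "\<beta> = Some \<alpha> \<longleftrightarrow> \<gamma> = Some \<alpha>" if a: "\<alpha> \<in> R" for \<alpha>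
    using eq[OF a] pos[OF a] unfolding lowered_apply by presburger
  show ?thesis
  proof (cases \<beta>)
    case None
    then show ?thesis using assms(2) * by (cases \<gamma>) auto
  next
    case (Some \<alpha>)
    then have "\<alpha> \<in> R" using assms(1) by auto
    then show ?thesis using *[of \<alpha>] Some by simp
  qed
qed

lemma power_sum_lowered:
  assumes R: "finite R" and b: "\<beta> \<in> insert None (Some ` R)" and d: "\<And>\<alpha>. \<alpha> \<in> R \<Longrightarrow> d \<alpha> \<ge> 1" and q: "q > 0"
  shows "real q ^ (\<Sum>\<alpha>\<in>R. lowered d \<beta> \<alpha>) = infinite_weight q \<beta> * real q ^ (\<Sum>\<alpha>\<in>R. d \<alpha>)"
proof (cases \<beta>)
  case None
  then show ?thesis by (simp add: lowered_def infinite_weight_def)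
next
  case (Some \<gamma>)
  then have g: "\<gamma> \<in> R" using b by auto
  have "(\<Sum>\<alpha>\<in>R. lowered d \<beta> \<alpha>) = (d \<gamma> - 1) + (\<Sum>\<alpha>\<in>R - {\<gamma>}. d \<alpha>)"
    unfolding sum.remove[OF R g] by (intro arg_cong2[where f = "(+)"] sum.cong) (auto simp: lowered_def Some)
  moreover have "(\<Sum>\<alpha>\<in>R. d \<alpha>) = d \<gamma> + (\<Sum>\<alpha>\<in>R - {\<gamma>}. d \<alpha>)" by (rule sum.remove[OF R g])
  ultimately have "(\<Sum>\<alpha>\<in>R. d \<alpha>) = Suc (\<Sum>\<alpha>\<in>R. lowered d \<beta> \<alpha>)" using d[OF g] by linarith
  then show ?thesis using q Some by (simp add: infinite_weight_def)
qed

lemma value_points_cong: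
  assumes "\<And>\<alpha>. \<alpha> \<in> index_vectors n r \<Longrightarrow> v \<alpha> = w \<alpha>"
  shows "value_points n r c v = value_points n r c w"
proof -
  have "{\<alpha>\<in>index_vectors n r. v \<alpha> = 0} = {\<alpha>\<in>index_vectors n r. w \<alpha> = 0}"
    "{\<alpha>\<in>index_vectors n r. v \<alpha> \<noteq> 0} = {\<alpha>\<in>index_vectors n r. w \<alpha> \<noteq> 0}" using assms by auto
  moreover have "(\<Prod>\<alpha>\<in>{\<alpha>\<in>index_vectors n r. w \<alpha> \<noteq> 0}. v \<alpha> ^ \<alpha> j) = (\<Prod>\<alpha>\<in>{\<alpha>\<in>index_vectors n r. w \<alpha> \<noteq> 0}. w \<alpha> ^ \<alpha> j)" for j
    by (rule prod.cong) (use assms in auto)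
  ultimately show ?thesis unfolding value_points_def by simp
qed

lemma value_tuples_iff:
  fixes f :: "(nat \<Rightarrow> nat) \<Rightarrow> 'a::{field,finite} poly"
  shows "f \<in> value_tuples (index_vectors n r) e v \<longleftrightarrow>
    f \<in> coprime_tuples n r (\<lambda>\<alpha>. int (e \<alpha>)) \<and> (\<forall>x. \<forall>\<alpha>\<in>index_vectors n r. poly (f \<alpha>) x = v x \<alpha>)"
proof -
  have "{p \<in> monics m. squarefree p} = monic_squarefree (int m)" for m
    by (auto simp: monics_def monic_squarefree_def)
  then show ?thesis by (auto simp: value_tuples_def coprime_tuples_def)
qed

lemma poly_tuples_lowered:
  assumes d: "\<And>\<alpha>. \<alpha> \<in> index_vectors n r \<Longrightarrow> d \<alpha> \<ge> 1"
  shows "poly_tuples n r d = (\<Union>\<beta>\<in>insert None (Some ` index_vectors n r). coprime_tuples n r (\<lambda>\<alpha>. int (lowered d \<beta> \<alpha>)))"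
proof -
  have "(\<lambda>\<alpha>. int (d \<alpha>))(\<beta> := int (d \<beta>) - 1) = (\<lambda>\<alpha>. int (lowered d (Some \<beta>) \<alpha>))" if "\<beta> \<in> index_vectors n r" for \<beta>
    using d[OF that] by (auto simp: lowered_def of_nat_diff)
  then have "(\<Union>\<beta>\<in>index_vectors n r. coprime_tuples n r ((\<lambda>\<alpha>. int (d \<alpha>))(\<beta> := int (d \<beta>) - 1))) =
      (\<Union>\<beta>\<in>index_vectors n r. coprime_tuples n r (\<lambda>\<alpha>. int (lowered d (Some \<beta>) \<alpha>)) :: ((nat \<Rightarrow> nat) \<Rightarrow> 'a poly) set)"
    by (intro SUP_cong refl) simp
  moreover have "lowered d None = d" by (simp add: lowered_def)
  ultimately show ?thesis by (simp add: poly_tuples_def)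
qed

text \<open>By admissibility the degree of the \<open>j\<close>-th radicand is 0 modulo
  \<open>r j\<close>, or \<open>- \<gamma> j\<close> if the entry \<open>\<gamma>\<close> was
  lowered; the order at infinity, being minus the degree, is then \<open>\<gamma> j\<close>. The
  bound \<open>d \<alpha> \<ge> 2\<close> keeps the lowered degree positive.\<close>

lemma function_field_points_lowered:
  fixes f :: "(nat \<Rightarrow> nat) \<Rightarrow> 'a::{field,finite} poly"
  assumes r: "\<And>j. j \<in> {1..n} \<Longrightarrow> r j dvd CARD('a) - 1"
    and c: "\<And>j. j \<in> {1..n} \<Longrightarrow> c j \<noteq> 0" and adm: "d \<in> admissible_degrees n r"
    and d: "\<And>\<alpha>. \<alpha> \<in> index_vectors n r \<Longrightarrow> d \<alpha> \<ge> 2" and b: "\<beta> \<in> insert None (Some ` index_vectors n r)"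
    and f: "f \<in> value_tuples (index_vectors n r) (lowered d \<beta>) v"
  shows "card (rational_points (function_field n r (c, f))) = (\<Sum>x\<in>UNIV. value_points n r c (v x)) + infinite_points n r \<beta> c"
proof -
  let ?R = "index_vectors n r"
  have f': "f \<in> coprime_tuples n r (\<lambda>\<alpha>. int (lowered d \<beta> \<alpha>))" "\<And>x \<alpha>. \<alpha> \<in> ?R \<Longrightarrow> poly (f \<alpha>) x = v x \<alpha>"
    using f unfolding value_tuples_iff by auto
  have e: "int (lowered d \<beta> \<alpha>) \<ge> 1" if "\<alpha> \<in> ?R" for \<alpha>
    using d[OF that] lowered_ge[of d \<alpha> \<beta>] by linarith
  have "local_points {1..n} r (\<lambda>j. - (\<Sum>\<alpha>\<in>?R. int (\<alpha> j) * int (lowered d \<beta> \<alpha>))) c = infinite_points n r \<beta> c"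
    unfolding infinite_points_def
  proof (rule local_points_mod)
    fix j assume j: "j \<in> {1..n}"
    have "r j dvd (\<Sum>\<alpha>\<in>?R. \<alpha> j * d \<alpha>)" using adm j by (auto simp: admissible_degrees_def cong_0_iff)
    then have "int (r j) dvd int (\<Sum>\<alpha>\<in>?R. \<alpha> j * d \<alpha>)" by (simp only: int_dvd_int_iff)
    then have dv: "int (r j) dvd (\<Sum>\<alpha>\<in>?R. int (\<alpha> j) * int (d \<alpha>))" by simp
    have "- (\<Sum>\<alpha>\<in>?R. int (\<alpha> j) * int (lowered d \<beta> \<alpha>)) - (case \<beta> of None \<Rightarrow> \<lambda>_. 0 | Some \<alpha> \<Rightarrow> \<lambda>j. int (\<alpha> j)) j =
        - (\<Sum>\<alpha>\<in>?R. int (\<alpha> j) * int (d \<alpha>))"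
    proof (cases \<beta>)
      case None
      then show ?thesis by (simp add: lowered_def)
    next
      case (Some \<gamma>)
      then have g: "\<gamma> \<in> ?R" using b by auto
      have "(\<Sum>\<alpha>\<in>?R - {\<gamma>}. int (\<alpha> j) * int (lowered d \<beta> \<alpha>)) = (\<Sum>\<alpha>\<in>?R - {\<gamma>}. int (\<alpha> j) * int (d \<alpha>))"
        by (rule sum.cong) (auto simp: lowered_def Some)
      moreover have lg: "int (lowered d \<beta> \<gamma>) = int (d \<gamma>) - 1" using d[OF g] by (simp add: lowered_def Some of_nat_diff)
      moreover have "int (\<gamma> j) * int (lowered d \<beta> \<gamma>) = int (\<gamma> j) * int (d \<gamma>) - int (\<gamma> j)"
        unfolding lg by (simp add: right_diff_distrib)
      moreover have "(case \<beta> of None \<Rightarrow> \<lambda>_. 0 | Some \<alpha> \<Rightarrow> \<lambda>j. int (\<alpha> j)) j = int (\<gamma> j)" by (simp add: Some)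
      ultimately show ?thesis
        unfolding sum.remove[OF finite_index_vectors g] by linarith
    qed
    then show "int (r j) dvd - (\<Sum>\<alpha>\<in>?R. int (\<alpha> j) * int (lowered d \<beta> \<alpha>)) - (case \<beta> of None \<Rightarrow> \<lambda>_. 0 | Some \<alpha> \<Rightarrow> \<lambda>j. int (\<alpha> j)) j"
      using dv by simp
  qed
  moreover have "value_points n r c (\<lambda>\<alpha>. poly (f \<alpha>) x) = value_points n r c (v x)" for x
    by (rule value_points_cong) (use f'(2) in simp)
  ultimately show ?thesis using function_field_points[where n = n and r = r and c = c, OF r c f'(1) e] by simp
qed

text \<open>A parameter determines its option by the degrees and its \<open>v\<close> by the values,
  so for each \<open>c\<close> the family splits into disjoint pieces on which the number of points
  is constant. The predicate \<open>Q\<close> covers numerator and denominator together.\<close>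

lemma card_curve_params:
  fixes Q :: "nat \<Rightarrow> bool"
  assumes r: "\<And>j. j \<in> {1..n} \<Longrightarrow> r j dvd CARD('a::{field,finite}) - 1"
    and adm: "d \<in> admissible_degrees n r" and d: "\<And>\<alpha>. \<alpha> \<in> index_vectors n r \<Longrightarrow> d \<alpha> \<ge> 2"
  shows "card {t \<in> curve_params n r d. Q (card (rational_points (function_field n r (t :: _ \<times> (_ \<Rightarrow> 'a poly)))))} =
    (\<Sum>\<beta>\<in>insert None (Some ` index_vectors n r). \<Sum>c\<in>(\<Pi>\<^sub>E j\<in>{1..n}. UNIV - {0 :: 'a}).
      \<Sum>v\<in>(\<Pi>\<^sub>E x\<in>UNIV. {w \<in> (\<Pi>\<^sub>E \<gamma>\<in>index_vectors n r. UNIV). single_zero (index_vectors n r) w}).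
        if Q ((\<Sum>x\<in>UNIV. value_points n r c (v x)) + infinite_points n r \<beta> c)
        then card (value_tuples (index_vectors n r) (lowered d \<beta>) v) else 0)"
proof -
  let ?R = "index_vectors n r"
  let ?O = "insert None (Some ` ?R)" and ?A = "\<Pi>\<^sub>E j\<in>{1..n}. UNIV - {0 :: 'a}"
  let ?V = "\<Pi>\<^sub>E x\<in>(UNIV :: 'a set). {w \<in> (\<Pi>\<^sub>E \<gamma>\<in>?R. UNIV :: 'a set). single_zero ?R w}"
  let ?N = "\<lambda>c v \<beta>. (\<Sum>x\<in>UNIV. value_points n r c (v x)) + infinite_points n r \<beta> c"
  define F where "F \<beta> c v = (if Q (?N c v \<beta>) then value_tuples ?R (lowered d \<beta>) v else {})"
    for \<beta> and c :: "nat \<Rightarrow> 'a" and v :: "'a \<Rightarrow> (nat \<Rightarrow> nat) \<Rightarrow> 'a"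
  have finR: "finite ?R" by (rule finite_index_vectors)
  have finA: "finite ?A" by (intro finite_PiE) auto
  have "finite (\<Pi>\<^sub>E \<gamma>\<in>?R. UNIV :: 'a set)" using finR by (intro finite_PiE) auto
  then have finV: "finite ?V" by (intro finite_PiE) auto
  have finvt: "finite (value_tuples ?R e v)" for e and v :: "'a \<Rightarrow> (nat \<Rightarrow> nat) \<Rightarrow> 'a"
  proof (rule finite_subset)
    show "value_tuples ?R e v \<subseteq> (\<Pi>\<^sub>E \<alpha>\<in>?R. monics (e \<alpha>))" by (auto simp: value_tuples_def)
    show "finite (\<Pi>\<^sub>E \<alpha>\<in>?R. monics (e \<alpha>) :: 'a poly set)" using finR by (intro finite_PiE) (auto simp: card_monics)
  qed
  have finF: "finite (F \<beta> c v)" for \<beta> c v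
    unfolding F_def using finvt[of "lowered d \<beta>" v] by (cases "Q (?N c v \<beta>)") auto
  have inj: "\<beta> = \<beta>' \<and> v = v'" if bb: "\<beta> \<in> ?O" "\<beta>' \<in> ?O" and v: "v \<in> ?V" "v' \<in> ?V"
    and f: "f \<in> value_tuples ?R (lowered d \<beta>) v" "f \<in> value_tuples ?R (lowered d \<beta>') v'" for \<beta> \<beta>' v v' f
  proof
    have "lowered d \<beta> \<alpha> = lowered d \<beta>' \<alpha>" if "\<alpha> \<in> ?R" for \<alpha>
      using f that by (auto simp: value_tuples_def monics_def dest!: PiE_mem)
    moreover have "1 \<le> d \<alpha>" if "\<alpha> \<in> ?R" for \<alpha> using d[OF that] by simp
    ultimately show "\<beta> = \<beta>'" by (intro lowered_inj[OF bb, of d]) blast+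
    have "v x \<alpha> = v' x \<alpha>" if "\<alpha> \<in> ?R" for x \<alpha> using f that unfolding value_tuples_iff by metis
    moreover have "v x \<in> extensional ?R" "v' x \<in> extensional ?R" for x using v by (auto simp: PiE_iff)
    ultimately have "v x = v' x" for x by (meson extensionalityI)
    then show "v = v'" by blast
  qed
  let ?T = "SIGMA \<beta>:?O. SIGMA c:?A. SIGMA v:?V. F \<beta> c v"
  have "bij_betw (\<lambda>(\<beta>, c, v, f). (c, f)) ?T {t \<in> curve_params n r d. Q (card (rational_points (function_field n r t)))}"
  proof (rule bij_betw_imageI)
    show "inj_on (\<lambda>(\<beta>, c, v, f). (c, f)) ?T"
    proof (rule inj_onI)
      fix s t assume s: "s \<in> ?T" and t: "t \<in> ?T" and eq: "(\<lambda>(\<beta>, c, v, f). (c, f)) s = (\<lambda>(\<beta>, c, v, f). (c, f)) t"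
      obtain \<beta> c v f where s': "s = (\<beta>, c, v, f)" by (cases s)
      obtain \<beta>' c' v' f' where t': "t = (\<beta>', c', v', f')" by (cases t)
      have e: "c' = c" "f' = f" using eq s' t' by auto
      have "f \<in> F \<beta> c v" "f \<in> F \<beta>' c v'" "\<beta> \<in> ?O" "\<beta>' \<in> ?O" "v \<in> ?V" "v' \<in> ?V"
        using s t unfolding s' t' e by blast+
      then have "\<beta> = \<beta>' \<and> v = v'" by (intro inj[of \<beta> \<beta>' v v' f]) (auto simp: F_def split: if_splits)
      then show "s = t" unfolding s' t' e by simp
    qed
    show "(\<lambda>(\<beta>, c, v, f). (c, f)) ` ?T = {t \<in> curve_params n r d. Q (card (rational_points (function_field n r t)))}"
    proof (intro equalityI subsetI)
      fix t assume "t \<in> (\<lambda>(\<beta>, c, v, f). (c, f)) ` ?T"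
      then obtain p where p: "p \<in> ?T" "t = (\<lambda>(\<beta>, c, v, f). (c, f)) p" by blast
      obtain \<beta> c v f where p': "p = (\<beta>, c, v, f)" by (cases p)
      have t: "t = (c, f)" "\<beta> \<in> ?O" "c \<in> ?A" "v \<in> ?V" "f \<in> F \<beta> c v" using p unfolding p' by (simp, blast+)
      then have Q: "Q (?N c v \<beta>)" and f: "f \<in> value_tuples ?R (lowered d \<beta>) v" by (auto simp: F_def split: if_splits)
      have "card (rational_points (function_field n r (c, f))) = ?N c v \<beta>"
        by (rule function_field_points_lowered[OF r _ adm d t(2) f]) (use t(3) in auto)
      moreover have "f \<in> coprime_tuples n r (\<lambda>\<alpha>. int (lowered d \<beta> \<alpha>))" using f unfolding value_tuples_iff by blast
      then have "f \<in> poly_tuples n r d" using t(2) d by (subst poly_tuples_lowered) force+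
      ultimately show "t \<in> {t \<in> curve_params n r d. Q (card (rational_points (function_field n r t)))}"
        using t(1,3) Q by (simp add: curve_params_def)
    next
      fix t :: "(nat \<Rightarrow> 'a) \<times> ((nat \<Rightarrow> nat) \<Rightarrow> 'a poly)"
      assume t: "t \<in> {t \<in> curve_params n r d. Q (card (rational_points (function_field n r t)))}"
      obtain c f where cf: "t = (c, f)" by (cases t)
      then have c: "c \<in> ?A" and f: "f \<in> poly_tuples n r d" using t by (auto simp: curve_params_def)
      from f obtain \<beta> where b: "\<beta> \<in> ?O" "f \<in> coprime_tuples n r (\<lambda>\<alpha>. int (lowered d \<beta> \<alpha>))"
        using d by (subst (asm) poly_tuples_lowered) force+
      define v where "v x = (\<lambda>\<alpha>\<in>?R. poly (f \<alpha>) x)" for x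
      have v: "v \<in> ?V"
      proof
        fix x :: 'a
        have "single_zero ?R (v x)"
          unfolding single_zero_def v_def using coprime_tuples_zero_unique[OF b(2)] by simp
        then show "v x \<in> {w \<in> (\<Pi>\<^sub>E \<gamma>\<in>?R. UNIV). single_zero ?R w}" by (simp add: v_def)
      qed simp
      have f: "f \<in> value_tuples ?R (lowered d \<beta>) v" unfolding value_tuples_iff using b(2) by (simp add: v_def)
      have "card (rational_points (function_field n r (c, f))) = ?N c v \<beta>"
        by (rule function_field_points_lowered[OF r _ adm d b(1) f]) (use c in auto)
      then have "f \<in> F \<beta> c v" using t f cf by (simp add: F_def)
      then have "(\<beta>, c, v, f) \<in> ?T" using b(1) c v by blast
      then show "t \<in> (\<lambda>(\<beta>, c, v, f). (c, f)) ` ?T" unfolding cf by (rule rev_image_eqI) simp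
    qed
  qed
  then have "card {t \<in> curve_params n r d. Q (card (rational_points (function_field n r (t :: _ \<times> (_ \<Rightarrow> 'a poly)))))} = card ?T"
    by (rule bij_betw_same_card[symmetric])
  also have "\<dots> = (\<Sum>\<beta>\<in>?O. card (SIGMA c:?A. SIGMA v:?V. F \<beta> c v))"
    by (rule card_SigmaI) (use finR finA finV finF in \<open>auto intro!: finite_SigmaI\<close>)
  also have "\<dots> = (\<Sum>\<beta>\<in>?O. \<Sum>c\<in>?A. card (SIGMA v:?V. F \<beta> c v))"
    by (intro sum.cong refl card_SigmaI) (use finA finV finF in \<open>auto intro!: finite_SigmaI\<close>)
  also have "\<dots> = (\<Sum>\<beta>\<in>?O. \<Sum>c\<in>?A. \<Sum>v\<in>?V. card (F \<beta> c v))"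
    by (intro sum.cong refl card_SigmaI) (use finV finF in auto)
  also have "\<dots> = (\<Sum>\<beta>\<in>?O. \<Sum>c\<in>?A. \<Sum>v\<in>?V. if Q (?N c v \<beta>) then card (value_tuples ?R (lowered d \<beta>) v) else 0)"
    by (intro sum.cong refl) (simp add: F_def)
  finally show ?thesis .
qed

subsection \<open>The limit\<close>

lemma eventually_degrees_at_top:
  "\<forall>\<^sub>F d in degrees_at_top n r. d \<in> admissible_degrees n r \<and> (\<forall>\<alpha>\<in>index_vectors n r. N \<le> d \<alpha>)"
proof -
  let ?F = "degrees_at_top n r"
  have "\<forall>\<^sub>F d in ?F. N \<le> d \<alpha>" if a: "\<alpha> \<in> index_vectors n r" for \<alpha>
  proof (rule filter_leD)
    show "?F \<le> filtercomap (\<lambda>d. d \<alpha>) at_top"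
      unfolding degrees_at_top_def by (intro inf.coboundedI1 INF_lower a)
    show "\<forall>\<^sub>F d in filtercomap (\<lambda>d. d \<alpha>) at_top. N \<le> d \<alpha>"
      by (rule eventually_filtercomapI[OF eventually_ge_at_top])
  qed
  then have "\<forall>\<^sub>F d in ?F. \<forall>\<alpha>\<in>index_vectors n r. N \<le> d \<alpha>"
    by (intro eventually_ball_finite finite_index_vectors) blast
  moreover have "\<forall>\<^sub>F d in ?F. d \<in> admissible_degrees n r"
    unfolding degrees_at_top_def eventually_inf_principal by simp
  ultimately show ?thesis by (simp add: eventually_conj_iff)
qed

lemma local_density_pos: "local_density R w > 0" for w :: "'i \<Rightarrow> 'a::{field,finite}"
  unfolding local_density_def using card_field_ge2[where 'a='a] by (intro prod_pos) auto

text \<open>All pieces are normalized by the same power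
  \<open>q ^ (\<Sum>\<alpha>\<in>R. d \<alpha>)\<close>; this is where the weight
  \<open>1 / q\<close> of a lowered tuple appears.\<close>

lemma value_tuples_tendsto:
  fixes v :: "'a::{field,finite} \<Rightarrow> (nat \<Rightarrow> nat) \<Rightarrow> 'a" and n r
  defines "R \<equiv> index_vectors n r"
  assumes dens: "\<And>\<epsilon>. \<epsilon> > 0 \<Longrightarrow> \<exists>N. \<forall>e v. (\<forall>\<alpha>\<in>R. N \<le> e \<alpha>) \<longrightarrow> (\<forall>x :: 'a. single_zero R (v x)) \<longrightarrow>
      \<bar>real (card (value_tuples R e v)) / real CARD('a) ^ (\<Sum>\<alpha>\<in>R. e \<alpha>) - (\<Prod>x\<in>UNIV. local_density R (v x)) * B\<bar> \<le> \<epsilon>"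
    and v: "\<And>x. single_zero R (v x)" and b: "\<beta> \<in> insert None (Some ` R)"
  shows "((\<lambda>d. real (card (value_tuples R (lowered d \<beta>) v)) / real CARD('a) ^ (\<Sum>\<alpha>\<in>R. d \<alpha>)) \<longlongrightarrow>
    infinite_weight CARD('a) \<beta> * ((\<Prod>x\<in>UNIV. local_density R (v x)) * B)) (degrees_at_top n r)"
proof (rule Lim_transform_eventually)
  let ?q = "real CARD('a)" and ?L = "(\<Prod>x\<in>UNIV. local_density R (v x)) * B"
  let ?g = "\<lambda>d. real (card (value_tuples R (lowered d \<beta>) v)) / ?q ^ (\<Sum>\<alpha>\<in>R. lowered d \<beta> \<alpha>)"
  have finR: "finite R" unfolding R_def by (rule finite_index_vectors)
  have "(?g \<longlongrightarrow> ?L) (degrees_at_top n r)"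
  proof (rule tendstoI)
    fix \<epsilon> :: real assume eps: "\<epsilon> > 0"
    then obtain N where N: "\<And>e. (\<forall>\<alpha>\<in>R. N \<le> e \<alpha>) \<Longrightarrow>
        \<bar>real (card (value_tuples R e v)) / ?q ^ (\<Sum>\<alpha>\<in>R. e \<alpha>) - ?L\<bar> \<le> \<epsilon> / 2"
      using dens[of "\<epsilon> / 2"] v by (metis half_gt_zero)
    \<comment> \<open>\<open>Suc N\<close>, because one degree may be lowered by 1.\<close>
    from eventually_degrees_at_top[of n r "Suc N"] show "\<forall>\<^sub>F d in degrees_at_top n r. dist (?g d) ?L < \<epsilon>"
    proof eventually_elim
      case (elim d)
      have "N \<le> lowered d \<beta> \<alpha>" if "\<alpha> \<in> R" for \<alpha>
        using lowered_ge[of d \<alpha> \<beta>] elim that unfolding R_def by force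
      then have "\<bar>?g d - ?L\<bar> \<le> \<epsilon> / 2" by (intro N) blast
      then show ?case using eps unfolding dist_real_def by linarith
    qed
  qed
  then show "((\<lambda>d. infinite_weight CARD('a) \<beta> * ?g d) \<longlongrightarrow> infinite_weight CARD('a) \<beta> * ?L) (degrees_at_top n r)"
    by (rule tendsto_mult_left)
  from eventually_degrees_at_top[of n r 1] show "\<forall>\<^sub>F d in degrees_at_top n r. infinite_weight CARD('a) \<beta> * ?g d =
      real (card (value_tuples R (lowered d \<beta>) v)) / ?q ^ (\<Sum>\<alpha>\<in>R. d \<alpha>)"
  proof eventually_elim
    case (elim d)
    have "?q ^ (\<Sum>\<alpha>\<in>R. lowered d \<beta> \<alpha>) = infinite_weight CARD('a) \<beta> * ?q ^ (\<Sum>\<alpha>\<in>R. d \<alpha>)"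
      by (rule power_sum_lowered[OF finR b]) (use elim in \<open>auto simp: R_def\<close>)
    moreover have "infinite_weight CARD('a) \<beta> \<noteq> 0" by (auto simp: infinite_weight_def split: option.split)
    ultimately show ?case by simp
  qed
qed

lemma sum_point_law:
  assumes V: "finite V" "0 \<in> V" "(\<Prod>j\<in>{1..n}. r j) \<in> V" "\<And>\<alpha>. \<alpha> \<in> index_vectors n r \<Longrightarrow> (\<Prod>j\<in>{1..n}. r j) div index_order n r \<alpha> \<in> V"
    and q: "q > 0"
  shows "(\<Sum>v\<in>V. point_law n r q v) = 1"
proof -
  let ?g = "\<Prod>j\<in>{1..n}. r j" and ?R = "index_vectors n r"
  have one: "(\<Sum>v\<in>V. c * of_bool (v = a)) = c" if "a \<in> V" for c :: real and a
  proof -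
    have "(\<Sum>v\<in>V. c * of_bool (v = a)) = (\<Sum>v\<in>V. if v = a then c else 0)" by (rule sum.cong) auto
    then show ?thesis using V(1) that by simp
  qed
  have two: "(\<Sum>v\<in>V. two_point_law ?g s v) = 1" if "?g div s \<in> V" for s
    unfolding two_point_law_def sum.distrib one[OF that] one[OF V(2)] by simp
  have "(\<Sum>v\<in>V. real q * two_point_law ?g 1 v + (\<Sum>\<alpha>\<in>?R. two_point_law ?g (index_order n r \<alpha>) v)) = real q + real (card ?R)"
    unfolding sum.distrib sum.swap[of _ ?R V] sum_distrib_left[symmetric]
    using two[of 1] two V(3,4) by simp
  then show ?thesis unfolding point_law_def sum_divide_distrib[symmetric] using q by simp
qed

lemma local_points_range:
  fixes c :: "nat \<Rightarrow> 'a::field"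
  assumes r: "\<And>j. j \<in> {1..n} \<Longrightarrow> r j dvd N" "N > 0"
  shows "local_points {1..n} r a c \<in> insert 0 ((\<lambda>s. (\<Prod>j\<in>{1..n}. r j) div s) ` {s. s dvd N})"
proof (cases "local_points {1..n} r a c = 0")
  case False
  have pos: "r j > 0" if "j \<in> {1..n}" for j using r(1)[OF that] r(2) by (auto intro: Nat.gr0I)
  have "local_points {1..n} r a c = (\<Prod>j\<in>{1..n}. r j) div vector_order {1..n} r a"
    by (rule local_points_neq_0_iff(2)) (use pos False in auto)
  moreover have "vector_order {1..n} r a dvd N" by (rule vector_order(3)[OF r])
  ultimately show ?thesis by blast
qed simp

lemma sum_point_law_divisors:
  assumes r: "\<And>j. j \<in> {1..n} \<Longrightarrow> r j dvd N" "N > 0" and q: "q > 0"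
  shows "(\<Sum>v\<in>insert 0 ((\<lambda>s. (\<Prod>j\<in>{1..n}. r j) div s) ` {s. s dvd N}). point_law n r q v) = 1"
proof (rule sum_point_law[OF _ _ _ _ q])
  show "(\<Prod>j\<in>{1..n}. r j) \<in> insert 0 ((\<lambda>s. (\<Prod>j\<in>{1..n}. r j) div s) ` {s. s dvd N})"
    by (intro insertI2 image_eqI[of _ _ 1]) auto
  show "(\<Prod>j\<in>{1..n}. r j) div index_order n r \<alpha> \<in> insert 0 ((\<lambda>s. (\<Prod>j\<in>{1..n}. r j) div s) ` {s. s dvd N})" for \<alpha>
    by (intro insertI2 imageI CollectI index_order(2)[OF r])
qed (use r(2) in auto)

lemma num_elements_of_order_1:
  assumes "\<And>j. j \<in> {1..n} \<Longrightarrow> r j > 0"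
  shows "num_elements_of_order (prod_cyclic_group n r) 1 = 1"
proof -
  interpret G: Group.group "prod_cyclic_group n r"
    unfolding prod_cyclic_group_def by (intro product_group) simp
  have "{g \<in> carrier (prod_cyclic_group n r). G.ord g = 1} = {\<one>\<^bsub>prod_cyclic_group n r\<^esub>}"
    using G.ord_eq_1 by auto
  then show ?thesis by (simp add: num_elements_of_order_def)
qed

text \<open>The neutral element contributes the summand 1; this accounts for the \<open>+ 1\<close>
  in the probability of the value 0.\<close>

lemma sum_order_elements:
  assumes r: "\<And>j. j \<in> {1..n} \<Longrightarrow> r j dvd N" "N > 0"
  shows "(\<Sum>s | s dvd N. real s * real (num_elements_of_order (prod_cyclic_group n r) s)) =
    1 + (\<Sum>\<alpha>\<in>index_vectors n r. real (index_order n r \<alpha>))"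
proof -
  let ?R = "index_vectors n r" and ?o = "index_order n r"
  let ?\<phi> = "num_elements_of_order (prod_cyclic_group n r)"
  have pos: "r j > 0" if "j \<in> {1..n}" for j using r(1)[OF that] r(2) by (auto intro: Nat.gr0I)
  have fin: "finite {s. s dvd N}" using r(2) by simp
  have o1: "?o \<alpha> \<noteq> 1" if "\<alpha> \<in> ?R" for \<alpha> by (rule index_order_neq_1) (use pos that in auto)
  have summand: "real s * real (?\<phi> s) = (\<Sum>\<alpha>\<in>{\<alpha>\<in>?R. ?o \<alpha> = s}. real (?o \<alpha>))" if "s \<noteq> 1" for s
  proof -
    have "?\<phi> s = card {\<alpha>\<in>?R. ?o \<alpha> = s}" by (rule num_elements_of_order_eq) (use pos that in auto)
    then show ?thesis by simp
  qed
  have "(\<Sum>s | s dvd N. real s * real (?\<phi> s)) = real 1 * real (?\<phi> 1) + (\<Sum>s\<in>{s. s dvd N} - {1}. real s * real (?\<phi> s))"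
    by (rule sum.remove) (use fin in auto)
  also have "\<dots> = 1 + (\<Sum>s\<in>{s. s dvd N} - {1}. \<Sum>\<alpha>\<in>{\<alpha>\<in>?R. ?o \<alpha> = s}. real (?o \<alpha>))"
    using num_elements_of_order_1[where n = n and r = r, OF pos] by (simp add: summand)
  also have "(\<Sum>s\<in>{s. s dvd N} - {1}. \<Sum>\<alpha>\<in>{\<alpha>\<in>?R. ?o \<alpha> = s}. real (?o \<alpha>)) = (\<Sum>\<alpha>\<in>?R. real (?o \<alpha>))"
    by (rule sum.group) (use fin finite_index_vectors o1 index_order(2)[where n = n and r = r, OF r] in auto)
  finally show ?thesis .
qed

text \<open>For divisors \<open>s\<close> of \<open>g\<close> the numbers \<open>g div s\<close> are
  nonzero and pairwise distinct. So for \<open>s \<noteq> 1\<close> the mass at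
  \<open>g div s\<close> comes only from index vectors of order \<open>s\<close>, and the mass at
  \<open>g\<close> only from the unramified case.\<close>

lemma point_law_values:
  assumes r: "\<And>j. j \<in> {1..n} \<Longrightarrow> r j dvd N" "N > 0" "N dvd (\<Prod>j\<in>{1..n}. r j)" and q: "q > 0"
  defines "g \<equiv> \<Prod>j\<in>{1..n}. r j" and "\<phi> \<equiv> num_elements_of_order (prod_cyclic_group n r)"
  shows "s dvd N \<Longrightarrow> s \<noteq> 1 \<Longrightarrow> point_law n r q (g div s) = real s * real (\<phi> s) / (real g * (real q + real g - 1))"
    "point_law n r q g = real q / (real g * (real q + real g - 1))"
    "point_law n r q 0 = ((real g - 1) * (real q + real g) - (\<Sum>s | s dvd N. real s * real (\<phi> s)) + 1) /
       (real g * (real q + real g - 1))"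
proof -
  let ?R = "index_vectors n r" and ?o = "index_order n r"
  have pos: "r j > 0" if "j \<in> {1..n}" for j using r(1)[OF that] r(2) by (auto intro: Nat.gr0I)
  have g: "g > 0" unfolding g_def using pos by (intro prod_pos) auto
  have k: "real (card ?R) = real g - 1" using card_index_vectors[where n = n and r = r, OF pos] unfolding g_def by linarith
  have qk: "real q + real (card ?R) = real q + real g - 1" unfolding k by simp
  have o_dvd: "?o \<alpha> dvd g" for \<alpha>
    using index_order(2)[where n = n and r = r, OF r(1,2)] r(3) unfolding g_def by (rule dvd_trans)
  have o1: "?o \<alpha> \<noteq> 1" if "\<alpha> \<in> ?R" for \<alpha> by (rule index_order_neq_1) (use pos that in auto)
  have div_eq: "g div s = g div t \<longleftrightarrow> s = t" if "s dvd g" "t dvd g" for s t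
  proof
    assume eq: "g div s = g div t"
    have "g div s > 0" using that(1) g by (simp add: div_greater_zero_iff dvd_imp_le dvd_pos_nat)
    moreover have "s * (g div s) = t * (g div s)" using that unfolding eq by (metis dvd_mult_div_cancel eq)
    ultimately show "s = t" by simp
  qed simp
  have div0: "g div s \<noteq> 0" if "s dvd g" for s
    using that g by (metis dvd_div_eq_0_iff not_gr0)
  have two: "two_point_law g s (g div t) = (if s = t then real s / real g else 0)" if "s dvd g" "t dvd g" for s t
    using div_eq[OF that] div_eq[OF that(2) that(1)] div0[OF that(2)] by (auto simp: two_point_law_def)
  have two0: "two_point_law g s 0 = 1 - real s / real g" if "s dvd g" for s
    using div0[OF that] by (simp add: two_point_law_def)
  have law: "point_law n r q m = (real q * two_point_law g 1 m + (\<Sum>\<alpha>\<in>?R. two_point_law g (?o \<alpha>) m)) / (real q + real g - 1)" for m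
    unfolding point_law_def g_def[symmetric] qk ..
  have sums: "(\<Sum>\<alpha>\<in>?R. two_point_law g (?o \<alpha>) (g div t)) = real t / real g * real (card {\<alpha>\<in>?R. ?o \<alpha> = t})" if "t dvd g" for t
  proof -
    have "(\<Sum>\<alpha>\<in>?R. two_point_law g (?o \<alpha>) (g div t)) = (\<Sum>\<alpha>\<in>?R. if ?o \<alpha> = t then real t / real g else 0)"
      by (rule sum.cong[OF refl]) (use two[OF o_dvd that] in auto)
    also have "\<dots> = (\<Sum>\<alpha>\<in>{\<alpha>\<in>?R. ?o \<alpha> = t}. real t / real g)"
      by (rule sum.inter_filter[symmetric]) (rule finite_index_vectors)
    finally show ?thesis by simp
  qed
  show "point_law n r q (g div s) = real s * real (\<phi> s) / (real g * (real q + real g - 1))" if s: "s dvd N" "s \<noteq> 1"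
  proof -
    have sg: "s dvd g" using s(1) r(3) unfolding g_def by (rule dvd_trans)
    have "\<phi> s = card {\<alpha>\<in>?R. ?o \<alpha> = s}"
      unfolding \<phi>_def by (rule num_elements_of_order_eq) (use pos s in auto)
    then have "(\<Sum>\<alpha>\<in>?R. two_point_law g (?o \<alpha>) (g div s)) = real s / real g * real (\<phi> s)" using sums[OF sg] by simp
    moreover have "two_point_law g 1 (g div s) = 0" using two[OF one_dvd sg] s(2) by simp
    ultimately show ?thesis unfolding law by simp
  qed
  show "point_law n r q g = real q / (real g * (real q + real g - 1))"
  proof -
    have e: "{\<alpha>\<in>?R. ?o \<alpha> = 1} = {}" using o1 by blast
    have "(\<Sum>\<alpha>\<in>?R. two_point_law g (?o \<alpha>) (g div 1)) = 0" unfolding sums[OF one_dvd] e by simp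
    moreover have "two_point_law g 1 (g div 1) = 1 / real g" using two[OF one_dvd one_dvd] by simp
    ultimately show ?thesis using law[of "g div 1"] by simp
  qed
  show "point_law n r q 0 = ((real g - 1) * (real q + real g) - (\<Sum>s | s dvd N. real s * real (\<phi> s)) + 1) /
       (real g * (real q + real g - 1))"
  proof -
    have e: "(\<Sum>\<alpha>\<in>?R. two_point_law g (?o \<alpha>) 0) = (real g - 1) - (\<Sum>\<alpha>\<in>?R. real (?o \<alpha>)) / real g"
      using two0[OF o_dvd] k by (simp add: sum_subtractf sum_divide_distrib)
    have e1: "two_point_law g 1 0 = 1 - 1 / real g" using two0[OF one_dvd] by simp
    have num: "real q * two_point_law g 1 0 + (\<Sum>\<alpha>\<in>?R. two_point_law g (?o \<alpha>) 0) =
        ((real g - 1) * (real q + real g) - (1 + (\<Sum>\<alpha>\<in>?R. real (?o \<alpha>))) + 1) / real g"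
      unfolding e e1 using g by (simp add: field_simps)
    show ?thesis
      unfolding law num \<phi>_def using sum_order_elements[where n = n and r = r, OF r(1,2)] by simp
  qed
qed

text \<open>The counts are sums over finitely many triples \<open>(\<beta>, c, v)\<close>, a number
  independent of \<open>d\<close>, so limits are taken termwise. The limit factors into the affine
  places and infinity, and the common factor \<open>z ^ q * B * K\<close> cancels.\<close>

theorem curves_limit:
  fixes M :: nat and r :: "nat \<Rightarrow> nat"
  assumes r: "\<And>j. j \<in> {1..n} \<Longrightarrow> r j dvd N" "N dvd CARD('a::{field,finite}) - 1"
  defines "V \<equiv> insert 0 ((\<lambda>s. (\<Prod>j\<in>{1..n}. r j) div s) ` {s. s dvd N})"
  defines "L \<equiv> convolution (point_law n r CARD('a)) V (Suc CARD('a)) M"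
  shows "(\<lambda>d. real (card {t \<in> curve_params n r d. card (rational_points (function_field n r (t :: _ \<times> (_ \<Rightarrow> 'a poly)))) = M}) /
      real (card (curve_params n r d :: (_ \<times> (_ \<Rightarrow> 'a poly)) set))) \<sim>[degrees_at_top n r] (\<lambda>_. L)"
proof -
  let ?R = "index_vectors n r" and ?A = "\<Pi>\<^sub>E j\<in>{1..n}. UNIV - {0 :: 'a}" and ?F = "degrees_at_top n r"
  let ?O = "insert None (Some ` ?R)" and ?p = "point_law n r CARD('a)"
  define \<Omega> where "\<Omega> = {w \<in> (\<Pi>\<^sub>E \<gamma>\<in>?R. UNIV :: 'a set). single_zero ?R w}"
  let ?V = "\<Pi>\<^sub>E x\<in>(UNIV :: 'a set). \<Omega>"
  define q k where "q = real CARD('a)" and "k = card ?R"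
  let ?q1 = "CARD('a) - 1"
  have q1: "?q1 > 0" and q: "q \<ge> 2" using card_field_ge2[where 'a='a] by (auto simp: q_def)
  have N: "N > 0" using r(2) q1 by (auto intro: Nat.gr0I)
  have rq: "r j dvd ?q1" if "j \<in> {1..n}" for j using r(1)[OF that] r(2) by (rule dvd_trans)
  have finR: "finite ?R" by (rule finite_index_vectors)
  have finA: "finite ?A" by (intro finite_PiE) auto
  have "finite (\<Pi>\<^sub>E \<gamma>\<in>?R. UNIV :: 'a set)" using finR by (intro finite_PiE) auto
  then have fin\<Omega>: "finite \<Omega>" by (simp add: \<Omega>_def)
  then have finPi: "finite ?V" by (intro finite_PiE) auto
  have finV: "finite V" using N by (simp add: V_def)
  have range: "local_points {1..n} r a c \<in> V" for a and c :: "nat \<Rightarrow> 'a"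
    unfolding V_def by (rule local_points_range[OF r(1) N])
  then have vp: "value_points n r c w \<in> V" for c :: "nat \<Rightarrow> 'a" and w
    unfolding value_points_def .
  have ip: "infinite_points n r \<beta> c \<in> V" for \<beta> and c :: "nat \<Rightarrow> 'a" unfolding infinite_points_def by (rule range)
  have total: "(\<Sum>v\<in>V. ?p v) = 1"
    unfolding V_def by (rule sum_point_law_divisors[OF r(1) N]) auto
  obtain B where B: "B > 0" and dens: "\<And>\<epsilon>. \<epsilon> > 0 \<Longrightarrow> \<exists>N. \<forall>e v. (\<forall>\<alpha>\<in>?R. N \<le> e \<alpha>) \<longrightarrow> (\<forall>x :: 'a. single_zero ?R (v x)) \<longrightarrow>
    \<bar>real (card (value_tuples ?R e v)) / real CARD('a) ^ (\<Sum>\<alpha>\<in>?R. e \<alpha>) - (\<Prod>x\<in>UNIV. local_density ?R (v x)) * B\<bar> \<le> \<epsilon>"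
    by (rule value_tuples_density[where 'a = 'a, OF finR]) (rule that)
  define pts where "pts \<beta> c v = (\<Sum>x\<in>UNIV. value_points n r c (v x)) + infinite_points n r \<beta> c"
    for \<beta> and c :: "nat \<Rightarrow> 'a" and v :: "'a \<Rightarrow> (nat \<Rightarrow> nat) \<Rightarrow> 'a"
  define W where "W \<beta> v = infinite_weight CARD('a) \<beta> * ((\<Prod>x\<in>UNIV. local_density ?R (v x)) * B)"
    for \<beta> :: "(nat \<Rightarrow> nat) option" and v :: "'a \<Rightarrow> (nat \<Rightarrow> nat) \<Rightarrow> 'a"
  have W_pos: "W \<beta> v > 0" for \<beta> v
    unfolding W_def using B local_density_pos by (intro mult_pos_pos prod_pos) (auto simp: infinite_weight_def split: option.split)
  define S where "S Q = (\<Sum>\<beta>\<in>?O. \<Sum>c\<in>?A. \<Sum>v\<in>?V. of_bool (Q (pts \<beta> c v)) * W \<beta> v)" for Q :: "nat \<Rightarrow> bool"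
  define C where "C Q d = card {t \<in> curve_params n r d. Q (card (rational_points (function_field n r (t :: _ \<times> (_ \<Rightarrow> 'a poly)))))}" for Q d
  have C_eq: "C Q d = (\<Sum>\<beta>\<in>?O. \<Sum>c\<in>?A. \<Sum>v\<in>?V. if Q (pts \<beta> c v) then card (value_tuples ?R (lowered d \<beta>) v) else 0)"
    if "d \<in> admissible_degrees n r" "\<forall>\<alpha>\<in>?R. 2 \<le> d \<alpha>" for Q d
    unfolding C_def pts_def \<Omega>_def by (rule card_curve_params) (use rq that in auto)
  have C_lim: "((\<lambda>d. real (C Q d) / q ^ (\<Sum>\<alpha>\<in>?R. d \<alpha>)) \<longlongrightarrow> S Q) ?F" for Q
  proof (rule Lim_transform_eventually)
    let ?G = "\<lambda>d. \<Sum>\<beta>\<in>?O. \<Sum>c\<in>?A. \<Sum>v\<in>?V. of_bool (Q (pts \<beta> c v)) *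
      (real (card (value_tuples ?R (lowered d \<beta>) v)) / q ^ (\<Sum>\<alpha>\<in>?R. d \<alpha>))"
    show "(?G \<longlongrightarrow> S Q) ?F"
      unfolding S_def W_def q_def
      by (intro tendsto_sum tendsto_mult_left value_tuples_tendsto[OF dens]) (auto simp: \<Omega>_def)
    from eventually_degrees_at_top[of n r 2] show "\<forall>\<^sub>F d in ?F. ?G d = real (C Q d) / q ^ (\<Sum>\<alpha>\<in>?R. d \<alpha>)"
    proof eventually_elim
      case (elim d)
      have "real (C Q d) = (\<Sum>\<beta>\<in>?O. \<Sum>c\<in>?A. \<Sum>v\<in>?V. of_bool (Q (pts \<beta> c v)) * real (card (value_tuples ?R (lowered d \<beta>) v)))"
        unfolding C_eq[OF conjunct1[OF elim] conjunct2[OF elim]] of_nat_sum by (intro sum.cong refl) simp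
      then show ?case by (simp only: sum_divide_distrib times_divide_eq_right)
    qed
  qed
  \<comment> \<open>\<open>z\<close> is the total mass of one affine place, \<open>K\<close> that of
    infinity including the leading constants.\<close>
  define z where "z = ((q - 1) / q) ^ k * ((q + real k) / q)"
  define K where "K = (q - 1) ^ n * ((q + real k) / q)"
  have zK: "z > 0" "K > 0" using q by (auto simp: z_def K_def)
  have fibre: "(\<Sum>w\<in>{w\<in>\<Omega>. value_points n r c w = m}. local_density ?R w) = z * ?p m" if c: "c \<in> ?A" for c m
  proof -
    have "{w\<in>\<Omega>. value_points n r c w = m} = {w \<in> (\<Pi>\<^sub>E \<gamma>\<in>?R. UNIV). single_zero ?R w \<and> value_points n r c w = m}"
      by (auto simp: \<Omega>_def)
    moreover have "(\<Sum>w\<in>{w \<in> (\<Pi>\<^sub>E \<gamma>\<in>?R. UNIV). single_zero ?R w \<and> value_points n r c w = m}. local_density ?R w) = z * ?p m"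
      unfolding z_def q_def k_def by (rule mass_finite) (use rq c in auto)
    ultimately show ?thesis by simp
  qed
  have inf: "(\<Sum>\<beta>\<in>?O. infinite_weight CARD('a) \<beta> * real (card {c\<in>?A. infinite_points n r \<beta> c = m})) = K * ?p m" for m
    unfolding K_def q_def k_def by (rule mass_infinite) (use rq in auto)
  have group_inf: "(\<Sum>\<beta>\<in>?O. \<Sum>c\<in>?A. infinite_weight CARD('a) \<beta> * h (infinite_points n r \<beta> c)) = K * (\<Sum>m\<in>V. ?p m * h m)" for h
  proof -
    have "(\<Sum>c\<in>?A. infinite_weight CARD('a) \<beta> * h (infinite_points n r \<beta> c)) =
        (\<Sum>m\<in>V. infinite_weight CARD('a) \<beta> * real (card {c\<in>?A. infinite_points n r \<beta> c = m}) * h m)" for \<beta>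
    proof -
      have "(\<Sum>c\<in>?A. infinite_weight CARD('a) \<beta> * h (infinite_points n r \<beta> c)) =
          (\<Sum>m\<in>V. \<Sum>c\<in>{c\<in>?A. infinite_points n r \<beta> c = m}. infinite_weight CARD('a) \<beta> * h (infinite_points n r \<beta> c))"
        by (rule sum.group[symmetric]) (use finA finV ip in auto)
      also have "\<dots> = (\<Sum>m\<in>V. infinite_weight CARD('a) \<beta> * real (card {c\<in>?A. infinite_points n r \<beta> c = m}) * h m)"
        by (rule sum.cong[OF refl]) simp
      finally show ?thesis .
    qed
    then have "(\<Sum>\<beta>\<in>?O. \<Sum>c\<in>?A. infinite_weight CARD('a) \<beta> * h (infinite_points n r \<beta> c)) =
        (\<Sum>m\<in>V. \<Sum>\<beta>\<in>?O. infinite_weight CARD('a) \<beta> * real (card {c\<in>?A. infinite_points n r \<beta> c = m}) * h m)"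
      by (simp only: sum.swap[of _ V ?O])
    also have "\<dots> = (\<Sum>m\<in>V. K * ?p m * h m)" unfolding sum_distrib_right[symmetric] inf ..
    finally show ?thesis by (simp only: sum_distrib_left mult.assoc)
  qed
  have S_M: "S (\<lambda>m. m = M) = z ^ CARD('a) * B * K * L"
  proof -
    \<comment> \<open>The weight, up to the factor \<open>z ^ q * B\<close>, with which the affine
      places supply the missing points when infinity contributes \<open>i\<close>.\<close>
    define h where "h i = (if i \<le> M then convolution ?p V CARD('a) (M - i) else 0)" for i
    have inner: "(\<Sum>v\<in>?V. of_bool (pts \<beta> c v = M) * W \<beta> v) = z ^ CARD('a) * B * (infinite_weight CARD('a) \<beta> * h (infinite_points n r \<beta> c))"
      if c: "c \<in> ?A" for \<beta> c
    proof (cases "infinite_points n r \<beta> c \<le> M")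
      case True
      let ?i = "infinite_points n r \<beta> c"
      have "pts \<beta> c v = M \<longleftrightarrow> (\<Sum>x\<in>UNIV. value_points n r c (v x)) = M - ?i" for v
        using True unfolding pts_def by linarith
      then have "(\<Sum>v\<in>?V. of_bool (pts \<beta> c v = M) * W \<beta> v) = (\<Sum>v\<in>?V. infinite_weight CARD('a) \<beta> * B *
          ((\<Prod>x\<in>UNIV. local_density ?R (v x)) * of_bool ((\<Sum>x\<in>UNIV. value_points n r c (v x)) = M - ?i)))"
        unfolding W_def by (intro sum.cong refl) simp
      also have "\<dots> = infinite_weight CARD('a) \<beta> * B * (z ^ card (UNIV :: 'a set) * convolution ?p V (card (UNIV :: 'a set)) (M - ?i))"
        unfolding sum_distrib_left[symmetric]
        by (intro arg_cong2[where f = "(*)"] refl sum_PiE_convolution) (use fin\<Omega> finV vp fibre[OF c] in auto)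
      finally show ?thesis using True by (simp add: h_def)
    next
      case False
      then have "pts \<beta> c v \<noteq> M" for v unfolding pts_def by linarith
      then show ?thesis using False by (simp add: h_def)
    qed
    have "S (\<lambda>m. m = M) = z ^ CARD('a) * B * (\<Sum>\<beta>\<in>?O. \<Sum>c\<in>?A. infinite_weight CARD('a) \<beta> * h (infinite_points n r \<beta> c))"
      unfolding S_def sum_distrib_left by (intro sum.cong refl inner)
    also have "\<dots> = z ^ CARD('a) * B * (K * (\<Sum>m\<in>V. ?p m * h m))" unfolding group_inf ..
    also have "(\<Sum>m\<in>V. ?p m * h m) = (\<Sum>m\<in>{m\<in>V. m \<le> M}. ?p m * convolution ?p V CARD('a) (M - m))"
      unfolding sum.inter_filter[OF finV] by (rule sum.cong[OF refl]) (simp add: h_def)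
    finally show ?thesis by (simp add: L_def mult.assoc)
  qed
  have S_all: "S (\<lambda>_. True) = z ^ CARD('a) * B * K"
  proof -
    have inner: "(\<Sum>v\<in>?V. of_bool True * W \<beta> v) = z ^ CARD('a) * B * (infinite_weight CARD('a) \<beta> * 1)" if c: "c \<in> ?A" for \<beta> c
    proof -
      have "(\<Sum>w\<in>\<Omega>. local_density ?R w) = (\<Sum>m\<in>V. \<Sum>w\<in>{w\<in>\<Omega>. value_points n r c w = m}. local_density ?R w)"
        by (rule sum.group[symmetric]) (use fin\<Omega> finV vp in auto)
      also have "\<dots> = z" unfolding fibre[OF c] sum_distrib_left[symmetric] total by simp
      finally have mass: "(\<Sum>w\<in>\<Omega>. local_density ?R w) = z" .
      have "(\<Sum>v\<in>?V. \<Prod>x\<in>UNIV. local_density ?R (v x)) = (\<Prod>x\<in>(UNIV :: 'a set). \<Sum>w\<in>\<Omega>. local_density ?R w)"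
        by (rule prod_sum_PiE[symmetric]) (use fin\<Omega> in auto)
      then have "(\<Sum>v\<in>?V. \<Prod>x\<in>UNIV. local_density ?R (v x)) = z ^ CARD('a)" unfolding mass by simp
      moreover have "(\<Sum>v\<in>?V. of_bool True * W \<beta> v) = infinite_weight CARD('a) \<beta> * B * (\<Sum>v\<in>?V. \<Prod>x\<in>UNIV. local_density ?R (v x))"
        unfolding W_def sum_distrib_left by (intro sum.cong refl) simp
      ultimately show ?thesis by simp
    qed
    have "S (\<lambda>_. True) = z ^ CARD('a) * B * (\<Sum>\<beta>\<in>?O. \<Sum>c\<in>?A. infinite_weight CARD('a) \<beta> * 1)"
      unfolding S_def sum_distrib_left by (intro sum.cong refl inner)
    also have "\<dots> = z ^ CARD('a) * B * (K * (\<Sum>m\<in>V. ?p m * 1))" unfolding group_inf[of "\<lambda>_. 1"] ..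
    finally show ?thesis using total by simp
  qed
  have S_all_pos: "S (\<lambda>_. True) \<noteq> 0" unfolding S_all using zK B by simp
  have all: "curve_params n r d = {t \<in> curve_params n r d. True}" for d by simp
  have "((\<lambda>d. (real (C (\<lambda>m. m = M) d) / q ^ (\<Sum>\<alpha>\<in>?R. d \<alpha>)) / (real (C (\<lambda>_. True) d) / q ^ (\<Sum>\<alpha>\<in>?R. d \<alpha>))) \<longlongrightarrow>
      S (\<lambda>m. m = M) / S (\<lambda>_. True)) ?F"
    by (intro tendsto_divide C_lim S_all_pos)
  moreover have "S (\<lambda>m. m = M) / S (\<lambda>_. True) = L" unfolding S_M S_all using zK B by simp
  moreover have cancel: "(real (C Q d) / q ^ (\<Sum>\<alpha>\<in>?R. d \<alpha>)) / (real (C Q' d) / q ^ (\<Sum>\<alpha>\<in>?R. d \<alpha>)) = real (C Q d) / real (C Q' d)" for Q Q' d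
    using q by simp
  ultimately have lim: "((\<lambda>d. real (C (\<lambda>m. m = M) d) / real (C (\<lambda>_. True) d)) \<longlongrightarrow> L) ?F" by (simp only: cancel)
  have "(\<lambda>d. real (C (\<lambda>m. m = M) d) / real (C (\<lambda>_. True) d)) \<sim>[?F] (\<lambda>_. L)"
  proof (cases "L = 0")
    case False
    then show ?thesis by (rule tendsto_imp_asymp_equiv_const[OF lim])
  next
    \<comment> \<open>Asymptotic equivalence to 0 means being eventually 0. All weights
      \<open>W\<close> are positive, so a vanishing limit leaves no triple with \<open>M\<close>
      points at all.\<close>
    case True
    then have S0: "S (\<lambda>m. m = M) = 0" using S_M by simp
    have nn: "of_bool (pts \<beta> c v = M) * W \<beta> v \<ge> 0" for \<beta> c v using W_pos[of \<beta> v] by simp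
    have no: "pts \<beta> c v \<noteq> M" if "\<beta> \<in> ?O" "c \<in> ?A" "v \<in> ?V" for \<beta> c v
    proof -
      have "\<forall>\<beta>\<in>?O. (\<Sum>c\<in>?A. \<Sum>v\<in>?V. of_bool (pts \<beta> c v = M) * W \<beta> v) = 0"
        using S0 unfolding S_def by (subst (asm) sum_nonneg_eq_0_iff) (use finR nn in \<open>auto intro!: sum_nonneg\<close>)
      then have "(\<Sum>c\<in>?A. \<Sum>v\<in>?V. of_bool (pts \<beta> c v = M) * W \<beta> v) = 0" using that(1) by blast
      then have "\<forall>c\<in>?A. (\<Sum>v\<in>?V. of_bool (pts \<beta> c v = M) * W \<beta> v) = 0"
        by (subst (asm) sum_nonneg_eq_0_iff) (use finA nn in \<open>auto intro!: sum_nonneg\<close>)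
      then have "(\<Sum>v\<in>?V. of_bool (pts \<beta> c v = M) * W \<beta> v) = 0" using that(2) by blast
      then have "\<forall>v\<in>?V. of_bool (pts \<beta> c v = M) * W \<beta> v = 0"
        by (subst (asm) sum_nonneg_eq_0_iff) (use finPi nn in auto)
      then have "of_bool (pts \<beta> c v = M) * W \<beta> v = 0" using that(3) by blast
      then show ?thesis using W_pos[of \<beta> v] by auto
    qed
    have "C (\<lambda>m. m = M) d = 0" if "d \<in> admissible_degrees n r" "\<forall>\<alpha>\<in>?R. 2 \<le> d \<alpha>" for d
      unfolding C_eq[OF that] by (intro sum.neutral ballI) (simp add: no)
    then have "real (C (\<lambda>m. m = M) d) / real (C (\<lambda>_. True) d) = L"
      if "d \<in> admissible_degrees n r \<and> (\<forall>\<alpha>\<in>?R. 2 \<le> d \<alpha>)" for d using that True by simp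
    then show ?thesis
      by (intro asymp_equiv_refl_ev eventually_mono[OF eventually_degrees_at_top[of n r 2]]) blast
  qed
  then show ?thesis unfolding C_def by simp
qed

theorem theorem1p2:
  fixes n q M :: nat and r :: "nat \<Rightarrow> nat"
    and P :: "'w measure" and Y :: "nat \<Rightarrow> 'w \<Rightarrow> real"
    and G :: "(nat \<Rightarrow> int) monoid"
    and H :: "((nat \<Rightarrow> nat) \<Rightarrow> nat) \<Rightarrow>
                ((nat \<Rightarrow> 'a::{field,finite}) \<times> ((nat \<Rightarrow> nat) \<Rightarrow> 'a poly)) set"
  defines "q \<equiv> CARD('a)"
    and "G \<equiv> prod_cyclic_group n r"
    and "H \<equiv> curve_params n r"
  assumes "n \<ge> 1"
    and "\<forall>j\<in>{1..n}. r j \<ge> 1"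
    and "\<forall>j. 1 \<le> j \<and> j < n \<longrightarrow> r j dvd r (Suc j)"
    and "[q = 1] (mod r n)"
    and "prob_space P"
    and "prob_space.indep_vars P (\<lambda>_. borel) Y {1..q + 1}"
    and "\<And>i s. i \<in> {1..q + 1} \<Longrightarrow> s dvd r n \<Longrightarrow> s \<noteq> 1 \<Longrightarrow>
           measure P {\<omega> \<in> space P. Y i \<omega> = real (Coset.order G) / real s} =
             real s * real (num_elements_of_order G s) /
             (real (Coset.order G) * (real q + real (Coset.order G) - 1))"
    and "\<And>i. i \<in> {1..q + 1} \<Longrightarrow>
           measure P {\<omega> \<in> space P. Y i \<omega> = real (Coset.order G)} =
             real q / (real (Coset.order G) * (real q + real (Coset.order G) - 1))"
    and "\<And>i. i \<in> {1..q + 1} \<Longrightarrow>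
           measure P {\<omega> \<in> space P. Y i \<omega> = 0} =
             ((real (Coset.order G) - 1) * (real q + real (Coset.order G))
                - (\<Sum>s | s dvd r n. real s * real (num_elements_of_order G s)) + 1) /
             (real (Coset.order G) * (real q + real (Coset.order G) - 1))"
  shows "(\<lambda>d. real (card {t \<in> H d. card (rational_points (function_field n r t)) = M}) /
                real (card (H d)))
           \<sim>[degrees_at_top n r]
         (\<lambda>_. measure P {\<omega> \<in> space P. (\<Sum>i = 1..q + 1. Y i \<omega>) = real M})"
proof -
  interpret prob_space P by (rule assms(8))
  let ?g = "\<Prod>j\<in>{1..n}. r j"
  \<comment> \<open>\<open>r n\<close> is the exponent of the group, so its divisors give all
    ramification indices and \<open>V\<close> contains every possible local count.\<close>
  define V where "V = insert 0 ((\<lambda>s. ?g div s) ` {s. s dvd r n})"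
  have q: "q \<ge> 2" unfolding assms(1) by (rule card_field_ge2)
  have r_pos: "r j > 0" if "j \<in> {1..n}" for j using assms(5) that by fastforce
  have N: "r n > 0" using r_pos[of n] assms(4) by simp
  have chain: "1 \<le> j \<Longrightarrow> r j dvd r i" if "j \<le> i" "i \<le> n" for i j
    using that
  proof (induction i rule: dec_induct)
    case (step i)
    then have "r j dvd r i" "r i dvd r (Suc i)" using assms(6) by auto
    then show ?case by (rule dvd_trans)
  qed simp
  have r: "r j dvd r n" if "j \<in> {1..n}" for j using chain[of j n] that by simp
  have "q mod r n = 1 mod r n" using assms(7) by (simp add: cong_def)
  then have rn: "r n dvd q - 1" using mod_eq_dvd_iff_nat[of 1 q "r n"] q by simp
  have rg: "r n dvd ?g" by (rule dvd_prodI) (use assms(4) in auto)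
  have order: "Coset.order G = ?g" unfolding assms(2) by (rule order_prod_cyclic_group) (rule r_pos)
  have q0: "q > 0" using q by simp
  let ?den = "real (Coset.order G) * (real q + real (Coset.order G) - 1)"
  have law: "point_law n r q (?g div s) = real s * real (num_elements_of_order G s) / ?den" if "s dvd r n" "s \<noteq> 1" for s
    unfolding order unfolding assms(2) by (rule point_law_values(1)[OF r N rg q0 that])
  have law1: "point_law n r q ?g = real q / ?den"
    unfolding order by (rule point_law_values(2)[OF r N rg q0])
  have law0: "point_law n r q 0 = ((real (Coset.order G) - 1) * (real q + real (Coset.order G))
      - (\<Sum>s | s dvd r n. real s * real (num_elements_of_order G s)) + 1) / ?den"
    unfolding order unfolding assms(2) by (rule point_law_values(3)[OF r N rg q0])
  have "prob {\<omega> \<in> space P. (\<Sum>i\<in>{1..q + 1}. Y i \<omega>) = real M} = convolution (point_law n r q) V (card {1..q + 1}) M"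
  proof (rule prob_sum_eq_convolution[OF assms(9)])
    show "finite V" using N by (simp add: V_def)
    show "(\<Sum>v\<in>V. point_law n r q v) = 1" unfolding V_def by (rule sum_point_law_divisors[OF r N q0])
    fix i v assume i: "i \<in> {1..q + 1}" and "v \<in> V"
    then consider "v = 0" | s where "s dvd r n" "v = ?g div s" by (auto simp: V_def)
    then show "prob {\<omega> \<in> space P. Y i \<omega> = real v} = point_law n r q v"
    proof cases
      case 1
      then show ?thesis using assms(12)[OF i] law0 by simp
    next
      case (2 s)
      show ?thesis
      proof (cases "s = 1")
        case True
        then have "v = ?g" using 2(2) by simp
        then show ?thesis using assms(11)[OF i] law1 unfolding order by simp
      next
        case False
        \<comment> \<open>Divisibility makes the real quotient in the hypotheses equal to
          \<open>?g div s\<close>.\<close>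
        have "s dvd Coset.order G" using 2(1) rg unfolding order by (rule dvd_trans)
        then have "real v = real (Coset.order G) / real s" unfolding 2(2) order by (simp add: real_of_nat_div)
        then show ?thesis using assms(10)[OF i 2(1) False] law[OF 2(1) False] 2(2) by simp
      qed
    qed
  qed auto
  moreover have "card {1..q + 1} = Suc q" by simp
  ultimately have prob: "prob {\<omega> \<in> space P. (\<Sum>i = 1..q + 1. Y i \<omega>) = real M} = convolution (point_law n r q) V (Suc q) M" by metis
  show ?thesis
    unfolding prob unfolding V_def assms(3) unfolding assms(1)
    by (rule curves_limit[OF r]) (use rn assms(1) in auto)
qed

end
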